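(* Let $(h_1,h_2)\in\mathcal B$, let $G=\langle h_1,h_2\rangle$, and let $p\in(0,1)$. Suppose that $K(h_1)\subset\mathrm{int}(K(h_2))$. Let $U:=(\mathrm{int}(K(h_2)))\setminus K(h_1)$, and suppose that $(h_1,h_2)$ satisfies the open set condition with $U$. Then all of the following hold. (i) $J_{\ker}(h_1,h_2)=\emptyset$. Moreover, $T(h_1,h_2,p,\cdot)$ is Hölder continuous on $\hat{\mathbb C}$ and locally constant on $F(G)$. Moreover, $J(G)=\{z_0\in\hat{\mathbb C}:\text{for each neighborhood }V\text{ of }z_0,\ T(h_1,h_2,p,\cdot)|_V\text{ is not constant}\}$. (ii) There exists a unique minimal set $L$ for $(\langle h_1,h_2\rangle,\hat K(h_1,h_2))$, and the set of minimal sets for $(\langle h_1,h_2\rangle,\hat{\mathbb C})$ is $\{\{\infty\},L\}$. (iii) For each $z\in\hat{\mathbb C}$ there exists a Borel subset $\mathcal B_z$ of $\{h_1,h_2\}^{\mathbb N}$ with $\tilde\tau_{h_1,h_2,p}(\mathcal B_z)=1$ such that for each $\gamma=(\gamma_1,\gamma_2,\dots)\in\mathcal B_z$ we have $d(\gamma_n\cdots\gamma_1(z),\{\infty\}\cup L)\to0$ as $n\to\infty$. (iv) There exists a unique $M_{h_1,h_2,p}^*$-invariant Borel probability measure $\nu$ on $\hat K(h_1,h_2)$ such that for each $\varphi\in C(\hat{\mathbb C})$, $$M_{h_1,h_2,p}^n(\varphi)(z)\to T(h_1,h_2,p,z)\cdot\varphi(\infty)+(1-T(h_1,h_2,p,z))\cdot\int\varphi\,d\nu\quad\text{as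 }n\to\infty$$ uniformly on $\hat{\mathbb C}$. (v) For each $z\in\hat{\mathbb C}$, the function $p\mapsto T(h_1,h_2,p,z)$ is real-analytic on $(0,1)$. Moreover, for each $n\in\mathbb N\cup\{0\}$, the function $(p,z)\mapsto(\partial^nT/\partial p^n)(h_1,h_2,p,z)$ is continuous on $(0,1)\times\hat{\mathbb C}$. The function $z\mapsto T(h_1,h_2,p,z)$ is characterized as the unique element $\varphi\in C(\hat{\mathbb C})$ such that $M_{h_1,h_2,p}(\varphi)=\varphi$, $\varphi|_{\hat K(G)}\equiv0$, $\varphi|_{F_\infty(G)}\equiv1$. Furthermore, inductively, for any $n\in\mathbb N\cup\{0\}$, the function $z\mapsto(\partial^{n+1}T/\partial p^{n+1})(h_1,h_2,p,z)$ is characterized as the unique element $\varphi\in C(\hat{\mathbb C})$ such that $$\varphi(z)\equiv M_{h_1,h_2,p}(\varphi)(z)+(n+1)\left(\frac{\partial^nT}{\partial p^n}(h_1,h_2,p,h_1(z))-\frac{\partial^nT}{\partial p^n}(h_1,h_2,p,h_2(z))\right),\qquad\varphi|_{\hat K(G)\cup F_\infty(G)}\equiv0.$$ Moreover, the function $z\mapsto(\partial^{n+1}T/\partial p^{n+1})(h_1,h_2,p,z)$ is locally constant on $F(G)$. Moreover, setting $\psi_{n,h_1,h_2,p}(z)=(\partial^nT/\partial p^n)(h_1,h_2,p,z)$ for each $p\in(0,1)$, $z\in\hat{\mathbb C}$, $n\in\mathbb N\cup\{0\}$, we have $$\psi_{n+1,h_1,h_2,p}=\sum_{j=0}^\infty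 M_{h_1,h_2,p}^j\big((n+1)(\psi_{n,h_1,h_2,p}\circ h_1-\psi_{n,h_1,h_2,p}\circ h_2)\big)\quad\text{in }(C(\hat{\mathbb C}),\|\cdot\|_\infty)$$ for each $n\in\mathbb N\cup\{0\}$.
   Context: $\hat{\mathbb C}$ is the Riemann sphere with spherical distance $d$. $\mathcal P$ is the set of all polynomial maps $g:\hat{\mathbb C}\to\hat{\mathbb C}$ with $\deg(g)\ge2$. A polynomial semigroup is a semigroup of non-constant polynomial maps under composition; $\langle h_1,\dots,h_m\rangle$ is the one generated by $h_1,\dots,h_m$. For a polynomial semigroup $G$: $F(G)$ is the maximal open subset of $\hat{\mathbb C}$ on which $G$ is equicontinuous with respect to $d$; $J(G)=\hat{\mathbb C}\setminus F(G)$; $J_{\ker}(G)=\bigcap_{g\in G}g^{-1}(J(G))$; $P(G)=\overline{\bigcup_{g\in G}\mathrm{CV}(g)}$ (closure in $\hat{\mathbb C}$; $\mathrm{CV}(g)$ is the set of critical values of $g:\hat{\mathbb C}\to\hat{\mathbb C}$); $P^*(G)=P(G)\setminus\{\infty\}$; $\hat K(G)=\{z\in\mathbb C:\{g(z):g\in G\}\text{ is bounded in }\mathbb C\}$; $F_\infty(G)$ is the connected component of $F(G)$ containing $\infty$ (when $\infty\in F(G)$, which holds for semigroups finitely generated by elements of $\mathcal P$). Write $J(h_1,h_2)=J(\langle h_1,h_2\rangle)$ and similarly for $J_{\ker},P^*,\hat K$. For $g\in\mathcal P$, $K(g)=\{z\in\mathbb C:\{g^n(z)\}_{n\in\mathbb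 N}\text{ is bounded}\}$. $\mathrm{int}$ is interior in $\hat{\mathbb C}$. $\mathcal B=\{(h_1,h_2)\in\mathcal P^2:P^*(h_1,h_2)\text{ is bounded in }\mathbb C\}$. $(h_1,h_2)$ satisfies the open set condition with $U$ if $U$ is a non-empty open set with $\bigcup_{j=1}^2h_j^{-1}(U)\subset U$ and $h_1^{-1}(U)\cap h_2^{-1}(U)=\emptyset$. Minimal sets: for $Y=\hat{\mathbb C}$ or $Y=\hat K(G)$, a minimal set for $(G,Y)$ is a non-empty compact $L\subset Y$ that is minimal with respect to inclusion among non-empty compact $C\subset Y$ with $g(C)\subset C$ for all $g\in G$. For $p\in(0,1)$: $\tau_{h_1,h_2,p}=p\delta_{h_1}+(1-p)\delta_{h_2}$, $\tilde\tau_{h_1,h_2,p}=\otimes_{n=1}^\infty\tau_{h_1,h_2,p}$ on $\{h_1,h_2\}^{\mathbb N}$, $T(h_1,h_2,p,z)=\tilde\tau_{h_1,h_2,p}(\{\gamma:\gamma_n\circ\cdots\circ\gamma_1(z)\to\infty\text{ as }n\to\infty\})$ for $z\in\hat{\mathbb C}$. $C(\hat{\mathbb C})$ is the Banach space of complex-valued continuous functions on $\hat{\mathbb C}$ with sup norm $\|\cdot\|_\infty$; $M_{h_1,h_2,p}(\varphi)(z)=p\varphi(h_1(z))+(1-p)\varphi(h_2(z))$; $M_{h_1,h_2,p}^*$ is the dual map on Borel probability measures: $\int\varphi\,d(M_{h_1,h_2,p}^*\mu)=\int M_{h_1,h_2,p}(\varphi)\,d\mu$. Hölder continuity on $\hat{\mathbb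 C}$ is with respect to $d$. *)

theory Defs
  imports
    "HOL-Probability.Probability"
    "HOL-Complex_Analysis.Complex_Analysis"
    "HOL-Computational_Algebra.Polynomial"
begin

section \<open>The Riemann sphere with the spherical distance\<close>

datatype csphere = Fin complex | Infty

text \<open>Inverse stereographic projection onto the unit sphere of \<open>\<complex> \<times> \<real>\<close>.\<close>

fun stereo :: "csphere \<Rightarrow> complex \<times> real" where
  "stereo (Fin z) =
     ((2 / (1 + (norm z)\<^sup>2)) *\<^sub>R z, ((norm z)\<^sup>2 - 1) / (1 + (norm z)\<^sup>2))"
| "stereo Infty = (0, 1)"

lemma inner_stereo_self: "stereo x \<bullet> stereo x = 1"
proof (cases x)
  case (Fin z)
  have *: "1 + (norm z)\<^sup>2 \<noteq> 0"
    by (smt (verit) zero_le_power2)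
  have "stereo x \<bullet> stereo x =
      (2 / (1 + (norm z)\<^sup>2))\<^sup>2 * (norm z)\<^sup>2 + (((norm z)\<^sup>2 - 1) / (1 + (norm z)\<^sup>2))\<^sup>2"
    by (simp add: Fin dot_square_norm[of z] power2_eq_square)
  also have "\<dots> = (4 * (norm z)\<^sup>2 + ((norm z)\<^sup>2 - 1)\<^sup>2) / (1 + (norm z)\<^sup>2)\<^sup>2"
    by (simp add: power_divide add_divide_distrib)
  also have "4 * (norm z)\<^sup>2 + ((norm z)\<^sup>2 - 1)\<^sup>2 = (1 + (norm z)\<^sup>2)\<^sup>2"
    by (simp add: power2_eq_square algebra_simps)
  finally show ?thesis
    using * by simp
qed auto

lemma norm_stereo [simp]: "norm (stereo x) = 1"
  by (simp add: norm_eq_sqrt_inner inner_stereo_self)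

lemma inj_stereo: "stereo x = stereo y \<Longrightarrow> x = y"
proof (cases x; cases y)
  fix z w assume eq: "stereo x = stereo y" and xy: "x = Fin z" "y = Fin w"
  have pos: "1 + (norm z)\<^sup>2 > 0" "1 + (norm w)\<^sup>2 > 0"
    by (smt (verit) zero_le_power2)+
  have "((norm z)\<^sup>2 - 1) / (1 + (norm z)\<^sup>2) = ((norm w)\<^sup>2 - 1) / (1 + (norm w)\<^sup>2)"
    using eq xy by simp
  then have n: "(norm z)\<^sup>2 = (norm w)\<^sup>2"
    using pos by (simp add: field_simps)
  have "(2 / (1 + (norm z)\<^sup>2)) *\<^sub>R z = (2 / (1 + (norm w)\<^sup>2)) *\<^sub>R w"
    using eq xy by simp
  then show "x = y"
    using n pos xy by simp
next
  fix z assume eq: "stereo x = stereo y" and xy: "x = Fin z" "y = Infty"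
  have "1 + (norm z)\<^sup>2 > 0"
    by (smt (verit) zero_le_power2)
  then show "x = y"
    using eq xy by (simp add: field_simps)
next
  fix z assume eq: "stereo x = stereo y" and xy: "x = Infty" "y = Fin z"
  have "1 + (norm z)\<^sup>2 > 0"
    by (smt (verit) zero_le_power2)
  then show "x = y"
    using eq xy by (simp add: field_simps)
qed auto

lemma unit_inner_bounds:
  fixes u v :: "'a :: real_inner"
  assumes "norm u = 1" "norm v = 1"
  shows "- 1 \<le> u \<bullet> v" "u \<bullet> v \<le> 1"
  using Cauchy_Schwarz_ineq2[of u v] assms by auto

lemma arccos_inner_triangle:
  fixes u v w :: "'a :: real_inner"
  assumes [simp]: "norm u = 1" "norm v = 1" "norm w = 1"
  shows "arccos (u \<bullet> w) \<le> arccos (u \<bullet> v) + arccos (v \<bullet> w)"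
proof (cases "arccos (u \<bullet> v) + arccos (v \<bullet> w) \<le> pi")
  case False
  then show ?thesis
    using arccos_ubound[of "u \<bullet> w"] unit_inner_bounds[of u w] by simp
next
  case True
  let ?a = "u \<bullet> v" and ?b = "v \<bullet> w"
  have ab: "- 1 \<le> ?a" "?a \<le> 1" "- 1 \<le> ?b" "?b \<le> 1" "- 1 \<le> u \<bullet> w" "u \<bullet> w \<le> 1"
    by (simp_all add: unit_inner_bounds)
  have [simp]: "u \<bullet> u = 1" "v \<bullet> v = 1" "w \<bullet> w = 1"
    by (simp_all add: dot_square_norm)
  have nu: "norm (u - ?a *\<^sub>R v) = sqrt (1 - ?a\<^sup>2)"
    by (simp add: norm_eq_sqrt_inner inner_diff_left inner_diff_right
        inner_commute[of v u] power2_eq_square)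
  have nw: "norm (w - ?b *\<^sub>R v) = sqrt (1 - ?b\<^sup>2)"
    by (simp add: norm_eq_sqrt_inner inner_diff_left inner_diff_right
        inner_commute[of w v] power2_eq_square)
  have "(u - ?a *\<^sub>R v) \<bullet> (w - ?b *\<^sub>R v) = u \<bullet> w - ?a * ?b"
    by (simp add: inner_diff_left inner_diff_right algebra_simps)
  then have "?a * ?b - sqrt (1 - ?a\<^sup>2) * sqrt (1 - ?b\<^sup>2) \<le> u \<bullet> w"
    using Cauchy_Schwarz_ineq2[of "u - ?a *\<^sub>R v" "w - ?b *\<^sub>R v"] nu nw by simp
  moreover have "cos (arccos ?a + arccos ?b) = ?a * ?b - sqrt (1 - ?a\<^sup>2) * sqrt (1 - ?b\<^sup>2)"
    using ab by (simp add: cos_add sin_arccos_abs cos_arccos abs_le_iff)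
  ultimately have "cos (arccos ?a + arccos ?b) \<le> u \<bullet> w"
    by simp
  then have "arccos (u \<bullet> w) \<le> arccos (cos (arccos ?a + arccos ?b))"
    using ab by (intro arccos_le_arccos) auto
  also have "\<dots> = arccos ?a + arccos ?b"
    using True ab arccos_lbound[of ?a] arccos_lbound[of ?b] by (intro arccos_cos) auto
  finally show ?thesis .
qed

text \<open>The spherical distance is the geodesic (great-circle) distance; all topological and
  measurable notions on \<^typ>\<open>csphere\<close> are those induced by it.\<close>

instantiation csphere :: metric_space
begin

definition dist_csphere :: "csphere \<Rightarrow> csphere \<Rightarrow> real" where
  "dist_csphere x y = arccos (stereo x \<bullet> stereo y)"

definition uniformity_csphere :: "(csphere \<times> csphere) filter" where
  "uniformity_csphere = (INF e\<in>{0 <..}. principal {(x, y). dist x y < e})"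

definition open_csphere :: "csphere set \<Rightarrow> bool" where
  "open_csphere U \<longleftrightarrow> (\<forall>x\<in>U. \<forall>\<^sub>F (x', y) in uniformity. x' = x \<longrightarrow> y \<in> U)"

instance
proof
  fix x y z :: csphere
  show "dist x y = 0 \<longleftrightarrow> x = y"
  proof
    assume "dist x y = 0"
    then have "cos (arccos (stereo x \<bullet> stereo y)) = 1"
      by (simp add: dist_csphere_def)
    then have "stereo x \<bullet> stereo y = 1"
      using unit_inner_bounds[of "stereo x" "stereo y"] by (simp add: cos_arccos)
    then have "(stereo x - stereo y) \<bullet> (stereo x - stereo y) = 0"
      by (simp add: inner_diff_left inner_diff_right inner_stereo_self inner_commute)
    then show "x = y"
      using inj_stereo by simp
  qed (simp add: dist_csphere_def inner_stereo_self)
  show "dist x y \<le> dist x z + dist y z"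
    using arccos_inner_triangle[of "stereo x" "stereo z" "stereo y"]
    by (simp add: dist_csphere_def inner_commute)
qed (simp_all add: uniformity_csphere_def open_csphere_def)

end

text \<open>A subset of the sphere that is contained and bounded in the plane.\<close>

definition bounded_in_plane :: "csphere set \<Rightarrow> bool" where
  "bounded_in_plane A \<longleftrightarrow> Infty \<notin> A \<and> bounded (Fin -` A)"


section \<open>Polynomial maps and polynomial semigroups\<close>

fun poly_map :: "complex poly \<Rightarrow> csphere \<Rightarrow> csphere" where
  "poly_map q (Fin z) = Fin (poly q z)"
| "poly_map q Infty = Infty"

definition polymaps :: "(csphere \<Rightarrow> csphere) set" where
  "polymaps = {poly_map q | q. degree q \<ge> 2}"

inductive_set semigroup_gen :: "(csphere \<Rightarrow> csphere) set \<Rightarrow> (csphere \<Rightarrow> csphere) set"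
  for S :: "(csphere \<Rightarrow> csphere) set" where
  gen: "h \<in> S \<Longrightarrow> h \<in> semigroup_gen S"
| comp: "f \<in> semigroup_gen S \<Longrightarrow> g \<in> semigroup_gen S \<Longrightarrow> f \<circ> g \<in> semigroup_gen S"

definition equicontinuous_on :: "csphere set \<Rightarrow> (csphere \<Rightarrow> csphere) set \<Rightarrow> bool" where
  "equicontinuous_on V G \<longleftrightarrow>
     (\<forall>z\<in>V. \<forall>\<epsilon>>0. \<exists>\<delta>>0. \<forall>w\<in>V. dist z w < \<delta> \<longrightarrow> (\<forall>g\<in>G. dist (g z) (g w) < \<epsilon>))"

definition Fatou :: "(csphere \<Rightarrow> csphere) set \<Rightarrow> csphere set" where
  "Fatou G = \<Union>{V. open V \<and> equicontinuous_on V G}"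

definition Julia :: "(csphere \<Rightarrow> csphere) set \<Rightarrow> csphere set" where
  "Julia G = - Fatou G"

definition Jker :: "(csphere \<Rightarrow> csphere) set \<Rightarrow> csphere set" where
  "Jker G = (\<Inter>g\<in>G. g -` Julia G)"

text \<open>Local coordinates: \<open>coord a\<close> is a holomorphic chart around \<open>a\<close>, namely \<open>z\<close> if \<open>a\<close> is
  finite and \<open>1/z\<close> if \<open>a = \<infinity>\<close>, and \<open>param a\<close> is its inverse. The values of \<open>coord (Fin _)\<close> at
  \<open>\<infinity>\<close> and of \<open>coord Infty\<close> at \<open>0\<close>, outside the chart domains, are irrelevant. A
  critical point is a point where the derivative in local coordinates vanishes.\<close>

fun coord :: "csphere \<Rightarrow> csphere \<Rightarrow> complex" where
  "coord (Fin _) (Fin z) = z"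
| "coord (Fin _) Infty = 0"
| "coord Infty (Fin z) = inverse z"
| "coord Infty Infty = 0"

fun param :: "csphere \<Rightarrow> complex \<Rightarrow> csphere" where
  "param (Fin _) w = Fin w"
| "param Infty w = (if w = 0 then Infty else Fin (inverse w))"

definition critical_points :: "(csphere \<Rightarrow> csphere) \<Rightarrow> csphere set" where
  "critical_points g =
     {a. ((coord (g a) \<circ> g \<circ> param a) has_field_derivative 0) (at (coord a a))}"

definition critical_values :: "(csphere \<Rightarrow> csphere) \<Rightarrow> csphere set" where
  "critical_values g = g ` critical_points g"

definition postcritical :: "(csphere \<Rightarrow> csphere) set \<Rightarrow> csphere set" where
  "postcritical G = closure (\<Union>g\<in>G. critical_values g)"

definition planar_postcritical :: "(csphere \<Rightarrow> csphere) set \<Rightarrow> csphere set" where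
  "planar_postcritical G = postcritical G - {Infty}"

definition Khat :: "(csphere \<Rightarrow> csphere) set \<Rightarrow> csphere set" where
  "Khat G = {Fin z | z. bounded_in_plane {g (Fin z) | g. g \<in> G}}"

definition filled_Julia :: "(csphere \<Rightarrow> csphere) \<Rightarrow> csphere set" where
  "filled_Julia g = {Fin z | z. bounded_in_plane {(g ^^ n) (Fin z) | n. True}}"

definition Fatou_infty :: "(csphere \<Rightarrow> csphere) set \<Rightarrow> csphere set" where
  "Fatou_infty G = connected_component_set (Fatou G) Infty"

definition class_B :: "((csphere \<Rightarrow> csphere) \<times> (csphere \<Rightarrow> csphere)) set" where
  "class_B = {(h1, h2). h1 \<in> polymaps \<and> h2 \<in> polymaps \<and>
     bounded_in_plane (planar_postcritical (semigroup_gen {h1, h2}))}"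

definition open_set_condition ::
  "(csphere \<Rightarrow> csphere) \<Rightarrow> (csphere \<Rightarrow> csphere) \<Rightarrow> csphere set \<Rightarrow> bool" where
  "open_set_condition h1 h2 U \<longleftrightarrow>
     U \<noteq> {} \<and> open U \<and> h1 -` U \<union> h2 -` U \<subseteq> U \<and> h1 -` U \<inter> h2 -` U = {}"

definition forward_invariant_compact ::
  "(csphere \<Rightarrow> csphere) set \<Rightarrow> csphere set \<Rightarrow> csphere set \<Rightarrow> bool" where
  "forward_invariant_compact G Y C \<longleftrightarrow>
     C \<noteq> {} \<and> compact C \<and> C \<subseteq> Y \<and> (\<forall>g\<in>G. g ` C \<subseteq> C)"

definition minimal_set ::
  "(csphere \<Rightarrow> csphere) set \<Rightarrow> csphere set \<Rightarrow> csphere set \<Rightarrow> bool" where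
  "minimal_set G Y L \<longleftrightarrow> forward_invariant_compact G Y L \<and>
     (\<forall>C. forward_invariant_compact G Y C \<longrightarrow> C \<subseteq> L \<longrightarrow> C = L)"


section \<open>The random dynamical system\<close>

text \<open>\<open>p \<delta>\<^bsub>h1\<^esub> + (1 - p) \<delta>\<^bsub>h2\<^esub>\<close> on the finite discrete space \<open>{h1, h2}\<close>.\<close>

definition tau :: "(csphere \<Rightarrow> csphere) \<Rightarrow> (csphere \<Rightarrow> csphere) \<Rightarrow> real
    \<Rightarrow> (csphere \<Rightarrow> csphere) measure" where
  "tau h1 h2 p =
     point_measure {h1, h2} (\<lambda>g. ennreal (p * indicator {h1} g + (1 - p) * indicator {h2} g))"

text \<open>Sequences are indexed from 0, so \<open>\<gamma> n\<close> is the map usually written \<open>\<gamma>\<^bsub>n+1\<^esub>\<close>. The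
  \<open>\<sigma>\<close>-algebra of the countable product coincides with the Borel \<open>\<sigma>\<close>-algebra of the product
  topology on \<open>{h1, h2}\<^bsup>\<nat>\<^esup>\<close>.\<close>

definition tau_seq :: "(csphere \<Rightarrow> csphere) \<Rightarrow> (csphere \<Rightarrow> csphere) \<Rightarrow> real
    \<Rightarrow> (nat \<Rightarrow> csphere \<Rightarrow> csphere) measure" where
  "tau_seq h1 h2 p = (\<Pi>\<^sub>M n\<in>UNIV. tau h1 h2 p)"

primrec random_orbit :: "(nat \<Rightarrow> csphere \<Rightarrow> csphere) \<Rightarrow> csphere \<Rightarrow> nat \<Rightarrow> csphere" where
  "random_orbit \<gamma> z 0 = z"
| "random_orbit \<gamma> z (Suc n) = \<gamma> n (random_orbit \<gamma> z n)"

definition T :: "(csphere \<Rightarrow> csphere) \<Rightarrow> (csphere \<Rightarrow> csphere) \<Rightarrow> real \<Rightarrow> csphere \<Rightarrow> real" where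
  "T h1 h2 p z = measure (tau_seq h1 h2 p)
     {\<gamma> \<in> space (tau_seq h1 h2 p). random_orbit \<gamma> z \<longlonglongrightarrow> Infty}"

definition dT :: "nat \<Rightarrow> (csphere \<Rightarrow> csphere) \<Rightarrow> (csphere \<Rightarrow> csphere) \<Rightarrow> real \<Rightarrow> csphere \<Rightarrow> real"
  where
  "dT n h1 h2 p z = (deriv ^^ n) (\<lambda>q. T h1 h2 q z) p"

definition M_op :: "(csphere \<Rightarrow> csphere) \<Rightarrow> (csphere \<Rightarrow> csphere) \<Rightarrow> real
    \<Rightarrow> (csphere \<Rightarrow> complex) \<Rightarrow> csphere \<Rightarrow> complex" where
  "M_op h1 h2 p \<phi> z = of_real p * \<phi> (h1 z) + of_real (1 - p) * \<phi> (h2 z)"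

definition borel_prob :: "csphere measure \<Rightarrow> bool" where
  "borel_prob \<mu> \<longleftrightarrow> sets \<mu> = sets borel \<and> prob_space \<mu>"

text \<open>\<open>M_dual h1 h2 p \<mu> \<mu>'\<close> says that \<open>\<mu>'\<close> is the image of \<open>\<mu>\<close> under the dual of \<open>M_op h1 h2 p\<close>,
  acting on Borel probability measures.\<close>

definition M_dual :: "(csphere \<Rightarrow> csphere) \<Rightarrow> (csphere \<Rightarrow> csphere) \<Rightarrow> real
    \<Rightarrow> csphere measure \<Rightarrow> csphere measure \<Rightarrow> bool" where
  "M_dual h1 h2 p \<mu> \<mu>' \<longleftrightarrow> borel_prob \<mu> \<and> borel_prob \<mu>' \<and>
     (\<forall>\<phi> :: csphere \<Rightarrow> complex. continuous_on UNIV \<phi> \<longrightarrow>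
        (\<integral>z. \<phi> z \<partial>\<mu>') = (\<integral>z. M_op h1 h2 p \<phi> z \<partial>\<mu>))"

definition invariant_prob_on :: "(csphere \<Rightarrow> csphere) \<Rightarrow> (csphere \<Rightarrow> csphere) \<Rightarrow> real
    \<Rightarrow> csphere set \<Rightarrow> csphere measure \<Rightarrow> bool" where
  "invariant_prob_on h1 h2 p Y \<nu> \<longleftrightarrow>
     borel_prob \<nu> \<and> emeasure \<nu> Y = 1 \<and> M_dual h1 h2 p \<nu> \<nu>"


section \<open>Regularity notions\<close>

definition Hoelder_continuous :: "(csphere \<Rightarrow> real) \<Rightarrow> bool" where
  "Hoelder_continuous f \<longleftrightarrow>
     (\<exists>\<alpha> C. 0 < \<alpha> \<and> \<alpha> \<le> 1 \<and> (\<forall>x y. \<bar>f x - f y\<bar> \<le> C * dist x y powr \<alpha>))"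

definition real_analytic_on :: "(real \<Rightarrow> real) \<Rightarrow> real set \<Rightarrow> bool" where
  "real_analytic_on f S \<longleftrightarrow>
     (\<forall>x\<in>S. \<exists>r>0. \<exists>a. \<forall>y. \<bar>y - x\<bar> < r \<longrightarrow> (\<lambda>n. a n * (y - x) ^ n) sums f y)"

end

theory Submission
  imports Defs "HOL-Computational_Algebra.Fundamental_Theorem_Algebra"
begin

text \<open>Write \<open>P\<close>, \<open>Q\<close> for the polynomials behind \<open>h1\<close>, \<open>h2\<close> and \<open>K\<^sub>1\<close>, \<open>K\<^sub>2\<close> for their filled Julia sets
in the plane. The hypotheses enter through three facts (\<open>poly_pairI\<close>, \<open>Q_K1_interior\<close>, \<open>P_K2\<close>): \<open>Q\<close> maps
\<open>K\<^sub>1\<close> into the interior of \<open>K\<^sub>1\<close>; if \<open>P z \<in> K\<^sub>2\<close>, then \<open>Q z \<in> K\<^sub>1\<close> and \<open>z\<close> is interior to \<open>K\<^sub>2\<close>; and every finite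
critical value of \<open>P\<close> or \<open>Q\<close> lies in \<open>K\<^sub>1\<close>, which is the set \<open>Khat G\<close>. Hence, of a point strictly between \<open>K\<^sub>1\<close>
and the boundary of \<open>K\<^sub>2\<close>, at most one of the two images is again such a point; the other one is already in
\<open>K\<^sub>1\<close>, where all orbits stay bounded, or outside the interior of \<open>K\<^sub>2\<close>, where almost all random orbits escape.

\<^bold>\<open>The function T.\<close> Because of this alternative, the transition operator contracts the functions that vanish
outside the intermediate region by the factor \<open>max \<bar>p\<bar> \<bar>1 - p\<bar>\<close>, also for complex \<open>p\<close> with \<open>\<bar>p\<bar>, \<bar>1 - p\<bar> < 1\<close>
(\<open>Mc_contraction\<close>). So the iterates of a continuous function that is \<open>0\<close> on \<open>K\<^sub>1\<close> and \<open>1\<close> off the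
interior of \<open>K\<^sub>2\<close> converge uniformly to a fixed point \<open>Tc p\<close>. As a function of \<open>p\<close> it is a locally uniform limit of
polynomials, hence holomorphic; Cauchy's inequality, the differentiated fixed point equation and the same
contraction give everything about the derivatives in \<open>p\<close>. That \<open>T\<close> is the restriction of \<open>Tc\<close> to real \<open>p\<close>,
that the functional equations have unique solutions, and the convergence on the whole sphere come
from uniform absorption (\<open>Mc_pow_absorb\<close>): some word of a fixed length takes any given point into \<open>K\<^sub>1\<close> or
near infinity. Hoelder continuity follows by weighing the geometric error of the iterates against their
Lipschitz constants.

\<^bold>\<open>The Julia set.\<close> Points with an itinerary that stays in \<open>K\<^sub>2 - interior K\<^sub>1\<close> for ever form the Julia set
(\<open>Fatou_eq\<close>). Off this set every word of some fixed length leads into one of two regions, on both of which \<open>G\<close> is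
equicontinuous and \<open>T\<close> is constant. At a point of the set, branches along the itinerary are expanding
(\<open>expansion\<close>): since all critical values are in \<open>K\<^sub>1\<close>, discs outside \<open>K\<^sub>1\<close> lift through every word, and each
lift through \<open>Q\<close>, being relatively compact in the region, may be enlarged by a fixed factor, as in the theorem
of Earle and Hamilton; a bounded disc cannot be enlarged indefinitely. So images of a small disc
along the itinerary are unbounded (\<open>survivors_runs_unbounded\<close>). This excludes equicontinuity, and it excludes
that \<open>T\<close> is constant near the point, since constancy would propagate along the itinerary
and keep the images inside \<open>K\<^sub>2\<close> (\<open>constant_step\<close>).

\<^bold>\<open>The minimal set and the invariant measure.\<close> As the critical values are in \<open>K\<^sub>1\<close>, the set \<open>K\<^sub>1\<close> is connected
(\<open>connected_fillK\<close>). Since \<open>Q\<close> maps \<open>K\<^sub>1\<close> into a compact connected part of its interior, the enlargement trick,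
now applied forwards, shows that words with many letters \<open>Q\<close> contract \<open>K\<^sub>1\<close> exponentially (\<open>sync\<close>).
Random orbits in \<open>K\<^sub>1\<close> therefore synchronise. The orbit closure of the attracting fixed point of \<open>Q\<close> is the only
minimal set in \<open>K\<^sub>1\<close>, and the law of the limit of the backward compositions \<open>\<gamma>\<^sub>0 \<circ> \<dots> \<circ> \<gamma>\<^sub>n\<close> is the
invariant measure.\<close>

section \<open>The chordal and the spherical metric\<close>

text \<open>A crude form of Jordan's inequality, enough to compare arc and chord: \<open>sin t = 2 tan (t/2) cos\<^sup>2 (t/2)\<close>, where
\<open>tan x \<ge> x\<close> and \<open>cos\<^sup>2 \<ge> 1/2\<close> up to \<open>\<pi>/4\<close>.\<close>

lemma half_le_sin:
  fixes t :: real assumes "0 \<le> t" "t \<le> pi/2" shows "t / 2 \<le> sin t"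
proof -
  define s where "s = t/2"
  have s: "0 \<le> s" "s \<le> pi/4" using assms by (auto simp: s_def)
  have c: "cos (pi/4) \<le> cos s" using s by (intro cos_monotone_0_pi_le) auto
  have c0: "0 < cos s" using c cos_45 by (smt (verit) divide_pos_pos real_sqrt_gt_zero)
  have c2: "1/2 \<le> (cos s)\<^sup>2"
  proof -
    have "(sqrt 2/2)\<^sup>2 \<le> (cos s)\<^sup>2" using c c0 by (intro power_mono) (auto simp: cos_45)
    then show ?thesis by (simp add: power_divide)
  qed
  have "s \<le> tan s"
  proof (cases "s = 0")
    case False
    have "\<exists>x. 0 < x \<and> x < s \<and> tan s - tan 0 = (s - 0) * (1 + (tan x)\<^sup>2)"
    proof (rule MVT2)
      show "0 < s" using s False by simp
      fix x assume "0 \<le> x" "x \<le> s"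
      then have "cos (pi/4) \<le> cos x" using s by (intro cos_monotone_0_pi_le) auto
      then have "cos x \<noteq> 0" using cos_45 by (smt (verit) divide_pos_pos real_sqrt_gt_zero)
      then have "DERIV tan x :> inverse ((cos x)\<^sup>2)" by (rule DERIV_tan)
      then show "DERIV tan x :> 1 + (tan x)\<^sup>2" using \<open>cos x \<noteq> 0\<close> tan_sec[of x] by (simp add: power_inverse)
    qed
    then obtain x where "tan s - tan 0 = (s - 0) * (1 + (tan x)\<^sup>2)" by blast
    then show ?thesis using s by (smt (verit) mult_left_mono tan_zero zero_le_power2 mult_cancel_left1)
  qed simp
  then have "s * cos s \<le> sin s" using c0 by (simp add: tan_def field_simps)
  then have "2 * (s * cos s) * cos s \<le> 2 * sin s * cos s" using c0 by simp
  moreover have "s * (1/2) \<le> s * (cos s)\<^sup>2" using c2 s by (intro mult_left_mono) auto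
  ultimately have "s \<le> sin (2 * s)" unfolding sin_double by (simp add: power2_eq_square algebra_simps)
  then show ?thesis by (simp add: s_def)
qed

text \<open>Chordal distances are algebraic in the plane coordinate, and \<open>dist_csphere_bounds\<close> makes them interchangeable
with the geodesic distance in all topological and Lipschitz statements.\<close>

definition chord :: "csphere \<Rightarrow> csphere \<Rightarrow> real" where
  "chord x y = norm (stereo x - stereo y)"

lemma chord_sq: "(chord x y)\<^sup>2 = 2 - 2 * (stereo x \<bullet> stereo y)"
  by (simp add: chord_def power2_norm_eq_inner inner_diff_left inner_diff_right inner_stereo_self inner_commute)

lemma chord_nonneg: "0 \<le> chord x y" by (simp add: chord_def)

lemma chord_eq_sin: "chord x y = 2 * sin (dist x y / 2)"
proof -
  have b: "- 1 \<le> stereo x \<bullet> stereo y" "stereo x \<bullet> stereo y \<le> 1"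
    by (simp_all add: unit_inner_bounds)
  have d: "0 \<le> dist x y" "dist x y \<le> pi" using b by (auto simp: dist_csphere_def arccos_lbound arccos_ubound)
  have "stereo x \<bullet> stereo y = cos (2 * (dist x y / 2))" using b by (simp add: dist_csphere_def)
  also have "\<dots> = 1 - 2 * (sin (dist x y / 2))\<^sup>2" by (rule cos_double_sin)
  finally have "(chord x y)\<^sup>2 = (2 * sin (dist x y / 2))\<^sup>2"
    unfolding chord_sq by (simp add: power_mult_distrib)
  moreover have "0 \<le> sin (dist x y / 2)" by (rule sin_ge_zero) (use d pi_gt_zero in linarith)+
  ultimately show ?thesis using chord_nonneg by (metis power2_eq_imp_eq mult_nonneg_nonneg zero_le_numeral)
qed

lemma dist_csphere_bounds: "chord x y \<le> dist x y" "dist x y \<le> 2 * chord x y"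
proof -
  have b: "- 1 \<le> stereo x \<bullet> stereo y" "stereo x \<bullet> stereo y \<le> 1"
    by (simp_all add: unit_inner_bounds)
  have d: "0 \<le> dist x y" "dist x y \<le> pi" using b by (auto simp: dist_csphere_def arccos_lbound arccos_ubound)
  show "chord x y \<le> dist x y" unfolding chord_eq_sin using d sin_x_le_x[of "dist x y/2"] by simp
  have "dist x y / 2 / 2 \<le> sin (dist x y / 2)" by (rule half_le_sin) (use d pi_gt_zero in linarith)+
  then show "dist x y \<le> 2 * chord x y" unfolding chord_eq_sin by simp
qed

lemma one_plus_norm_sq_pos: "0 < 1 + (norm (z::complex))\<^sup>2" by (smt (verit) zero_le_power2)

lemma chord_Fin: "chord (Fin z) (Fin w) = 2 * norm (z - w) / (sqrt (1 + (norm z)\<^sup>2) * sqrt (1 + (norm w)\<^sup>2))"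
proof -
  let ?a = "1 + (norm z)\<^sup>2" and ?b = "1 + (norm w)\<^sup>2"
  have p: "0 < ?a" "0 < ?b" using one_plus_norm_sq_pos by auto
  have "stereo (Fin z) \<bullet> stereo (Fin w) = (4 * (z \<bullet> w) + ((norm z)\<^sup>2 - 1) * ((norm w)\<^sup>2 - 1)) / (?a * ?b)"
    by (simp add: add_divide_distrib)
  then have "(chord (Fin z) (Fin w))\<^sup>2 = (2 * (?a * ?b) - 2 * (4 * (z \<bullet> w) + ((norm z)\<^sup>2 - 1) * ((norm w)\<^sup>2 - 1))) / (?a * ?b)"
    unfolding chord_sq using p mult_pos_pos[OF p] by (simp only: diff_divide_distrib) simp
  also have "2 * (?a * ?b) - 2 * (4 * (z \<bullet> w) + ((norm z)\<^sup>2 - 1) * ((norm w)\<^sup>2 - 1)) = 4 * (norm (z-w))\<^sup>2"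
    by (simp add: power2_norm_eq_inner inner_diff_left inner_diff_right inner_commute algebra_simps)
  also have "4 * (norm (z-w))\<^sup>2 / (?a * ?b) = (2 * norm (z - w) / (sqrt ?a * sqrt ?b))\<^sup>2"
    using p by (simp add: power_divide power_mult_distrib)
  finally show ?thesis using p by (intro power2_eq_imp_eq[OF _ chord_nonneg]) auto
qed

lemma chord_Fin_Infty: "chord (Fin z) Infty = 2 / sqrt (1 + (norm z)\<^sup>2)"
proof -
  let ?a = "1 + (norm z)\<^sup>2"
  have p: "0 < ?a" using one_plus_norm_sq_pos by auto
  have "(chord (Fin z) Infty)\<^sup>2 = 2 - 2 * (((norm z)\<^sup>2 - 1) / ?a)" unfolding chord_sq by simp
  also have "\<dots> = (2 * ?a - 2 * ((norm z)\<^sup>2 - 1)) / ?a" using p by (simp add: field_simps)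
  also have "\<dots> = (2 / sqrt ?a)\<^sup>2" using p by (simp add: power_divide)
  finally show ?thesis using p by (intro power2_eq_imp_eq[OF _ chord_nonneg]) auto
qed

lemma dist_Fin_le: "dist (Fin z) (Fin w) \<le> 4 * dist z w"
proof -
  have "1 \<le> sqrt (1 + (norm z)\<^sup>2) * sqrt (1 + (norm w)\<^sup>2)"
    using mult_mono[of 1 "sqrt (1 + (norm z)\<^sup>2)" 1 "sqrt (1 + (norm w)\<^sup>2)"] by simp
  then have "chord (Fin z) (Fin w) \<le> 2 * norm (z-w) / 1"
    unfolding chord_Fin by (intro divide_left_mono) auto
  then show ?thesis using dist_csphere_bounds(2)[of "Fin z" "Fin w"] by (simp add: dist_norm)
qed

lemma continuous_on_Fin: "continuous_on S Fin"
proof (rule continuous_onI)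
  fix x e assume "0 < (e::real)"
  then show "\<exists>d>0. \<forall>x'\<in>S. dist x' x < d \<longrightarrow> dist (Fin x') (Fin x) \<le> e"
  proof (intro exI[of _ "e/4"] conjI ballI impI)
    fix x' assume "dist x' x < e/4"
    then show "dist (Fin x') (Fin x) \<le> e" using dist_Fin_le[of x' x] by simp
  qed simp
qed

lemma open_vimage_Fin: "open V \<Longrightarrow> open (Fin -` V)"
  using continuous_on_Fin[of UNIV] by (simp add: open_vimage)

text \<open>Near \<open>Fin z\<close> the factor \<open>\<surd>(1 + \<bar>w\<bar>\<^sup>2)\<close> in the chordal distance cannot cancel the growth of
\<open>\<bar>z - w\<bar>\<close>: for \<open>\<bar>z - w\<bar> \<ge> e\<close> that factor is at most \<open>\<bar>z - w\<bar> / e\<close> times its largest value on the disc of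
radius \<open>e\<close>.\<close>

lemma open_Fin_image: assumes "open S" shows "open (Fin ` S)"
proof (unfold open_dist, intro ballI)
  fix x assume "x \<in> Fin ` S"
  then obtain z where z: "z \<in> S" "x = Fin z" by auto
  obtain e where e: "e > 0" "ball z e \<subseteq> S" using assms z openE by blast
  define M where "M = sqrt (1 + (norm z)\<^sup>2)"
  define N where "N = sqrt (1 + (norm z + e)\<^sup>2)"
  have MN: "M > 0" "N > 0" unfolding M_def N_def using one_plus_norm_sq_pos[of z] by (auto intro: add_pos_nonneg)
  have key: "\<exists>w. y = Fin w \<and> w \<in> S" if y: "dist y x < min (1/M) (e/(2*M*N))" for y
  proof (cases y)
    case Infty
    have "chord y x \<le> dist y x" by (rule dist_csphere_bounds)
    moreover have "chord y x = 2 / M" unfolding Infty z M_def chord_Fin_Infty[symmetric] by (simp only: chord_def norm_minus_commute)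
    ultimately show ?thesis using y MN by (simp add: field_simps)
  next
    case (Fin w)
    have c: "chord x y \<le> dist y x" using dist_csphere_bounds(1)[of x y] by (simp add: dist_commute)
    have eq: "chord x y = 2 * norm (z-w) / (M * sqrt (1 + (norm w)\<^sup>2))" using Fin z by (simp add: chord_Fin M_def)
    let ?W = "sqrt (1 + (norm w)\<^sup>2)"
    have W: "?W \<ge> 1" by simp
    have l1: "2 * norm (z-w) < ?W" 
    proof -
      have "2 * norm (z-w) / (M * ?W) < 1/M" using c eq y by simp
      then have "2 * norm (z-w) / ?W < 1" using MN by (simp add: field_simps)
      moreover have "0 < ?W" using W by linarith
      ultimately show ?thesis by (simp only: divide_less_eq_1_pos)
    qed
    have Ww: "?W \<le> 1 + norm w" by (rule real_le_lsqrt) (auto simp: power2_eq_square algebra_simps)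
    have "norm w \<le> norm z + norm (z-w)" by (metis norm_minus_commute norm_triangle_sub)
    then have "norm (z - w) \<le> 1 + norm z" using l1 Ww by linarith
    have l2: "4 * norm (z-w) * N < e * ?W"
    proof -
      have "2 * norm (z-w) / (M * ?W) < e/(2*M*N)" using c eq y by simp
      then have "4 * norm (z-w) * N / ?W < e" using MN by (simp add: field_simps)
      moreover have "0 < ?W" using W by linarith
      ultimately show ?thesis by (simp only: pos_divide_less_eq)
    qed
    have "norm (z-w) < e"
    proof (rule ccontr)
      assume a: "\<not> norm (z-w) < e"
      define u where "u = norm (z-w)"
      have u: "e \<le> u" "0 < u" using a e by (auto simp: u_def)
      have "?W \<le> sqrt (1 + (norm z + u)\<^sup>2)"
        using \<open>norm w \<le> norm z + norm (z-w)\<close> by (auto simp: u_def intro!: power_mono)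
      also have "\<dots> \<le> sqrt ((u/e)\<^sup>2 * (1 + (norm z + e)\<^sup>2))"
      proof -
        have 1: "1 \<le> u/e" using u e by simp
        have "norm z + u \<le> (u/e) * (norm z + e)" using 1 e mult_right_mono[OF 1, of "norm z"] by (simp add: distrib_left)
        then have "(norm z + u)\<^sup>2 \<le> (u/e)\<^sup>2 * (norm z + e)\<^sup>2"
          using u by (metis power_mono power_mult_distrib add_nonneg_nonneg norm_ge_zero less_imp_le)
        moreover have "1 \<le> (u/e)\<^sup>2" using 1 by simp
        ultimately show ?thesis by (simp add: distrib_left)
      qed
      also have "\<dots> = u/e * N" using u e by (simp add: real_sqrt_mult N_def)
      finally have "e * ?W \<le> u * N" using e by (simp add: field_simps)
      moreover have "u * N < 4 * (u * N)" using mult_pos_pos[of u N] u MN by linarith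
      moreover have "4 * (u * N) < e * ?W" using l2 by (simp only: u_def mult.assoc)
      moreover note \<open>e * ?W \<le> u * N\<close>
      ultimately show False by linarith
    qed
    then show ?thesis using e Fin by (auto simp: dist_norm)
  qed
  show "\<exists>e>0. \<forall>y. dist y x < e \<longrightarrow> y \<in> Fin ` S"
  proof (intro exI conjI allI impI)
    show "0 < min (1/M) (e/(2*M*N))" using MN e by simp
  qed (use key in blast)
qed

definition nbhd_Infty :: "real \<Rightarrow> csphere set" where
  "nbhd_Infty R = insert Infty (Fin ` {z. R < norm z})"

lemma mem_nbhd_Infty [simp]: "Infty \<in> nbhd_Infty R" "Fin z \<in> nbhd_Infty R \<longleftrightarrow> R < norm z"
  by (auto simp: nbhd_Infty_def)

lemma nbhd_Infty_subset_ball: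
  assumes "e > 0" obtains R where "R > 0" "nbhd_Infty R \<subseteq> ball Infty e"
proof
  show "0 < 4/e" using assms by simp
  show "nbhd_Infty (4/e) \<subseteq> ball Infty e"
  proof
    fix x assume x: "x \<in> nbhd_Infty (4/e)"
    show "x \<in> ball Infty e"
    proof (cases x)
      case (Fin z)
      then have z: "4/e < norm z" using x by simp
      have "norm z < sqrt (1 + (norm z)\<^sup>2)" by (rule real_less_rsqrt) simp
      moreover have "0 < norm z" using z assms by (smt (verit) divide_pos_pos)
      ultimately have "chord x Infty < 2 / norm z" unfolding Fin chord_Fin_Infty
        by (intro divide_strict_left_mono mult_pos_pos) linarith+
      moreover have "2/norm z < e/2" using z assms \<open>0 < norm z\<close> by (simp add: field_simps)
      ultimately show ?thesis using dist_csphere_bounds(2)[of x Infty] by (simp add: dist_commute)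
    qed (use assms in simp)
  qed
qed

lemma open_nbhd_Infty: "open (nbhd_Infty R)"
proof (unfold open_dist, intro ballI)
  fix x assume x: "x \<in> nbhd_Infty R"
  show "\<exists>e>0. \<forall>y. dist y x < e \<longrightarrow> y \<in> nbhd_Infty R"
  proof (cases x)
    case (Fin z)
    have "open (Fin ` {z. R < norm z})" by (intro open_Fin_image open_Collect_less continuous_intros)
    then obtain e where "e>0" "\<forall>y. dist y x < e \<longrightarrow> y \<in> Fin ` {z. R < norm z}"
      using Fin x unfolding open_dist by auto
    then show ?thesis unfolding nbhd_Infty_def by blast
  next
    case Infty
    define S where "S = max R 0"
    have S: "S \<ge> 0" "S \<ge> R" by (auto simp: S_def)
    have "y \<in> nbhd_Infty R" if y: "dist y x < 1 / (1 + S)" for y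
    proof (cases y)
      case (Fin w)
      have "chord y x < 1/(1+S)" using y dist_csphere_bounds(1)[of y x] by simp
      then have "2 / sqrt (1 + (norm w)\<^sup>2) < 1/(1+S)" by (simp only: Fin Infty chord_Fin_Infty)
      moreover have "0 < sqrt (1 + (norm w)\<^sup>2)" using one_plus_norm_sq_pos by simp
      ultimately have "2 * (1+S) < sqrt (1 + (norm w)\<^sup>2)" using S by (simp add: field_simps)
      also have "\<dots> \<le> 1 + norm w" by (rule real_le_lsqrt) (auto simp: power2_eq_square algebra_simps)
      finally show ?thesis using S Fin by simp
    qed simp
    then show ?thesis using S by (intro exI[of _ "1/(1+S)"]) auto
  qed
qed

lemma open_Infty_imp_nbhd:
  assumes "open V" "Infty \<in> V" obtains R where "R > 0" "nbhd_Infty R \<subseteq> V"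
proof -
  obtain e where e: "e > 0" "ball Infty e \<subseteq> V" using openE[OF assms] .
  obtain R where "R > 0" "nbhd_Infty R \<subseteq> ball Infty e" using nbhd_Infty_subset_ball[OF e(1)] .
  then show ?thesis using that[of R] e(2) by simp
qed

lemma tendsto_Infty_iff:
  "(f \<longlongrightarrow> Infty) F \<longleftrightarrow> (\<forall>R. eventually (\<lambda>x. f x \<in> nbhd_Infty R) F)"
proof
  assume "(f \<longlongrightarrow> Infty) F"
  then show "\<forall>R. eventually (\<lambda>x. f x \<in> nbhd_Infty R) F"
    using topological_tendstoD open_nbhd_Infty mem_nbhd_Infty(1) by blast
next
  assume *: "\<forall>R. eventually (\<lambda>x. f x \<in> nbhd_Infty R) F"
  show "(f \<longlongrightarrow> Infty) F"
  proof (rule topological_tendstoI)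
    fix S :: "csphere set" assume "open S" "Infty \<in> S"
    then obtain R where "nbhd_Infty R \<subseteq> S" using open_Infty_imp_nbhd by metis
    moreover have "eventually (\<lambda>x. f x \<in> nbhd_Infty R) F" using * by blast
    ultimately show "eventually (\<lambda>x. f x \<in> S) F" by (auto elim: eventually_mono)
  qed
qed

lemma compact_Fin_image: "compact S \<Longrightarrow> compact (Fin ` S)"
  by (rule compact_continuous_image[OF continuous_on_Fin])

lemma interior_Fin_image: "interior (Fin ` S) = Fin ` interior S"
proof
  show "Fin ` interior S \<subseteq> interior (Fin ` S)"
    by (rule interior_maximal) (auto intro!: open_Fin_image interior_subset image_mono)
  show "interior (Fin ` S) \<subseteq> Fin ` interior S"
  proof
    fix x assume x: "x \<in> interior (Fin ` S)"
    then obtain z where z: "x = Fin z" using interior_subset by blast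
    have "Fin -` interior (Fin ` S) \<subseteq> S" using interior_subset[of "Fin ` S"] by auto
    then have "Fin -` interior (Fin ` S) \<subseteq> interior S"
      by (intro interior_maximal open_vimage_Fin open_interior)
    then show "x \<in> Fin ` interior S" using x z by auto
  qed
qed

lemma UNIV_csphere_decomp: "UNIV = Fin ` cball 0 R \<union> nbhd_Infty R"
proof -
  have "x \<in> Fin ` cball 0 R \<union> nbhd_Infty R" for x by (cases x) (auto simp: not_less)
  then show ?thesis by blast
qed

text \<open>The member of a cover that contains infinity leaves only the image of a closed disc to be covered.\<close>

lemma compact_UNIV_csphere: "compact (UNIV :: csphere set)"
proof (unfold compact_eq_Heine_Borel, intro allI impI, elim conjE)
  fix C :: "csphere set set" assume C: "\<forall>t\<in>C. open t" "UNIV \<subseteq> \<Union>C"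
  then obtain V where V: "V \<in> C" "Infty \<in> V" by blast
  then obtain R where R: "nbhd_Infty R \<subseteq> V" using C open_Infty_imp_nbhd by metis
  have "compact (Fin ` cball 0 R)" by (intro compact_Fin_image compact_cball)
  then obtain C' where C': "C' \<subseteq> C" "finite C'" "Fin ` cball 0 R \<subseteq> \<Union>C'"
    using C by (meson compactE subset_UNIV subset_trans)
  have "UNIV \<subseteq> \<Union>(insert V C')"
    unfolding UNIV_csphere_decomp[of R] using C'(3) R by auto
  then show "\<exists>C'\<subseteq>C. finite C' \<and> UNIV \<subseteq> \<Union>C'" using C' V by (intro exI[of _ "insert V C'"]) auto
qed

lemma closed_csphere_compact: "closed (S :: csphere set) \<Longrightarrow> compact S"
  using compact_Int_closed[OF compact_UNIV_csphere, of S] by simp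

section \<open>Filled Julia sets of polynomials\<close>

lemma deriv_bound_ball:
  assumes hol: "f holomorphic_on ball z s" and s: "0 < s" and B: "\<And>w. w \<in> ball z s \<Longrightarrow> norm (f w) \<le> B"
  shows "norm (deriv f z) \<le> 2 * B / s"
proof -
  have sub: "cball z (s/2) \<subseteq> ball z s" using s by auto
  have "norm ((deriv ^^ 1) f z) \<le> fact 1 * B / (s/2) ^ 1"
  proof (rule Cauchy_inequality)
    show "f holomorphic_on ball z (s/2)" using hol by (rule holomorphic_on_subset) (use s in auto)
    show "continuous_on (cball z (s/2)) f" using hol sub by (meson continuous_on_subset holomorphic_on_imp_continuous_on)
    show "norm (f x) \<le> B" if "norm (z - x) = s/2" for x using that s by (intro B) (auto simp: dist_norm)
  qed (use s in auto)
  then show ?thesis by (simp add: field_simps)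
qed

text \<open>The quantitative form of normality of bounded families: a Lipschitz constant that depends only on the bound and
the radius. All equicontinuity statements below reduce to it.\<close>

lemma bounded_holomorphic_lipschitz:
  assumes hol: "f holomorphic_on ball z s" and B: "\<And>w. w \<in> ball z s \<Longrightarrow> norm (f w) \<le> B"
    and w: "w \<in> ball z (s/2)"
  shows "norm (f w - f z) \<le> 4 * B / s * norm (w - z)"
proof -
  have s: "0 < s" using w by (metis ball_eq_empty empty_iff half_gt_zero_iff not_less)
  show ?thesis
  proof (rule field_differentiable_bound[of "ball z (s/2)" f "deriv f"])
    fix u assume u: "u \<in> ball z (s/2)"
    then have "u \<in> ball z s" using s by auto
    then show "(f has_field_derivative deriv f u) (at u within ball z (s/2))"
      using hol by (simp add: holomorphic_derivI)
    have sub: "ball u (s/2) \<subseteq> ball z s"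
    proof
      fix v assume "v \<in> ball u (s/2)"
      then show "v \<in> ball z s" using u dist_triangle[of z v u] by simp
    qed
    have "norm (deriv f u) \<le> 2 * B / (s/2)"
      by (rule deriv_bound_ball) (use hol holomorphic_on_subset sub s B in auto)
    then show "norm (deriv f u) \<le> 4 * B / s" by simp
  qed (use s w in auto)
qed

definition escape_radius :: "complex poly \<Rightarrow> real \<Rightarrow> bool" where
  "escape_radius P R \<longleftrightarrow> 1 \<le> R \<and> (\<forall>z. R \<le> norm z \<longrightarrow> 2 * norm z \<le> norm (poly P z))"

lemma escape_radius_mono: "escape_radius P R \<Longrightarrow> R \<le> R' \<Longrightarrow> escape_radius P R'" by (auto simp: escape_radius_def)

lemma escape_radiusD: "escape_radius P R \<Longrightarrow> R \<le> norm z \<Longrightarrow> 2 * norm z \<le> norm (poly P z)" by (auto simp: escape_radius_def)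
lemma escape_radius_ge1: "escape_radius P R \<Longrightarrow> 1 \<le> R" by (auto simp: escape_radius_def)

lemma escape_radius_exists: assumes "degree P \<ge> 2" obtains R where "escape_radius P R"
proof -
  obtain a Q where P: "P = pCons a Q" by (cases P)
  obtain b Q' where Q: "Q = pCons b Q'" by (cases Q)
  have "Q' \<noteq> 0" using assms P Q by (auto split: if_splits)
  then obtain r where r: "\<And>z. r \<le> norm z \<Longrightarrow> 2 + norm a \<le> norm (poly Q z)" using poly_infinity[of Q' "2 + norm a" b] Q by auto
  have "escape_radius P (max 1 r)" unfolding escape_radius_def
  proof (intro conjI allI impI)
    fix z :: complex assume z: "max 1 r \<le> norm z"
    have "norm z * (2 + norm a) \<le> norm z * norm (poly Q z)" using r[of z] z by (intro mult_left_mono) auto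
    moreover have "1 * norm a \<le> norm z * norm a" using z by (intro mult_right_mono) auto
    moreover have "norm (z * poly Q z) \<le> norm (poly P z) + norm a"
      using norm_triangle_ineq4[of "a + z * poly Q z" a] by (simp add: P)
    ultimately show "2 * norm z \<le> norm (poly P z)" by (simp add: norm_mult algebra_simps)
  qed simp
  then show ?thesis by (rule that)
qed

lemma escape_radius_iter: assumes "escape_radius P R" "R \<le> norm z" shows "2 ^ n * norm z \<le> norm ((poly P ^^ n) z) \<and> R \<le> norm ((poly P ^^ n) z)"
proof (induction n)
  case (Suc n)
  have "2 * norm ((poly P ^^ n) z) \<le> norm ((poly P ^^ Suc n) z)" using Suc escape_radiusD[OF assms(1)] by simp
  then show ?case using Suc escape_radius_ge1[OF assms(1)] by auto
qed (use assms in auto)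

definition fillK :: "complex poly \<Rightarrow> complex set" where
  "fillK P = {z. bounded (range (\<lambda>n. (poly P ^^ n) z))}"

lemma escape_radius_unbounded: assumes "escape_radius P R" "R \<le> norm z" shows "\<not> bounded (range (\<lambda>n. (poly P ^^ n) z))"
proof
  assume "bounded (range (\<lambda>n. (poly P ^^ n) z))"
  then obtain C where C: "\<And>n. norm ((poly P ^^ n) z) \<le> C" by (auto simp: bounded_iff)
  obtain n where n: "C < 2 ^ n" using real_arch_pow[of 2 C] by auto
  have "1 \<le> norm z" using assms escape_radius_ge1 order_trans by blast
  then have "2 ^ n * 1 \<le> 2 ^ n * norm z" by (intro mult_left_mono) auto
  then show False using n C[of n] escape_radius_iter[OF assms, of n] by linarith
qed

lemma funpow_plus_apply: "(f ^^ (m + n)) x = (f ^^ m) ((f ^^ n) x)" by (simp add: funpow_add)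

lemma fillK_step: "poly P z \<in> fillK P \<longleftrightarrow> z \<in> fillK P"
proof -
  have "range (\<lambda>n. (poly P ^^ n) z) = insert z (range (\<lambda>n. (poly P ^^ n) (poly P z)))"
  proof (rule set_eqI)
    fix x show "x \<in> range (\<lambda>n. (poly P ^^ n) z) \<longleftrightarrow> x \<in> insert z (range (\<lambda>n. (poly P ^^ n) (poly P z)))"
      by (auto simp: funpow_swap1 image_iff) (metis funpow_0 funpow.simps(2) funpow_swap1 o_apply not0_implies_Suc)+
  qed
  then show ?thesis by (simp add: fillK_def)
qed

lemma fillK_funpow: "(poly P ^^ n) z \<in> fillK P \<longleftrightarrow> z \<in> fillK P"
  by (induction n) (auto simp: fillK_step)

lemma fillK_norm_less: assumes "escape_radius P R" "z \<in> fillK P" shows "norm z < R"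
  using escape_radius_unbounded[OF assms(1), of z] assms(2) by (force simp: fillK_def)

lemma fillK_iff: assumes "escape_radius P R" shows "z \<in> fillK P \<longleftrightarrow> (\<forall>n. norm ((poly P ^^ n) z) \<le> R)"
proof
  assume "z \<in> fillK P" then show "\<forall>n. norm ((poly P ^^ n) z) \<le> R"
    using fillK_norm_less[OF assms] fillK_funpow less_imp_le by blast
next
  assume "\<forall>n. norm ((poly P ^^ n) z) \<le> R" then show "z \<in> fillK P"
    by (auto simp: fillK_def bounded_iff)
qed

lemma continuous_on_poly_funpow: "continuous_on S (poly (P::complex poly) ^^ n)"
proof (induction n arbitrary: S)
  case (Suc n)
  have "continuous_on S (poly P \<circ> (poly P ^^ n))" by (intro continuous_on_compose Suc continuous_intros)
  then show ?case by simp
qed (simp add: id_def)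

lemma holomorphic_poly_funpow: "(poly (P::complex poly) ^^ n) holomorphic_on S"
proof (induction n arbitrary: S)
  case (Suc n)
  have "(poly P \<circ> (poly P ^^ n)) holomorphic_on S" by (intro holomorphic_on_compose Suc) (auto intro!: holomorphic_intros)
  then show ?case by (simp add: o_def)
qed (simp add: id_def)

lemma compact_fillK: assumes "degree P \<ge> 2" shows "compact (fillK P)"
proof -
  obtain R where R: "escape_radius P R" using escape_radius_exists[OF assms] .
  have eq: "fillK P = (\<Inter>n. (poly P ^^ n) -` cball 0 R)" using fillK_iff[OF R] by auto
  have "closed (fillK P)" unfolding eq
    by (intro closed_INT ballI closed_vimage closed_cball continuous_on_poly_funpow)
  moreover have "bounded (fillK P)" using fillK_norm_less[OF R] by (auto simp: bounded_iff intro: less_imp_le)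
  ultimately show ?thesis by (simp add: compact_eq_bounded_closed)
qed

lemma poly_surj: assumes "degree (P::complex poly) \<ge> 1" obtains z where "poly P z = w"
proof -
  have "\<exists>z. poly (P - [:w:]) z = 0"
  proof (rule fundamental_theorem_of_algebra)
    have "degree (P - [:w:]) = degree P" using degree_add_eq_left[of "-[:w:]" P] assms by (simp only: diff_conv_add_uminus) simp
    then show "\<not> Fundamental_Theorem_Algebra.constant (poly (P - [:w:]))" using assms constant_degree by (metis not_one_le_zero)
  qed
  then show ?thesis using that by auto
qed

lemma fillK_nonempty: assumes "degree P \<ge> 2" shows "fillK P \<noteq> {}"
proof -
  have "degree (P - [:0,1:]) = degree P" using degree_add_eq_left[of "-[:0,1:]" P] assms by (simp only: diff_conv_add_uminus) simp
  then obtain z where "poly (P - [:0,1:]) z = 0" using poly_surj[of "P - [:0,1:]" 0] assms by auto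
  then have z: "poly P z = z" by simp
  have "(poly P ^^ n) z = z" for n by (induction n) (auto simp: z)
  then have "z \<in> fillK P" by (simp add: fillK_def)
  then show ?thesis by auto
qed

lemma poly_nonconst_open: assumes "degree (P::complex poly) \<ge> 1" "open S" shows "open (poly P ` S)"
proof (rule open_mapping_thm[of "poly P" UNIV])
  show "\<not> poly P constant_on UNIV"
  proof
    assume "poly P constant_on UNIV"
    then obtain c where c: "\<And>z. poly P z = c" by (auto simp: constant_on_def)
    obtain z where "poly P z = c + 1" using poly_surj[OF assms(1)] .
    then show False using c[of z] by simp
  qed
qed (use assms in \<open>auto intro!: holomorphic_intros\<close>)

text \<open>Escape beyond the radius \<open>R\<close> is an open condition that persists, so compactness makes it uniform on a closed set
without bounded orbits.\<close>

lemma uniform_escape: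
  assumes escape_radius: "escape_radius P R" and W: "closed W" "W \<inter> fillK P = {}"
  obtains N where "\<And>z n. z \<in> W \<Longrightarrow> N \<le> n \<Longrightarrow> R < norm ((poly P ^^ n) z)"
proof -
  have mono: "R < norm ((poly P ^^ n) z)" if mn: "R < norm ((poly P ^^ m) z)" "m \<le> n" for m n z
  proof -
    obtain k where k: "n = k + m" using mn(2) le_Suc_ex by (metis add.commute)
    have "2 ^ k * norm ((poly P ^^ m) z) \<le> norm ((poly P ^^ k) ((poly P ^^ m) z))"
      using escape_radius_iter[OF escape_radius, of "(poly P ^^ m) z" k] mn(1) by simp
    moreover have "1 * norm ((poly P ^^ m) z) \<le> 2 ^ k * norm ((poly P ^^ m) z)" by (intro mult_right_mono) auto
    ultimately show ?thesis using mn(1) by (simp add: k funpow_plus_apply)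
  qed
  have "compact (W \<inter> cball 0 R)" using W by (simp add: closed_Int_compact)
  moreover have "W \<inter> cball 0 R \<subseteq> (\<Union>n\<in>UNIV. (poly P ^^ n) -` (- cball 0 R))"
    using W(2) fillK_iff[OF escape_radius] by auto
  moreover have "open ((poly P ^^ n) -` (- cball 0 R))" for n
    by (intro open_vimage continuous_on_poly_funpow) auto
  ultimately obtain I where I: "finite I" "W \<inter> cball 0 R \<subseteq> (\<Union>n\<in>I. (poly P ^^ n) -` (- cball 0 R))"
    by (metis (mono_tags, lifting) compactE_image subset_UNIV)
  show ?thesis
  proof (rule that[of "Max (insert 0 I)"])
    fix z n assume z: "z \<in> W" and n: "Max (insert 0 I) \<le> n"
    show "R < norm ((poly P ^^ n) z)"
    proof (cases "norm z \<le> R")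
      case True
      then obtain m where m: "m \<in> I" "R < norm ((poly P ^^ m) z)" using I z by force
      moreover have "m \<le> n" using m(1) I(1) n by auto
      ultimately show ?thesis using mono by blast
    next
      case False
      then show ?thesis using mono[of 0 z n] by simp
    qed
  qed
qed

lemma interior_fillK_step: "poly P z \<in> interior (fillK P) \<Longrightarrow> z \<in> interior (fillK P)"
proof -
  have "poly P -` interior (fillK P) \<subseteq> interior (fillK P)"
  proof (rule interior_maximal)
    show "poly P -` interior (fillK P) \<subseteq> fillK P" using interior_subset fillK_step by blast
    show "open (poly P -` interior (fillK P))" by (intro open_vimage open_interior continuous_intros)
  qed
  then show "poly P z \<in> interior (fillK P) \<Longrightarrow> z \<in> interior (fillK P)" by auto
qed

lemma interior_fillK_funpow: "(poly P ^^ n) z \<in> interior (fillK P) \<Longrightarrow> z \<in> interior (fillK P)"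
  by (induction n arbitrary: z) (auto simp: funpow_swap1 dest: interior_fillK_step)

text \<open>A filled Julia set with interior has no hairs. Near a boundary point with a neighbourhood disjoint from the
interior, the iterates avoid a disc \<open>ball a e\<close> inside the interior, so that \<open>1 / (P\<^sup>n - a)\<close> is a bounded,
hence equi-Lipschitz family; but it stays away from \<open>0\<close> at the point and tends to \<open>0\<close> at escaping points
arbitrarily close to it.\<close>

lemma fillK_subset_closure_interior:
  assumes deg: "degree P \<ge> 2" and ne: "interior (fillK P) \<noteq> {}"
  shows "fillK P \<subseteq> closure (interior (fillK P))"
proof
  fix z assume z: "z \<in> fillK P"
  show "z \<in> closure (interior (fillK P))"
  proof (rule ccontr)
    assume "z \<notin> closure (interior (fillK P))"
    then obtain s where s: "s > 0" "ball z s \<subseteq> - closure (interior (fillK P))"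
      using open_Compl[OF closed_closure] openE by (metis ComplI)
    have out: "w \<notin> interior (fillK P)" if "w \<in> ball z s" for w using s that closure_subset by blast
    obtain a e where a: "e > 0" "ball a e \<subseteq> interior (fillK P)" using ne openE[OF open_interior] by (metis all_not_in_conv)
    obtain R where R: "escape_radius P R" using escape_radius_exists[OF deg] .
    define F where "F = (\<lambda>n w. inverse ((poly P ^^ n) w - a))"
    have far: "e \<le> norm ((poly P ^^ n) w - a)" if "w \<in> ball z s" for n w
    proof (rule ccontr)
      assume "\<not> e \<le> norm ((poly P ^^ n) w - a)"
      then have "(poly P ^^ n) w \<in> ball a e" by (simp add: dist_norm norm_minus_commute)
      then show False using a out[OF that] interior_fillK_funpow by blast
    qed
    have lip: "norm (F n w - F n z) \<le> 4 * inverse e / s * norm (w - z)" if "w \<in> ball z (s/2)" for n w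
    proof (rule bounded_holomorphic_lipschitz[OF _ _ that])
      have "(poly P ^^ n) w \<noteq> a" if "w \<in> ball z s" for w using far[OF that, of n] a by auto
      then show "F n holomorphic_on ball z s" unfolding F_def
        by (intro holomorphic_intros holomorphic_poly_funpow) auto
      show "norm (F n w) \<le> inverse e" if "w \<in> ball z s" for w
        unfolding F_def norm_inverse using far[OF that, of n] a by (intro le_imp_inverse_le) auto
    qed
    define M where "M = R + norm a + 1"
    have M: "M > 0" using escape_radius_ge1[OF R] by (simp add: M_def add_pos_nonneg)
    have Fz: "inverse M \<le> norm (F n z)" for n
    proof -
      have "norm ((poly P ^^ n) z - a) \<le> M" 
        using fillK_iff[OF R, THEN iffD1, OF z, rule_format, of n] norm_triangle_ineq4[of "(poly P ^^ n) z" a] unfolding M_def by linarith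
      moreover have "norm ((poly P ^^ n) z - a) > 0" using far[of z n] s a by auto
      ultimately show ?thesis unfolding F_def norm_inverse by (intro le_imp_inverse_le)
    qed
    \<comment> \<open>Within the distance \<open>d\<close> the Lipschitz bound allows a change of at most half the lower bound \<open>1/M\<close> at \<open>z\<close>.\<close>
    define d where "d = min (s/2) (s * e / (8 * M))"
    have d: "d > 0" "d \<le> s/2" "4 * inverse e / s * d \<le> inverse M / 2"
    proof -
      show "d > 0" "d \<le> s/2" using s a M by (auto simp: d_def)
      have "4 * inverse e / s * d \<le> 4 * inverse e / s * (s * e / (8 * M))" using s a by (intro mult_left_mono) (auto simp: d_def)
      also have "\<dots> = inverse M / 2" using s a by (simp add: field_simps)
      finally show "4 * inverse e / s * d \<le> inverse M / 2" .
    qed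
    have "z \<notin> interior (fillK P)" using out s by auto
    then have "\<not> ball z d \<subseteq> fillK P" using d(1) by (meson centre_in_ball interior_maximal open_ball subsetD)
    then obtain w where w: "w \<in> ball z d" "w \<notin> fillK P" by blast
    have w2: "w \<in> ball z (s/2)" using w d by auto
    define R' where "R' = max R (norm a + 4 * M)"
    have R': "escape_radius P R'" using R by (rule escape_radius_mono) (simp add: R'_def)
    obtain n where n: "R' < norm ((poly P ^^ n) w)" using w(2) fillK_iff[OF R'] by (meson not_le)
    have "4 * M < norm ((poly P ^^ n) w - a)"
      using n norm_triangle_ineq2[of "(poly P ^^ n) w" a] by (simp add: R'_def)
    then have "norm (F n w) < inverse (4 * M)" unfolding F_def norm_inverse using M by (intro less_imp_inverse_less) auto
    also have "\<dots> = inverse M / 4" by simp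
    finally have 1: "norm (F n w) < inverse M / 4" .
    have "norm (F n w - F n z) \<le> 4 * inverse e / s * d"
      using lip[OF w2, of n] w s a by (smt (verit) dist_norm mem_ball norm_minus_commute mult_left_mono divide_nonneg_pos inverse_positive_iff_positive)
    then have "norm (F n w - F n z) \<le> inverse M / 2" using d(3) by linarith
    moreover have "norm (F n z) \<le> norm (F n w) + norm (F n w - F n z)" by (metis norm_minus_commute norm_triangle_sub)
    moreover have "0 < inverse M" using M by simp
    ultimately show False using 1 Fz[of n] by linarith
  qed
qed

section \<open>Lifting through polynomials\<close>

lemma poly_norm_large: assumes "degree (P::complex poly) \<ge> 1" obtains r where "\<And>z. r \<le> norm z \<Longrightarrow> d \<le> norm (poly P z)"
proof -
  obtain a Q where P: "P = pCons a Q" by (cases P)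
  have "Q \<noteq> 0" using assms P by auto
  then show ?thesis using poly_infinity[of Q d a] that P by blast
qed

lemma bounded_poly_sublevel: assumes "degree (P::complex poly) \<ge> 1" shows "bounded {z. norm (poly P z) \<le> d}"
proof -
  obtain r where r: "\<And>z. r \<le> norm z \<Longrightarrow> d + 1 \<le> norm (poly P z)" using poly_norm_large[OF assms] by blast
  have "norm z \<le> r" if "norm (poly P z) \<le> d" for z using r[of z] that by linarith
  then show ?thesis by (auto simp: bounded_iff)
qed

lemma poly_hol: "poly (P::complex poly) holomorphic_on S" by (auto intro!: holomorphic_intros)

text \<open>Over a value without critical preimages, \<open>P\<close> is injective on small discs around the finitely many
preimages; since \<open>P\<close> is proper, these discs contain the whole preimage of a small neighbourhood.\<close>

lemma poly_covering_space:
  fixes P :: "complex poly"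
  assumes deg: "degree P \<ge> 1" and S: "open S" and crit: "\<And>z. poly P z \<in> S \<Longrightarrow> poly (pderiv P) z \<noteq> 0"
  shows "covering_space (poly P -` S) (poly P) S"
proof
  show "continuous_on (poly P -` S) (poly P)" by (intro continuous_intros)
  show "poly P ` (poly P -` S) = S" using poly_surj[OF deg] by (auto simp: image_iff) (metis vimageI)
next
  fix w assume w: "w \<in> S"
  define R0 where "R0 = {z. poly P z = w}"
  have oS: "open (poly P -` S)" by (intro open_vimage S continuous_intros)
  have "P - [:w:] \<noteq> 0" using deg by auto
  then have fin: "finite R0" using poly_roots_finite[of "P - [:w:]"] by (simp add: R0_def)
  have "\<exists>r. r > 0 \<and> inj_on (poly P) (ball a r)" if "a \<in> R0" for a
  proof -
    have "poly P a \<in> S" using that w by (simp add: R0_def)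
    then have "deriv (poly P) a \<noteq> 0" using crit by (simp add: DERIV_imp_deriv[OF poly_DERIV])
    from has_complex_derivative_locally_injective[OF poly_hol UNIV_I open_UNIV this]
    obtain ra where "ra > 0" "ball a ra \<subseteq> UNIV" "inj_on (poly P) (ball a ra)" .
    then show ?thesis by blast
  qed
  then obtain r where r: "\<And>a. a \<in> R0 \<Longrightarrow> r a > 0" "\<And>a. a \<in> R0 \<Longrightarrow> inj_on (poly P) (ball a (r a))" by metis
  define DD where "DD = insert 1 ((\<lambda>(a,b). dist a b) ` {(a,b). (a,b) \<in> R0 \<times> R0 \<and> a \<noteq> b})"
  \<comment> \<open>Balls of radius at most half the least distance between two preimages are disjoint; the element \<open>1\<close> keeps the set nonempty.\<close>
  define \<delta> where "\<delta> = Min DD"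
  have "finite {(a,b). (a,b) \<in> R0 \<times> R0 \<and> a \<noteq> b}" by (rule finite_subset[of _ "R0 \<times> R0"]) (use fin in auto)
  then have DDf: "finite DD" unfolding DD_def by simp
  have \<delta>0: "\<delta> > 0" unfolding \<delta>_def using DDf by (subst Min_gr_iff) (auto simp: DD_def)
  have \<delta>: "\<delta> \<le> dist a b" if "a \<in> R0" "b \<in> R0" "a \<noteq> b" for a b
    unfolding \<delta>_def using DDf that by (intro Min_le) (auto simp: DD_def image_iff)
  define U where "U = (\<lambda>a. ball a (min (r a) (\<delta>/2)))"
  have U0: "a \<in> U a" if "a \<in> R0" for a using r(1)[OF that] \<delta>0 by (simp add: U_def)
  have Uinj: "inj_on (poly P) (U a)" if "a \<in> R0" for a
    by (rule inj_on_subset[OF r(2)[OF that]]) (auto simp: U_def)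
  have Uopen: "open (U a)" for a by (simp add: U_def)
  have Udisj: "U a \<inter> U b = {}" if "a \<in> R0" "b \<in> R0" "a \<noteq> b" for a b
  proof -
    have False if x: "x \<in> U a" "x \<in> U b" for x
      using x \<delta>[OF \<open>a \<in> R0\<close> \<open>b \<in> R0\<close> \<open>a \<noteq> b\<close>] dist_triangle[of a b x] by (auto simp: U_def dist_commute)
    then show ?thesis by blast
  qed
  \<comment> \<open>What remains of the preimage of a disc about \<open>w\<close> is compact, so \<open>w\<close> keeps a distance from its image.\<close>
  define Kc where "Kc = {z. norm (poly P z) \<le> norm w + 1} - \<Union>(U ` R0)"
  have "closed {z. norm (poly P z) \<le> norm w + 1}" by (intro closed_Collect_le continuous_intros)
  then have "compact {z. norm (poly P z) \<le> norm w + 1}" using bounded_poly_sublevel[OF deg] by (simp add: compact_eq_bounded_closed)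
  then have "compact Kc" unfolding Kc_def using Uopen by (intro compact_diff) auto
  then have "compact (poly P ` Kc)" by (intro compact_continuous_image continuous_intros)
  then have cl: "closed (poly P ` Kc)" by (rule compact_imp_closed)
  define T where "T = ball w 1 \<inter> - (poly P ` Kc) \<inter> S \<inter> (\<Inter>a\<in>R0. poly P ` U a)"
  have Topen: "open T" unfolding T_def using cl S fin by (intro open_Int open_Compl open_INT ballI poly_nonconst_open[OF deg] Uopen) auto
  have wT: "w \<in> T"
  proof -
    have "w \<notin> poly P ` Kc" using U0 by (auto simp: Kc_def R0_def)
    moreover have "w \<in> poly P ` U a" if "a \<in> R0" for a using U0[OF that] that by (auto simp: R0_def intro!: image_eqI[of _ _ a])
    ultimately show ?thesis using w by (auto simp: T_def)
  qed
  have cover: "z \<in> \<Union>(U ` R0)" if "poly P z \<in> T" for z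
  proof (rule ccontr)
    assume "z \<notin> \<Union>(U ` R0)"
    moreover have "norm (poly P z) \<le> norm w + 1"
    proof -
      have "dist w (poly P z) < 1" using that by (simp add: T_def)
      then show ?thesis using norm_triangle_sub[of "poly P z" w] by (simp add: dist_norm norm_minus_commute)
    qed
    ultimately have "z \<in> Kc" by (simp add: Kc_def)
    then show False using that by (auto simp: T_def)
  qed
  define v where "v = (\<lambda>a. U a \<inter> poly P -` T) ` R0"
  have oT: "open (poly P -` T)" by (intro open_vimage Topen continuous_intros)
  show "\<exists>T. w \<in> T \<and> openin (top_of_set S) T \<and>
           (\<exists>v. \<Union>v = poly P -` S \<inter> poly P -` T \<and> (\<forall>u\<in>v. openin (top_of_set (poly P -` S)) u) \<and>
                pairwise disjnt v \<and> (\<forall>u\<in>v. \<exists>q. homeomorphism u T (poly P) q))"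
  proof (intro exI[of _ T] conjI exI[of _ v])
    show "w \<in> T" by (rule wT)
    show "openin (top_of_set S) T" by (rule open_subset[OF _ Topen]) (auto simp: T_def)
    show "\<Union>v = poly P -` S \<inter> poly P -` T" unfolding v_def using cover by (auto simp: T_def)
    show "\<forall>u\<in>v. openin (top_of_set (poly P -` S)) u"
      unfolding v_def by (auto intro!: open_subset open_Int Uopen oT) (auto simp: T_def)
    show "pairwise disjnt v" using Udisj unfolding v_def pairwise_def disjnt_def by blast
    show "\<forall>u\<in>v. \<exists>q. homeomorphism u T (poly P) q"
    proof
      fix u assume "u \<in> v"
      then obtain a where a: "a \<in> R0" "u = U a \<inter> poly P -` T" by (auto simp: v_def)
      have "T \<subseteq> poly P ` U a" using a(1) unfolding T_def by blast
      then have im: "poly P ` u = T" unfolding a(2) by blast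
      have "open u" unfolding a(2) by (intro open_Int Uopen oT)
      moreover have "inj_on (poly P) u" using Uinj[OF a(1)] by (rule inj_on_subset) (auto simp: a)
      moreover have "continuous_on u (poly P)" by (intro continuous_intros)
      ultimately obtain g where "homeomorphism u (poly P ` u) (poly P) g"
        using invariance_of_domain_homeomorphism[of u "poly P"] by auto
      then show "\<exists>q. homeomorphism u T (poly P) q" using im by auto
    qed
  qed
qed

text \<open>The difference quotient as a polynomial; it makes differentiability of continuous lifts a matter of continuity.\<close>

lemma poly_slope: fixes P :: "complex poly" obtains Q where "\<And>z. poly P z - poly P a = (z - a) * poly Q z" "poly Q a = poly (pderiv (P::complex poly)) a"
proof -
  have "poly (P - [:poly P a:]) a = 0" by simp
  then obtain Q where Q: "P - [:poly P a:] = [:-a, 1:] * Q" using poly_eq_0_iff_dvd by (metis dvdE)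
  have eq: "poly P z - poly P a = (z - a) * poly Q z" for z
  proof -
    have "poly (P - [:poly P a:]) z = poly ([:-a, 1:] * Q) z" using Q by simp
    then show ?thesis by (simp add: algebra_simps)
  qed
  have "pderiv (P - [:poly P a:]) = pderiv ([:-a, 1:] * Q)" using Q by simp
  then have "pderiv P = [:-a, 1:] * pderiv Q + Q * pderiv [:-a, 1:]"
    by (simp only: pderiv_diff pderiv_mult) (simp add: pderiv_pCons)
  then have "poly Q a = poly (pderiv P) a" by (simp add: pderiv_pCons)
  then show ?thesis using that eq by blast
qed

lemma lift_has_derivative:
  fixes P :: "complex poly"
  assumes U: "open U" "z0 \<in> U" and g: "continuous_on U g" and f: "(f has_field_derivative f') (at z0)"
    and eq: "\<And>z. z \<in> U \<Longrightarrow> poly P (g z) = f z" and nz: "poly (pderiv P) (g z0) \<noteq> 0"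
  shows "(g has_field_derivative f' / poly (pderiv P) (g z0)) (at z0)"
proof -
  obtain Q where Q: "\<And>z. poly P z - poly P (g z0) = (z - g z0) * poly Q z" "poly Q (g z0) = poly (pderiv P) (g z0)"
    using poly_slope[of P "g z0"] by blast
  have cg: "isCont g z0" using g U by (simp add: continuous_on_eq_continuous_at)
  have tQ: "((\<lambda>z. poly Q (g z)) \<longlongrightarrow> poly Q (g z0)) (at z0)" using cg by (intro tendsto_poly) (simp add: isCont_def)
  have nzev: "eventually (\<lambda>z. poly Q (g z) \<noteq> 0) (at z0)"
    using tendsto_imp_eventually_ne[OF tQ] nz Q by auto
  have "((\<lambda>z. (f z - f z0) / (z - z0) / poly Q (g z)) \<longlongrightarrow> f' / poly Q (g z0)) (at z0)"
    using f nz Q unfolding has_field_derivative_iff by (intro tendsto_divide tQ) auto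
  moreover have "eventually (\<lambda>z. (f z - f z0) / (z - z0) / poly Q (g z) = (g z - g z0) / (z - z0)) (at z0)"
  proof -
    have "eventually (\<lambda>z. z \<in> U) (at z0)" using U by (metis eventually_at_topological)
    with nzev show ?thesis
    proof eventually_elim
      case (elim z)
      have "f z - f z0 = (g z - g z0) * poly Q (g z)" using Q(1)[of "g z"] eq elim U by simp
      then show ?case using elim by simp
    qed
  qed
  ultimately have "((\<lambda>z. (g z - g z0) / (z - z0)) \<longlongrightarrow> f' / poly Q (g z0)) (at z0)" by (rule Lim_transform_eventually)
  then show ?thesis using Q by (simp add: has_field_derivative_iff)
qed

text \<open>Convex domains are simply connected, so maps into a region without critical values lift through the covering.\<close>

lemma poly_lift:
  assumes deg: "degree P \<ge> 1" and S: "open S" and crit: "\<And>z. poly P z \<in> S \<Longrightarrow> poly (pderiv P) z \<noteq> 0"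
    and U: "open U" "convex U" "z0 \<in> U" and f: "f holomorphic_on U" "f ` U \<subseteq> S" and a: "poly P a = f z0"
  obtains g where "g holomorphic_on U" "g z0 = a" "\<And>z. z \<in> U \<Longrightarrow> poly P (g z) = f z"
    "deriv g z0 = deriv f z0 / poly (pderiv P) a"
proof -
  note cov = poly_covering_space[OF deg S crit]
  have aS: "a \<in> poly P -` S" using a f U by auto
  obtain g where g: "continuous_on U g" "g \<in> U \<rightarrow> poly P -` S" "g z0 = a" "\<And>y. y \<in> U \<Longrightarrow> poly P (g y) = f y"
  proof (rule covering_space_lift_strong[OF cov aS, of z0 U f])
    show "simply_connected U" using U by (simp add: convex_imp_simply_connected)
    show "locally path_connected U" using U by (simp add: open_imp_locally_path_connected)
    show "continuous_on U f" using f by (simp add: holomorphic_on_imp_continuous_on)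
  qed (use a f U in auto)
  have D: "(g has_field_derivative deriv f z / poly (pderiv P) (g z)) (at z)" if "z \<in> U" for z
    by (rule lift_has_derivative[OF U(1) that g(1)])
      (use f U g crit that in \<open>auto intro: holomorphic_derivI\<close>)
  show ?thesis
  proof
    show "g holomorphic_on U" using D U by (auto simp: holomorphic_on_open)
    show "deriv g z0 = deriv f z0 / poly (pderiv P) a" using D[OF U(3)] g by (simp add: DERIV_imp_deriv)
  qed (use g in auto)
qed

section \<open>Connected filled Julia sets\<close>

text \<open>By the maximum principle every component is unbounded, and the set contains the complement of a disc, which is
connected.\<close>

lemma connected_poly_superlevel:
  fixes P :: "complex poly"
  assumes deg: "degree P \<ge> 1"
  shows "connected {z. R < norm (poly P z)}"
proof -
  let ?X = "{z. R < norm (poly P z)}"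
  have oX: "open ?X" by (intro open_Collect_less continuous_intros)
  obtain r where r: "\<And>z. r \<le> norm z \<Longrightarrow> R + 1 \<le> norm (poly P z)" using poly_norm_large[OF deg] by blast
  have outX: "- cball 0 r \<subseteq> ?X"
  proof
    fix z :: complex assume "z \<in> - cball 0 r" then show "z \<in> ?X" using r[of z] by simp
  qed
  have outc: "connected (- cball (0::complex) r)" by (rule connected_complement_bounded_convex) auto
  have meet: "connected_component_set ?X x \<inter> - cball 0 r \<noteq> {}" if x: "x \<in> ?X" for x
  proof
    let ?Y = "connected_component_set ?X x"
    assume "?Y \<inter> - cball 0 r = {}"
    then have "?Y \<subseteq> cball 0 r" by auto
    then have b: "bounded ?Y" using bounded_cball bounded_subset by blast
    have "norm (poly P x) \<le> R"
    proof (rule maximum_modulus_frontier[where f = "poly P" and \<xi> = x and S = ?Y])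
      show "bounded ?Y" by (rule b)
      show "x \<in> ?Y" using x by simp
      show "norm (poly P z) \<le> R" if "z \<in> frontier ?Y" for z
      proof -
        have "z \<in> frontier ?X" using that Path_Connected.frontier_of_connected_component_subset by blast
        then have "z \<notin> ?X" using oX by (simp add: frontier_def interior_open)
        then show ?thesis by simp
      qed
    qed (auto intro!: holomorphic_intros continuous_intros)
    then show False using x by simp
  qed
  show ?thesis unfolding connected_iff_connected_component
  proof (intro ballI)
    fix x y assume xy: "x \<in> ?X" "y \<in> ?X"
    obtain u where u: "connected_component ?X x u" "u \<in> - cball 0 r" using meet[OF xy(1)] by auto
    obtain v where v: "connected_component ?X y v" "v \<in> - cball 0 r" using meet[OF xy(2)] by auto
    have "connected_component ?X u v" using outc outX u v unfolding connected_component_def by blast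
    then show "connected_component ?X x y" using u v by (meson connected_component_sym connected_component_trans)
  qed
qed

text \<open>The half plane \<open>Re s > ln R\<close> covers \<open>{w. R < \<bar>w\<bar>}\<close> through the exponential function. Its lift \<open>\<psi>\<close> through \<open>P\<close> reaches
every point of the connected superlevel set, by uniqueness of path lifting, and so maps the line \<open>Re s = ln \<rho>\<close> onto
the level set.\<close>

lemma connected_poly_level:
  fixes P :: "complex poly"
  assumes deg: "degree P \<ge> 1" and R: "0 < R" and crit: "\<And>z. R < norm (poly P z) \<Longrightarrow> poly (pderiv P) z \<noteq> 0" and \<rho>: "R < \<rho>"
  shows "connected {z. norm (poly P z) = \<rho>}"
proof -
  define X where "X = {z. R < norm (poly P z)}"
  define E where "E = {w::complex. R < norm w}"
  define H where "H = {s::complex. ln R < Re s}"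
  have oE: "open E" unfolding E_def by (intro open_Collect_less continuous_intros)
  have oH: "open H" unfolding H_def by (intro open_Collect_less continuous_intros)
  have cH: "convex H" unfolding H_def by (rule convex_halfspace_Re_gt)
  have XE: "X = poly P -` E" by (auto simp: X_def E_def)
  have oX: "open X" unfolding XE by (intro open_vimage oE continuous_intros)
  have pcX: "path_connected X" using connected_poly_superlevel[OF deg, of R] connected_open_path_connected[OF oX] by (simp add: X_def)
  have cov: "covering_space X (poly P) E" unfolding XE by (rule poly_covering_space[OF deg oE]) (use crit in \<open>auto simp: E_def\<close>)
  have expE: "exp s \<in> E \<longleftrightarrow> s \<in> H" for s using R unfolding E_def H_def mem_Collect_eq norm_exp_eq_Re by (metis exp_ln exp_less_cancel_iff)
  obtain a where a: "poly P a = of_real \<rho>" using poly_surj[OF deg] by blast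
  have aX: "a \<in> X" using a \<rho> R by (simp add: X_def)
  define sa where "sa = complex_of_real (ln \<rho>)"
  have sa: "exp sa = poly P a" using \<rho> R by (simp add: sa_def a exp_of_real)
  have saH: "sa \<in> H" using expE[of sa] sa aX by (simp add: XE)
  obtain \<psi> where \<psi>: "continuous_on H \<psi>" "\<psi> \<in> H \<rightarrow> X" "\<psi> sa = a" "\<And>s. s \<in> H \<Longrightarrow> poly P (\<psi> s) = exp s"
  proof (rule covering_space_lift_strong[OF cov aX saH, of exp])
    show "simply_connected H" using cH by (simp add: convex_imp_simply_connected)
    show "locally path_connected H" using oH by (simp add: open_imp_locally_path_connected)
    show "continuous_on H exp" by (intro continuous_intros)
  qed (use expE sa in auto)
  have "{z. norm (poly P z) = \<rho>} = \<psi> ` {s. Re s = ln \<rho>}"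
  proof
    have "{s. Re s = ln \<rho>} \<subseteq> H" using R \<rho> by (auto simp: H_def)
    then show "\<psi> ` {s. Re s = ln \<rho>} \<subseteq> {z. norm (poly P z) = \<rho>}" using \<psi>(4) R \<rho> by (auto simp: subset_iff)
    show "{z. norm (poly P z) = \<rho>} \<subseteq> \<psi> ` {s. Re s = ln \<rho>}"
    proof
      fix b assume b: "b \<in> {z. norm (poly P z) = \<rho>}"
      then have bX: "b \<in> X" using \<rho> by (simp add: X_def)
      obtain g where g: "path g" "path_image g \<subseteq> X" "pathstart g = a" "pathfinish g = b"
        using pcX aX bX unfolding path_connected_def by blast
      have pg: "path (poly P \<circ> g)" by (intro path_continuous_image g continuous_intros)
      have pgE: "path_image (poly P \<circ> g) \<subseteq> E" using g by (auto simp: path_image_compose XE)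
      have pgE': "path_image (poly P \<circ> g) \<subseteq> - {0}" using pgE R by (auto simp: E_def)
      obtain h where h: "path h" "pathstart h = sa" "\<And>t. t \<in> {0..1} \<Longrightarrow> exp (h t) = (poly P \<circ> g) t"
        by (rule covering_space_lift_path_strong[OF covering_space_exp_punctured_plane _ pg pgE', of sa])
          (use g sa in \<open>auto simp: pathstart_compose\<close>)
      have hH: "h t \<in> H" if "t \<in> {0..1}" for t
      proof -
        have "(poly P \<circ> g) t \<in> E" using pgE that by (auto simp only: path_image_def)
        then show ?thesis using expE[of "h t"] h(3)[OF that] by simp
      qed
      have "(\<psi> \<circ> h) 1 = g 1"
      proof (rule covering_space_lift_unique[OF cov, of _ 0 _ "{0..1}" "poly P \<circ> g"])
        show "(\<psi> \<circ> h) 0 = g 0" using h(2) \<psi>(3) g(3) by (simp add: pathstart_def)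
        show "continuous_on {0..1} (poly P \<circ> g)" using pg by (simp add: path_def)
        show "poly P \<circ> g \<in> {0..1} \<rightarrow> E" using pgE by (auto simp: path_image_def)
        show "continuous_on {0..1} (\<psi> \<circ> h)" using h(1) hH \<psi>(1)
          by (intro continuous_on_compose) (auto simp: path_def intro: continuous_on_subset)
        show "\<psi> \<circ> h \<in> {0..1} \<rightarrow> X" using hH \<psi>(2) by auto
        show "(poly P \<circ> g) x = poly P ((\<psi> \<circ> h) x)" if "x \<in> {0..1}" for x using \<psi>(4) hH h(3) that by simp
        show "continuous_on {0..1} g" using g(1) by (simp add: path_def)
        show "g \<in> {0..1} \<rightarrow> X" using g(2) by (auto simp: path_image_def)
      qed auto
      then have "\<psi> (h 1) = b" using g(4) by (simp add: pathfinish_def)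
      moreover have "exp (Re (h 1)) = \<rho>"
      proof -
        have "exp (h 1) = poly P b" using h(3)[of 1] g(4) by (simp add: pathfinish_def)
        then show ?thesis using b by (metis mem_Collect_eq norm_exp_eq_Re)
      qed
      ultimately show "b \<in> \<psi> ` {s. Re s = ln \<rho>}" by (intro image_eqI[of _ _ "h 1"]) auto
    qed
  qed
  moreover have "connected {s. Re s = ln \<rho>}"
    using convex_connected[OF convex_hyperplane[of "1::complex" "ln \<rho>"]] by (simp add: inner_complex_def)
  moreover have "continuous_on {s. Re s = ln \<rho>} \<psi>" by (rule continuous_on_subset[OF \<psi>(1)]) (use R \<rho> in \<open>auto simp: H_def\<close>)
  ultimately show ?thesis by (simp add: connected_continuous_image)
qed

text \<open>A closed part of a sublevel set that avoids the level set is open in the plane, hence empty.\<close>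

lemma connected_poly_sublevel:
  fixes P :: "complex poly"
  assumes deg: "degree P \<ge> 1" and R: "0 < R" and crit: "\<And>z. R < norm (poly P z) \<Longrightarrow> poly (pderiv P) z \<noteq> 0" and \<rho>: "R < \<rho>"
  shows "connected {z. norm (poly P z) \<le> \<rho>}"
proof -
  let ?S = "{z. norm (poly P z) \<le> \<rho>}" and ?L = "{z. norm (poly P z) = \<rho>}"
  have clS: "closed ?S" by (intro closed_Collect_le continuous_intros)
  have conL: "connected ?L" by (rule connected_poly_level[OF assms])
  have key: False if AB: "closed A" "closed B" "B \<noteq> {}" "A \<union> B = ?S" "A \<inter> B = {}" "?L \<subseteq> A" for A B
  proof -
    have "B = ?S - A" using AB(4,5) by blast
    also have "\<dots> = {z. norm (poly P z) < \<rho>} - A" using AB(6) by (auto simp: order_less_le)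
    finally have "B = {z. norm (poly P z) < \<rho>} - A" .
    moreover have "open {z. norm (poly P z) < \<rho>}" by (intro open_Collect_less continuous_intros)
    ultimately have "open B" using AB(1) by (simp add: open_Diff)
    then have "B = UNIV" using AB clopen by blast
    then have "bounded (UNIV::complex set)" using AB bounded_poly_sublevel[OF deg, of \<rho>] by (metis bounded_subset sup_ge2)
    then show False using not_bounded_UNIV by blast
  qed
  show ?thesis unfolding connected_closed_set[OF clS]
  proof
    assume "\<exists>A B. closed A \<and> closed B \<and> A \<noteq> {} \<and> B \<noteq> {} \<and> A \<union> B = ?S \<and> A \<inter> B = {}"
    then obtain A B where AB: "closed A" "closed B" "A \<noteq> {}" "B \<noteq> {}" "A \<union> B = ?S" "A \<inter> B = {}" by blast
    have "?L \<subseteq> ?S" by auto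
    have "?L \<subseteq> A \<union> B" using AB(5) \<open>?L \<subseteq> ?S\<close> by simp
    moreover have "A \<inter> B \<inter> ?L = {}" using AB(6) by simp
    ultimately have "A \<inter> ?L = {} \<or> B \<inter> ?L = {}" using conL AB(1,2) unfolding connected_closed by metis
    then have "?L \<subseteq> A \<or> ?L \<subseteq> B" using \<open>?L \<subseteq> A \<union> B\<close> by blast
    then show False
    proof
      assume "?L \<subseteq> A" then show False using key[OF AB(1,2,4,5,6)] by simp
    next
      assume "?L \<subseteq> B" then show False using key[OF AB(2,1,3)] AB(5,6) by (simp add: Un_commute Int_commute)
    qed
  qed
qed

lemma poly_funpow_poly:
  obtains Q where "poly Q = poly (P::complex poly) ^^ n"
proof (induction n arbitrary: thesis)
  case 0
  show ?case by (rule 0[of "[:0,1:]"]) (auto simp: fun_eq_iff)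
next
  case (Suc n)
  obtain Q where "poly Q = poly P ^^ n" using Suc.IH .
  then show ?case by (intro Suc.prems[of "P \<circ>\<^sub>p Q"]) (auto simp: fun_eq_iff poly_pcompose)
qed

text \<open>When the critical orbits do not escape, all sublevel sets of the iterates above the escape radius are
connected, and the filled Julia set is their decreasing intersection.\<close>

lemma connected_fillK:
  assumes deg: "degree P \<ge> 2" and crit: "\<And>z. poly (pderiv P) z = 0 \<Longrightarrow> poly P z \<in> fillK P"
  shows "connected (fillK P)"
proof -
  obtain R where R: "escape_radius P R" using escape_radius_exists[OF deg] .
  define S where "S = (\<lambda>n. {z. norm ((poly P ^^ n) z) \<le> R + 1})"
  have cS: "compact (S n) \<and> connected (S n)" for n
  proof -
    obtain Q where Q: "poly Q = poly P ^^ n" using poly_funpow_poly .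
    have dQ: "degree Q \<ge> 1"
    proof (rule ccontr)
      assume "\<not> degree Q \<ge> 1"
      then obtain c where "Q = [:c:]" using degree_eq_zeroE[of Q] by auto
      then have c: "(poly P ^^ n) z = c" for z by (simp flip: Q)
      obtain z :: complex where z: "norm z = max R (norm c + 1)" using vector_choose_size[of "max R (norm c + 1)"] escape_radius_ge1[OF R] by (metis add_nonneg_nonneg max.coboundedI2 norm_ge_zero zero_le_one)
      have "2 ^ n * norm z \<le> norm ((poly P ^^ n) z)" using escape_radius_iter[OF R, of z n] z by simp
      moreover have "1 * norm z \<le> 2 ^ n * norm z" by (intro mult_right_mono) auto
      ultimately show False using z c by simp
    qed
    have "connected {z. norm (poly Q z) \<le> R + 1}"
    proof (rule connected_poly_sublevel[OF dQ, of R])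
      show "0 < R" using escape_radius_ge1[OF R] by simp
      fix z assume z: "R < norm (poly Q z)"
      have "((poly P ^^ m) has_field_derivative (\<Prod>k<m. poly (pderiv P) ((poly P ^^ k) z))) (at z)" for m
      proof (induction m)
        case (Suc m)
        have "((poly P \<circ> (poly P ^^ m)) has_field_derivative poly (pderiv P) ((poly P ^^ m) z) * (\<Prod>k<m. poly (pderiv P) ((poly P ^^ k) z))) (at z)"
          by (rule DERIV_chain[OF poly_DERIV Suc])
        then show ?case by (simp add: mult.commute o_def)
      qed (simp add: id_def)
      from this[of n] have "poly (pderiv Q) z = (\<Prod>k<n. poly (pderiv P) ((poly P ^^ k) z))"
        unfolding Q[symmetric] using DERIV_unique poly_DERIV by blast
      moreover have "poly (pderiv P) ((poly P ^^ k) z) \<noteq> 0" for k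
      proof
        assume "poly (pderiv P) ((poly P ^^ k) z) = 0"
        then have "poly P ((poly P ^^ k) z) \<in> fillK P" by (rule crit)
        then have "z \<in> fillK P" by (simp add: fillK_step fillK_funpow)
        then show False using z fillK_iff[OF R] unfolding Q by (meson not_le)
      qed
      ultimately show "poly (pderiv Q) z \<noteq> 0" by simp
    qed simp
    moreover have "closed {z. norm (poly Q z) \<le> R + 1}" by (intro closed_Collect_le continuous_intros)
    ultimately show ?thesis using bounded_poly_sublevel[OF dQ, of "R+1"] by (simp add: S_def Q compact_eq_bounded_closed)
  qed
  have dec: "S (Suc n) \<subseteq> S n" for n
  proof
    fix z assume z: "z \<in> S (Suc n)"
    show "z \<in> S n"
    proof (rule ccontr)
      assume "z \<notin> S n"
      then have "R + 1 < norm ((poly P ^^ n) z)" by (simp add: S_def)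
      moreover then have "2 * norm ((poly P ^^ n) z) \<le> norm ((poly P ^^ Suc n) z)" using escape_radiusD[OF R, of "(poly P ^^ n) z"] by simp
      ultimately show False using z escape_radius_ge1[OF R] by (simp add: S_def)
    qed
  qed
  have "connected (\<Inter>(range S))"
    by (rule connected_nest) (use cS decseq_SucI[of S, OF dec] in \<open>auto dest: decseqD\<close>)
  moreover have "\<Inter>(range S) = fillK P" using fillK_iff[OF escape_radius_mono[OF R, of "R+1"]] by (auto simp: S_def)
  ultimately show ?thesis by simp
qed

section \<open>The pair of polynomials in the plane\<close>

text \<open>The planar content of the hypotheses. The last assumption is what disjointness of the two preimages in the open
set condition says about the interior of \<open>fillK Q\<close>.\<close>

locale poly_pair =
  fixes P Q :: "complex poly"
  assumes degP: "2 \<le> degree P" and degQ: "2 \<le> degree Q"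
    and critP: "\<And>z. poly (pderiv P) z = 0 \<Longrightarrow> poly P z \<in> fillK P"
    and critQ: "\<And>z. poly (pderiv Q) z = 0 \<Longrightarrow> poly Q z \<in> fillK P"
    and fillK_nested: "fillK P \<subseteq> interior (fillK Q)"
    and Q_fillK: "\<And>z. z \<in> fillK P \<Longrightarrow> poly Q z \<in> fillK P"
    and P_into: "\<And>z. poly P z \<in> interior (fillK Q) \<Longrightarrow> poly Q z \<in> fillK P"
begin

abbreviation "K1 \<equiv> fillK P"
abbreviation "K2 \<equiv> fillK Q"

lemma openP: "open S \<Longrightarrow> open (poly P ` S)" using poly_nonconst_open[of P S] degP by simp
lemma openQ: "open S \<Longrightarrow> open (poly Q ` S)" using poly_nonconst_open[of Q S] degQ by simp

lemma K1_P: "poly P z \<in> K1 \<longleftrightarrow> z \<in> K1" by (rule fillK_step)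
lemma K2_Q: "poly Q z \<in> K2 \<longleftrightarrow> z \<in> K2" by (rule fillK_step)

lemma K1_ne: "K1 \<noteq> {}" by (rule fillK_nonempty[OF degP])
lemma compact_K1: "compact K1" by (rule compact_fillK[OF degP])
lemma compact_K2: "compact K2" by (rule compact_fillK[OF degQ])

lemma Q_K1_interior: assumes "z \<in> K1" shows "poly Q z \<in> interior K1"
proof -
  have "open (poly P -` interior K2)" by (intro open_vimage open_interior continuous_intros)
  then have "open (poly Q ` (poly P -` interior K2))" by (rule openQ)
  moreover have "poly Q ` (poly P -` interior K2) \<subseteq> K1" using P_into by auto
  ultimately have "poly Q ` (poly P -` interior K2) \<subseteq> interior K1" by (rule interior_maximal[rotated])
  moreover have "z \<in> poly P -` interior K2" using assms fillK_nested K1_P by auto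
  ultimately show ?thesis by blast
qed

lemma P_interior_K1: assumes "z \<in> interior K1" shows "poly P z \<in> interior K1"
proof -
  have "poly P ` interior K1 \<subseteq> interior K1"
    by (intro interior_maximal openP open_interior) (use K1_P interior_subset in blast)
  then show ?thesis using assms by blast
qed

lemma closure_interior_K2: "K2 \<subseteq> closure (interior K2)"
  by (rule fillK_subset_closure_interior[OF degQ]) (use K1_ne fillK_nested in blast)

text \<open>The assumption on \<open>interior (fillK Q)\<close> passes to its closure because \<open>P\<close> is open, and that closure is all of
\<open>fillK Q\<close>.\<close>

lemma P_K2: assumes "poly P z \<in> K2" shows "poly Q z \<in> K1"
proof -
  have "z \<in> closure (poly P -` interior K2)"
  proof (unfold closure_iff_nhds_not_empty, intro allI impI)
    fix A S assume S: "S \<subseteq> A" "open S" "z \<in> S"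
    have "open (poly P ` S)" using S by (intro openP)
    moreover have "poly P z \<in> closure (interior K2)" using assms closure_interior_K2 by blast
    ultimately have "interior K2 \<inter> poly P ` S \<noteq> {}" using S by (metis closure_iff_nhds_not_empty image_eqI order_refl)
    then show "poly P -` interior K2 \<inter> A \<noteq> {}" using S by blast
  qed
  moreover have "closure (poly P -` interior K2) \<subseteq> poly Q -` K1"
  proof (rule closure_minimal)
    show "closed (poly Q -` K1)" by (intro closed_vimage compact_imp_closed compact_K1 continuous_intros)
  qed (use P_into in auto)
  ultimately show ?thesis by blast
qed

lemma interior_K2_Q: "poly Q z \<in> interior K2 \<Longrightarrow> z \<in> interior K2" by (rule interior_fillK_step)

lemma Q_interior_K2: assumes "z \<in> interior K2" shows "poly Q z \<in> interior K2"
proof -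
  have "poly Q ` interior K2 \<subseteq> interior K2"
    by (intro interior_maximal openQ open_interior) (use K2_Q interior_subset in blast)
  then show ?thesis using assms by blast
qed

lemma Q_K1_imp: "poly Q z \<in> K1 \<Longrightarrow> z \<in> interior K2" using fillK_nested interior_K2_Q by blast

text \<open>So both maps keep the complement of \<open>interior K2\<close> invariant, and \<open>P\<close> even pushes its boundary off \<open>K2\<close>.\<close>

lemma P_outside: "z \<notin> interior K2 \<Longrightarrow> poly P z \<notin> K2" using P_K2 Q_K1_imp by blast

text \<open>A common escape radius, to be used for both polynomials and all words.\<close>

definition Rad :: real where "Rad = (SOME R. escape_radius P R \<and> escape_radius Q R)"

lemma escape_radius_Rad: "escape_radius P Rad" "escape_radius Q Rad"
proof -
  obtain R1 R2 where "escape_radius P R1" "escape_radius Q R2" using escape_radius_exists degP degQ by metis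
  then have "escape_radius P (max R1 R2) \<and> escape_radius Q (max R1 R2)" using escape_radius_mono by (metis max.cobounded1 max.cobounded2)
  then have "escape_radius P Rad \<and> escape_radius Q Rad" unfolding Rad_def by (rule someI)
  then show "escape_radius P Rad" "escape_radius Q Rad" by auto
qed

lemma Rad_ge1: "1 \<le> Rad" using escape_radius_ge1 escape_radius_Rad by blast

definition step :: "bool \<Rightarrow> complex \<Rightarrow> complex" where "step b = (if b then poly P else poly Q)"

lemma step_simps [simp]: "step True = poly P" "step False = poly Q" by (simp_all add: step_def)

text \<open>The action of a word on the plane; \<open>True\<close> stands for \<open>P\<close>, \<open>False\<close> for \<open>Q\<close>, and the first letter acts first, as in
\<open>random_orbit\<close>.\<close>

definition run :: "bool list \<Rightarrow> complex \<Rightarrow> complex" where "run ws z = fold step ws z"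

lemma run_simps [simp]: "run [] z = z" "run (b # ws) z = run ws (step b z)" "run (ws @ vs) z = run vs (run ws z)"
  by (simp_all add: run_def)

lemma run_comp: "run [] = (\<lambda>z. z)" "run (b # ws) = run ws \<circ> step b" "run (ws @ [b]) = step b \<circ> run ws"
  by auto

lemma run_replicate: "run (replicate n True) z = (poly P ^^ n) z" "run (replicate n False) z = (poly Q ^^ n) z"
  by (induction n arbitrary: z) (auto simp: funpow_swap1)

lemma step_K1: "z \<in> K1 \<Longrightarrow> step b z \<in> K1" using Q_fillK K1_P by (cases b) auto
lemma run_K1: "z \<in> K1 \<Longrightarrow> run ws z \<in> K1" by (induction ws arbitrary: z) (auto simp: step_K1)
lemma step_int_K1: "z \<in> interior K1 \<Longrightarrow> step b z \<in> interior K1"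
  using Q_K1_interior P_interior_K1 interior_subset by (cases b) auto
lemma run_int_K1: "z \<in> interior K1 \<Longrightarrow> run ws z \<in> interior K1" by (induction ws arbitrary: z) (auto simp: step_int_K1)
lemma step_outside: "z \<notin> K2 \<Longrightarrow> step b z \<notin> K2"
  using P_outside K2_Q interior_subset by (cases b) auto
lemma step_large: "Rad \<le> norm z \<Longrightarrow> 2 * norm z \<le> norm (step b z)" using escape_radius_Rad escape_radiusD by (cases b) auto
lemma step_large': "R < norm z \<Longrightarrow> Rad \<le> R \<Longrightarrow> R < norm (step b z)" using step_large[of z b] Rad_ge1 by auto
lemma open_step: "open S \<Longrightarrow> open (step b ` S)" using openP openQ by (cases b) auto
lemma open_run: "open S \<Longrightarrow> open (run ws ` S)"
proof (induction ws arbitrary: S)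
  case (Cons b ws)
  have "run (b # ws) ` S = run ws ` (step b ` S)" by (simp add: image_image)
  then show ?case using Cons open_step by metis
qed (simp add: run_def)

lemma holomorphic_step: "step b holomorphic_on S" by (cases b) (auto intro: poly_hol)
lemma holomorphic_run: "run ws holomorphic_on S"
proof (induction ws arbitrary: S)
  case (Cons b ws)
  show ?case unfolding run_comp by (intro holomorphic_on_compose holomorphic_step Cons)
qed (unfold run_comp, intro holomorphic_intros)

lemma field_differentiable_run: "run ws field_differentiable at z"
  using holomorphic_run[of ws UNIV] by (simp add: holomorphic_on_def)

lemma field_differentiable_step: "step b field_differentiable at z"
  using holomorphic_step[of b UNIV] by (simp add: holomorphic_on_def)

lemma deriv_run_Cons: "deriv (run (b # ws)) z = deriv (run ws) (step b z) * deriv (step b) z"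
proof -
  show ?thesis unfolding run_comp
    by (rule deriv_chain) (auto intro: field_differentiable_run field_differentiable_step)
qed

lemma deriv_run_snoc: "deriv (run (ws @ [b])) z = deriv (step b) (run ws z) * deriv (run ws) z"
proof -
  show ?thesis unfolding run_comp
    by (rule deriv_chain) (auto intro: field_differentiable_run field_differentiable_step)
qed

lemma deriv_run_Nil: "deriv (run []) z = 1"
proof -
  show ?thesis unfolding run_comp by simp
qed

text \<open>Only the letters \<open>Q\<close> expand or contract by a definite factor, so all rates are measured by their number.\<close>

definition Q_count :: "bool list \<Rightarrow> nat" where "Q_count ws = length (filter Not ws)"
lemma Q_count_simps [simp]: "Q_count [] = 0" "Q_count (True # ws) = Q_count ws" "Q_count (False # ws) = Suc (Q_count ws)" "Q_count (ws @ vs) = Q_count ws + Q_count vs"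
  by (simp_all add: Q_count_def)

section \<open>Expansion outside the inner filled Julia set\<close>

text \<open>The region in which discs are lifted. It contains no critical values, and both preimages of it lie in it.\<close>

definition annulus :: "complex set" where "annulus = ball 0 Rad - K1"

lemma open_annulus: "open annulus" unfolding annulus_def using compact_K1 compact_imp_closed by blast

lemma step_annulus: assumes "step b z \<in> annulus" shows "z \<in> annulus"
proof -
  have "z \<notin> K1" using assms step_K1 by (auto simp: annulus_def)
  moreover have "norm z < Rad" using step_large[of z b] assms Rad_ge1 by (fastforce simp: annulus_def)
  ultimately show ?thesis by (simp add: annulus_def)
qed

text \<open>A disc around the end point of a word is lifted backwards, letter by letter. After a lift \<open>g\<close> through \<open>Q\<close> its values lie in
a compact part of the region, so \<open>g\<close> may be replaced by \<open>g + t (g - g 0)\<close>, which has the same centre, a derivative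
larger by the factor \<open>1 + t\<close>, and still takes values in the region.\<close>

lemma expanding_disc:
  obtains t where "t > 0" and
    "\<And>ws z r. 0 < r \<Longrightarrow> ball (run ws z) r \<subseteq> annulus \<Longrightarrow>
      \<exists>F. F holomorphic_on ball 0 1 \<and> F ` ball 0 1 \<subseteq> annulus \<and> F 0 = z \<and>
          deriv F 0 * deriv (run ws) z = of_real (r * (1 + t) ^ Q_count ws)"
proof -
  define C where "C = {z. norm (poly Q z) \<le> Rad} - poly Q -` interior K1"
  have "closed {z. norm (poly Q z) \<le> Rad}" by (intro closed_Collect_le continuous_intros)
  then have "compact {z. norm (poly Q z) \<le> Rad}" using bounded_poly_sublevel[of Q Rad] degQ by (simp add: compact_eq_bounded_closed)
  moreover have "open (poly Q -` interior K1)" by (intro open_vimage open_interior continuous_intros)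
  ultimately have cC: "compact C" unfolding C_def by (rule compact_diff)
  have CA: "C \<subseteq> annulus"
  proof
    fix z assume z: "z \<in> C"
    then have "z \<notin> K1" using Q_K1_interior by (auto simp: C_def)
    moreover have "norm z < Rad" using step_large[of z False] z Rad_ge1 by (fastforce simp: C_def)
    ultimately show "z \<in> annulus" by (simp add: annulus_def)
  qed
  obtain e where e: "e > 0" "(\<Union>x\<in>C. ball x e) \<subseteq> annulus"
    using compact_subset_open_imp_ball_epsilon_subset[OF cC open_annulus CA] .
  define t where "t = e / (2 * Rad)"
  have t: "t > 0" using e Rad_ge1 by (simp add: t_def)
  show ?thesis
  proof (rule that[OF t])
    fix ws z and r :: real
    assume "0 < r" "ball (run ws z) r \<subseteq> annulus"
    then show "\<exists>F. F holomorphic_on ball 0 1 \<and> F ` ball 0 1 \<subseteq> annulus \<and> F 0 = z \<and>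
          deriv F 0 * deriv (run ws) z = of_real (r * (1 + t) ^ Q_count ws)"
    proof (induction ws arbitrary: z)
      case Nil
      let ?F = "\<lambda>\<zeta>. z + of_real r * \<zeta>"
      have "(?F has_field_derivative of_real r) (at 0)" by (auto intro!: derivative_eq_intros)
      then have d: "deriv ?F 0 = of_real r" by (rule DERIV_imp_deriv)
      have "?F ` ball 0 1 \<subseteq> ball z r" using Nil(1) by (auto simp: dist_norm norm_mult)
      then show ?case using Nil d
        by (intro exI[of _ ?F]) (auto intro!: holomorphic_intros simp: deriv_run_Nil)
    next
      case (Cons b ws)
      obtain F where F: "F holomorphic_on ball 0 1" "F ` ball 0 1 \<subseteq> annulus" "F 0 = step b z"
        "deriv F 0 * deriv (run ws) (step b z) = of_real (r * (1 + t) ^ Q_count ws)"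
        using Cons.IH[of "step b z"] Cons.prems by auto
      define B where "B = (if b then P else Q)"
      have B: "poly B = step b" by (auto simp: B_def)
      have Bc: "poly (pderiv B) u \<noteq> 0" if "poly B u \<in> annulus" for u
        using that critP critQ by (auto simp: B_def annulus_def split: if_splits)
      have dB: "deriv (step b) u = poly (pderiv B) u" for u unfolding B[symmetric] by (rule DERIV_imp_deriv[OF poly_DERIV])
      obtain g where g: "g holomorphic_on ball 0 1" "g 0 = z" "\<And>\<zeta>. \<zeta> \<in> ball 0 1 \<Longrightarrow> poly B (g \<zeta>) = F \<zeta>"
        "deriv g 0 = deriv F 0 / poly (pderiv B) z"
      proof (rule poly_lift[of B annulus "ball 0 1" 0 F z])
        show "1 \<le> degree B" using degP degQ by (auto simp: B_def)
        show "poly B z = F 0" using F(3) B by simp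
      qed (use F open_annulus Bc in auto)
      have "F 0 \<in> annulus" using F(2) by (simp only: image_subset_iff centre_in_ball zero_less_one)
      then have "poly B z \<in> annulus" using F(3) B by simp
      then have nz: "poly (pderiv B) z \<noteq> 0" by (rule Bc)
      have gs: "step b (g \<zeta>) \<in> annulus" if "\<zeta> \<in> ball 0 1" for \<zeta> using g(3)[OF that] F(2) that B by auto
      have gA: "g \<zeta> \<in> annulus" if "\<zeta> \<in> ball 0 1" for \<zeta> using gs[OF that] by (rule step_annulus)
      have eqd: "deriv g 0 * deriv (run (b # ws)) z = of_real (r * (1 + t) ^ Q_count ws)"
        using F(4) nz by (simp add: deriv_run_Cons g(4) dB mult.commute)
      show ?case
      proof (cases b)
        case True
        then have "Q_count (b # ws) = Q_count ws" by simp
        then show ?thesis using g(2) gA eqd by (intro exI[of _ g] conjI g(1)) (auto simp only:)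
      next
        case False
        let ?G = "\<lambda>\<zeta>. g \<zeta> + of_real t * (g \<zeta> - z)"
        have gC: "g \<zeta> \<in> C" if "\<zeta> \<in> ball 0 1" for \<zeta>
        proof -
          have "poly Q (g \<zeta>) \<in> annulus" using gs[OF that] False by simp
          then show ?thesis using interior_subset by (auto simp: C_def annulus_def)
        qed
        have "?G ` ball 0 1 \<subseteq> annulus"
        proof
          fix x assume "x \<in> ?G ` ball 0 1"
          then obtain \<zeta> where \<zeta>: "\<zeta> \<in> ball 0 1" "x = ?G \<zeta>" by auto
          have "norm (g \<zeta>) < Rad" "norm z < Rad" using gA[OF \<zeta>(1)] gA[of 0] g(2) by (auto simp: annulus_def)
          then have "norm (g \<zeta> - z) < 2 * Rad" using norm_triangle_ineq4[of "g \<zeta>" z] by linarith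
          then have "t * norm (g \<zeta> - z) < t * (2 * Rad)" using t by simp
          moreover have "t * (2 * Rad) = e" using Rad_ge1 by (simp add: t_def)
          ultimately have "norm (of_real t * (g \<zeta> - z)) < e" using t unfolding norm_mult norm_of_real by simp
          then have "x \<in> ball (g \<zeta>) e" using \<zeta> by (simp add: dist_norm)
          then show "x \<in> annulus" using e(2) gC[OF \<zeta>(1)] by blast
        qed
        moreover have "?G holomorphic_on ball 0 1" by (intro holomorphic_intros g)
        moreover have "deriv ?G 0 = (1 + of_real t) * deriv g 0"
        proof -
          have "(g has_field_derivative deriv g 0) (at 0)" using g(1) by (rule holomorphic_derivI) auto
          then have "(?G has_field_derivative (1 + of_real t) * deriv g 0) (at 0)"
            by (auto intro!: derivative_eq_intros simp: algebra_simps)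
          then show ?thesis by (rule DERIV_imp_deriv)
        qed
        moreover have "(1 + of_real t) * deriv g 0 * deriv (run (b # ws)) z = of_real (r * (1 + t) ^ Q_count (b # ws))"
        proof -
          have "Q_count (b # ws) = Suc (Q_count ws)" using False by simp
          then have "of_real (r * (1 + t) ^ Q_count (b # ws)) = (1 + complex_of_real t) * of_real (r * (1 + t) ^ Q_count ws)"
            by (simp add: algebra_simps)
          then show ?thesis using eqd by (simp only: mult.assoc)
        qed
        moreover have "?G 0 = z" using g(2) by simp
        ultimately show ?thesis by (intro exI[of _ ?G] conjI) (simp_all only:)
      qed
    qed
  qed
qed

text \<open>The lifted disc is bounded by the escape radius, so Cauchy's estimate bounds its derivative; the
derivative of the word must then be large.\<close>

lemma expansion:
  obtains c t where "c > 0" "t > 0" and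
    "\<And>ws z. run ws z \<in> K2 \<Longrightarrow> poly Q (run ws z) \<notin> interior K1 \<Longrightarrow> c * (1 + t) ^ Q_count ws \<le> norm (deriv (run ws) z)"
proof -
  obtain t where t: "t > 0" and disc:
    "\<And>ws z r. 0 < r \<Longrightarrow> ball (run ws z) r \<subseteq> annulus \<Longrightarrow>
      \<exists>F. F holomorphic_on ball 0 1 \<and> F ` ball 0 1 \<subseteq> annulus \<and> F 0 = z \<and>
          deriv F 0 * deriv (run ws) z = of_real (r * (1 + t) ^ Q_count ws)"
    using expanding_disc by blast
  define C where "C = K2 - poly Q -` interior K1"
  have "open (poly Q -` interior K1)" by (intro open_vimage open_interior continuous_intros)
  then have cC: "compact C" unfolding C_def by (rule compact_diff[OF compact_K2])
  have CA: "C \<subseteq> annulus" using Q_K1_interior fillK_norm_less[OF escape_radius_Rad(2)] by (auto simp: C_def annulus_def)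
  obtain r where r: "r > 0" "(\<Union>x\<in>C. ball x r) \<subseteq> annulus"
    using compact_subset_open_imp_ball_epsilon_subset[OF cC open_annulus CA] .
  show ?thesis
  proof (rule that[of "r / (2 * Rad)" t])
    show "0 < r / (2 * Rad)" using r Rad_ge1 by simp
    fix ws z assume "run ws z \<in> K2" "poly Q (run ws z) \<notin> interior K1"
    then have "ball (run ws z) r \<subseteq> annulus" using r(2) by (auto simp: C_def)
    from disc[OF r(1) this] obtain F where F: "F holomorphic_on ball 0 1" "F ` ball 0 1 \<subseteq> annulus" "F 0 = z"
      "deriv F 0 * deriv (run ws) z = of_real (r * (1 + t) ^ Q_count ws)" by blast
    have "norm (deriv F 0) \<le> 2 * Rad / 1"
      by (rule deriv_bound_ball[OF F(1)]) (use F(2) in \<open>auto simp: annulus_def image_subset_iff intro!: less_imp_le\<close>)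
    then have "norm (deriv F 0) * norm (deriv (run ws) z) \<le> 2 * Rad * norm (deriv (run ws) z)"
      by (intro mult_right_mono) auto
    moreover have "norm (deriv F 0) * norm (deriv (run ws) z) = r * (1 + t) ^ Q_count ws"
      unfolding norm_mult[symmetric] F(4) norm_of_real using r(1) t by simp
    ultimately show "r / (2 * Rad) * (1 + t) ^ Q_count ws \<le> norm (deriv (run ws) z)"
      using Rad_ge1 by (simp add: field_simps)
  qed (rule t)
qed

section \<open>Points that stay between the two filled Julia sets\<close>

text \<open>\<open>surviving n\<close> consists of the points with some word of length \<open>n\<close> that ends in \<open>K2 - interior K1\<close>. As the
complement of this set is forward invariant, the word then never leaves it.\<close>

primrec surviving :: "nat \<Rightarrow> complex set" where
  "surviving 0 = K2 - interior K1"
| "surviving (Suc n) = poly P -` surviving n \<union> poly Q -` surviving n"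

definition survivors :: "complex set" where "survivors = (\<Inter>n. surviving n)"

lemma surviving_Suc_subset: "surviving (Suc n) \<subseteq> surviving n"
proof (induction n)
  case 0
  have "z \<in> K2" if "poly P z \<in> K2" for z using P_K2[OF that] Q_K1_imp interior_subset by blast
  moreover have "poly Q z \<in> interior K1" if "z \<in> interior K1" for z using that Q_K1_interior interior_subset by blast
  ultimately show ?case using P_interior_K1 K2_Q by auto
next
  case (Suc n)
  then show ?case by auto
qed

lemma surviving_antimono: "m \<le> n \<Longrightarrow> surviving n \<subseteq> surviving m"
  using surviving_Suc_subset by (rule lift_Suc_antimono_le[of surviving])

lemma closed_surviving: "closed (surviving n)"
proof (induction n)
  case 0 show ?case using compact_imp_closed[OF compact_K2] by (simp add: closed_Diff)
next
  case (Suc n) then show ?case by (auto intro!: closed_Un closed_vimage continuous_intros)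
qed

lemma JstD: "z \<in> survivors \<Longrightarrow> z \<in> K2 \<and> z \<notin> interior K1" unfolding survivors_def by (metis Diff_iff surviving.simps(1) INT_D UNIV_I)

text \<open>The sets \<open>surviving n\<close> decrease, so if both images dropped out at finite stages, the point would drop out too.\<close>

lemma survivors_step: assumes "z \<in> survivors" shows "\<exists>b. step b z \<in> survivors"
proof (rule ccontr)
  assume a: "\<nexists>b. step b z \<in> survivors"
  obtain m n where "poly P z \<notin> surviving m" "poly Q z \<notin> surviving n" using a[simplified] by (metis INT_I survivors_def step_simps)
  then have "z \<notin> surviving (Suc (max m n))" using surviving_antimono[of m "max m n"] surviving_antimono[of n "max m n"] by auto
  then show False using assms unfolding survivors_def by blast
qed

lemma survivors_itinerary: assumes "z \<in> survivors"
  obtains \<beta> where "\<And>n. run (map \<beta> [0..<n]) z \<in> survivors"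
proof -
  define nxt where "nxt = (\<lambda>z. SOME b. step b z \<in> survivors)"
  have nxt: "step (nxt z) z \<in> survivors" if "z \<in> survivors" for z unfolding nxt_def using survivors_step[OF that] by (rule someI_ex)
  define x where "x = rec_nat z (\<lambda>n u. step (nxt u) u)"
  have x: "x 0 = z" "x (Suc n) = step (nxt (x n)) (x n)" for n by (simp_all add: x_def)
  have xJ: "x n \<in> survivors" for n by (induction n) (auto simp: x assms nxt)
  have "run (map (\<lambda>n. nxt (x n)) [0..<n]) z = x n" for n by (induction n) (auto simp: x)
  then show ?thesis using that[of "\<lambda>n. nxt (x n)"] xJ by simp
qed

text \<open>If the itinerary contains infinitely many letters \<open>Q\<close>, boundedness contradicts expansion by Cauchy's estimate. Otherwise
it is eventually constantly \<open>P\<close>; it then sits on the boundary of \<open>K1\<close>, and the open images of the disc contain points that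
escape under \<open>P\<close>.\<close>

lemma survivors_runs_unbounded:
  assumes \<beta>: "\<And>n. run (map \<beta> [0..<n]) z \<in> survivors" and s: "0 < s"
  shows "\<exists>n y. y \<in> ball z s \<and> C < norm (run (map \<beta> [0..<n]) y)"
proof (rule ccontr)
  assume "\<nexists>n y. y \<in> ball z s \<and> C < norm (run (map \<beta> [0..<n]) y)"
  then have C: "norm (run (map \<beta> [0..<n]) y) \<le> C" if "y \<in> ball z s" for n y using that by (meson not_le)
  show False
  proof (cases "infinite {n. \<not> \<beta> n}")
    case True
    have ex: "\<exists>n. \<not> \<beta> n \<and> m \<le> Q_count (map \<beta> [0..<n])" for m
    proof (induction m)
      case 0 show ?case using True infinite_imp_nonempty by force
    next
      case (Suc m)
      then obtain n where n: "\<not> \<beta> n" "m \<le> Q_count (map \<beta> [0..<n])" by blast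
      obtain n' where n': "\<not> \<beta> n'" "n < n'" using True unfolding infinite_nat_iff_unbounded by blast
      have "map \<beta> [0..<n'] = map \<beta> [0..<n] @ \<beta> n # map \<beta> [Suc n..<n']"
        using n' upt_add_eq_append[of 0 n "n'-n"] by (simp add: upt_conv_Cons)
      then show ?case using n n' by (intro exI[of _ n']) simp
    qed
    obtain c t where c: "c > 0" "t > 0"
      "\<And>ws z. run ws z \<in> K2 \<Longrightarrow> poly Q (run ws z) \<notin> interior K1 \<Longrightarrow> c * (1 + t) ^ Q_count ws \<le> norm (deriv (run ws) z)"
      using expansion by blast
    obtain m where m: "2 * C / s / c < (1 + t) ^ m" using real_arch_pow[of "1+t" "2 * C / s / c"] c by auto
    obtain n where n: "\<not> \<beta> n" "m \<le> Q_count (map \<beta> [0..<n])" using ex by blast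
    let ?w = "map \<beta> [0..<n]"
    have 1: "run ?w z \<in> K2" using JstD[OF \<beta>[of n]] by simp
    have "poly Q (run ?w z) \<notin> interior K1" using JstD[OF \<beta>[of "Suc n"]] n(1) by simp
    from c(3)[OF 1 this] have "c * (1 + t) ^ Q_count ?w \<le> norm (deriv (run ?w) z)" .
    also have "\<dots> \<le> 2 * C / s" by (rule deriv_bound_ball[OF holomorphic_run s]) (rule C)
    finally have "(1 + t) ^ Q_count ?w \<le> 2 * C / s / c" using c(1) by (simp only: pos_le_divide_eq mult.commute)
    moreover have "(1 + t) ^ m \<le> (1 + t) ^ Q_count ?w" using n(2) c(2) by (intro power_increasing) auto
    ultimately show False using m by linarith
  next
    case False
    then obtain N where N: "\<And>n. N \<le> n \<Longrightarrow> \<beta> n" unfolding infinite_nat_iff_unbounded_le by (auto simp: not_less)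
    have runN: "run (map \<beta> [0..<N + k]) y = (poly P ^^ k) (run (map \<beta> [0..<N]) y)" for k y
      by (induction k) (auto simp: N)
    let ?x = "run (map \<beta> [0..<N]) z"
    have "(poly P ^^ k) ?x \<in> K2" for k using JstD[OF \<beta>[of "N+k"]] runN[of k z] by simp
    then have "norm ((poly P ^^ k) ?x) \<le> Rad" for k using fillK_norm_less[OF escape_radius_Rad(2)] by (meson less_imp_le)
    then have "?x \<notin> interior K1" using JstD[OF \<beta>[of N]] by simp
    moreover have "open (run (map \<beta> [0..<N]) ` ball z s)" by (rule open_run) simp
    moreover have "?x \<in> run (map \<beta> [0..<N]) ` ball z s" using s by auto
    ultimately have "\<not> run (map \<beta> [0..<N]) ` ball z s \<subseteq> K1" by (meson interior_maximal subsetD)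
    then obtain y where y: "y \<in> ball z s" "run (map \<beta> [0..<N]) y \<notin> K1" by blast
    have "norm ((poly P ^^ k) (run (map \<beta> [0..<N]) y)) \<le> max C Rad" for k
      using C[OF y(1), of "N+k"] runN[of k y] by simp
    then have "run (map \<beta> [0..<N]) y \<in> K1" using fillK_iff[OF escape_radius_mono[OF escape_radius_Rad(1), of "max C Rad"]] by simp
    then show False using y by simp
  qed
qed

section \<open>Synchronisation on the inner filled Julia set\<close>

text \<open>The forward counterpart of \<open>expanding_disc\<close>: \<open>Q\<close> maps \<open>K1\<close> into a compact part of its interior, so every
application of \<open>Q\<close> leaves room to enlarge the composed map about the orbit of \<open>x\<close> by \<open>1 + t\<close>; the enlarged map
is still bounded, which forces the derivative of the original word to be small.\<close>

lemma sync_deriv: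
  obtains q where "0 < q" "q < 1"
    "\<And>ws x \<rho>. ball x \<rho> \<subseteq> interior K1 \<Longrightarrow> 0 < \<rho> \<Longrightarrow> norm (deriv (run ws) x) \<le> 2 * Rad / \<rho> * q ^ Q_count ws"
proof -
  have cC: "compact (poly Q ` K1)" by (intro compact_continuous_image compact_K1 continuous_intros)
  have CI: "poly Q ` K1 \<subseteq> interior K1" using Q_K1_interior by auto
  obtain e where e: "e > 0" "(\<Union>x\<in>poly Q ` K1. ball x e) \<subseteq> interior K1"
    using compact_subset_open_imp_ball_epsilon_subset[OF cC open_interior CI] .
  define t where "t = e / (2 * Rad)"
  have t: "t > 0" using e Rad_ge1 by (simp add: t_def)
  have K1n: "norm u < Rad" if "u \<in> K1" for u by (rule fillK_norm_less[OF escape_radius_Rad(1) that])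
  have ex: "\<exists>g. g holomorphic_on interior K1 \<and> g ` interior K1 \<subseteq> interior K1 \<and> g x = run ws x \<and>
      deriv g x = of_real ((1 + t) ^ Q_count ws) * deriv (run ws) x" if x: "x \<in> interior K1" for x ws
  proof (induction ws rule: rev_induct)
    case Nil
    have "deriv (run []) x = deriv (\<lambda>z. z) x" by (simp add: deriv_run_Nil)
    then show ?case by (intro exI[of _ "\<lambda>z. z"]) (auto intro!: holomorphic_intros)
  next
    case (snoc b ws)
    then obtain g where g: "g holomorphic_on interior K1" "g ` interior K1 \<subseteq> interior K1" "g x = run ws x"
      "deriv g x = of_real ((1 + t) ^ Q_count ws) * deriv (run ws) x" by blast
    define h where "h = step b \<circ> g"
    have hh: "h holomorphic_on interior K1" unfolding h_def by (intro holomorphic_on_compose g holomorphic_step)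
    have him: "h ` interior K1 \<subseteq> interior K1" using g(2) step_int_K1 by (auto simp: h_def)
    have hx: "h x = run (ws @ [b]) x" by (simp add: h_def g)
    have gd: "g field_differentiable at x" using g(1) x by (simp add: holomorphic_on_imp_differentiable_at)
    have "deriv h x = deriv (step b) (g x) * deriv g x" unfolding h_def
      by (rule deriv_chain[OF gd field_differentiable_step])
    then have hd: "deriv h x = of_real ((1 + t) ^ Q_count ws) * deriv (run (ws @ [b])) x"
      by (simp add: g deriv_run_snoc)
    show ?case
    proof (cases b)
      case True
      then have "Q_count (ws @ [b]) = Q_count ws" by simp
      then show ?thesis using hd by (intro exI[of _ h] conjI hh him hx) (simp only:)
    next
      case False
      let ?G = "\<lambda>u. h u + of_real t * (h u - h x)"
      have "?G ` interior K1 \<subseteq> interior K1"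
      proof
        fix v assume "v \<in> ?G ` interior K1"
        then obtain u where u: "u \<in> interior K1" "v = ?G u" by auto
        have "norm (h u) < Rad" "norm (h x) < Rad" using him u x interior_subset K1n by blast+
        then have "norm (h u - h x) < 2 * Rad" using norm_triangle_ineq4[of "h u" "h x"] by linarith
        then have "t * norm (h u - h x) < t * (2 * Rad)" using t by simp
        moreover have "t * (2 * Rad) = e" using Rad_ge1 by (simp add: t_def)
        ultimately have "norm (of_real t * (h u - h x)) < e" using t unfolding norm_mult norm_of_real by simp
        then have "v \<in> ball (h u) e" using u by (simp add: dist_norm)
        moreover have "h u \<in> poly Q ` K1" using u g(2) False interior_subset by (force simp: h_def)
        ultimately show "v \<in> interior K1" using e(2) by blast
      qed
      moreover have "?G holomorphic_on interior K1" by (intro holomorphic_intros hh)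
      moreover have "deriv ?G x = (1 + of_real t) * deriv h x"
      proof -
        have "(h has_field_derivative deriv h x) (at x)" using hh x by (simp add: holomorphic_derivI)
        then have "(?G has_field_derivative (1 + of_real t) * deriv h x) (at x)"
          by (auto intro!: derivative_eq_intros simp: algebra_simps)
        then show ?thesis by (rule DERIV_imp_deriv)
      qed
      moreover have "deriv ?G x = of_real ((1 + t) ^ Q_count (ws @ [b])) * deriv (run (ws @ [b])) x"
      proof -
        have "Q_count (ws @ [b]) = Suc (Q_count ws)" using False by simp
        then show ?thesis using \<open>deriv ?G x = (1 + of_real t) * deriv h x\<close> hd
          by (simp only: power_Suc of_real_mult of_real_add of_real_1 mult.assoc)
      qed
      moreover have "?G x = run (ws @ [b]) x" using hx by simp
      ultimately show ?thesis by (intro exI[of _ ?G] conjI)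
    qed
  qed
  show ?thesis
  proof (rule that[of "1 / (1 + t)"])
    fix ws x \<rho> assume \<rho>: "ball x \<rho> \<subseteq> interior K1" "0 < \<rho>"
    then have "x \<in> interior K1" by auto
    from ex[OF this, of ws] obtain g where g: "g holomorphic_on interior K1" "g ` interior K1 \<subseteq> interior K1"
      "deriv g x = of_real ((1 + t) ^ Q_count ws) * deriv (run ws) x" by blast
    have "norm (deriv g x) \<le> 2 * Rad / \<rho>"
      by (rule deriv_bound_ball[OF holomorphic_on_subset[OF g(1) \<rho>(1)] \<rho>(2)])
        (use g(2) \<rho>(1) interior_subset K1n less_imp_le in blast)
    then have "(1 + t) ^ Q_count ws * norm (deriv (run ws) x) \<le> 2 * Rad / \<rho>"
      using t unfolding g(3) norm_mult norm_of_real by simp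
    moreover have "0 < (1 + t) ^ Q_count ws" using t by simp
    ultimately have "norm (deriv (run ws) x) \<le> 2 * Rad / \<rho> / (1 + t) ^ Q_count ws"
      by (simp only: pos_le_divide_eq mult.commute)
    then show "norm (deriv (run ws) x) \<le> 2 * Rad / \<rho> * (1 / (1 + t)) ^ Q_count ws"
      by (simp only: power_one_over times_divide_eq_right mult_1_right)
  qed (use t in auto)
qed

text \<open>The derivative bound gives contraction on small discs around points of \<open>Q ` K1\<close>. This set is connected, so nearby points can be
chained, and compactness makes the constant uniform. The letters before the first \<open>Q\<close> only move points within \<open>K1\<close>.\<close>

lemma sync:
  obtains M q where "0 < q" "q < 1" "0 < M"
    "\<And>ws x y. x \<in> K1 \<Longrightarrow> y \<in> K1 \<Longrightarrow> norm (run ws x - run ws y) \<le> M * q ^ Q_count ws"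
proof -
  obtain q where q: "0 < q" "q < 1" and dq:
    "\<And>ws x \<rho>. ball x \<rho> \<subseteq> interior K1 \<Longrightarrow> 0 < \<rho> \<Longrightarrow> norm (deriv (run ws) x) \<le> 2 * Rad / \<rho> * q ^ Q_count ws"
    using sync_deriv by blast
  define C where "C = poly Q ` K1"
  have cC: "compact C" unfolding C_def by (intro compact_continuous_image compact_K1 continuous_intros)
  have CI: "C \<subseteq> interior K1" using Q_K1_interior by (auto simp: C_def)
  have "connected K1" by (rule connected_fillK[OF degP critP])
  then have conC: "connected C" unfolding C_def by (intro connected_continuous_image continuous_intros)
  obtain e where e: "e > 0" "(\<Union>x\<in>C. ball x e) \<subseteq> interior K1"
    using compact_subset_open_imp_ball_epsilon_subset[OF cC open_interior CI] .
  have loc: "norm (run ws y - run ws x) \<le> 2 * Rad * q ^ Q_count ws" if x: "x \<in> C" and y: "y \<in> ball x (e/2)" for x y ws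
  proof -
    have "norm (run ws y - run ws x) \<le> 2 * Rad / (e/2) * q ^ Q_count ws * norm (y - x)"
    proof (rule field_differentiable_bound[of "ball x (e/2)" "run ws" "deriv (run ws)"])
      fix u assume u: "u \<in> ball x (e/2)"
      show "(run ws has_field_derivative deriv (run ws) u) (at u within ball x (e/2))"
        using field_differentiable_run by (simp add: DERIV_deriv_iff_field_differentiable has_field_derivative_at_within)
      have "ball u (e/2) \<subseteq> ball x e"
      proof
        fix v assume "v \<in> ball u (e/2)"
        then show "v \<in> ball x e" using u dist_triangle[of x v u] by simp
      qed
      then have "ball u (e/2) \<subseteq> interior K1" using e(2) x by blast
      then show "norm (deriv (run ws) u) \<le> 2 * Rad / (e/2) * q ^ Q_count ws" by (rule dq) (use e in simp)
    qed (use e y in auto)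
    also have "\<dots> \<le> 2 * Rad / (e/2) * q ^ Q_count ws * (e/2)"
      using y q e Rad_ge1 by (intro mult_left_mono) (auto simp: dist_norm norm_minus_commute)
    also have "\<dots> = 2 * Rad * q ^ Q_count ws" using e by simp
    finally show ?thesis .
  qed
  obtain c0 where c0: "c0 \<in> C" using K1_ne by (auto simp: C_def)
  have rel: "\<exists>M. \<forall>ws. norm (run ws x - run ws y) \<le> M * q ^ Q_count ws" if xy: "x \<in> C" "y \<in> C" for x y
  proof (rule connected_equivalence_relation[OF conC xy])
    fix x y assume "\<exists>M. \<forall>ws. norm (run ws x - run ws y) \<le> M * q ^ Q_count ws"
    then show "\<exists>M. \<forall>ws. norm (run ws y - run ws x) \<le> M * q ^ Q_count ws" by (simp add: norm_minus_commute)
  next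
    fix x y z assume "\<exists>M. \<forall>ws. norm (run ws x - run ws y) \<le> M * q ^ Q_count ws" "\<exists>M. \<forall>ws. norm (run ws y - run ws z) \<le> M * q ^ Q_count ws"
    then obtain M1 M2 where M: "\<And>ws. norm (run ws x - run ws y) \<le> M1 * q ^ Q_count ws" "\<And>ws. norm (run ws y - run ws z) \<le> M2 * q ^ Q_count ws" by blast
    have "norm (run ws x - run ws z) \<le> (M1 + M2) * q ^ Q_count ws" for ws
      using norm_triangle_ineq[of "run ws x - run ws y" "run ws y - run ws z"] M(1)[of ws] M(2)[of ws]
      by (simp add: distrib_right)
    then show "\<exists>M. \<forall>ws. norm (run ws x - run ws z) \<le> M * q ^ Q_count ws" by blast
  next
    fix a assume a: "a \<in> C"
    have "\<exists>M. \<forall>ws. norm (run ws a - run ws x) \<le> M * q ^ Q_count ws" if "x \<in> C \<inter> ball a (e/2)" for x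
      using loc[OF a, of x] that by (intro exI[of _ "2 * Rad"]) (auto simp: norm_minus_commute)
    then show "\<exists>T. openin (top_of_set C) T \<and> a \<in> T \<and> (\<forall>x\<in>T. \<exists>M. \<forall>ws. norm (run ws a - run ws x) \<le> M * q ^ Q_count ws)"
      using a e by (intro exI[of _ "C \<inter> ball a (e/2)"]) (auto simp: openin_open_Int)
  qed
  obtain F where F: "F \<subseteq> C" "finite F" "C \<subseteq> (\<Union>c\<in>F. ball c (e/2))"
    using compactE_image[OF cC, of C "\<lambda>c. ball c (e/2)"] e by (metis UN_I centre_in_ball half_gt_zero open_ball subsetI)
  obtain m where m: "\<And>c ws. c \<in> F \<Longrightarrow> norm (run ws c - run ws c0) \<le> m c * q ^ Q_count ws"
    using rel[OF _ c0] F(1) by (metis subsetD)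
  define M0 where "M0 = Max (insert 0 (m ` F)) + 2 * Rad"
  have M0: "norm (run ws x - run ws c0) \<le> M0 * q ^ Q_count ws" if "x \<in> C" for x ws
  proof -
    have "x \<in> (\<Union>c\<in>F. ball c (e/2))" using F(3) that by (rule subsetD)
    then obtain c where c: "c \<in> F" "x \<in> ball c (e/2)" by blast
    have "m c \<le> Max (insert 0 (m ` F))" using c F by (intro Max_ge) auto
    then have "m c * q ^ Q_count ws \<le> Max (insert 0 (m ` F)) * q ^ Q_count ws" using q by (intro mult_right_mono) auto
    moreover have "norm (run ws x - run ws c) \<le> 2 * Rad * q ^ Q_count ws" using loc c F by blast
    moreover have "norm (run ws x - run ws c0) \<le> norm (run ws x - run ws c) + norm (run ws c - run ws c0)"
      using norm_triangle_ineq[of "run ws x - run ws c" "run ws c - run ws c0"] by simp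
    ultimately show ?thesis using m[OF c(1), of ws] by (simp add: M0_def distrib_right)
  qed
  have M0C: "norm (run ws x - run ws y) \<le> 2 * M0 * q ^ Q_count ws" if "x \<in> C" "y \<in> C" for x y ws
    using norm_triangle_ineq4[of "run ws x - run ws c0" "run ws y - run ws c0"] M0[OF that(1), of ws] M0[OF that(2), of ws] by simp
  define M where "M = max (2 * M0 / q) (2 * Rad)"
  show ?thesis
  proof (rule that[OF q, of M])
    show "0 < M" using Rad_ge1 by (simp add: M_def)
    fix ws x y assume "x \<in> K1" "y \<in> K1"
    then show "norm (run ws x - run ws y) \<le> M * q ^ Q_count ws"
    proof (induction ws arbitrary: x y)
      case Nil
      then have "norm x < Rad" "norm y < Rad" using fillK_norm_less[OF escape_radius_Rad(1)] by auto
      then have "norm (x - y) \<le> 2 * Rad" using norm_triangle_ineq4[of x y] by linarith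
      then show ?case by (simp add: M_def)
    next
      case (Cons b ws)
      show ?case
      proof (cases b)
        case True
        then show ?thesis using Cons.IH[of "poly P x" "poly P y"] Cons.prems by (simp add: K1_P)
      next
        case False
        have "norm (run ws (poly Q x) - run ws (poly Q y)) \<le> 2 * M0 * q ^ Q_count ws"
          by (rule M0C) (use Cons.prems in \<open>auto simp: C_def\<close>)
        also have "\<dots> = (2 * M0 / q) * q ^ Suc (Q_count ws)" using q by simp
        also have "\<dots> \<le> M * q ^ Suc (Q_count ws)" using q by (intro mult_right_mono) (auto simp: M_def)
        finally show ?thesis using False by simp
      qed
    qed
  qed
qed

text \<open>Either \<open>P z\<close> is outside \<open>K2\<close>, and a bounded number of further applications of \<open>P\<close> leads beyond the escape radius,
or \<open>Q z\<close> is already in \<open>K1\<close>.\<close>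

lemma absorption:
  obtains N where "\<And>z. \<exists>ws. length ws = N \<and> (run ws z \<in> K1 \<or> Rad < norm (run ws z))"
proof -
  obtain N0 where N0: "\<And>z n. z \<in> - interior K2 \<Longrightarrow> N0 \<le> n \<Longrightarrow> Rad < norm ((poly P ^^ n) z)"
    by (rule uniform_escape[OF escape_radius_Rad(1), of "- interior K2"]) (use fillK_nested in auto)
  show ?thesis
  proof (rule that[of "Suc N0"])
    fix z
    show "\<exists>ws. length ws = Suc N0 \<and> (run ws z \<in> K1 \<or> Rad < norm (run ws z))"
    proof (cases "poly P z \<in> K2")
      case True
      then have "run (False # replicate N0 True) z \<in> K1" using run_K1[OF P_K2[OF True]] by simp
      then show ?thesis by (intro exI[of _ "False # replicate N0 True"]) simp
    next
      case False
      then have "Rad < norm ((poly P ^^ N0) (poly P z))" using interior_subset by (intro N0) auto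
      then show ?thesis by (intro exI[of _ "replicate (Suc N0) True"]) (simp add: run_replicate)
    qed
  qed
qed

end

section \<open>Polynomial maps are Lipschitz on the sphere\<close>

text \<open>In terms of \<open>weight\<close> the chordal distance of \<open>z\<close> and \<open>w\<close> is \<open>2 \<bar>z - w\<bar> / (weight z * weight w)\<close>.\<close>

definition weight :: "complex \<Rightarrow> real" where "weight z = sqrt (1 + (norm z)\<^sup>2)"

lemma weight_ge: "1 \<le> weight z" "norm z \<le> weight z" "0 < weight z"
proof -
  show "1 \<le> weight z" by (simp add: weight_def)
  then show "0 < weight z" by linarith
  show "norm z \<le> weight z" unfolding weight_def by (rule real_le_rsqrt) simp
qed

lemma poly_le_weight: "\<exists>B\<ge>0. \<forall>z. norm (poly (P::complex poly) z) \<le> B * weight z ^ degree P"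
proof (induction P)
  case (pCons c P)
  then obtain B where B: "B \<ge> 0" "\<And>z. norm (poly P z) \<le> B * weight z ^ degree P" by blast
  show ?case
  proof (cases "P = 0")
    case True then show ?thesis by (intro exI[of _ "norm c"]) auto
  next
    case False
    have "norm (poly (pCons c P) z) \<le> (norm c + B) * weight z ^ degree (pCons c P)" for z
    proof -
      have "norm (poly (pCons c P) z) \<le> norm c + norm z * norm (poly P z)"
        using norm_triangle_ineq[of c "z * poly P z"] by (simp add: norm_mult)
      also have "\<dots> \<le> norm c * weight z ^ Suc (degree P) + weight z * (B * weight z ^ degree P)"
        using B weight_ge[of z] one_le_power[of "weight z" "Suc (degree P)"] by (intro add_mono mult_mono mult_left_le[of _ _] ) (auto simp: mult_le_cancel_left1 simp del: power_Suc)
      finally show ?thesis using False by (simp add: algebra_simps)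
    qed
    then show ?thesis using B by (intro exI[of _ "norm c + B"]) auto
  qed
qed auto

lemma poly_diff_le_weight:
  "\<exists>A\<ge>0. \<forall>z w. norm (poly (P::complex poly) z - poly P w) \<le> A * norm (z - w) * (weight z * weight w) ^ (degree P - 1)"
proof (induction P)
  case (pCons c P)
  then obtain A where A: "A \<ge> 0" "\<And>z w. norm (poly P z - poly P w) \<le> A * norm (z - w) * (weight z * weight w) ^ (degree P - 1)" by blast
  obtain B where B: "B \<ge> 0" "\<And>z. norm (poly P z) \<le> B * weight z ^ degree P" using poly_le_weight by blast
  show ?case
  proof (cases "P = 0")
    case True then show ?thesis by (intro exI[of _ 0]) auto
  next
    case False
    have "norm (poly (pCons c P) z - poly (pCons c P) w) \<le> (A + B) * norm (z - w) * (weight z * weight w) ^ degree P" for z w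
    proof -
      have g: "0 < weight z" "0 < weight w" "1 \<le> weight z" "1 \<le> weight w" "norm w \<le> weight w" using weight_ge by auto
      have "poly (pCons c P) z - poly (pCons c P) w = (z - w) * poly P z + w * (poly P z - poly P w)"
        by (simp add: algebra_simps)
      then have "norm (poly (pCons c P) z - poly (pCons c P) w) \<le> norm (z - w) * norm (poly P z) + norm w * norm (poly P z - poly P w)"
        by (metis norm_mult norm_triangle_ineq)
      moreover have "norm (z - w) * norm (poly P z) \<le> norm (z - w) * (B * (weight z * weight w) ^ degree P)"
      proof -
        have "weight z ^ degree P \<le> (weight z * weight w) ^ degree P" using g by (intro power_mono) auto
        then have "B * weight z ^ degree P \<le> B * (weight z * weight w) ^ degree P" using B by (intro mult_left_mono)
        then show ?thesis using B(2)[of z] by (intro mult_left_mono) auto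
      qed
      moreover have "norm w * norm (poly P z - poly P w) \<le> A * norm (z - w) * (weight z * weight w) ^ degree P"
      proof (cases "degree P")
        case 0
        then obtain d where "P = [:d:]" by (rule degree_eq_zeroE)
        then show ?thesis using A by simp
      next
        case (Suc k)
        have "norm w * norm (poly P z - poly P w) \<le> (weight z * weight w) * (A * norm (z - w) * (weight z * weight w) ^ k)"
        proof (rule mult_mono)
          have "1 * weight w \<le> weight z * weight w" using g by (intro mult_right_mono) auto
          then show "norm w \<le> weight z * weight w" using g by linarith
          show "norm (poly P z - poly P w) \<le> A * norm (z - w) * (weight z * weight w) ^ k" using A(2)[of z w] Suc by simp
        qed (use g in auto)
        then show ?thesis using Suc by (simp add: algebra_simps)
      qed
      ultimately show ?thesis by (simp add: algebra_simps)
    qed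
    then show ?thesis using A B False by (intro exI[of _ "A + B"]) auto
  qed
qed auto

lemma poly_lower_large: "(P::complex poly) \<noteq> 0 \<Longrightarrow> \<exists>a>0. \<exists>r\<ge>1. \<forall>z. r \<le> norm z \<longrightarrow> a * norm z ^ degree P \<le> norm (poly P z)"
proof (induction P)
  case (pCons c P)
  show ?case
  proof (cases "P = 0")
    case True then show ?thesis using pCons by (intro exI[of _ "norm c"]) auto
  next
    case False
    then obtain a r where a: "a > 0" "r \<ge> 1" "\<And>z. r \<le> norm z \<Longrightarrow> a * norm z ^ degree P \<le> norm (poly P z)" using pCons by blast
    define r' where "r' = max r (2 * norm c / a)"
    have "a/2 * norm z ^ degree (pCons c P) \<le> norm (poly (pCons c P) z)" if z: "r' \<le> norm z" for z
    proof -
      have z': "r \<le> norm z" "2 * norm c \<le> a * norm z" using z a by (auto simp: r'_def field_simps)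
      have "norm z ^ 1 \<le> norm z ^ Suc (degree P)" using z' a by (intro power_increasing) auto
      then have "a * norm z \<le> a * norm z ^ Suc (degree P)" using a by simp
      then have 1: "2 * norm c \<le> a * norm z ^ Suc (degree P)" using z' by linarith
      have "norm z * (a * norm z ^ degree P) \<le> norm z * norm (poly P z)" using a z' by (intro mult_left_mono) auto
      moreover have "norm (z * poly P z) \<le> norm (poly (pCons c P) z) + norm c"
        using norm_triangle_ineq4[of "c + z * poly P z" c] by simp
      ultimately show ?thesis using 1 False by (simp add: norm_mult algebra_simps)
    qed
    then show ?thesis using a by (intro exI[of _ "a/2"] conjI exI[of _ r']) (auto simp: r'_def)
  qed
qed simp

lemma weight_poly_lower: assumes "(P::complex poly) \<noteq> 0" shows "\<exists>a>0. \<forall>z. a * weight z ^ degree P \<le> weight (poly P z)"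
proof -
  obtain a r where a: "a > 0" "r \<ge> 1" "\<And>z. r \<le> norm z \<Longrightarrow> a * norm z ^ degree P \<le> norm (poly P z)" using poly_lower_large[OF assms] by blast
  define n where "n = degree P"
  define b where "b = sqrt (1 + r\<^sup>2)"
  have b: "b \<ge> 1" by (simp add: b_def)
  define a' where "a' = min (a / 2 ^ n) (1 / b ^ n)"
  have "a' * weight z ^ n \<le> weight (poly P z)" for z
  proof (cases "r \<le> norm z")
    case True
    have "weight z \<le> 2 * norm z" unfolding weight_def
    proof (rule real_le_lsqrt)
      have "1\<^sup>2 \<le> (norm z)\<^sup>2" using True a by (intro power_mono) auto
      then have "1 \<le> (norm z)\<^sup>2" by simp
      moreover have "(2 * norm z)\<^sup>2 = 4 * (norm z)\<^sup>2" by (simp add: power_mult_distrib)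
      ultimately show "1 + (norm z)\<^sup>2 \<le> (2 * norm z)\<^sup>2" by linarith
    qed auto
    then have "weight z ^ n \<le> (2 * norm z) ^ n" using weight_ge[of z] by (intro power_mono) auto
    then have "a / 2 ^ n * weight z ^ n \<le> a / 2 ^ n * (2 * norm z) ^ n" using a by (intro mult_left_mono) auto
    also have "\<dots> = a * norm z ^ n" by (simp add: power_mult_distrib)
    also have "\<dots> \<le> norm (poly P z)" using a(3)[OF True] by (simp add: n_def)
    also have "\<dots> \<le> weight (poly P z)" by (rule weight_ge)
    finally have "a / 2 ^ n * weight z ^ n \<le> weight (poly P z)" .
    moreover have "a' * weight z ^ n \<le> a / 2 ^ n * weight z ^ n" using weight_ge(3)[of z] by (intro mult_right_mono) (auto simp: a'_def)
    ultimately show ?thesis by linarith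
  next
    case False
    then have "weight z \<le> b" unfolding weight_def b_def by (auto intro!: power_mono)
    then have "weight z ^ n \<le> b ^ n" using weight_ge[of z] by (intro power_mono) auto
    then have "1 / b ^ n * weight z ^ n \<le> 1" using b by (simp add: field_simps)
    moreover have "a' * weight z ^ n \<le> 1 / b ^ n * weight z ^ n" using weight_ge(3)[of z] by (intro mult_right_mono) (auto simp: a'_def)
    ultimately show ?thesis using weight_ge(1)[of "poly P z"] by linarith
  qed
  moreover have "a' > 0" using a b by (simp add: a'_def)
  ultimately show ?thesis by (auto simp: n_def)
qed

lemma chord_commute: "chord x y = chord y x" by (simp add: chord_def norm_minus_commute)

lemma chord_weight: "chord (Fin z) (Fin w) = 2 * norm (z - w) / (weight z * weight w)" "chord (Fin z) Infty = 2 / weight z"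
  unfolding chord_Fin chord_Fin_Infty weight_def by auto

text \<open>A difference of values of \<open>P\<close> has at most one factor \<open>\<bar>z - w\<bar>\<close> and degree \<open>d - 1\<close> in each variable, while the weight
of a value grows like the power \<open>d\<close> of the weight, so the chordal quotient stays bounded up to infinity.\<close>

lemma poly_map_lipschitz:
  assumes deg: "degree P \<ge> 1"
  obtains \<Lambda> where "\<Lambda> \<ge> 1" "\<And>x y. dist (poly_map P x) (poly_map P y) \<le> \<Lambda> * dist x y"
proof -
  have "P \<noteq> 0" using deg by auto
  then obtain a where a: "a > 0" "\<And>z. a * weight z ^ degree P \<le> weight (poly P z)" using weight_poly_lower by blast
  obtain A where A: "A \<ge> 0" "\<And>z w. norm (poly P z - poly P w) \<le> A * norm (z - w) * (weight z * weight w) ^ (degree P - 1)"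
    using poly_diff_le_weight by blast
  define C where "C = max 1 (max (1/a) (A / a\<^sup>2))"
  have C: "1 \<le> C" "1/a \<le> C" "A / a\<^sup>2 \<le> C" by (auto simp: C_def)
  obtain n where n: "degree P = Suc n" using deg by (metis Suc_le_D One_nat_def)
  have inf: "chord (poly_map P (Fin z)) Infty \<le> C * chord (Fin z) Infty" for z
  proof -
    have "weight z ^ 1 \<le> weight z ^ degree P" using weight_ge deg by (intro power_increasing) auto
    then have "a * weight z \<le> a * weight z ^ degree P" using a by simp
    then have 1: "a * weight z \<le> weight (poly P z)" using a(2)[of z] by linarith
    have "2 / weight (poly P z) \<le> 2 / (a * weight z)" using 1 a weight_ge(3)[of z] weight_ge(3) by (intro divide_left_mono) auto
    also have "\<dots> = 1 / a * (2 / weight z)" by simp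
    also have "\<dots> \<le> C * (2 / weight z)" using C weight_ge(3)[of z] by (intro mult_right_mono) auto
    finally show ?thesis by (simp add: chord_weight)
  qed
  have fin: "chord (poly_map P (Fin z)) (poly_map P (Fin w)) \<le> C * chord (Fin z) (Fin w)" for z w
  proof -
    have g: "0 < weight z" "0 < weight w" "0 < weight (poly P z)" "0 < weight (poly P w)" using weight_ge by auto
    have "(a * weight z ^ degree P) * (a * weight w ^ degree P) \<le> weight (poly P z) * weight (poly P w)"
      using a g by (intro mult_mono) (auto intro: less_imp_le)
    then have 1: "a\<^sup>2 * (weight z * weight w) ^ degree P \<le> weight (poly P z) * weight (poly P w)"
      by (simp add: power2_eq_square power_mult_distrib algebra_simps)
    have p: "0 < a\<^sup>2 * (weight z * weight w) ^ degree P" using a g by simp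
    have "2 * norm (poly P z - poly P w) / (weight (poly P z) * weight (poly P w))
      \<le> 2 * norm (poly P z - poly P w) / (a\<^sup>2 * (weight z * weight w) ^ degree P)"
      using 1 p g by (intro divide_left_mono) auto
    also have "\<dots> \<le> 2 * (A * norm (z - w) * (weight z * weight w) ^ n) / (a\<^sup>2 * (weight z * weight w) ^ degree P)"
      using A(2)[of z w] p n by (intro divide_right_mono) auto
    also have "\<dots> = A / a\<^sup>2 * (2 * norm (z - w) / (weight z * weight w))" using g a n by (simp add: field_simps)
    also have "\<dots> \<le> C * (2 * norm (z - w) / (weight z * weight w))" using C g by (intro mult_right_mono) auto
    finally show ?thesis by (simp add: chord_weight)
  qed
  have ch: "chord (poly_map P x) (poly_map P y) \<le> C * chord x y" for x y
  proof (cases x)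
    case (Fin z)
    show ?thesis
    proof (cases y)
      case (Fin w) then show ?thesis using fin \<open>x = Fin z\<close> by blast
    next
      case Infty then show ?thesis using inf[of z] \<open>x = Fin z\<close> by simp
    qed
  next
    case Infty
    show ?thesis
    proof (cases y)
      case (Fin w) then show ?thesis using inf[of w] \<open>x = Infty\<close> by (simp add: chord_commute)
    next
      case Infty then show ?thesis using \<open>x = Infty\<close> by (simp add: chord_def)
    qed
  qed
  show ?thesis
  proof (rule that[of "2 * C"])
    fix x y
    have "dist (poly_map P x) (poly_map P y) \<le> 2 * chord (poly_map P x) (poly_map P y)" by (rule dist_csphere_bounds)
    also have "\<dots> \<le> 2 * (C * chord x y)" using ch by simp
    also have "\<dots> \<le> 2 * (C * dist x y)" using C dist_csphere_bounds by simp
    finally show "dist (poly_map P x) (poly_map P y) \<le> 2 * C * dist x y" by simp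
  qed (use C in simp)
qed

lemma continuous_poly_map: assumes "degree P \<ge> 1" shows "continuous_on S (poly_map P)"
proof -
  obtain L where L: "L \<ge> 1" "\<And>x y. dist (poly_map P x) (poly_map P y) \<le> L * dist x y" using poly_map_lipschitz[OF assms] by blast
  show ?thesis
  proof (rule continuous_onI)
    fix x e assume "0 < (e::real)"
    then show "\<exists>d>0. \<forall>x'\<in>S. dist x' x < d \<longrightarrow> dist (poly_map P x') (poly_map P x) \<le> e"
    proof (intro exI[of _ "e/L"] conjI ballI impI)
      fix x' assume "dist x' x < e/L"
      then have "L * dist x' x < e" using L by (simp add: field_simps)
      then show "dist (poly_map P x') (poly_map P x) \<le> e" using L(2)[of x' x] by linarith
    qed (use L in simp)
  qed
qed

text \<open>The map \<open>y \<mapsto> a + 1/y\<close>, with \<open>0 \<mapsto> \<infinity>\<close>, is continuous into the sphere and hence uniformly continuous on discs. This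
turns bounds on \<open>1 / (g - a)\<close> into spherical equicontinuity of maps \<open>g\<close> that avoid a disc about \<open>a\<close>.\<close>

lemma uniformly_continuous_inversion:
  assumes "0 < (\<epsilon>::real)"
  obtains \<eta> where "\<eta> > 0" "\<And>u v. norm (inverse (u - a)) \<le> C \<Longrightarrow> norm (inverse (v - a)) \<le> C \<Longrightarrow> u \<noteq> a \<Longrightarrow> v \<noteq> a \<Longrightarrow>
      norm (inverse (u - a) - inverse (v - a)) < \<eta> \<Longrightarrow> dist (Fin u) (Fin v) < \<epsilon>"
proof -
  define m where "m = (\<lambda>y::complex. if y = 0 then Infty else Fin (a + inverse y))"
  have "isCont m y" for y
  proof (cases "y = 0")
    case False
    have "isCont (\<lambda>y. Fin (a + inverse y)) y"
      by (rule isCont_o2[of y "\<lambda>y. a + inverse y" Fin])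
        (use False continuous_on_Fin[of UNIV] in \<open>auto intro!: continuous_intros simp: continuous_on_eq_continuous_at\<close>)
    moreover have "eventually (\<lambda>y. m y = Fin (a + inverse y)) (nhds y)"
      using t1_space_nhds[OF False] by eventually_elim (simp add: m_def)
    ultimately show ?thesis by (simp add: isCont_cong)
  next
    case True
    have "(m \<longlongrightarrow> Infty) (at 0)"
    proof (unfold tendsto_Infty_iff, intro allI)
      fix R :: real
      define K where "K = \<bar>R\<bar> + norm a + 1"
      have K: "K > 0" by (simp add: K_def add_nonneg_pos)
      have "K < norm (inverse y)" if "y \<noteq> 0" "dist y 0 < 1/K" for y :: complex
        using that K by (simp add: norm_inverse norm_divide field_simps)
      then have "eventually (\<lambda>y. norm (inverse y) > \<bar>R\<bar> + norm a) (at (0::complex))"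
        unfolding eventually_at using K by (intro exI[of _ "1/K"]) (fastforce simp: K_def)
      then show "eventually (\<lambda>y. m y \<in> nbhd_Infty R) (at 0)"
      proof eventually_elim
        case (elim y)
        then show ?case using norm_diff_ineq[of "inverse y" a] by (auto simp: m_def add.commute)
      qed
    qed
    then show ?thesis using True by (simp add: isCont_def m_def)
  qed
  then have "continuous_on (cball 0 C) m" by (simp add: continuous_at_imp_continuous_on)
  then have "uniformly_continuous_on (cball 0 C) m" by (rule compact_uniformly_continuous) simp
  then obtain \<eta> where \<eta>: "\<eta> > 0" "\<And>x x'. x \<in> cball 0 C \<Longrightarrow> x' \<in> cball 0 C \<Longrightarrow> dist x' x < \<eta> \<Longrightarrow> dist (m x') (m x) < \<epsilon>"
    using assms unfolding uniformly_continuous_on_def by metis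
  have mu: "m (inverse (u - a)) = Fin u" if "u \<noteq> a" for u using that by (simp add: m_def)
  show ?thesis
  proof (rule that[OF \<eta>(1)])
    fix u v assume *: "norm (inverse (u - a)) \<le> C" "norm (inverse (v - a)) \<le> C" "u \<noteq> a" "v \<noteq> a"
      "norm (inverse (u - a) - inverse (v - a)) < \<eta>"
    have "dist (m (inverse (u - a))) (m (inverse (v - a))) < \<epsilon>"
      by (rule \<eta>(2)) (use * in \<open>auto simp: dist_norm\<close>)
    then show "dist (Fin u) (Fin v) < \<epsilon>" using mu * by simp
  qed
qed

context poly_pair begin

section \<open>Fatou, Julia and minimal sets of the semigroup\<close>

definition sstep :: "bool \<Rightarrow> csphere \<Rightarrow> csphere" where "sstep b = (if b then poly_map P else poly_map Q)"
definition srun :: "bool list \<Rightarrow> csphere \<Rightarrow> csphere" where "srun ws z = fold sstep ws z"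
abbreviation "G \<equiv> semigroup_gen {poly_map P, poly_map Q}"

lemma sstep_simps [simp]: "sstep True = poly_map P" "sstep False = poly_map Q" by (simp_all add: sstep_def)
lemma srun_simps [simp]: "srun [] z = z" "srun (b # ws) z = srun ws (sstep b z)" "srun (ws @ vs) z = srun vs (srun ws z)"
  by (simp_all add: srun_def)
lemma sstep_Fin [simp]: "sstep b (Fin z) = Fin (step b z)" "sstep b Infty = Infty" by (cases b; simp)+
lemma srun_Fin [simp]: "srun ws (Fin z) = Fin (run ws z)" "srun ws Infty = Infty" by (induction ws arbitrary: z) auto
lemma srun_comp: "srun (b # ws) = srun ws \<circ> sstep b" "srun (ws @ vs) = srun vs \<circ> srun ws" by auto

lemma srun_in_G: "ws \<noteq> [] \<Longrightarrow> srun ws \<in> G"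
proof (induction ws)
  case (Cons b ws)
  have b: "sstep b \<in> G" by (cases b) (auto intro: semigroup_gen.gen)
  show ?case
  proof (cases "ws = []")
    case True
    have "srun [b] = sstep b" by auto
    then show ?thesis using b True by simp
  next
    case False
    then show ?thesis using Cons b by (auto simp only: srun_comp intro: semigroup_gen.comp)
  qed
qed simp

lemma G_imp_srun: "g \<in> G \<Longrightarrow> \<exists>ws. ws \<noteq> [] \<and> g = srun ws"
proof (induction rule: semigroup_gen.induct)
  case (gen h)
  then have "h = srun [True] \<or> h = srun [False]" by auto
  then show ?case by blast
next
  case (comp f g)
  then obtain vs ws where "f = srun vs" "g = srun ws" "ws \<noteq> []" by blast
  then show ?case using srun_comp(2)[of ws vs] by (intro exI[of _ "ws @ vs"]) simp
qed

lemma G_eq: "G = srun ` {ws. ws \<noteq> []}" using srun_in_G G_imp_srun by auto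

lemma sstep_lipschitz: obtains \<Lambda> where "\<Lambda> \<ge> 1" "\<And>b x y. dist (sstep b x) (sstep b y) \<le> \<Lambda> * dist x y"
proof -
  obtain L1 where L1: "L1 \<ge> 1" "\<And>x y. dist (poly_map P x) (poly_map P y) \<le> L1 * dist x y" using poly_map_lipschitz[of P] degP by (metis dual_order.trans one_le_numeral)
  obtain L2 where L2: "L2 \<ge> 1" "\<And>x y. dist (poly_map Q x) (poly_map Q y) \<le> L2 * dist x y" using poly_map_lipschitz[of Q] degQ by (metis dual_order.trans one_le_numeral)
  show ?thesis
  proof (rule that[of "max L1 L2"])
    fix b :: bool and x y :: csphere
    have "L1 * dist x y \<le> max L1 L2 * dist x y" "L2 * dist x y \<le> max L1 L2 * dist x y" by (intro mult_right_mono; simp)+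
    then show "dist (sstep b x) (sstep b y) \<le> max L1 L2 * dist x y" using L1(2)[of x y] L2(2)[of x y] by (cases b) auto
  qed (use L1 in simp)
qed

lemma continuous_sstep: "continuous_on S (sstep b)" using continuous_poly_map[of P S] continuous_poly_map[of Q S] degP degQ by (cases b) auto

lemma continuous_srun: "continuous_on S (srun ws)"
proof (induction ws arbitrary: S)
  case Nil
  have "srun [] = (\<lambda>x. x)" by auto
  then show ?case by simp
next
  case (Cons b ws)
  show ?case unfolding srun_comp by (intro continuous_on_compose continuous_sstep Cons)
qed

text \<open>\<open>K1\<close> is invariant under both maps, and boundedness under \<open>P\<close> alone already characterises it.\<close>

lemma Khat_eq: "Khat G = Fin ` K1"
proof
  show "Fin ` K1 \<subseteq> Khat G"
  proof
    fix x assume "x \<in> Fin ` K1"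
    then obtain z where z: "z \<in> K1" "x = Fin z" by auto
    have sub: "{g (Fin z) | g. g \<in> G} \<subseteq> Fin ` K1" using z run_K1 by (auto simp: G_eq)
    have "Fin -` {g (Fin z) | g. g \<in> G} \<subseteq> K1" using sub by auto
    then have "bounded (Fin -` {g (Fin z) | g. g \<in> G})" using compact_imp_bounded[OF compact_K1] bounded_subset by blast
    moreover have "Infty \<notin> {g (Fin z) | g. g \<in> G}" using sub by auto
    ultimately show "x \<in> Khat G" using z by (auto simp: Khat_def bounded_in_plane_def)
  qed
  show "Khat G \<subseteq> Fin ` K1"
  proof
    fix x assume "x \<in> Khat G"
    then obtain z where z: "x = Fin z" "bounded (Fin -` {g (Fin z) | g. g \<in> G})" by (auto simp: Khat_def bounded_in_plane_def)
    have "(poly P ^^ n) (poly P z) \<in> Fin -` {g (Fin z) | g. g \<in> G}" for n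
    proof -
      have "srun (replicate (Suc n) True) \<in> G" by (intro srun_in_G) simp
      moreover have "srun (replicate (Suc n) True) (Fin z) = Fin ((poly P ^^ n) (poly P z))" by (simp add: run_replicate)
      ultimately show ?thesis by (auto intro!: exI[of _ "srun (replicate (Suc n) True)"])
    qed
    then have "bounded (range (\<lambda>n. (poly P ^^ n) (poly P z)))" using z(2) by (meson bounded_subset image_subsetI)
    then have "poly P z \<in> K1" by (simp add: fillK_def)
    then show "x \<in> Fin ` K1" using z K1_P by auto
  qed
qed

text \<open>Pointwise equicontinuity of all words, without reference to an open set; an open set of such points belongs to the
Fatou set.\<close>

definition equicontinuity_point :: "csphere \<Rightarrow> bool" where
  "equicontinuity_point z \<longleftrightarrow> (\<forall>\<epsilon>>0. \<exists>\<delta>>0. \<forall>w. dist z w < \<delta> \<longrightarrow> (\<forall>ws. dist (srun ws z) (srun ws w) < \<epsilon>))"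

text \<open>A nonempty word is a word applied to one of the two images, and the two maps are Lipschitz.\<close>

lemma equicontinuity_point_pull: assumes "\<And>b. equicontinuity_point (sstep b z)" shows "equicontinuity_point z"
  unfolding equicontinuity_point_def
proof (intro allI impI)
  fix \<epsilon> :: real assume e: "\<epsilon> > 0"
  obtain \<Lambda> where L: "\<Lambda> \<ge> 1" "\<And>b x y. dist (sstep b x) (sstep b y) \<le> \<Lambda> * dist x y" using sstep_lipschitz by blast
  have "\<exists>\<delta>>0. \<forall>w. dist (sstep b z) w < \<delta> \<longrightarrow> (\<forall>ws. dist (srun ws (sstep b z)) (srun ws w) < \<epsilon>)" for b
    using assms[of b] e unfolding equicontinuity_point_def by blast
  then obtain d where d: "\<And>b. d b > 0" "\<And>b w ws. dist (sstep b z) w < d b \<Longrightarrow> dist (srun ws (sstep b z)) (srun ws w) < \<epsilon>" by metis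
  define \<delta> where "\<delta> = min \<epsilon> (min (d True) (d False) / \<Lambda>)"
  have db: "\<delta> \<le> d b / \<Lambda>" for b using L by (cases b) (auto simp: \<delta>_def divide_right_mono min.coboundedI2)
  show "\<exists>\<delta>>0. \<forall>w. dist z w < \<delta> \<longrightarrow> (\<forall>ws. dist (srun ws z) (srun ws w) < \<epsilon>)"
  proof (intro exI[of _ \<delta>] conjI allI impI)
    show "0 < \<delta>" using e d(1) L by (simp add: \<delta>_def)
    fix w ws assume w: "dist z w < \<delta>"
    show "dist (srun ws z) (srun ws w) < \<epsilon>"
    proof (cases ws)
      case Nil then show ?thesis using w by (simp add: \<delta>_def)
    next
      case (Cons b vs)
      have "dist z w < d b / \<Lambda>" using w db[of b] by linarith
      then have "\<Lambda> * dist z w < d b" using L by (simp add: field_simps)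
      then have "dist (sstep b z) (sstep b w) < d b" using L(2)[of b z w] by linarith
      then show ?thesis using d(2) Cons by simp
    qed
  qed
qed

lemma nbhd_Fin: assumes "s > 0" obtains \<delta> where "\<delta> > 0" "\<And>w. dist (Fin z) w < \<delta> \<Longrightarrow> \<exists>u. w = Fin u \<and> u \<in> ball z s"
proof -
  have "open (Fin ` ball z s)" by (intro open_Fin_image) simp
  then obtain \<delta> where "\<delta> > 0" "\<forall>w. dist w (Fin z) < \<delta> \<longrightarrow> w \<in> Fin ` ball z s" using assms unfolding open_dist by force
  then show ?thesis by (intro that[of \<delta>]) (auto simp: dist_commute)
qed

lemma equicontinuity_point_interior_K1: assumes "z \<in> interior K1" shows "equicontinuity_point (Fin z)"
  unfolding equicontinuity_point_def
proof (intro allI impI)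
  fix \<epsilon> :: real assume e: "\<epsilon> > 0"
  obtain s where s: "s > 0" "ball z s \<subseteq> interior K1" using assms openE[OF open_interior] by metis
  define s' where "s' = min (s/2) (\<epsilon> * s / (16 * Rad + 1))"
  have R: "Rad \<ge> 1" by (rule Rad_ge1)
  have s': "s' > 0" using s e R by (auto simp: s'_def)
  obtain \<delta> where \<delta>: "\<delta> > 0" "\<And>w. dist (Fin z) w < \<delta> \<Longrightarrow> \<exists>u. w = Fin u \<and> u \<in> ball z s'" using nbhd_Fin[OF s'] by metis
  show "\<exists>\<delta>>0. \<forall>w. dist (Fin z) w < \<delta> \<longrightarrow> (\<forall>ws. dist (srun ws (Fin z)) (srun ws w) < \<epsilon>)"
  proof (intro exI[of _ \<delta>] conjI allI impI)
    fix w ws assume "dist (Fin z) w < \<delta>"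
    then obtain u where u: "w = Fin u" "u \<in> ball z s'" using \<delta> by blast
    have "norm (run ws u - run ws z) \<le> 4 * Rad / s * norm (u - z)"
    proof (rule bounded_holomorphic_lipschitz[OF holomorphic_run])
      show "u \<in> ball z (s/2)" using u by (simp add: s'_def)
      fix v assume "v \<in> ball z s"
      then have "run ws v \<in> K1" using s run_int_K1 interior_subset by blast
      then show "norm (run ws v) \<le> Rad" using fillK_norm_less[OF escape_radius_Rad(1)] less_imp_le by blast
    qed
    also have "\<dots> < 4 * Rad / s * (\<epsilon> * s / (16 * Rad))"
    proof (rule mult_strict_left_mono)
      have "norm (u - z) < \<epsilon> * s / (16 * Rad + 1)" using u by (simp add: s'_def dist_norm norm_minus_commute)
      also have "\<dots> \<le> \<epsilon> * s / (16 * Rad)" using e s R by (intro divide_left_mono) auto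
      finally show "norm (u - z) < \<epsilon> * s / (16 * Rad)" .
    qed (use s R in simp)
    also have "\<dots> = \<epsilon> / 4" using s R by simp
    finally have "dist (run ws z) (run ws u) < \<epsilon> / 4" by (simp add: dist_norm norm_minus_commute)
    then show "dist (srun ws (Fin z)) (srun ws w) < \<epsilon>" using dist_Fin_le[of "run ws z" "run ws u"] u by simp
  qed (rule \<delta>)
qed

lemma run_outside: "z \<notin> K2 \<Longrightarrow> run ws z \<notin> K2" by (induction ws arbitrary: z) (auto simp: step_outside)

text \<open>Outside \<open>K2\<close> all words avoid a disc in the interior of \<open>K2\<close>, which gives the bounded family \<open>1 / (run ws - a)\<close>.\<close>

lemma equicontinuity_point_outside: assumes "z \<notin> K2" shows "equicontinuity_point (Fin z)"
  unfolding equicontinuity_point_def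
proof (intro allI impI)
  fix \<epsilon> :: real assume eps: "\<epsilon> > 0"
  have "open (- K2)" using compact_imp_closed[OF compact_K2] by (rule open_Compl)
  then obtain s where s: "s > 0" "ball z s \<subseteq> - K2" using assms openE by (metis ComplI)
  obtain a where "a \<in> interior K2" using K1_ne fillK_nested by blast
  then obtain e where a: "e > 0" "ball a e \<subseteq> interior K2" using openE[OF open_interior] by metis
  have far: "e \<le> norm (run ws u - a)" if "u \<in> ball z s" for u ws
  proof (rule ccontr)
    assume "\<not> e \<le> norm (run ws u - a)"
    then have "run ws u \<in> ball a e" by (simp add: dist_norm norm_minus_commute)
    then show False using a run_outside[of u ws] that s interior_subset by blast
  qed
  have bd: "norm (inverse (run ws u - a)) \<le> inverse e" if "u \<in> ball z s" for u ws
    unfolding norm_inverse using far[OF that, of ws] a by (intro le_imp_inverse_le) auto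
  have na: "run ws u \<noteq> a" if "u \<in> ball z s" for u ws using far[OF that, of ws] a by auto
  obtain \<eta> where \<eta>: "\<eta> > 0" "\<And>u v. norm (inverse (u - a)) \<le> inverse e \<Longrightarrow> norm (inverse (v - a)) \<le> inverse e \<Longrightarrow> u \<noteq> a \<Longrightarrow> v \<noteq> a \<Longrightarrow>
      norm (inverse (u - a) - inverse (v - a)) < \<eta> \<Longrightarrow> dist (Fin u) (Fin v) < \<epsilon>"
    using uniformly_continuous_inversion[OF eps] by metis
  define s' where "s' = min (s/2) (\<eta> * s * e / 8)"
  have s': "s' > 0" using s \<eta> a by (auto simp: s'_def)
  obtain \<delta> where \<delta>: "\<delta> > 0" "\<And>w. dist (Fin z) w < \<delta> \<Longrightarrow> \<exists>u. w = Fin u \<and> u \<in> ball z s'" using nbhd_Fin[OF s'] by metis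
  show "\<exists>\<delta>>0. \<forall>w. dist (Fin z) w < \<delta> \<longrightarrow> (\<forall>ws. dist (srun ws (Fin z)) (srun ws w) < \<epsilon>)"
  proof (intro exI[of _ \<delta>] conjI allI impI)
    fix w ws assume "dist (Fin z) w < \<delta>"
    then obtain u where u: "w = Fin u" "u \<in> ball z s'" using \<delta> by blast
    have us: "u \<in> ball z (s/2)" "u \<in> ball z s" "z \<in> ball z s" using u s by (auto simp: s'_def)
    have "norm (inverse (run ws u - a) - inverse (run ws z - a)) \<le> 4 * inverse e / s * norm (u - z)"
    proof (rule bounded_holomorphic_lipschitz[OF _ _ us(1)])
      show "(\<lambda>u. inverse (run ws u - a)) holomorphic_on ball z s"
        using na by (intro holomorphic_intros holomorphic_run) auto
    qed (rule bd)
    also have "\<dots> \<le> 4 * inverse e / s * (\<eta> * s * e / 8)"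
      using u s a by (intro mult_left_mono) (auto simp: s'_def dist_norm norm_minus_commute)
    also have "\<dots> = \<eta> / 2" using s a by (simp add: field_simps)
    also have "\<dots> < \<eta>" using \<eta> by simp
    finally have "norm (inverse (run ws z - a) - inverse (run ws u - a)) < \<eta>" by (simp add: norm_minus_commute)
    then have "dist (Fin (run ws z)) (Fin (run ws u)) < \<epsilon>" by (intro \<eta>(2) bd na us)
    then show "dist (srun ws (Fin z)) (srun ws w) < \<epsilon>" using u by simp
  qed (rule \<delta>)
qed

lemma sstep_nbhd_Infty: "x \<in> nbhd_Infty R \<Longrightarrow> Rad \<le> R \<Longrightarrow> sstep b x \<in> nbhd_Infty R"
  by (cases x) (auto simp: step_large')

lemma srun_nbhd_Infty: "x \<in> nbhd_Infty R \<Longrightarrow> Rad \<le> R \<Longrightarrow> srun ws x \<in> nbhd_Infty R"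
  by (induction ws arbitrary: x) (auto simp: sstep_nbhd_Infty)

lemma equicontinuity_point_Infty: "equicontinuity_point Infty"
  unfolding equicontinuity_point_def
proof (intro allI impI)
  fix \<epsilon> :: real assume e: "\<epsilon> > 0"
  obtain R where R: "R > 0" "nbhd_Infty R \<subseteq> ball Infty \<epsilon>" using nbhd_Infty_subset_ball[OF e] .
  define R' where "R' = max R Rad"
  have sub: "nbhd_Infty R' \<subseteq> nbhd_Infty R" by (auto simp: nbhd_Infty_def R'_def)
  obtain \<delta> where \<delta>: "\<delta> > 0" "ball Infty \<delta> \<subseteq> nbhd_Infty R'" using openE[OF open_nbhd_Infty, of Infty R'] by auto
  show "\<exists>\<delta>>0. \<forall>w. dist Infty w < \<delta> \<longrightarrow> (\<forall>ws. dist (srun ws Infty) (srun ws w) < \<epsilon>)"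
  proof (intro exI[of _ \<delta>] conjI allI impI)
    fix w ws assume "dist Infty w < \<delta>"
    then have "w \<in> nbhd_Infty R'" using \<delta> by auto
    then have "srun ws w \<in> nbhd_Infty R'" by (rule srun_nbhd_Infty) (simp add: R'_def)
    then show "dist (srun ws Infty) (srun ws w) < \<epsilon>" using sub R by auto
  qed (rule \<delta>)
qed

text \<open>A property that holds on \<open>interior K1\<close>, outside \<open>K2\<close> and at infinity, and that is inherited from both images, holds off the
surviving set: such a point lies outside some \<open>surviving n\<close>, and the induction is on \<open>n\<close>.\<close>

lemma complement_surviving_induct:
  assumes base: "\<And>z. z \<in> interior K1 \<Longrightarrow> A (Fin z)" "\<And>z. z \<notin> K2 \<Longrightarrow> A (Fin z)" "A Infty"
    and pull: "\<And>x. (\<And>b. A (sstep b x)) \<Longrightarrow> A x"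
    and x: "x \<notin> Fin ` survivors"
  shows "A x"
proof -
  have D: "A (Fin z)" if "z \<notin> surviving n" for n z using that
  proof (induction n arbitrary: z)
    case 0 then show ?case using base by auto
  next
    case (Suc n)
    have "A (sstep b (Fin z))" for b using Suc.IH[of "step b z"] Suc.prems by (cases b) auto
    then show ?case by (rule pull)
  qed
  show ?thesis
  proof (cases x)
    case (Fin z)
    then obtain n where "z \<notin> surviving n" using x unfolding survivors_def by blast
    then show ?thesis using D Fin by simp
  qed (use base in simp)
qed

lemma compact_survivors: "compact survivors"
proof -
  have "closed survivors" unfolding survivors_def by (intro closed_INT ballI closed_surviving)
  moreover have "bounded survivors" using compact_imp_bounded[OF compact_K2] JstD by (meson bounded_subset subsetI)
  ultimately show ?thesis by (simp add: compact_eq_bounded_closed)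
qed

text \<open>Points of the disc of radius \<open>Rad\<close> have a positive spherical distance from infinity.\<close>

lemma sphere_bounded_nbhd:
  obtains \<epsilon> C where "\<epsilon> > 0" "\<And>x y. norm x \<le> Rad \<Longrightarrow> dist (Fin x) (Fin y) < \<epsilon> \<Longrightarrow> norm y \<le> C"
proof -
  define e where "e = 1 / weight (of_real Rad)"
  have e: "e > 0" using weight_ge by (simp add: e_def)
  obtain C where C: "C > 0" "nbhd_Infty C \<subseteq> ball Infty e" using nbhd_Infty_subset_ball[OF e] .
  show ?thesis
  proof (rule that[OF e, of C])
    fix x y assume xy: "norm x \<le> Rad" "dist (Fin x) (Fin y) < e"
    show "norm y \<le> C"
    proof (rule ccontr)
      assume "\<not> norm y \<le> C"
      then have "Fin y \<in> nbhd_Infty C" by simp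
      then have "dist Infty (Fin y) < e" using C(2) mem_ball by blast
      then have "dist (Fin x) Infty < 2 * e" using xy dist_triangle[of "Fin x" Infty "Fin y"] by (simp add: dist_commute)
      then have "2 / weight x < 2 * e" using dist_csphere_bounds(1)[of "Fin x" Infty] by (simp only: chord_weight)
      moreover have "weight x \<le> weight (of_real Rad)" unfolding weight_def using xy(1) Rad_ge1 by (auto intro!: power_mono)
      then have "2 / weight (of_real Rad) \<le> 2 / weight x" using weight_ge by (intro divide_left_mono) auto
      ultimately show False by (simp add: e_def)
    qed
  qed
qed

text \<open>Off the survivors, equicontinuity is pulled back from \<open>interior K1\<close> and the outside of \<open>K2\<close>. At a
survivor, equicontinuity would keep the images of a small disc along its itinerary within a bounded
distance of \<open>K2\<close>.\<close>

lemma Fatou_eq: "Fatou G = - Fin ` survivors"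
proof
  have op: "open (- Fin ` survivors)" using compact_imp_closed[OF compact_Fin_image[OF compact_survivors]] by (rule open_Compl)
  have ec: "equicontinuity_point x" if "x \<in> - Fin ` survivors" for x
    by (rule complement_surviving_induct[of equicontinuity_point]) (use that in \<open>auto intro: equicontinuity_point_interior_K1 equicontinuity_point_outside equicontinuity_point_Infty equicontinuity_point_pull\<close>)
  have "equicontinuous_on (- Fin ` survivors) G" unfolding equicontinuous_on_def
  proof (intro ballI allI impI)
    fix z \<epsilon> assume "z \<in> - Fin ` survivors" "(0::real) < \<epsilon>"
    then obtain \<delta> where "\<delta> > 0" "\<forall>w. dist z w < \<delta> \<longrightarrow> (\<forall>ws. dist (srun ws z) (srun ws w) < \<epsilon>)" using ec unfolding equicontinuity_point_def by blast
    then show "\<exists>\<delta>>0. \<forall>w\<in>- Fin ` survivors. dist z w < \<delta> \<longrightarrow> (\<forall>g\<in>G. dist (g z) (g w) < \<epsilon>)"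
      unfolding G_eq by auto
  qed
  then show "- Fin ` survivors \<subseteq> Fatou G" using op by (auto simp: Fatou_def)
  show "Fatou G \<subseteq> - Fin ` survivors"
  proof (rule ccontr)
    assume "\<not> Fatou G \<subseteq> - Fin ` survivors"
    then obtain u where u: "u \<in> survivors" "Fin u \<in> Fatou G" by auto
    then obtain V where V: "open V" "equicontinuous_on V G" "Fin u \<in> V" by (auto simp: Fatou_def)
    obtain \<epsilon> C where \<epsilon>: "\<epsilon> > 0" "\<And>x y. norm x \<le> Rad \<Longrightarrow> dist (Fin x) (Fin y) < \<epsilon> \<Longrightarrow> norm y \<le> C" using sphere_bounded_nbhd by metis
    obtain \<delta> where \<delta>: "\<delta> > 0" "\<And>w g. w \<in> V \<Longrightarrow> dist (Fin u) w < \<delta> \<Longrightarrow> g \<in> G \<Longrightarrow> dist (g (Fin u)) (g w) < \<epsilon>"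
      using V \<epsilon>(1) unfolding equicontinuous_on_def by metis
    have "open (Fin -` (V \<inter> ball (Fin u) \<delta>))" using V by (intro open_vimage_Fin open_Int) auto
    then obtain s where s: "s > 0" "ball u s \<subseteq> Fin -` (V \<inter> ball (Fin u) \<delta>)"
      using openE[of "Fin -` (V \<inter> ball (Fin u) \<delta>)" u] V \<delta> by auto
    obtain \<beta> where \<beta>: "\<And>n. run (map \<beta> [0..<n]) u \<in> survivors" using survivors_itinerary[OF u(1)] by metis
    obtain n y where y: "y \<in> ball u s" "max C (norm u + s) < norm (run (map \<beta> [0..<n]) y)"
      using survivors_runs_unbounded[OF \<beta> s(1)] by blast
    show False
    proof (cases "n = 0")
      case True
      then show False using y norm_triangle_sub[of y u] by (simp add: dist_norm norm_minus_commute)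
    next
      case False
      then have "srun (map \<beta> [0..<n]) \<in> G" by (intro srun_in_G) simp
      then have "dist (srun (map \<beta> [0..<n]) (Fin u)) (srun (map \<beta> [0..<n]) (Fin y)) < \<epsilon>"
        using s y by (intro \<delta>(2)) auto
      moreover have "norm (run (map \<beta> [0..<n]) u) \<le> Rad"
        using JstD[OF \<beta>[of n]] fillK_norm_less[OF escape_radius_Rad(2)] less_imp_le by blast
      ultimately have "norm (run (map \<beta> [0..<n]) y) \<le> C" using \<epsilon>(2) by simp
      then show False using y by simp
    qed
  qed
qed

lemma Julia_eq: "Julia G = Fin ` survivors" by (simp add: Julia_def Fatou_eq)

text \<open>If \<open>P z\<close> is in \<open>K2\<close>, then \<open>Q z\<close> is in \<open>K1\<close> and a second application of \<open>Q\<close> leads into its interior; otherwise \<open>P z\<close> is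
already outside \<open>K2\<close>.\<close>

lemma Jker_empty: "Jker G = {}"
proof -
  have "\<exists>g\<in>G. g x \<notin> Julia G" for x
  proof (cases x)
    case Infty
    then show ?thesis using srun_in_G[of "[True]"] by (intro bexI[of _ "srun [True]"]) (auto simp: Julia_eq)
  next
    case (Fin z)
    show ?thesis
    proof (cases "poly P z \<in> K2")
      case True
      have "srun [False, False] x \<notin> Julia G" using JstD Q_K1_interior[OF P_K2[OF True]] Fin by (auto simp: Julia_eq)
      then show ?thesis using srun_in_G by blast
    next
      case False
      then have "srun [True] x \<notin> Julia G" using JstD Fin by (auto simp: Julia_eq)
      then show ?thesis using srun_in_G by blast
    qed
  qed
  then show ?thesis unfolding Jker_def by fastforce
qed

lemma sync_ex: "\<exists>M q. 0 < q \<and> q < 1 \<and> 0 < M \<and> (\<forall>ws. \<forall>x\<in>K1. \<forall>y\<in>K1. norm (run ws x - run ws y) \<le> M * q ^ Q_count ws)"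
proof (rule sync)
  fix M q :: real
  assume "0 < q" "q < 1" "0 < M" "\<And>ws x y. x \<in> K1 \<Longrightarrow> y \<in> K1 \<Longrightarrow> norm (run ws x - run ws y) \<le> M * q ^ Q_count ws"
  then show ?thesis by blast
qed

text \<open>By synchronisation along the words \<open>Q\<^sup>n\<close>, orbits of \<open>Q\<close> in \<open>K1\<close> are Cauchy sequences with a common limit.\<close>

lemma attracting_point:
  obtains c where "c \<in> K1" "poly Q c = c" "\<And>y. y \<in> K1 \<Longrightarrow> (\<lambda>n. (poly Q ^^ n) y) \<longlonglongrightarrow> c"
proof -
  obtain M q where q: "0 < q" "q < 1" "0 < M" and
    sy: "\<And>ws x y. x \<in> K1 \<Longrightarrow> y \<in> K1 \<Longrightarrow> norm (run ws x - run ws y) \<le> M * q ^ Q_count ws" using sync_ex by blast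
  have Q_count_rep: "Q_count (replicate n False) = n" for n by (induction n) auto
  have sQ: "norm ((poly Q ^^ n) x - (poly Q ^^ n) y) \<le> M * q ^ n" if "x \<in> K1" "y \<in> K1" for x y n
    using sy[OF that, of "replicate n False"] by (simp add: Q_count_rep run_replicate)
  have QK: "(poly Q ^^ n) x \<in> K1" if "x \<in> K1" for x n using that by (induction n) (auto intro: Q_fillK)
  have lim0: "(\<lambda>n. M * q ^ n) \<longlonglongrightarrow> 0" using q tendsto_mult_right_zero[OF LIMSEQ_realpow_zero[of q], of M] by simp
  obtain x0 where x0: "x0 \<in> K1" using K1_ne by blast
  have "Cauchy (\<lambda>n. (poly Q ^^ n) x0)"
  proof (rule CauchyI)
    fix e :: real assume "0 < e"
    then obtain N where N: "M * q ^ N < e" using order_tendstoD(2)[OF lim0] eventually_sequentially by (meson order_refl)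
    show "\<exists>N. \<forall>m\<ge>N. \<forall>n\<ge>N. norm ((poly Q ^^ m) x0 - (poly Q ^^ n) x0) < e"
    proof (intro exI[of _ N] allI impI)
      fix m n assume "N \<le> m" "N \<le> n"
      then obtain i j where ij: "m = N + i" "n = N + j" by (metis le_Suc_ex)
      have "norm ((poly Q ^^ N) ((poly Q ^^ i) x0) - (poly Q ^^ N) ((poly Q ^^ j) x0)) \<le> M * q ^ N" by (intro sQ QK x0)
      then show "norm ((poly Q ^^ m) x0 - (poly Q ^^ n) x0) < e" using N by (simp add: ij funpow_plus_apply)
    qed
  qed
  then obtain c where c: "(\<lambda>n. (poly Q ^^ n) x0) \<longlonglongrightarrow> c" using Cauchy_convergent convergent_def by blast
  have cK: "c \<in> K1" by (rule closed_sequentially[OF compact_imp_closed[OF compact_K1] _ c]) (use QK x0 in blast)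
  have "(\<lambda>n. poly Q ((poly Q ^^ n) x0)) \<longlonglongrightarrow> poly Q c" by (intro tendsto_intros c)
  moreover have "(\<lambda>n. (poly Q ^^ Suc n) x0) \<longlonglongrightarrow> c" using c by (rule LIMSEQ_Suc)
  ultimately have fixc: "poly Q c = c" using LIMSEQ_unique by simp
  have fixn: "(poly Q ^^ n) c = c" for n by (induction n) (auto simp: fixc)
  show ?thesis
  proof (rule that[OF cK fixc])
    fix y assume y: "y \<in> K1"
    show "(\<lambda>n. (poly Q ^^ n) y) \<longlonglongrightarrow> c"
      by (rule LIM_zero_cancel, rule Lim_null_comparison[OF _ lim0])
        (use sQ[OF y cK] fixn in \<open>auto intro!: always_eventually\<close>)
  qed
qed

definition attractor :: complex where
  "attractor = (SOME c. c \<in> K1 \<and> poly Q c = c \<and> (\<forall>y\<in>K1. (\<lambda>n. (poly Q ^^ n) y) \<longlonglongrightarrow> c))"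

lemma attractor: "attractor \<in> K1" "poly Q attractor = attractor" "\<And>y. y \<in> K1 \<Longrightarrow> (\<lambda>n. (poly Q ^^ n) y) \<longlonglongrightarrow> attractor"
proof -
  have "\<exists>c. c \<in> K1 \<and> poly Q c = c \<and> (\<forall>y\<in>K1. (\<lambda>n. (poly Q ^^ n) y) \<longlonglongrightarrow> c)" by (rule attracting_point) blast
  from someI_ex[OF this] show "attractor \<in> K1" "poly Q attractor = attractor" "\<And>y. y \<in> K1 \<Longrightarrow> (\<lambda>n. (poly Q ^^ n) y) \<longlonglongrightarrow> attractor"
    unfolding attractor_def by blast+
qed

definition Lmin :: "csphere set" where "Lmin = closure (range (\<lambda>ws. Fin (run ws attractor)))"

lemma closed_Fin_K1: "closed (Fin ` K1)" using compact_imp_closed[OF compact_Fin_image[OF compact_K1]] .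

lemma Lmin_subset: "Lmin \<subseteq> Fin ` K1" unfolding Lmin_def
  by (rule closure_minimal[OF _ closed_Fin_K1]) (use run_K1[OF attractor(1)] in auto)

lemma run_attractor_Lmin: "Fin (run ws attractor) \<in> Lmin" unfolding Lmin_def by (rule subsetD[OF closure_subset rangeI])

lemma Lmin_invariant: assumes "x \<in> Lmin" shows "srun ws x \<in> Lmin"
proof -
  have "srun ws ` closure (range (\<lambda>ws. Fin (run ws attractor))) \<subseteq> closure (range (\<lambda>ws. Fin (run ws attractor)))"
  proof (rule image_closure_subset[OF continuous_srun closed_closure])
    show "srun ws ` range (\<lambda>ws. Fin (run ws attractor)) \<subseteq> closure (range (\<lambda>ws. Fin (run ws attractor)))"
    proof
      fix y assume "y \<in> srun ws ` range (\<lambda>ws. Fin (run ws attractor))"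
      then obtain vs where "y = srun ws (Fin (run vs attractor))" by blast
      then have "y = Fin (run (vs @ ws) attractor)" by simp
      then show "y \<in> closure (range (\<lambda>ws. Fin (run ws attractor)))"
        unfolding Lmin_def[symmetric] using run_attractor_Lmin[of "vs @ ws"] by simp
    qed
  qed
  then show ?thesis using assms by (auto simp: Lmin_def)
qed

lemma fic_iff: "forward_invariant_compact G Y C \<longleftrightarrow> C \<noteq> {} \<and> compact C \<and> C \<subseteq> Y \<and> (\<forall>ws. srun ws ` C \<subseteq> C)"
proof -
  have "(\<forall>g\<in>G. g ` C \<subseteq> C) \<longleftrightarrow> (\<forall>ws. srun ws ` C \<subseteq> C)"
  proof
    assume *: "\<forall>g\<in>G. g ` C \<subseteq> C"
    have "srun ws ` C \<subseteq> C" for ws using * srun_in_G[of ws] by (cases "ws = []") auto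
    then show "\<forall>ws. srun ws ` C \<subseteq> C" by blast
  qed (auto simp: G_eq)
  then show ?thesis by (simp add: forward_invariant_compact_def)
qed

text \<open>Iterating \<open>Q\<close> from any point of \<open>K1\<close> leads to the attracting point, so a closed invariant set that meets \<open>K1\<close> contains its
whole orbit.\<close>

lemma Lmin_least: assumes C: "forward_invariant_compact G Y C" and x: "Fin z \<in> C" "z \<in> K1" shows "Lmin \<subseteq> C"
proof -
  have cl: "closed C" and inv: "\<And>ws x. x \<in> C \<Longrightarrow> srun ws x \<in> C" using C by (auto simp: fic_iff compact_imp_closed)
  have "(\<lambda>n. Fin ((poly Q ^^ n) z)) \<longlonglongrightarrow> Fin attractor"
    by (rule continuous_on_tendsto_compose[OF continuous_on_Fin[of UNIV] attractor(3)[OF x(2)]]) auto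
  moreover have "Fin ((poly Q ^^ n) z) \<in> C" for n using inv[OF x(1), of "replicate n False"] by (simp add: run_replicate)
  ultimately have a: "Fin attractor \<in> C" by (rule closed_sequentially[OF cl, rotated])
  have "Fin (run ws attractor) \<in> C" for ws using inv[OF a, of ws] by simp
  then show ?thesis unfolding Lmin_def by (intro closure_minimal cl) auto
qed

lemma Infty_least: assumes C: "forward_invariant_compact G Y C" and x: "x \<in> C" "x \<notin> Fin ` K1" shows "Infty \<in> C"
proof (cases x)
  case (Fin z)
  have cl: "closed C" and inv: "\<And>ws x. x \<in> C \<Longrightarrow> srun ws x \<in> C" using C by (auto simp: fic_iff compact_imp_closed)
  have zK: "z \<notin> K1" using x Fin by auto
  have "(\<lambda>n. Fin ((poly P ^^ n) z)) \<longlonglongrightarrow> Infty" unfolding tendsto_Infty_iff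
  proof
    fix R
    obtain N where "\<And>z' n. z' \<in> {z} \<Longrightarrow> N \<le> n \<Longrightarrow> max R Rad < norm ((poly P ^^ n) z')"
      by (rule uniform_escape[OF escape_radius_mono[OF escape_radius_Rad(1), of "max R Rad"], of "{z}"]) (use zK in auto)
    then show "eventually (\<lambda>n. Fin ((poly P ^^ n) z) \<in> nbhd_Infty R) sequentially"
      unfolding eventually_sequentially by (intro exI[of _ N]) auto
  qed
  moreover have "Fin ((poly P ^^ n) z) \<in> C" for n using inv[OF x(1), of "replicate n True"] Fin by (simp add: run_replicate)
  ultimately show ?thesis by (rule closed_sequentially[OF cl, rotated])
qed (use x in simp)

lemma fic_Lmin: "Lmin \<subseteq> Y \<Longrightarrow> forward_invariant_compact G Y Lmin"
  unfolding fic_iff using Lmin_invariant run_attractor_Lmin[of "[]"] closed_csphere_compact[of Lmin] by (auto simp: Lmin_def)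

lemma minimal_sets_Khat: "{L'. minimal_set G (Khat G) L'} = {Lmin}"
proof -
  have f: "forward_invariant_compact G (Khat G) Lmin" using Lmin_subset by (intro fic_Lmin) (simp add: Khat_eq)
  have le: "Lmin \<subseteq> C" if C: "forward_invariant_compact G (Khat G) C" for C
  proof -
    obtain x where x: "x \<in> C" using C by (auto simp: fic_iff)
    moreover have "C \<subseteq> Fin ` K1" using C by (simp add: fic_iff Khat_eq)
    ultimately show ?thesis using Lmin_least[OF C] by blast
  qed
  have "minimal_set G (Khat G) Lmin" using f le by (auto simp: minimal_set_def)
  moreover have "L' = Lmin" if "minimal_set G (Khat G) L'" for L' using that f le unfolding minimal_set_def by blast
  ultimately show ?thesis by blast
qed

lemma minimal_sets_UNIV: "{L'. minimal_set G UNIV L'} = {{Infty}, Lmin}"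
proof -
  have f: "forward_invariant_compact G UNIV Lmin" by (intro fic_Lmin) simp
  have fI: "forward_invariant_compact G UNIV {Infty}" unfolding fic_iff by auto
  have "minimal_set G UNIV {Infty}" unfolding minimal_set_def using fI by (auto simp: forward_invariant_compact_def)
  moreover have "minimal_set G UNIV Lmin" unfolding minimal_set_def
  proof (intro conjI allI impI f)
    fix C assume C: "forward_invariant_compact G UNIV C" "C \<subseteq> Lmin"
    obtain x where x: "x \<in> C" using C(1) by (auto simp: fic_iff)
    then have "x \<in> Fin ` K1" using C(2) Lmin_subset by (meson subsetD)
    then show "C = Lmin" using x using Lmin_least[OF C(1)] C(2) by blast
  qed
  moreover have "L' = {Infty} \<or> L' = Lmin" if L': "minimal_set G UNIV L'" for L'
  proof -
    have fL: "forward_invariant_compact G UNIV L'" and mn: "\<And>C. forward_invariant_compact G UNIV C \<Longrightarrow> C \<subseteq> L' \<Longrightarrow> C = L'"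
      using L' by (auto simp: minimal_set_def)
    show ?thesis
    proof (cases "L' \<subseteq> Fin ` K1")
      case True
      moreover obtain x where "x \<in> L'" using fL by (auto simp: fic_iff)
      ultimately have "Lmin \<subseteq> L'" using Lmin_least[OF fL] by blast
      then show ?thesis using mn[OF f] by simp
    next
      case False
      then have "Infty \<in> L'" using Infty_least[OF fL] by blast
      then show ?thesis using mn[OF fI] by simp
    qed
  qed
  ultimately show ?thesis by blast
qed

end

section \<open>Real derivatives of restrictions of holomorphic functions\<close>

text \<open>The chain rule along the real axis; the imaginary part of the derivative vanishes because the restriction is real.\<close>

lemma deriv_real_restriction:
  assumes S: "open S" "f holomorphic_on S" and q: "q \<in> {a<..<b}"
    and eq: "\<And>q. q \<in> {a<..<b} \<Longrightarrow> of_real q \<in> S \<and> of_real (g q) = f (of_real q)"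
  shows "of_real (deriv g q) = deriv f (of_real q)"
proof -
  have "(f has_field_derivative deriv f (of_real q)) (at (of_real q))" using S eq[OF q] by (auto intro: holomorphic_derivI)
  then have "((\<lambda>x. f (of_real x)) has_vector_derivative deriv f (of_real q)) (at q)"
    by (rule has_vector_derivative_real_field)
  then have v: "((\<lambda>x. complex_of_real (g x)) has_vector_derivative deriv f (of_real q)) (at q)"
    by (rule has_vector_derivative_transform_within_open[OF _ open_greaterThanLessThan q]) (use eq in simp)
  have "((\<lambda>x. Re (complex_of_real (g x))) has_vector_derivative Re (deriv f (of_real q))) (at q)"
    by (rule bounded_linear.has_vector_derivative[OF bounded_linear_Re v])
  then have "(g has_real_derivative Re (deriv f (of_real q))) (at q)" by (simp add: has_real_derivative_iff_has_vector_derivative)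
  then have 1: "deriv g q = Re (deriv f (of_real q))" by (rule DERIV_imp_deriv)
  have "((\<lambda>x. Im (complex_of_real (g x))) has_vector_derivative Im (deriv f (of_real q))) (at q)"
    by (rule bounded_linear.has_vector_derivative[OF bounded_linear_Im v])
  then have "((\<lambda>x. 0) has_real_derivative Im (deriv f (of_real q))) (at q)" by (simp add: has_real_derivative_iff_has_vector_derivative)
  then have "Im (deriv f (of_real q)) = 0" using DERIV_unique DERIV_const by blast
  then show ?thesis using 1 by (simp add: complex_eq_iff)
qed

lemma higher_deriv_real_restriction:
  assumes S: "open S" "f holomorphic_on S"
    and eq: "\<And>q. q \<in> {a<..<b} \<Longrightarrow> of_real q \<in> S \<and> of_real (g q) = f (of_real q)" and q: "q \<in> {a<..<b}"
  shows "of_real ((deriv ^^ n) g q) = (deriv ^^ n) f (of_real q)"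
  using q
proof (induction n arbitrary: q)
  case (Suc n)
  have "of_real (deriv ((deriv ^^ n) g) q) = deriv ((deriv ^^ n) f) (of_real q)"
    by (rule deriv_real_restriction[of S _ _ a b]) (use S eq Suc in \<open>auto intro: holomorphic_higher_deriv\<close>)
  then show ?case by simp
qed (use eq in auto)

text \<open>The Leibniz rule for the two affine factors \<open>u\<close> and \<open>1 - u\<close>, written so as to give the recursion for the derivatives of
\<open>T\<close>.\<close>

lemma higher_deriv_convex_combination:
  assumes S: "open S" and f: "f holomorphic_on S" and g: "g holomorphic_on S" and u: "u \<in> S"
  shows "(deriv ^^ Suc n) (\<lambda>u. u * f u + (1 - u) * g u) u =
     u * (deriv ^^ Suc n) f u + (1 - u) * (deriv ^^ Suc n) g u + of_nat (Suc n) * ((deriv ^^ n) f u - (deriv ^^ n) g u)"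
  using u
proof (induction n arbitrary: u)
  case 0
  have "(f has_field_derivative deriv f u) (at u)" "(g has_field_derivative deriv g u) (at u)"
    using f g S 0 by (auto intro: holomorphic_derivI)
  then have "((\<lambda>u. u * f u + (1 - u) * g u) has_field_derivative u * deriv f u + (1 - u) * deriv g u + (f u - g u)) (at u)"
    by (auto intro!: derivative_eq_intros simp: algebra_simps)
  then show ?case by (simp add: DERIV_imp_deriv)
next
  case (Suc n)
  let ?F = "\<lambda>u. u * f u + (1 - u) * g u"
  let ?H = "\<lambda>u. u * (deriv ^^ Suc n) f u + (1 - u) * (deriv ^^ Suc n) g u + of_nat (Suc n) * ((deriv ^^ n) f u - (deriv ^^ n) g u)"
  note d = has_field_derivative_higher_deriv[OF f S Suc.prems] has_field_derivative_higher_deriv[OF g S Suc.prems]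
  have "(?H has_field_derivative u * (deriv ^^ Suc (Suc n)) f u + (1 - u) * (deriv ^^ Suc (Suc n)) g u
      + ((deriv ^^ Suc n) f u - (deriv ^^ Suc n) g u) + of_nat (Suc n) * ((deriv ^^ Suc n) f u - (deriv ^^ Suc n) g u)) (at u)"
    by (rule derivative_eq_intros d refl | simp add: algebra_simps)+
  then have "((deriv ^^ Suc n) ?F has_field_derivative u * (deriv ^^ Suc (Suc n)) f u + (1 - u) * (deriv ^^ Suc (Suc n)) g u
      + ((deriv ^^ Suc n) f u - (deriv ^^ Suc n) g u) + of_nat (Suc n) * ((deriv ^^ Suc n) f u - (deriv ^^ Suc n) g u)) (at u)"
    by (rule has_field_derivative_transform_within_open[OF _ S Suc.prems]) (use Suc.IH in simp)
  then have "(deriv ^^ Suc (Suc n)) ?F u = u * (deriv ^^ Suc (Suc n)) f u + (1 - u) * (deriv ^^ Suc (Suc n)) g u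
      + ((deriv ^^ Suc n) f u - (deriv ^^ Suc n) g u) + of_nat (Suc n) * ((deriv ^^ Suc n) f u - (deriv ^^ Suc n) g u)"
    by (simp add: DERIV_imp_deriv)
  then show ?case by (simp add: algebra_simps del: funpow.simps)
qed

section \<open>The transition operator with a complex parameter\<close>

text \<open>The complex parameters for which the transition operator contracts by \<open>r\<close>; the union \<open>open_lens\<close> over \<open>r < 1\<close> is an open
neighbourhood of the real interval from \<open>0\<close> to \<open>1\<close>.\<close>

definition lens :: "real \<Rightarrow> complex set" where "lens r = {p. norm p \<le> r \<and> norm (1 - p) \<le> r}"
definition open_lens :: "complex set" where "open_lens = {p. norm p < 1 \<and> norm (1 - p) < 1}"

lemma open_open_lens: "open open_lens"
  unfolding open_lens_def by (intro open_Collect_conj open_Collect_less continuous_intros)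

lemma of_real_open_lens: "q \<in> {0<..<1} \<Longrightarrow> complex_of_real q \<in> open_lens"
proof -
  assume q: "q \<in> {0<..<1}"
  have "1 - complex_of_real q = of_real (1 - q)" by simp
  then have "norm (1 - complex_of_real q) = 1 - q" unfolding norm_of_real[symmetric] using q by (simp only: norm_of_real) simp
  then show ?thesis using q by (simp add: open_lens_def)
qed

lemma lens_nbhd: assumes "p0 \<in> open_lens" obtains r \<rho> where "r < 1" "0 < r" "0 < \<rho>" "cball p0 (2 * \<rho>) \<subseteq> lens r"
proof -
  define m where "m = max (norm p0) (norm (1 - p0))"
  have m: "m < 1" "0 \<le> m" using assms by (auto simp: m_def open_lens_def max_def)
  define \<rho> where "\<rho> = (1 - m) / 4"
  have "cball p0 (2 * \<rho>) \<subseteq> lens (m + 2 * \<rho>)"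
  proof
    fix p assume "p \<in> cball p0 (2 * \<rho>)"
    then have d: "norm (p0 - p) \<le> 2 * \<rho>" by (simp add: dist_norm)
    have "norm p \<le> norm p0 + norm (p0 - p)" by (metis norm_minus_commute norm_triangle_sub)
    moreover have "norm (1 - p) \<le> norm (1 - p0) + norm (p0 - p)" using norm_triangle_ineq[of "1 - p0" "p0 - p"] by simp
    ultimately show "p \<in> lens (m + 2 * \<rho>)" using d by (auto simp: lens_def m_def)
  qed
  then show ?thesis using m by (intro that[of "m + 2 * \<rho>" \<rho>]) (auto simp: \<rho>_def field_simps)
qed

lemma lens_subset_open_lens: "r < 1 \<Longrightarrow> lens r \<subseteq> open_lens" by (auto simp: lens_def open_lens_def)

lemma open_lens_in_lens: "p \<in> open_lens \<Longrightarrow> \<exists>r. 0 < r \<and> r < 1 \<and> p \<in> lens r"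
  using lens_nbhd[of p] by (metis centre_in_cball less_imp_le mult_pos_pos subsetD zero_less_numeral)

context poly_pair begin

text \<open>The sphere is divided into \<open>Fin ` K1\<close>, \<open>outer\<close> and \<open>intermediate\<close>; the first two parts are forward invariant.\<close>

definition outer :: "csphere set" where "outer = - (Fin ` interior K2)"
definition intermediate :: "csphere set" where "intermediate = Fin ` (interior K2 - K1)"

lemma closed_outer: "closed outer" unfolding outer_def by (intro closed_Compl open_Fin_image open_interior)

lemma sphere_cases: obtains "x \<in> Fin ` K1" | "x \<in> outer" | "x \<in> intermediate"
  by (cases x) (auto simp: outer_def intermediate_def)

lemma sstep_K1: "x \<in> Fin ` K1 \<Longrightarrow> sstep b x \<in> Fin ` K1" using step_K1 by auto
lemma srun_K1: "x \<in> Fin ` K1 \<Longrightarrow> srun ws x \<in> Fin ` K1" using run_K1 by auto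

lemma sstep_outer: assumes "x \<in> outer" shows "sstep b x \<in> outer"
proof (cases x)
  case (Fin z)
  then have "z \<notin> interior K2" using assms by (auto simp: outer_def)
  then have "step b z \<notin> interior K2" using P_outside interior_K2_Q interior_subset by (cases b) auto
  then show ?thesis using Fin by (auto simp: outer_def)
qed (simp add: outer_def image_iff)

text \<open>This is the disjointness in the open set condition. It makes one of the two terms of the transition operator vanish in
\<open>Mc_contraction\<close>.\<close>

lemma intermediate_disjoint: "poly_map P x \<in> intermediate \<Longrightarrow> poly_map Q x \<notin> intermediate"
  by (cases x) (auto simp: intermediate_def dest: P_into)

lemma intermediate_not: "x \<in> intermediate \<Longrightarrow> x \<notin> Fin ` K1 \<and> x \<notin> outer" by (auto simp: intermediate_def outer_def)

lemma sstep_intermediate: "sstep b x \<in> intermediate \<Longrightarrow> x \<in> intermediate"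
  using sstep_K1 sstep_outer intermediate_not by (cases x rule: sphere_cases) blast+

lemma K1_outer_disjoint: "x \<in> Fin ` K1 \<Longrightarrow> x \<notin> outer" using fillK_nested by (auto simp: outer_def)

text \<open>\<open>M_op\<close> with a complex parameter.\<close>

definition Mc :: "complex \<Rightarrow> (csphere \<Rightarrow> complex) \<Rightarrow> csphere \<Rightarrow> complex" where
  "Mc p \<phi> x = p * \<phi> (poly_map P x) + (1 - p) * \<phi> (poly_map Q x)"

lemma M_op_Mc: "M_op (poly_map P) (poly_map Q) q = Mc (of_real q)"
  by (auto simp: M_op_def Mc_def fun_eq_iff)

lemma Mc_diff: "Mc p (\<lambda>x. \<phi> x - \<psi> x) = (\<lambda>x. Mc p \<phi> x - Mc p \<psi> x)"
  by (auto simp: Mc_def fun_eq_iff algebra_simps)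

lemma Mc_pow_diff: "(Mc p ^^ n) (\<lambda>x. \<phi> x - \<psi> x) = (\<lambda>x. (Mc p ^^ n) \<phi> x - (Mc p ^^ n) \<psi> x)"
  by (induction n) (auto simp: Mc_diff)

lemma Mc_continuous: assumes "continuous_on UNIV \<phi>" shows "continuous_on UNIV (Mc p \<phi>)"
proof -
  have "continuous_on UNIV (\<phi> \<circ> sstep b)" for b
    by (intro continuous_on_compose continuous_sstep continuous_on_subset[OF assms]) auto
  from this[of True] this[of False] show ?thesis unfolding Mc_def by (auto intro!: continuous_intros simp: o_def)
qed

lemma Mc_pow_continuous: "continuous_on UNIV \<phi> \<Longrightarrow> continuous_on UNIV ((Mc p ^^ n) \<phi>)"
  by (induction n) (auto intro: Mc_continuous)

text \<open>At most one of the two images of a point is in the intermediate region, so that only one summand contributes, with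
coefficient \<open>p\<close> or \<open>1 - p\<close>.\<close>

lemma Mc_contraction:
  assumes p: "p \<in> lens r" and supp: "\<And>x. x \<notin> intermediate \<Longrightarrow> D x = 0" and bd: "\<And>x. norm (D x) \<le> C"
  shows "norm (Mc p D x) \<le> r * C" "x \<notin> intermediate \<Longrightarrow> Mc p D x = 0"
proof -
  have C: "0 \<le> C" using bd[of x] norm_ge_zero[of "D x"] by linarith
  have r: "norm p \<le> r" "norm (1 - p) \<le> r" using p by (auto simp: lens_def)
  have r0: "0 \<le> r" using r(1) norm_ge_zero[of p] by linarith
  note r = r r0
  consider "poly_map Q x \<notin> intermediate" | "poly_map P x \<notin> intermediate" using intermediate_disjoint by blast
  then show "norm (Mc p D x) \<le> r * C"
  proof cases
    case 1
    then show ?thesis using supp r C bd by (simp add: Mc_def norm_mult mult_mono)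
  next
    case 2
    then show ?thesis using supp r C bd by (simp add: Mc_def norm_mult mult_mono)
  qed
  assume "x \<notin> intermediate"
  then have "poly_map P x \<notin> intermediate" "poly_map Q x \<notin> intermediate" using sstep_intermediate[of True x] sstep_intermediate[of False x] by auto
  then show "Mc p D x = 0" using supp by (simp add: Mc_def)
qed

lemma Mc_pow_contraction:
  assumes p: "p \<in> lens r" and supp: "\<And>x. x \<notin> intermediate \<Longrightarrow> D x = 0" and bd: "\<And>x. norm (D x) \<le> C"
  shows "norm ((Mc p ^^ n) D x) \<le> r ^ n * C \<and> (x \<notin> intermediate \<longrightarrow> (Mc p ^^ n) D x = 0)"
proof (induction n arbitrary: x)
  case (Suc n)
  have "norm (Mc p ((Mc p ^^ n) D) x) \<le> r * (r ^ n * C)" by (rule Mc_contraction(1)[OF p]) (use Suc in auto)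
  moreover have "x \<notin> intermediate \<Longrightarrow> Mc p ((Mc p ^^ n) D) x = 0" by (rule Mc_contraction(2)[OF p, of _ "r ^ n * C"]) (use Suc in auto)
  ultimately show ?case by simp
qed (use supp bd in auto)

lemma gap: obtains \<delta> where "\<delta> > 0" "\<And>x. x \<in> outer \<Longrightarrow> \<delta> \<le> infdist x (Fin ` K1)"
proof -
  have W: "compact outer" "outer \<noteq> {}" using closed_csphere_compact[OF closed_outer] by (auto simp: outer_def)
  have "continuous_on outer (\<lambda>x. infdist x (Fin ` K1))" by (intro continuous_intros)
  then obtain w where w: "w \<in> outer" "\<And>x. x \<in> outer \<Longrightarrow> infdist w (Fin ` K1) \<le> infdist x (Fin ` K1)"
    using continuous_attains_inf[OF W] by blast
  have "infdist w (Fin ` K1) \<noteq> 0"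
  proof
    assume "infdist w (Fin ` K1) = 0"
    then have "w \<in> Fin ` K1" using in_closed_iff_infdist_zero[OF closed_Fin_K1] K1_ne by blast
    then show False using w(1) K1_outer_disjoint by blast
  qed
  then have "infdist w (Fin ` K1) > 0" using infdist_nonneg by (metis order_less_le)
  then show ?thesis using w(2) by (rule that)
qed

definition gap_width :: real where "gap_width = (SOME \<delta>. \<delta> > 0 \<and> (\<forall>x\<in>outer. \<delta> \<le> infdist x (Fin ` K1)))"

lemma gap_width: "gap_width > 0" "\<And>x. x \<in> outer \<Longrightarrow> gap_width \<le> infdist x (Fin ` K1)"
proof -
  have "\<exists>\<delta>. \<delta> > 0 \<and> (\<forall>x\<in>outer. \<delta> \<le> infdist x (Fin ` K1))" by (rule gap) blast
  from someI_ex[OF this] show "gap_width > 0" "\<And>x. x \<in> outer \<Longrightarrow> gap_width \<le> infdist x (Fin ` K1)" unfolding gap_width_def by blast+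
qed

text \<open>A Lipschitz function that already has the boundary values of \<open>T\<close>: \<open>0\<close> on \<open>K1\<close> and \<open>1\<close> on \<open>outer\<close>.\<close>

definition profile0 :: "csphere \<Rightarrow> real" where "profile0 x = min 1 (infdist x (Fin ` K1) / gap_width)"

lemma profile0_K1: "x \<in> Fin ` K1 \<Longrightarrow> profile0 x = 0" by (simp add: profile0_def)
lemma profile0_outer: assumes "x \<in> outer" shows "profile0 x = 1" using gap_width(1) gap_width(2)[OF assms] by (simp add: profile0_def)
lemma profile0_bounds: "0 \<le> profile0 x" "profile0 x \<le> 1" using gap_width(1) infdist_nonneg[of x "Fin ` K1"] by (auto simp: profile0_def)
lemma profile0_lipschitz: "\<bar>profile0 x - profile0 y\<bar> \<le> dist x y / gap_width"
proof -
  have "\<bar>profile0 x - profile0 y\<bar> \<le> \<bar>infdist x (Fin ` K1) / gap_width - infdist y (Fin ` K1) / gap_width\<bar>" unfolding profile0_def by linarith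
  also have "\<dots> = \<bar>infdist x (Fin ` K1) - infdist y (Fin ` K1)\<bar> / gap_width" using gap_width(1) by (simp flip: diff_divide_distrib)
  also have "\<dots> \<le> dist x y / gap_width" using gap_width(1) infdist_triangle_abs by (intro divide_right_mono) auto
  finally show ?thesis .
qed

definition profile :: "nat \<Rightarrow> complex \<Rightarrow> csphere \<Rightarrow> complex" where "profile n p = (Mc p ^^ n) (\<lambda>x. of_real (profile0 x))"

lemma profile_Suc: "profile (Suc n) p = Mc p (profile n p)" "profile 0 p x = of_real (profile0 x)" by (simp_all add: profile_def)

lemma profile_bdry: "(x \<in> Fin ` K1 \<longrightarrow> profile n p x = 0) \<and> (x \<in> outer \<longrightarrow> profile n p x = 1)"
proof (induction n arbitrary: x)
  case (Suc n)
  have "sstep b x \<in> Fin ` K1" if "x \<in> Fin ` K1" for b using sstep_K1 that .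
  from this[of True] this[of False] sstep_outer[of x True] sstep_outer[of x False]
  show ?case using Suc[of "poly_map P x"] Suc[of "poly_map Q x"] by (auto simp: profile_Suc Mc_def)
qed (auto simp: profile_Suc profile0_K1 profile0_outer)

lemma profile_step: assumes "p \<in> lens r" "r < 1" shows "norm (profile (Suc n) p x - profile n p x) \<le> r ^ n * 3"
proof -
  let ?D = "\<lambda>x. profile 1 p x - profile 0 p x"
  have "profile (Suc n) p x - profile n p x = (Mc p ^^ n) ?D x"
    unfolding Mc_pow_diff by (simp add: profile_def funpow_swap1)
  moreover have "norm ((Mc p ^^ n) ?D x) \<le> r ^ n * 3"
  proof (rule Mc_pow_contraction[OF assms(1), THEN conjunct1])
    fix x assume "x \<notin> intermediate"
    then show "?D x = 0" using profile_bdry[of x 1 p] profile_bdry[of x 0 p] by (cases x rule: sphere_cases) auto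
  next
    fix x
    have a: "norm (complex_of_real (profile0 y)) \<le> 1" for y using profile0_bounds[of y] by simp
    have "norm p \<le> 1" "norm (1 - p) \<le> 1" using assms by (auto simp: lens_def)
    then have "norm (p * of_real (profile0 (poly_map P x))) \<le> 1 * 1" "norm ((1 - p) * of_real (profile0 (poly_map Q x))) \<le> 1 * 1"
      unfolding norm_mult using a by (intro mult_mono; simp)+
    then have "norm (profile 1 p x) \<le> 2" using norm_triangle_ineq[of "p * of_real (profile0 (poly_map P x))" "(1 - p) * of_real (profile0 (poly_map Q x))"]
      by (simp add: profile_def Mc_def)
    then show "norm (?D x) \<le> 3" using a[of x] norm_triangle_ineq4[of "profile 1 p x" "profile 0 p x"] by (simp add: profile_Suc)
  qed
  ultimately show ?thesis by simp
qed

text \<open>The fixed point of \<open>Mc p\<close> with these boundary values. For real \<open>p\<close> it is the escape probability, see \<open>T_eq_Tc\<close>.\<close>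

definition Tc :: "complex \<Rightarrow> csphere \<Rightarrow> complex" where "Tc p x = lim (\<lambda>n. profile n p x)"

lemma profile_uniform_limit:
  assumes r: "0 \<le> r" "r < 1"
  shows "uniform_limit (lens r \<times> UNIV) (\<lambda>n (p, x). profile n p x) (\<lambda>(p, x). Tc p x) sequentially"
proof -
  have "uniformly_convergent_on (lens r \<times> UNIV) (\<lambda>n px. \<Sum>i<n. (\<lambda>(p, x). profile (Suc i) p x - profile i p x) px)"
  proof (rule Weierstrass_m_test'[where M = "\<lambda>n. r ^ n * 3"])
    show "summable (\<lambda>n. r ^ n * 3)" using r by (intro summable_mult2 summable_geometric) auto
  qed (use profile_step r in auto)
  then obtain l where l: "uniform_limit (lens r \<times> UNIV) (\<lambda>n px. \<Sum>i<n. (\<lambda>(p, x). profile (Suc i) p x - profile i p x) px) l sequentially"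
    by (auto simp: uniformly_convergent_on_def)
  have eq: "(\<Sum>i<n. (\<lambda>(p, x). profile (Suc i) p x - profile i p x) px) = profile n (fst px) (snd px) - profile 0 (fst px) (snd px)" for n px
    using sum_lessThan_telescope[of "\<lambda>i. profile i (fst px) (snd px)" n] by (simp add: case_prod_unfold)
  have "uniform_limit (lens r \<times> UNIV) (\<lambda>n px. (profile n (fst px) (snd px) - profile 0 (fst px) (snd px)) + profile 0 (fst px) (snd px)) (\<lambda>px. l px + profile 0 (fst px) (snd px)) sequentially"
    by (intro uniform_limit_add uniform_limit_const) (use l in \<open>simp only: eq\<close>)
  then have u: "uniform_limit (lens r \<times> UNIV) (\<lambda>n px. profile n (fst px) (snd px)) (\<lambda>px. l px + profile 0 (fst px) (snd px)) sequentially" by simp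
  have "l px + profile 0 (fst px) (snd px) = Tc (fst px) (snd px)" if "px \<in> lens r \<times> UNIV" for px
    unfolding Tc_def using limI[OF tendsto_uniform_limitI[OF u that]] by simp
  then have "uniform_limit (lens r \<times> UNIV) (\<lambda>n px. profile n (fst px) (snd px)) (\<lambda>px. Tc (fst px) (snd px)) sequentially"
    by (intro uniform_limit_cong'[THEN iffD1, OF _ _ u]) auto
  then show ?thesis by (simp add: case_prod_unfold)
qed

lemma profile_tendsto: assumes "p \<in> open_lens" shows "(\<lambda>n. profile n p x) \<longlonglongrightarrow> Tc p x"
proof -
  obtain r where r: "0 < r" "r < 1" "p \<in> lens r" using open_lens_in_lens[OF assms] by blast
  show ?thesis using tendsto_uniform_limitI[OF profile_uniform_limit[of r], of "(p, x)"] r by simp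
qed

lemma Tc_fixed: assumes "p \<in> open_lens" shows "Mc p (Tc p) x = Tc p x"
proof -
  have "(\<lambda>n. Mc p (profile n p) x) \<longlonglongrightarrow> Mc p (Tc p) x" unfolding Mc_def by (intro tendsto_intros profile_tendsto assms)
  moreover have "(\<lambda>n. profile (Suc n) p x) \<longlonglongrightarrow> Tc p x" using profile_tendsto[OF assms] by (rule LIMSEQ_Suc)
  ultimately show ?thesis using LIMSEQ_unique by (simp add: profile_Suc)
qed

lemma Tc_K1: "p \<in> open_lens \<Longrightarrow> x \<in> Fin ` K1 \<Longrightarrow> Tc p x = 0"
  using LIMSEQ_unique[OF profile_tendsto[of p x], of 0] profile_bdry[of x] by simp
lemma Tc_outer: "p \<in> open_lens \<Longrightarrow> x \<in> outer \<Longrightarrow> Tc p x = 1"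
  using LIMSEQ_unique[OF profile_tendsto[of p x], of 1] profile_bdry[of x] by simp

lemma holomorphic_Mc: "(\<And>x. (\<lambda>p. \<Phi> p x) holomorphic_on S) \<Longrightarrow> (\<lambda>p. Mc p (\<Phi> p) x) holomorphic_on S"
  unfolding Mc_def by (intro holomorphic_intros)

lemma holomorphic_profile: "(\<lambda>p. profile n p x) holomorphic_on S"
proof (induction n arbitrary: x)
  case (Suc n)
  show ?case unfolding profile_Suc by (rule holomorphic_Mc) (rule Suc)
qed (simp add: profile_Suc)

text \<open>The iterates are polynomials in \<open>p\<close> and converge locally uniformly.\<close>

lemma holomorphic_Tc: "(\<lambda>p. Tc p x) holomorphic_on open_lens"
proof (rule holomorphic_uniform_sequence[OF open_open_lens])
  show "(\<lambda>p. profile n p x) holomorphic_on open_lens" for n by (rule holomorphic_profile)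
  fix p assume "p \<in> open_lens"
  then obtain r \<rho> where r: "r < 1" "0 < r" "0 < \<rho>" "cball p (2 * \<rho>) \<subseteq> lens r" using lens_nbhd by metis
  have "uniform_limit (cball p (2*\<rho>)) (\<lambda>n p. profile n p x) (\<lambda>p. Tc p x) sequentially"
    using uniform_limit_compose'[OF profile_uniform_limit[of r], of "\<lambda>p. (p, x)" "cball p (2*\<rho>)"] r by auto
  then show "\<exists>d>0. cball p d \<subseteq> open_lens \<and> uniform_limit (cball p d) (\<lambda>n p. profile n p x) (\<lambda>p. Tc p x) sequentially"
    using r lens_subset_open_lens[of r] by (intro exI[of _ "2*\<rho>"]) auto
qed

text \<open>Continuity in the point, uniformly in the parameter. It transfers to derivatives in the parameter by Cauchy's inequality.\<close>

definition equicontinuous_on_lens :: "real \<Rightarrow> (complex \<Rightarrow> csphere \<Rightarrow> complex) \<Rightarrow> bool" where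
  "equicontinuous_on_lens r \<Phi> \<longleftrightarrow> (\<forall>x \<epsilon>. \<epsilon> > 0 \<longrightarrow> (\<exists>\<delta>>0. \<forall>y p. dist x y < \<delta> \<longrightarrow> p \<in> lens r \<longrightarrow> norm (\<Phi> p x - \<Phi> p y) < \<epsilon>))"

lemma equicontinuous_on_lens_Mc: assumes "equicontinuous_on_lens r \<Phi>" "r < 1" shows "equicontinuous_on_lens r (\<lambda>p. Mc p (\<Phi> p))"
  unfolding equicontinuous_on_lens_def
proof (intro allI impI)
  fix x and \<epsilon> :: real assume e: "\<epsilon> > 0"
  obtain \<Lambda> where L: "\<Lambda> \<ge> 1" "\<And>b x y. dist (sstep b x) (sstep b y) \<le> \<Lambda> * dist x y" using sstep_lipschitz by blast
  have "\<exists>\<delta>>0. \<forall>y p. dist (sstep b x) y < \<delta> \<longrightarrow> p \<in> lens r \<longrightarrow> norm (\<Phi> p (sstep b x) - \<Phi> p y) < \<epsilon>/2" for b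
    using assms(1) e unfolding equicontinuous_on_lens_def by (meson half_gt_zero)
  then obtain d where d: "\<And>b. d b > 0" "\<And>b y p. dist (sstep b x) y < d b \<Longrightarrow> p \<in> lens r \<Longrightarrow> norm (\<Phi> p (sstep b x) - \<Phi> p y) < \<epsilon>/2" by metis
  define \<delta> where "\<delta> = min (d True) (d False) / \<Lambda>"
  have db: "\<delta> \<le> d b / \<Lambda>" for b using L by (cases b) (auto simp: \<delta>_def divide_right_mono)
  show "\<exists>\<delta>>0. \<forall>y p. dist x y < \<delta> \<longrightarrow> p \<in> lens r \<longrightarrow> norm (Mc p (\<Phi> p) x - Mc p (\<Phi> p) y) < \<epsilon>"
  proof (intro exI[of _ \<delta>] conjI allI impI)
    show "\<delta> > 0" using d(1) L by (simp add: \<delta>_def)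
    fix y p assume y: "dist x y < \<delta>" and p: "p \<in> lens r"
    have *: "norm (\<Phi> p (sstep b x) - \<Phi> p (sstep b y)) < \<epsilon>/2" for b
    proof (rule d(2)[OF _ p])
      have "dist x y < d b / \<Lambda>" using y db[of b] by linarith
      then have "\<Lambda> * dist x y < d b" using L by (simp add: field_simps)
      then show "dist (sstep b x) (sstep b y) < d b" using L(2)[of b x y] by linarith
    qed
    have pn: "norm p \<le> 1" "norm (1 - p) \<le> 1" using p assms(2) by (auto simp: lens_def)
    have "Mc p (\<Phi> p) x - Mc p (\<Phi> p) y = p * (\<Phi> p (sstep True x) - \<Phi> p (sstep True y)) + (1 - p) * (\<Phi> p (sstep False x) - \<Phi> p (sstep False y))"
      by (simp add: Mc_def algebra_simps)
    then have "norm (Mc p (\<Phi> p) x - Mc p (\<Phi> p) y) \<le> norm p * norm (\<Phi> p (sstep True x) - \<Phi> p (sstep True y)) + norm (1 - p) * norm (\<Phi> p (sstep False x) - \<Phi> p (sstep False y))"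
      by (metis norm_mult norm_triangle_ineq)
    also have "\<dots> \<le> 1 * norm (\<Phi> p (sstep True x) - \<Phi> p (sstep True y)) + 1 * norm (\<Phi> p (sstep False x) - \<Phi> p (sstep False y))"
      using pn by (intro add_mono mult_right_mono) auto
    also have "\<dots> < \<epsilon>" using *[of True] *[of False] by simp
    finally show "norm (Mc p (\<Phi> p) x - Mc p (\<Phi> p) y) < \<epsilon>" .
  qed
qed

lemma equicontinuous_on_lens_profile: assumes "r < 1" shows "equicontinuous_on_lens r (profile n)"
proof (induction n)
  case 0
  show ?case unfolding equicontinuous_on_lens_def
  proof (intro allI impI)
    fix x and \<epsilon> :: real assume e: "\<epsilon> > 0"
    show "\<exists>\<delta>>0. \<forall>y p. dist x y < \<delta> \<longrightarrow> p \<in> lens r \<longrightarrow> norm (profile 0 p x - profile 0 p y) < \<epsilon>"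
    proof (intro exI[of _ "\<epsilon> * gap_width"] conjI allI impI)
      fix y p assume "dist x y < \<epsilon> * gap_width"
      then have "dist x y / gap_width < \<epsilon>" using gap_width(1) by (simp add: field_simps)
      then have "\<bar>profile0 x - profile0 y\<bar> < \<epsilon>" using profile0_lipschitz[of x y] by linarith
      then show "norm (profile 0 p x - profile 0 p y) < \<epsilon>" by (simp add: profile_Suc flip: of_real_diff)
    qed (use e gap_width(1) in simp)
  qed
next
  case (Suc n)
  show ?case using equicontinuous_on_lens_Mc[OF Suc assms] by (simp add: profile_Suc)
qed

lemma equicontinuous_on_lens_Tc: assumes r: "0 \<le> r" "r < 1" shows "equicontinuous_on_lens r Tc"
  unfolding equicontinuous_on_lens_def
proof (intro allI impI)
  fix x and \<epsilon> :: real assume e: "\<epsilon> > 0"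
  have "eventually (\<lambda>n. \<forall>px\<in>lens r \<times> UNIV. dist ((\<lambda>(p, x). profile n p x) px) ((\<lambda>(p, x). Tc p x) px) < \<epsilon>/3) sequentially"
    by (rule uniform_limitD[OF profile_uniform_limit[OF r]]) (use e in simp)
  then obtain n where "\<forall>px\<in>lens r \<times> UNIV. dist ((\<lambda>(p, x). profile n p x) px) ((\<lambda>(p, x). Tc p x) px) < \<epsilon>/3"
    by (auto simp: eventually_sequentially)
  then have n: "norm (profile n p x - Tc p x) < \<epsilon>/3" if "p \<in> lens r" for p x
    using that by (auto simp: dist_norm dest: bspec[of _ _ "(p, x)"])
  have "\<epsilon>/3 > 0" using e by simp
  then obtain \<delta> where \<delta>: "\<delta> > 0" "\<And>y p. dist x y < \<delta> \<Longrightarrow> p \<in> lens r \<Longrightarrow> norm (profile n p x - profile n p y) < \<epsilon>/3"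
    using equicontinuous_on_lens_profile[OF r(2), of n] unfolding equicontinuous_on_lens_def by meson
  show "\<exists>\<delta>>0. \<forall>y p. dist x y < \<delta> \<longrightarrow> p \<in> lens r \<longrightarrow> norm (Tc p x - Tc p y) < \<epsilon>"
  proof (intro exI[of _ \<delta>] conjI allI impI \<delta>(1))
    fix y p assume y: "dist x y < \<delta>" and p: "p \<in> lens r"
    have "Tc p x - Tc p y = - (profile n p x - Tc p x) + (profile n p x - profile n p y) + (profile n p y - Tc p y)" by simp
    then have "norm (Tc p x - Tc p y) \<le> norm (profile n p x - Tc p x) + norm (profile n p x - profile n p y) + norm (profile n p y - Tc p y)"
      using norm_triangle_ineq[of "- (profile n p x - Tc p x) + (profile n p x - profile n p y)" "profile n p y - Tc p y"]
        norm_triangle_ineq[of "- (profile n p x - Tc p x)" "profile n p x - profile n p y"] norm_minus_cancel[of "profile n p x - Tc p x"] by simp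
    then show "norm (Tc p x - Tc p y) < \<epsilon>" using n[OF p, of x] n[OF p, of y] \<delta>(2)[OF y p] by linarith
  qed
qed

definition dTc :: "nat \<Rightarrow> complex \<Rightarrow> csphere \<Rightarrow> complex" where "dTc n p x = (deriv ^^ n) (\<lambda>p. Tc p x) p"

lemma dTc_0: "dTc 0 = Tc" by (simp add: dTc_def fun_eq_iff)

text \<open>The increment is split into one in the point and one in the parameter. The latter is small since \<open>dTc n\<close> is holomorphic in
the parameter; the former is a parameter derivative of \<open>Tc u x - Tc u x0\<close>, which is uniformly small on a disc of
parameters.\<close>

lemma continuous_dTc: "continuous_on (open_lens \<times> UNIV) (\<lambda>(p, x). dTc n p x)"
proof (unfold continuous_on_iff, intro ballI allI impI)
  fix px0 :: "complex \<times> csphere" and \<epsilon> :: real assume px0: "px0 \<in> open_lens \<times> UNIV" and e: "\<epsilon> > 0"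
  obtain p0 x0 where px: "px0 = (p0, x0)" "p0 \<in> open_lens" using px0 by auto
  obtain r \<rho> where r: "r < 1" "0 < r" "0 < \<rho>" "cball p0 (2 * \<rho>) \<subseteq> lens r" using lens_nbhd[OF px(2)] by metis
  \<comment> \<open>The bound that Cauchy's inequality on discs of radius \<open>\<rho>\<close> turns into \<open>\<epsilon> / 3\<close>.\<close>
  define B where "B = \<epsilon> / 3 * \<rho> ^ n / fact n"
  have B: "B > 0" using e r by (simp add: B_def)
  obtain \<delta>1 where d1: "\<delta>1 > 0" "\<And>y p. dist x0 y < \<delta>1 \<Longrightarrow> p \<in> lens r \<Longrightarrow> norm (Tc p x0 - Tc p y) < B"
    using equicontinuous_on_lens_Tc[of r] r B unfolding equicontinuous_on_lens_def by (meson less_imp_le)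
  have "continuous_on open_lens (\<lambda>p. dTc n p x0)" unfolding dTc_def
    using holomorphic_higher_deriv[OF holomorphic_Tc open_open_lens] by (rule holomorphic_on_imp_continuous_on)
  moreover have "\<epsilon>/3 > 0" using e by simp
  ultimately obtain \<delta>2 where d2: "\<delta>2 > 0" "\<And>p. p \<in> open_lens \<Longrightarrow> dist p p0 < \<delta>2 \<Longrightarrow> dist (dTc n p x0) (dTc n p0 x0) < \<epsilon>/3"
    using px(2) unfolding continuous_on_iff by meson
  define \<delta> where "\<delta> = min \<rho> (min \<delta>1 \<delta>2)"
  show "\<exists>d>0. \<forall>px'\<in>open_lens \<times> UNIV. dist px' px0 < d \<longrightarrow> dist ((\<lambda>(p, x). dTc n p x) px') ((\<lambda>(p, x). dTc n p x) px0) < \<epsilon>"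
  proof (intro exI[of _ \<delta>] conjI ballI impI)
    show "\<delta> > 0" using r d1 d2 by (simp add: \<delta>_def)
    fix px' assume px': "px' \<in> open_lens \<times> UNIV" "dist px' px0 < \<delta>"
    obtain p x where px'': "px' = (p, x)" "p \<in> open_lens" using px' by auto
    have dp: "dist p p0 < \<delta>" "dist x x0 < \<delta>"
      using px'(2) dist_fst_le[of px' px0] dist_snd_le[of px' px0] by (auto simp: px px'' intro: order_le_less_trans)
    have cb: "cball p \<rho> \<subseteq> lens r"
    proof
      fix u assume "u \<in> cball p \<rho>"
      then have "u \<in> cball p0 (2 * \<rho>)" using dp dist_triangle[of p0 u p] by (simp add: \<delta>_def dist_commute)
      then show "u \<in> lens r" using r by blast
    qed
    have cbo: "cball p \<rho> \<subseteq> open_lens" using cb lens_subset_open_lens[OF r(1)] by blast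
    have hol: "(\<lambda>u. Tc u x - Tc u x0) holomorphic_on open_lens" by (intro holomorphic_intros holomorphic_Tc)
    have "norm ((deriv ^^ n) (\<lambda>u. Tc u x - Tc u x0) p) \<le> fact n * B / \<rho> ^ n"
    proof (rule Cauchy_inequality)
      show "(\<lambda>u. Tc u x - Tc u x0) holomorphic_on ball p \<rho>" using hol cbo by (meson ball_subset_cball holomorphic_on_subset subset_trans)
      show "continuous_on (cball p \<rho>) (\<lambda>u. Tc u x - Tc u x0)" using hol cbo by (meson continuous_on_subset holomorphic_on_imp_continuous_on)
      fix u assume "norm (p - u) = \<rho>"
      then have "u \<in> lens r" using cb by (auto simp: dist_norm)
      then show "norm (Tc u x - Tc u x0) \<le> B" using d1(2)[of x u] dp by (simp add: \<delta>_def dist_commute norm_minus_commute less_imp_le)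
    qed (rule r)
    also have "\<dots> = \<epsilon> / 3" using r by (simp add: B_def)
    finally have "norm (dTc n p x - dTc n p x0) \<le> \<epsilon>/3"
      unfolding dTc_def using higher_deriv_diff[OF holomorphic_Tc holomorphic_Tc open_open_lens px''(2), of n x x0] by simp
    moreover have "dist (dTc n p x0) (dTc n p0 x0) < \<epsilon>/3" using d2(2)[OF px''(2)] dp by (simp add: \<delta>_def)
    ultimately have "dist (dTc n p x) (dTc n p0 x0) < \<epsilon>"
      using dist_triangle[of "dTc n p x" "dTc n p0 x0" "dTc n p x0"] e by (simp add: dist_norm)
    then show "dist ((\<lambda>(p, x). dTc n p x) px') ((\<lambda>(p, x). dTc n p x) px0) < \<epsilon>" by (simp add: px px'')
  qed
qed

lemma continuous_dTc_snd: assumes "p \<in> open_lens" shows "continuous_on UNIV (dTc n p)"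
proof -
  have "continuous_on UNIV ((\<lambda>(p, x). dTc n p x) \<circ> (\<lambda>x. (p, x)))"
    by (rule continuous_on_compose) (use assms in \<open>auto intro!: continuous_intros continuous_on_subset[OF continuous_dTc]\<close>)
  then show ?thesis by (simp add: o_def)
qed

text \<open>The fixed point equation of \<open>Tc\<close>, differentiated in the parameter.\<close>

lemma dTc_recursion: assumes "p \<in> open_lens"
  shows "dTc (Suc n) p x = Mc p (dTc (Suc n) p) x + of_nat (Suc n) * (dTc n p (poly_map P x) - dTc n p (poly_map Q x))"
proof -
  have "(deriv ^^ Suc n) (\<lambda>p. Tc p x) p = (deriv ^^ Suc n) (\<lambda>p. p * Tc p (poly_map P x) + (1 - p) * Tc p (poly_map Q x)) p"
  proof (rule higher_deriv_transform_within_open[OF holomorphic_Tc _ open_open_lens assms])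
    show "(\<lambda>p. p * Tc p (poly_map P x) + (1 - p) * Tc p (poly_map Q x)) holomorphic_on open_lens" by (intro holomorphic_intros holomorphic_Tc)
    show "Tc w x = w * Tc w (poly_map P x) + (1 - w) * Tc w (poly_map Q x)" if "w \<in> open_lens" for w
      using Tc_fixed[OF that, of x] by (simp add: Mc_def)
  qed
  then show ?thesis using higher_deriv_convex_combination[OF open_open_lens holomorphic_Tc holomorphic_Tc assms, of n "poly_map P x" "poly_map Q x"]
    by (simp add: dTc_def Mc_def del: funpow.simps)
qed

lemma dTc_cong: assumes "p \<in> open_lens" "\<And>u. u \<in> open_lens \<Longrightarrow> Tc u x = Tc u y" shows "dTc n p x = dTc n p y"
  unfolding dTc_def by (rule higher_deriv_transform_within_open[OF holomorphic_Tc holomorphic_Tc open_open_lens assms(1)]) (rule assms(2))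

lemma dTc_const: assumes "p \<in> open_lens" "\<And>u. u \<in> open_lens \<Longrightarrow> Tc u x = c" shows "dTc (Suc n) p x = 0"
proof -
  have "(deriv ^^ Suc n) (\<lambda>p. Tc p x) p = (deriv ^^ Suc n) (\<lambda>p. c) p"
    by (rule higher_deriv_transform_within_open[OF holomorphic_Tc _ open_open_lens assms(1)]) (use assms(2) in auto)
  then show ?thesis unfolding dTc_def by (simp only: higher_deriv_const) simp
qed

text \<open>There the boundary values of \<open>Tc\<close> are independent of the parameter.\<close>

lemma dTc_not_intermediate: assumes "p \<in> open_lens" "x \<notin> intermediate" shows "dTc (Suc n) p x = 0"
  using assms by (cases x rule: sphere_cases) (auto intro: dTc_const[where c = 0] dTc_const[where c = 1] Tc_K1 Tc_outer)

text \<open>Iterating the recursion: the remainder after \<open>N\<close> terms is the \<open>N\<close>-th image of a function supported in the intermediate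
region, to which the contraction applies.\<close>

lemma dTc_series_remainder:
  fixes n :: nat
  assumes p: "p \<in> open_lens"
  defines "g \<equiv> (\<lambda>x. of_nat (Suc n) * (dTc n p (poly_map P x) - dTc n p (poly_map Q x)))"
  shows "dTc (Suc n) p x - (\<Sum>j<N. (Mc p ^^ j) g x) = (Mc p ^^ N) (dTc (Suc n) p) x"
proof (induction N)
  case (Suc N)
  have "dTc (Suc n) p = (\<lambda>x. Mc p (dTc (Suc n) p) x + g x)" unfolding g_def using dTc_recursion[OF p] by blast
  then have "Mc p (dTc (Suc n) p) = (\<lambda>x. dTc (Suc n) p x - g x)" by (metis (no_types, lifting) add_diff_cancel_right' ext)
  then have "(Mc p ^^ Suc N) (dTc (Suc n) p) x = (Mc p ^^ N) (dTc (Suc n) p) x - (Mc p ^^ N) g x"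
    by (simp only: funpow_Suc_right o_apply Mc_pow_diff)
  then show ?case using Suc by simp
qed simp

lemma bounded_continuous_csphere:
  assumes "continuous_on UNIV (\<phi> :: csphere \<Rightarrow> complex)" obtains C where "C > 0" "\<And>x. norm (\<phi> x) \<le> C"
proof -
  have "compact (\<phi> ` UNIV)" by (rule compact_continuous_image[OF assms compact_UNIV_csphere])
  then have "bounded (range \<phi>)" by (rule compact_imp_bounded)
  then show ?thesis using that by (auto simp: bounded_pos)
qed

lemma dTc_series:
  assumes p: "p \<in> open_lens"
  shows "uniform_limit UNIV (\<lambda>N x. \<Sum>j<N. (Mc p ^^ j) (\<lambda>x. of_nat (Suc n) * (dTc n p (poly_map P x) - dTc n p (poly_map Q x))) x)
     (dTc (Suc n) p) sequentially"
proof -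
  obtain r where r: "0 < r" "r < 1" "p \<in> lens r" using open_lens_in_lens[OF p] by blast
  obtain C where C: "C > 0" "\<And>x. norm (dTc (Suc n) p x) \<le> C" using bounded_continuous_csphere[OF continuous_dTc_snd[OF p]] by metis
  have lim: "(\<lambda>N. r ^ N * C) \<longlonglongrightarrow> 0" using r tendsto_mult_left_zero[OF LIMSEQ_realpow_zero[of r], of C] by simp
  show ?thesis
  proof (rule uniform_limitI)
    fix e :: real assume "0 < e"
    then have "eventually (\<lambda>N. r ^ N * C < e) sequentially" using order_tendstoD(2)[OF lim] by simp
    then show "eventually (\<lambda>N. \<forall>x\<in>UNIV. dist (\<Sum>j<N. (Mc p ^^ j) (\<lambda>x. of_nat (Suc n) * (dTc n p (poly_map P x) - dTc n p (poly_map Q x))) x) (dTc (Suc n) p x) < e) sequentially"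
    proof eventually_elim
      case (elim N)
      show ?case
      proof
        fix x
        have "norm ((Mc p ^^ N) (dTc (Suc n) p) x) \<le> r ^ N * C"
          by (rule Mc_pow_contraction[OF r(3), THEN conjunct1]) (use C dTc_not_intermediate[OF p] in auto)
        then show "dist (\<Sum>j<N. (Mc p ^^ j) (\<lambda>x. of_nat (Suc n) * (dTc n p (poly_map P x) - dTc n p (poly_map Q x))) x) (dTc (Suc n) p x) < e"
          using elim dTc_series_remainder[OF p, of n x N] by (simp add: dist_norm norm_minus_commute)
      qed
    qed
  qed
qed

text \<open>One neighbourhood has to serve all parameters, so that parameter derivatives are locally constant as well.\<close>

lemma Tc_locally_constant:
  assumes "x \<notin> Fin ` survivors"
  shows "\<exists>V. open V \<and> x \<in> V \<and> (\<forall>u\<in>open_lens. \<forall>y\<in>V. Tc u y = Tc u x)"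
proof (rule complement_surviving_induct[of "\<lambda>x. \<exists>V. open V \<and> x \<in> V \<and> (\<forall>u\<in>open_lens. \<forall>y\<in>V. Tc u y = Tc u x)"])
  have oW: "open (- Fin ` K2)" using compact_imp_closed[OF compact_Fin_image[OF compact_K2]] by (rule open_Compl)
  have W: "- Fin ` K2 \<subseteq> outer" using interior_subset by (auto simp: outer_def)
  show "\<exists>V. open V \<and> Fin z \<in> V \<and> (\<forall>u\<in>open_lens. \<forall>y\<in>V. Tc u y = Tc u (Fin z))" if z: "z \<in> interior K1" for z
  proof (intro exI[of _ "Fin ` interior K1"] conjI)
    have "Fin ` interior K1 \<subseteq> Fin ` K1" using interior_subset by blast
    then show "\<forall>u\<in>open_lens. \<forall>y\<in>Fin ` interior K1. Tc u y = Tc u (Fin z)" using z Tc_K1 by (metis image_eqI subsetD)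
  qed (use z in \<open>auto intro: open_Fin_image\<close>)
  have out: "\<exists>V. open V \<and> x \<in> V \<and> (\<forall>u\<in>open_lens. \<forall>y\<in>V. Tc u y = Tc u x)" if x: "x \<in> - Fin ` K2" for x
  proof (intro exI[of _ "- Fin ` K2"] conjI ballI oW x)
    fix u y assume "u \<in> open_lens" "y \<in> - Fin ` K2"
    then show "Tc u y = Tc u x" using x W Tc_outer by (metis subsetD)
  qed
  show "\<exists>V. open V \<and> Fin z \<in> V \<and> (\<forall>u\<in>open_lens. \<forall>y\<in>V. Tc u y = Tc u (Fin z))" if z: "z \<notin> K2" for z
    by (rule out) (use z in auto)
  show "\<exists>V. open V \<and> Infty \<in> V \<and> (\<forall>u\<in>open_lens. \<forall>y\<in>V. Tc u y = Tc u Infty)"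
    by (rule out) auto
  show "\<exists>V. open V \<and> x \<in> V \<and> (\<forall>u\<in>open_lens. \<forall>y\<in>V. Tc u y = Tc u x)"
    if pull: "\<And>b. \<exists>V. open V \<and> sstep b x \<in> V \<and> (\<forall>u\<in>open_lens. \<forall>y\<in>V. Tc u y = Tc u (sstep b x))" for x
  proof -
    obtain V where V: "\<And>b. open (V b)" "\<And>b. sstep b x \<in> V b" "\<And>b u y. u \<in> open_lens \<Longrightarrow> y \<in> V b \<Longrightarrow> Tc u y = Tc u (sstep b x)" using pull by metis
    have o: "open (sstep b -` V b)" for b using V(1) continuous_sstep[of UNIV b] by (simp add: open_vimage)
    show ?thesis
    proof (intro exI[of _ "sstep True -` V True \<inter> sstep False -` V False"] conjI ballI)
      show "open (sstep True -` V True \<inter> sstep False -` V False)" using o by (intro open_Int)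
      show "x \<in> sstep True -` V True \<inter> sstep False -` V False" using V(2)[of True] V(2)[of False] by auto
      fix u y assume u: "u \<in> open_lens" and y: "y \<in> sstep True -` V True \<inter> sstep False -` V False"
      have "Tc u (sstep b y) = Tc u (sstep b x)" for b using V(3)[OF u, of "sstep b y" b] y by (cases b) auto
      from this[of True] this[of False] have "Mc u (Tc u) y = Mc u (Tc u) x" by (simp add: Mc_def)
      then show "Tc u y = Tc u x" using Tc_fixed[OF u] by simp
    qed
  qed
qed (rule assms)

section \<open>Absorption\<close>

text \<open>Both parts are forward invariant; orbits stay bounded in the first and escape from the second.\<close>

definition absorbing :: "csphere set" where "absorbing = Fin ` K1 \<union> nbhd_Infty Rad"

lemma sstep_absorbing: "x \<in> absorbing \<Longrightarrow> sstep b x \<in> absorbing" using sstep_K1[of x b] sstep_nbhd_Infty[of x Rad b] by (auto simp: absorbing_def)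

lemma nbhd_Infty_outer: "nbhd_Infty Rad \<subseteq> outer"
proof
  fix x assume x: "x \<in> nbhd_Infty Rad"
  show "x \<in> outer"
  proof (cases x)
    case (Fin z)
    then have "z \<notin> K2" using x fillK_norm_less[OF escape_radius_Rad(2), of z] by auto
    then show ?thesis using Fin interior_subset by (auto simp: outer_def)
  qed (auto simp: outer_def)
qed

lemma absorption_sphere: obtains N where "\<And>x. \<exists>ws. length ws = N \<and> srun ws x \<in> absorbing"
proof -
  obtain N where N: "\<And>z. \<exists>ws. length ws = N \<and> (run ws z \<in> K1 \<or> Rad < norm (run ws z))" using absorption by metis
  have "\<exists>ws. length ws = N \<and> srun ws x \<in> absorbing" for x
  proof (cases x)
    case (Fin z) then show ?thesis using N[of z] by (auto simp: absorbing_def)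
  next
    case Infty then show ?thesis by (intro exI[of _ "replicate N True"]) (auto simp: absorbing_def)
  qed
  then show ?thesis by (rule that)
qed

lemma norm_Mc_le:
  assumes q: "0 < q" "q < 1" and a: "norm (\<phi> (poly_map P x)) \<le> a" and b: "norm (\<phi> (poly_map Q x)) \<le> b"
  shows "norm (Mc (of_real q) \<phi> x) \<le> q * a + (1 - q) * b"
proof -
  have "norm (1 - complex_of_real q) = 1 - q"
  proof -
    have "1 - complex_of_real q = of_real (1 - q)" by simp
    then show ?thesis using q by (simp only: norm_of_real)
  qed
  then have "norm (Mc (of_real q) \<phi> x) \<le> q * norm (\<phi> (poly_map P x)) + (1 - q) * norm (\<phi> (poly_map Q x))"
    unfolding Mc_def using q norm_triangle_ineq[of "of_real q * \<phi> (poly_map P x)" "(1 - of_real q) * \<phi> (poly_map Q x)"] by (simp add: norm_mult)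
  also have "\<dots> \<le> q * a + (1 - q) * b" using q a b by (intro add_mono mult_left_mono) auto
  finally show ?thesis .
qed

lemma norm_Mc_pow_le:
  assumes q: "0 < q" "q < 1" and a: "\<And>x. norm (\<phi> x) \<le> a" shows "norm ((Mc (of_real q) ^^ n) \<phi> x) \<le> a"
proof (induction n arbitrary: x)
  case (Suc n)
  have "norm (Mc (of_real q) ((Mc (of_real q) ^^ n) \<phi>) x) \<le> q * a + (1 - q) * a" by (rule norm_Mc_le[OF q]) (rule Suc)+
  then show ?case by (simp add: algebra_simps)
qed (use a in simp)

text \<open>Along a word that ends in the absorbing set, the average loses at least the mass \<open>m ^ length ws\<close> of the excess \<open>C\<close>.\<close>

lemma Mc_pow_word:
  assumes q: "0 < q" "q < 1" and m: "m = min q (1 - q)" and C: "0 \<le> C"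
    and a: "\<And>x. norm (\<phi> x) \<le> \<epsilon> + C" "\<And>x. x \<in> absorbing \<Longrightarrow> norm (\<phi> x) \<le> \<epsilon>" and w: "srun ws x \<in> absorbing"
  shows "norm ((Mc (of_real q) ^^ length ws) \<phi> x) \<le> \<epsilon> + (1 - m ^ length ws) * C"
  using w
proof (induction ws arbitrary: x)
  case (Cons b ws)
  let ?M = "Mc (of_real q)" and ?n = "length ws"
  have m0: "0 < m" "m \<le> q" "m \<le> 1 - q" using q m by auto
  have ih: "norm ((?M ^^ ?n) \<phi> (sstep b x)) \<le> \<epsilon> + (1 - m ^ ?n) * C" using Cons by simp
  have all: "norm ((?M ^^ ?n) \<phi> y) \<le> \<epsilon> + C" for y by (rule norm_Mc_pow_le[OF q a(1)])
  have key: "\<epsilon> + C - t * (m ^ ?n * C) \<le> \<epsilon> + (1 - m * m ^ ?n) * C" if "m \<le> t" for t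
  proof -
    have "m * (m ^ ?n * C) \<le> t * (m ^ ?n * C)" using that m0 C by (intro mult_right_mono) auto
    then show ?thesis by (simp add: algebra_simps)
  qed
  show ?case
  proof (cases b)
    case True
    have "norm (?M ((?M ^^ ?n) \<phi>) x) \<le> q * (\<epsilon> + (1 - m ^ ?n) * C) + (1 - q) * (\<epsilon> + C)"
      by (rule norm_Mc_le[OF q]) (use ih True all in auto)
    also have "\<dots> = \<epsilon> + C - q * (m ^ ?n * C)" by (simp add: algebra_simps)
    also have "\<dots> \<le> \<epsilon> + (1 - m * m ^ ?n) * C" by (rule key[OF m0(2)])
    finally show ?thesis by simp
  next
    case False
    have "norm (?M ((?M ^^ ?n) \<phi>) x) \<le> q * (\<epsilon> + C) + (1 - q) * (\<epsilon> + (1 - m ^ ?n) * C)"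
      by (rule norm_Mc_le[OF q]) (use ih False all in auto)
    also have "\<dots> = \<epsilon> + C - (1 - q) * (m ^ ?n * C)" by (simp add: algebra_simps)
    also have "\<dots> \<le> \<epsilon> + (1 - m * m ^ ?n) * C" by (rule key[OF m0(3)])
    finally show ?thesis by simp
  qed
qed (use a in simp)

text \<open>Words of one common length lead every point into the absorbing set, so the excess over \<open>\<epsilon>\<close> shrinks by a fixed factor on the
whole sphere.\<close>

lemma Mc_pow_absorb:
  assumes q: "0 < q" "q < 1"
  obtains N \<kappa> where "0 < \<kappa>" "\<kappa> \<le> 1" "\<And>\<phi> C \<epsilon> x. 0 \<le> C \<Longrightarrow> (\<And>x. norm (\<phi> x) \<le> \<epsilon> + C) \<Longrightarrow>
    (\<And>x. x \<in> absorbing \<Longrightarrow> norm (\<phi> x) \<le> \<epsilon>) \<Longrightarrow> norm ((Mc (of_real q) ^^ N) \<phi> x) \<le> \<epsilon> + (1 - \<kappa>) * C"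
proof -
  obtain N where N: "\<And>x. \<exists>ws. length ws = N \<and> srun ws x \<in> absorbing" using absorption_sphere by metis
  define m where "m = min q (1 - q)"
  have m: "0 < m" "m \<le> 1" using q by (auto simp: m_def)
  show ?thesis
  proof (rule that[of "m ^ N" N])
    show "0 < m ^ N" "m ^ N \<le> 1" using m by (auto intro: power_le_one)
    fix \<phi> :: "csphere \<Rightarrow> complex" and C \<epsilon> x assume *: "0 \<le> C" "\<And>x. norm (\<phi> x) \<le> \<epsilon> + C" "\<And>x. x \<in> absorbing \<Longrightarrow> norm (\<phi> x) \<le> \<epsilon>"
    obtain ws where ws: "length ws = N" "srun ws x \<in> absorbing" using N by blast
    show "norm ((Mc (of_real q) ^^ N) \<phi> x) \<le> \<epsilon> + (1 - m ^ N) * C"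
      using Mc_pow_word[OF q m_def *(1,2,3) ws(2)] ws(1) by simp
  qed
qed

text \<open>A bounded fixed point that vanishes on the absorbing set shrinks at every step of \<open>Mc_pow_absorb\<close>. The difference of
\<open>T\<close> and \<open>Tc\<close> is such a fixed point, and its boundedness is known before its continuity.\<close>

lemma Mc_fixed_unique:
  assumes q: "0 < q" "q < 1" and fx: "\<And>x. Mc (of_real q) D x = D x" and bd: "\<And>x. norm (D x) \<le> C"
    and z: "\<And>x. x \<in> absorbing \<Longrightarrow> D x = 0"
  shows "D x = 0"
proof -
  have C: "0 \<le> C" using bd[of x] norm_ge_zero[of "D x"] by linarith
  have fx': "Mc (of_real q) D = D" using fx by (simp add: fun_eq_iff)
  have f: "(Mc (of_real q) ^^ n) D = D" for n by (induction n) (auto simp: fx')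
  obtain N \<kappa> where \<kappa>: "0 < \<kappa>" "\<kappa> \<le> 1" and st: "\<And>\<phi> C \<epsilon> x. 0 \<le> C \<Longrightarrow> (\<And>x. norm (\<phi> x) \<le> \<epsilon> + C) \<Longrightarrow>
    (\<And>x. x \<in> absorbing \<Longrightarrow> norm (\<phi> x) \<le> \<epsilon>) \<Longrightarrow> norm ((Mc (of_real q) ^^ N) \<phi> x) \<le> \<epsilon> + (1 - \<kappa>) * C"
    by (rule Mc_pow_absorb[OF q]) blast
  have k: "norm (D x) \<le> (1 - \<kappa>) ^ k * C" for k x
  proof (induction k arbitrary: x)
    case (Suc k)
    have "norm ((Mc (of_real q) ^^ N) D x) \<le> 0 + (1 - \<kappa>) * ((1 - \<kappa>) ^ k * C)"
      by (rule st) (use Suc z \<kappa> C in auto)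
    then show ?case by (simp add: f)
  qed (use bd in simp)
  have "(\<lambda>k. (1 - \<kappa>) ^ k * C) \<longlonglongrightarrow> 0" using \<kappa> tendsto_mult_left_zero[OF LIMSEQ_realpow_zero[of "1-\<kappa>"], of C] by simp
  then have "norm (D x) \<le> 0" by (rule LIMSEQ_le_const) (use k in auto)
  then show ?thesis by simp
qed

text \<open>Convergence to \<open>0\<close> on the absorbing set spreads to the sphere: once the function is below \<open>e/3\<close> there, absorption reduces the
rest, and later averages do not increase the bound.\<close>

lemma Mc_pow_converges:
  assumes q: "0 < q" "q < 1" and bd: "\<And>x. norm (\<eta> x) \<le> C"
    and ab: "\<And>\<epsilon>. \<epsilon> > 0 \<Longrightarrow> \<exists>n. \<forall>x\<in>absorbing. norm ((Mc (of_real q) ^^ n) \<eta> x) \<le> \<epsilon>"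
  shows "uniform_limit UNIV (\<lambda>n. (Mc (of_real q) ^^ n) \<eta>) (\<lambda>x. 0) sequentially"
proof (rule uniform_limitI)
  let ?M = "Mc (of_real q)"
  fix e :: real assume e: "0 < e"
  have C: "0 \<le> C" using bd[of Infty] norm_ge_zero[of "\<eta> Infty"] by linarith
  obtain n0 where n0: "\<And>x. x \<in> absorbing \<Longrightarrow> norm ((?M ^^ n0) \<eta> x) \<le> e/3" using ab[of "e/3"] e by auto
  have inv: "norm ((?M ^^ j) \<phi> x) \<le> \<epsilon>" if "\<And>x. x \<in> absorbing \<Longrightarrow> norm (\<phi> x) \<le> \<epsilon>" "x \<in> absorbing" for \<phi> \<epsilon> j x
    using that(2)
  proof (induction j arbitrary: x)
    case (Suc j)
    have "sstep b x \<in> absorbing" for b using sstep_absorbing Suc.prems .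
    from this[of True] this[of False] have "norm (?M ((?M ^^ j) \<phi>) x) \<le> q * \<epsilon> + (1 - q) * \<epsilon>"
      by (intro norm_Mc_le[OF q] Suc.IH) auto
    then show ?case by (simp add: algebra_simps)
  qed (use that(1) in simp)
  obtain N \<kappa> where \<kappa>: "0 < \<kappa>" "\<kappa> \<le> 1" and st: "\<And>\<phi> C \<epsilon> x. 0 \<le> C \<Longrightarrow> (\<And>x. norm (\<phi> x) \<le> \<epsilon> + C) \<Longrightarrow>
    (\<And>x. x \<in> absorbing \<Longrightarrow> norm (\<phi> x) \<le> \<epsilon>) \<Longrightarrow> norm ((?M ^^ N) \<phi> x) \<le> \<epsilon> + (1 - \<kappa>) * C"
    by (rule Mc_pow_absorb[OF q]) blast
  have ka: "norm ((?M ^^ (k * N)) ((?M ^^ n0) \<eta>) x) \<le> e/3 + (1 - \<kappa>) ^ k * C" for k x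
  proof (induction k arbitrary: x)
    case 0
    have "norm ((?M ^^ n0) \<eta> x) \<le> C" by (rule norm_Mc_pow_le[OF q bd])
    then show ?case using e by simp
  next
    case (Suc k)
    have "norm ((?M ^^ N) ((?M ^^ (k * N)) ((?M ^^ n0) \<eta>)) x) \<le> e/3 + (1 - \<kappa>) * ((1 - \<kappa>) ^ k * C)"
    proof (rule st)
      show "norm ((?M ^^ (k * N)) ((?M ^^ n0) \<eta>) y) \<le> e/3" if "y \<in> absorbing" for y
        by (rule inv[OF n0 that])
    qed (use Suc \<kappa> C in auto)
    then show ?case by (simp add: funpow_add)
  qed
  have "(\<lambda>k. (1 - \<kappa>) ^ k * C) \<longlonglongrightarrow> 0" using \<kappa> tendsto_mult_left_zero[OF LIMSEQ_realpow_zero[of "1-\<kappa>"], of C] by simp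
  then have "eventually (\<lambda>k. (1 - \<kappa>) ^ k * C < e/3) sequentially" by (rule order_tendstoD(2)) (use e in simp)
  then obtain k where k: "(1 - \<kappa>) ^ k * C < e/3" by (auto simp: eventually_sequentially)
  show "eventually (\<lambda>n. \<forall>x\<in>UNIV. dist ((?M ^^ n) \<eta> x) 0 < e) sequentially"
    unfolding eventually_sequentially
  proof (intro exI[of _ "k * N + n0"] allI impI ballI)
    fix n x assume "k * N + n0 \<le> n"
    then obtain j where j: "n = j + (k * N + n0)" by (metis add.commute le_Suc_ex)
    have "norm ((?M ^^ j) ((?M ^^ (k * N)) ((?M ^^ n0) \<eta>)) x) \<le> e/3 + (1 - \<kappa>) ^ k * C"
      by (rule norm_Mc_pow_le[OF q]) (rule ka)
    then show "dist ((?M ^^ n) \<eta> x) 0 < e" using k e by (simp add: j funpow_add)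
  qed
qed

end

section \<open>The random dynamical system\<close>

locale random_pair = poly_pair +
  fixes q :: real
  assumes q: "0 < q" "q < 1"
begin

abbreviation "h1 \<equiv> poly_map P"
abbreviation "h2 \<equiv> poly_map Q"
abbreviation "\<tau> \<equiv> tau h1 h2 q"
abbreviation "\<Gamma> \<equiv> tau_seq h1 h2 q"
abbreviation "M \<equiv> Mc (of_real q)"

text \<open>Equal maps would have equal filled Julia sets, and then \<open>K1\<close> would be open and compact. It ensures that the point measure
\<open>tau\<close> has total mass \<open>1\<close>.\<close>

lemma maps_distinct: "h1 \<noteq> h2"
proof
  assume "h1 = h2"
  then have "poly P z = poly Q z" for z by (metis csphere.inject poly_map.simps(1))
  then have "poly P = poly Q" by blast
  then have "K1 = K2" by (simp add: fillK_def)
  then have "open K1" using fillK_nested by (metis interior_subset open_interior subset_antisym)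
  then have "K1 = UNIV" using compact_imp_closed[OF compact_K1] K1_ne clopen by blast
  then show False using compact_K1 not_compact_UNIV by metis
qed

lemma prob_tau: "prob_space \<tau>"
  unfolding tau_def
proof (rule prob_space_point_measure)
  have "(\<Sum>s\<in>{h1, h2}. ennreal (q * indicator {h1} s + (1 - q) * indicator {h2} s)) = ennreal q + ennreal (1 - q)"
    using maps_distinct by (simp add: indicator_def)
  also have "\<dots> = 1" using q by (simp flip: ennreal_plus)
  finally show "(\<Sum>s\<in>{h1, h2}. ennreal (q * indicator {h1} s + (1 - q) * indicator {h2} s)) = 1" .
qed auto

lemma space_tau: "space \<tau> = {h1, h2}" by (simp add: tau_def space_point_measure)
lemma sets_tau: "sets \<tau> = Pow {h1, h2}" by (simp add: tau_def sets_point_measure)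

sublocale tauP: prob_space \<tau> by (rule prob_tau)
sublocale S: sequence_space \<tau> ..

lemma Gamma_eq: "\<Gamma> = S.S" by (simp add: tau_seq_def)

sublocale G: prob_space \<Gamma> unfolding Gamma_eq by (rule S.prob_space_axioms)

lemma space_Gamma: "\<gamma> \<in> space \<Gamma> \<longleftrightarrow> (\<forall>n. \<gamma> n \<in> {h1, h2})"
  by (simp add: tau_seq_def space_PiM space_tau PiE_iff Pi_iff)

lemma integral_tau: fixes f :: "_ \<Rightarrow> 'b::{banach, second_countable_topology}" shows "(\<integral>s. f s \<partial>\<tau>) = q *\<^sub>R f h1 + (1 - q) *\<^sub>R f h2"
proof -
  have "(\<integral>s. f s \<partial>\<tau>) = (\<integral>s. (q * indicator {h1} s + (1 - q) * indicator {h2} s) *\<^sub>R f s \<partial>count_space {h1, h2})"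
    unfolding tau_def point_measure_def
    by (rule integral_density) (use q in \<open>auto intro!: AE_I2\<close>)
  also have "\<dots> = q *\<^sub>R f h1 + (1 - q) *\<^sub>R f h2" using maps_distinct by (simp add: lebesgue_integral_count_space_finite)
  finally show ?thesis .
qed

lemma measurable_case_nat: assumes "s \<in> {h1, h2}" shows "(\<lambda>\<omega>. case_nat s \<omega>) \<in> measurable \<Gamma> \<Gamma>"
  unfolding tau_seq_def
  by (rule measurable_case_nat'[of "\<lambda>_. s" _ \<tau> "\<lambda>\<omega>. \<omega>", simplified]) (use assms in \<open>auto simp: space_tau\<close>)

text \<open>Conditioning on the first letter.\<close>

lemma integral_split:
  fixes F :: "(nat \<Rightarrow> csphere \<Rightarrow> csphere) \<Rightarrow> 'b::{banach, second_countable_topology}"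
  assumes F: "F \<in> borel_measurable \<Gamma>" and bd: "\<And>\<gamma>. \<gamma> \<in> space \<Gamma> \<Longrightarrow> norm (F \<gamma>) \<le> C"
  shows "(\<integral>\<gamma>. F \<gamma> \<partial>\<Gamma>) = q *\<^sub>R (\<integral>\<omega>. F (case_nat h1 \<omega>) \<partial>\<Gamma>) + (1 - q) *\<^sub>R (\<integral>\<omega>. F (case_nat h2 \<omega>) \<partial>\<Gamma>)"
proof -
  interpret PS: pair_prob_space \<tau> \<Gamma> ..
  have cm: "(\<lambda>(s, \<omega>). case_nat s \<omega>) \<in> measurable (\<tau> \<Otimes>\<^sub>M \<Gamma>) \<Gamma>" unfolding Gamma_eq by measurable
  have Fm: "(\<lambda>x. F ((\<lambda>(s, \<omega>). case_nat s \<omega>) x)) \<in> borel_measurable (\<tau> \<Otimes>\<^sub>M \<Gamma>)" by (rule measurable_compose[OF cm F])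
  have int: "integrable (\<tau> \<Otimes>\<^sub>M \<Gamma>) (\<lambda>x. F ((\<lambda>(s, \<omega>). case_nat s \<omega>) x))"
  proof (rule PS.integrable_const_bound[where B = C])
    show "AE x in \<tau> \<Otimes>\<^sub>M \<Gamma>. norm (F ((\<lambda>(s, \<omega>). case_nat s \<omega>) x)) \<le> C"
      by (rule AE_I2) (rule bd, rule measurable_space[OF cm])
  qed (rule Fm)
  have "(\<integral>\<gamma>. F \<gamma> \<partial>\<Gamma>) = (\<integral>\<gamma>. F \<gamma> \<partial>distr (\<tau> \<Otimes>\<^sub>M \<Gamma>) \<Gamma> (\<lambda>(s, \<omega>). case_nat s \<omega>))"
    unfolding Gamma_eq S.PiM_iter ..
  also have "\<dots> = (\<integral>x. F ((\<lambda>(s, \<omega>). case_nat s \<omega>) x) \<partial>(\<tau> \<Otimes>\<^sub>M \<Gamma>))" by (rule integral_distr[OF cm F])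
  also have "\<dots> = (\<integral>s. (\<integral>\<omega>. F (case_nat s \<omega>) \<partial>\<Gamma>) \<partial>\<tau>)" using PS.integral_fst'[OF int] by simp
  also have "\<dots> = q *\<^sub>R (\<integral>\<omega>. F (case_nat h1 \<omega>) \<partial>\<Gamma>) + (1 - q) *\<^sub>R (\<integral>\<omega>. F (case_nat h2 \<omega>) \<partial>\<Gamma>)" by (rule integral_tau)
  finally show ?thesis .
qed

lemma measure_split:
  assumes A: "{\<gamma> \<in> space \<Gamma>. R \<gamma>} \<in> sets \<Gamma>"
  shows "measure \<Gamma> {\<gamma> \<in> space \<Gamma>. R \<gamma>} = q * measure \<Gamma> {\<omega> \<in> space \<Gamma>. R (case_nat h1 \<omega>)} + (1 - q) * measure \<Gamma> {\<omega> \<in> space \<Gamma>. R (case_nat h2 \<omega>)}"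
proof -
  let ?A = "{\<gamma> \<in> space \<Gamma>. R \<gamma>}"
  have m: "(\<integral>\<omega>. indicator ?A (case_nat s \<omega>) \<partial>\<Gamma>) = measure \<Gamma> {\<omega> \<in> space \<Gamma>. R (case_nat s \<omega>)}" if s: "s \<in> {h1, h2}" for s
  proof -
    note cm = measurable_case_nat[OF s]
    have eq: "case_nat s -` ?A \<inter> space \<Gamma> = {\<omega> \<in> space \<Gamma>. R (case_nat s \<omega>)}" using measurable_space[OF cm] by auto
    have "(\<integral>\<omega>. indicator ?A (case_nat s \<omega>) \<partial>\<Gamma>) = (\<integral>\<omega>. indicator {\<omega> \<in> space \<Gamma>. R (case_nat s \<omega>)} \<omega> \<partial>\<Gamma>)"
      by (rule Bochner_Integration.integral_cong) (use measurable_space[OF cm] in \<open>auto simp: indicator_def\<close>)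
    also have "\<dots> = measure \<Gamma> {\<omega> \<in> space \<Gamma>. R (case_nat s \<omega>)}"
      using measurable_sets[OF cm A] unfolding eq by (simp add: Int_absorb1)
    finally show ?thesis .
  qed
  have "measure \<Gamma> ?A = (\<integral>\<gamma>. indicator ?A \<gamma> \<partial>\<Gamma>)" using A by simp
  also have "\<dots> = q *\<^sub>R (\<integral>\<omega>. indicator ?A (case_nat h1 \<omega>) \<partial>\<Gamma>) + (1 - q) *\<^sub>R (\<integral>\<omega>. indicator ?A (case_nat h2 \<omega>) \<partial>\<Gamma>)"
    by (rule integral_split[where C = 1]) (use A in \<open>auto simp: indicator_def\<close>)
  finally show ?thesis using m by simp
qed

lemma measurable_coord: "(\<lambda>\<gamma>. \<gamma> n) \<in> measurable \<Gamma> (count_space {h1, h2})"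
proof -
  have "(\<lambda>\<gamma>. \<gamma> n) \<in> measurable \<Gamma> \<tau>" unfolding tau_seq_def by (rule measurable_component_singleton) simp
  moreover have "sets \<tau> = sets (count_space {h1, h2})" by (simp add: sets_tau)
  ultimately show ?thesis using measurable_cong_sets by blast
qed

lemma sets_coord: "{\<gamma> \<in> space \<Gamma>. \<gamma> n = s} \<in> sets \<Gamma>"
proof (cases "s \<in> {h1, h2}")
  case True
  have "{\<gamma> \<in> space \<Gamma>. \<gamma> n = s} = (\<lambda>\<gamma>. \<gamma> n) -` {s} \<inter> space \<Gamma>" by auto
  then show ?thesis using measurable_sets[OF measurable_coord, of "{s}" n] True by simp
next
  case False
  then have "{\<gamma> \<in> space \<Gamma>. \<gamma> n = s} = {}" by (auto simp: space_Gamma)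
  then show ?thesis by (simp only: sets.empty_sets)
qed

text \<open>The letters of \<open>\<gamma>\<close> from position \<open>m\<close> up to, but excluding, position \<open>n\<close>.\<close>

definition word :: "(nat \<Rightarrow> csphere \<Rightarrow> csphere) \<Rightarrow> nat \<Rightarrow> nat \<Rightarrow> bool list" where
  "word \<gamma> m n = map (\<lambda>k. \<gamma> k = h1) [m..<n]"

lemma word_Suc: "word \<gamma> 0 (Suc n) = word \<gamma> 0 n @ [\<gamma> n = h1]" by (simp add: word_def)

text \<open>All events used below depend on finitely many letters or are countable combinations of such events; a word takes
finitely many values, so every function of it is measurable.\<close>

lemma measurable_word': "(\<lambda>\<gamma>. word \<gamma> 0 n) \<in> measurable \<Gamma> (count_space UNIV)"
proof (induction n)
  case 0
  show ?case by (simp add: word_def)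
next
  case (Suc n)
  show ?case
  proof (rule measurableI)
    fix A :: "bool list set"
    have a: "{\<gamma> \<in> space \<Gamma>. word \<gamma> 0 n \<in> X} \<in> sets \<Gamma>" for X
    proof -
      have "{\<gamma> \<in> space \<Gamma>. word \<gamma> 0 n \<in> X} = (\<lambda>\<gamma>. word \<gamma> 0 n) -` X \<inter> space \<Gamma>" by auto
      then show ?thesis using measurable_sets[OF Suc.IH, of X] by simp
    qed
    have "(\<lambda>\<gamma>. word \<gamma> 0 (Suc n)) -` A \<inter> space \<Gamma> =
      ({\<gamma> \<in> space \<Gamma>. word \<gamma> 0 n \<in> {w. w @ [True] \<in> A}} \<inter> {\<gamma> \<in> space \<Gamma>. \<gamma> n = h1}) \<union>
      ({\<gamma> \<in> space \<Gamma>. word \<gamma> 0 n \<in> {w. w @ [False] \<in> A}} - {\<gamma> \<in> space \<Gamma>. \<gamma> n = h1})"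
    proof (rule set_eqI)
      fix \<gamma>
      show "\<gamma> \<in> (\<lambda>\<gamma>. word \<gamma> 0 (Suc n)) -` A \<inter> space \<Gamma> \<longleftrightarrow> \<gamma> \<in>
        ({\<gamma> \<in> space \<Gamma>. word \<gamma> 0 n \<in> {w. w @ [True] \<in> A}} \<inter> {\<gamma> \<in> space \<Gamma>. \<gamma> n = h1}) \<union>
        ({\<gamma> \<in> space \<Gamma>. word \<gamma> 0 n \<in> {w. w @ [False] \<in> A}} - {\<gamma> \<in> space \<Gamma>. \<gamma> n = h1})"
        by (cases "\<gamma> n = h1") (auto simp: word_Suc)
    qed
    also have "\<dots> \<in> sets \<Gamma>" by (intro sets.Un sets.Int sets.Diff a sets_coord)
    finally show "(\<lambda>\<gamma>. word \<gamma> 0 (Suc n)) -` A \<inter> space \<Gamma> \<in> sets \<Gamma>" .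
  qed simp
qed

lemma sets_word: "{\<gamma> \<in> space \<Gamma>. R (word \<gamma> 0 n)} \<in> sets \<Gamma>"
proof -
  have "{\<gamma> \<in> space \<Gamma>. R (word \<gamma> 0 n)} = (\<lambda>\<gamma>. word \<gamma> 0 n) -` {w. R w} \<inter> space \<Gamma>" by auto
  then show ?thesis using measurable_sets[OF measurable_word', of "{w. R w}" n] by simp
qed

lemma random_orbit_word: "\<gamma> \<in> space \<Gamma> \<Longrightarrow> random_orbit \<gamma> z n = srun (word \<gamma> 0 n) z"
proof (induction n)
  case 0 then show ?case by (simp add: word_def)
next
  case (Suc n)
  have "\<gamma> n = sstep (\<gamma> n = h1)" using Suc.prems by (auto simp: space_Gamma sstep_def)
  then show ?case using Suc by (simp add: word_Suc)
qed

lemma word_case_nat: "word (case_nat s \<omega>) 0 (Suc n) = (s = h1) # word \<omega> 0 n"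
proof -
  have "[0..<Suc n] = 0 # map Suc [0..<n]" by (simp add: map_Suc_upt upt_conv_Cons)
  then show ?thesis by (simp add: word_def o_def)
qed

lemma borel_word: fixes f :: "bool list \<Rightarrow> 'b::topological_space" shows "(\<lambda>\<gamma>. f (word \<gamma> 0 n)) \<in> borel_measurable \<Gamma>"
  by (rule measurable_compose[OF measurable_word']) simp

text \<open>Powers of the transition operator are averages over forward orbits.\<close>

lemma expectation_forward:
  assumes bd: "\<And>x. norm (\<phi> x) \<le> C"
  shows "(\<integral>\<gamma>. \<phi> (srun (word \<gamma> 0 n) z) \<partial>\<Gamma>) = (M ^^ n) \<phi> z"
proof (induction n arbitrary: z)
  case 0
  then show ?case by (simp add: word_def G.prob_space)
next
  case (Suc n)
  have "(\<integral>\<gamma>. \<phi> (srun (word \<gamma> 0 (Suc n)) z) \<partial>\<Gamma>) = q *\<^sub>R (\<integral>\<omega>. \<phi> (srun (word (case_nat h1 \<omega>) 0 (Suc n)) z) \<partial>\<Gamma>)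
    + (1 - q) *\<^sub>R (\<integral>\<omega>. \<phi> (srun (word (case_nat h2 \<omega>) 0 (Suc n)) z) \<partial>\<Gamma>)"
    by (rule integral_split[OF borel_word]) (rule bd)
  also have "\<dots> = q *\<^sub>R (M ^^ n) \<phi> (h1 z) + (1 - q) *\<^sub>R (M ^^ n) \<phi> (h2 z)"
    using Suc maps_distinct unfolding word_case_nat by (simp add: sstep_def)
  finally show ?case by (simp add: Mc_def[of _ "(M ^^ n) \<phi>"] scaleR_conv_of_real)
qed

text \<open>Since the letters are independent and identically distributed, the reversed word has the same law. Reversed words
converge pointwise on \<open>K1\<close>, which forward words do not.\<close>

lemma expectation_backward:
  assumes bd: "\<And>x. norm (\<phi> x) \<le> C"
  shows "(\<integral>\<gamma>. \<phi> (srun (rev (word \<gamma> 0 n)) z) \<partial>\<Gamma>) = (M ^^ n) \<phi> z"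
  using bd
proof (induction n arbitrary: \<phi>)
  case 0
  then show ?case by (simp add: word_def G.prob_space)
next
  case (Suc n)
  have i: "integrable \<Gamma> (\<lambda>\<omega>. \<phi> (s (srun (rev (word \<omega> 0 n)) z)))" for s
    by (rule G.integrable_const_bound[where B = C]) (use Suc.prems in \<open>auto intro: borel_word\<close>)
  have "(\<integral>\<gamma>. \<phi> (srun (rev (word \<gamma> 0 (Suc n))) z) \<partial>\<Gamma>) = q *\<^sub>R (\<integral>\<omega>. \<phi> (srun (rev (word (case_nat h1 \<omega>) 0 (Suc n))) z) \<partial>\<Gamma>)
    + (1 - q) *\<^sub>R (\<integral>\<omega>. \<phi> (srun (rev (word (case_nat h2 \<omega>) 0 (Suc n))) z) \<partial>\<Gamma>)"
    by (rule integral_split[OF borel_word]) (rule Suc.prems)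
  also have "\<dots> = q *\<^sub>R (\<integral>\<omega>. \<phi> (h1 (srun (rev (word \<omega> 0 n)) z)) \<partial>\<Gamma>) + (1 - q) *\<^sub>R (\<integral>\<omega>. \<phi> (h2 (srun (rev (word \<omega> 0 n)) z)) \<partial>\<Gamma>)"
    using maps_distinct unfolding word_case_nat by (simp add: sstep_def)
  also have "\<dots> = (\<integral>\<omega>. of_real q * \<phi> (h1 (srun (rev (word \<omega> 0 n)) z)) \<partial>\<Gamma>) + (\<integral>\<omega>. (1 - of_real q) * \<phi> (h2 (srun (rev (word \<omega> 0 n)) z)) \<partial>\<Gamma>)"
    by (simp add: scaleR_conv_of_real)
  also have "\<dots> = (\<integral>\<omega>. M \<phi> (srun (rev (word \<omega> 0 n)) z) \<partial>\<Gamma>)"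
    unfolding Mc_def by (rule Bochner_Integration.integral_add[symmetric]) (intro integrable_mult_right i)+
  also have "\<dots> = (M ^^ n) (M \<phi>) z" by (rule Suc.IH) (rule norm_Mc_pow_le[OF q Suc.prems, of 1, simplified])
  finally show ?case by (simp add: funpow_swap1)
qed

section \<open>The escape probability\<close>

lemma srun_growth: "x \<in> nbhd_Infty R \<Longrightarrow> Rad \<le> R \<Longrightarrow> srun ws x \<in> nbhd_Infty (2 ^ length ws * R)"
proof (induction ws arbitrary: x R)
  case (Cons b ws)
  have "sstep b x \<in> nbhd_Infty (2 * R)"
  proof (cases x)
    case (Fin z)
    then have "R < norm z" using Cons.prems by simp
    then have "2 * R < norm (step b z)" using step_large[of z b] Cons.prems by simp
    then show ?thesis using Fin by simp
  qed simp
  then have "srun ws (sstep b x) \<in> nbhd_Infty (2 ^ length ws * (2 * R))" by (rule Cons.IH) (use Cons.prems Rad_ge1 in simp)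
  then show ?case by (simp add: mult.assoc mult.left_commute)
qed simp

lemma word_append: "m \<le> n \<Longrightarrow> word \<gamma> 0 n = word \<gamma> 0 m @ word \<gamma> m n"
  unfolding word_def using upt_add_eq_append[of 0 m "n - m"] by (metis le_add_diff_inverse le0 map_append)

lemma length_word: "length (word \<gamma> m n) = n - m" by (simp add: word_def)

text \<open>Beyond the escape radius every letter doubles the modulus.\<close>

lemma escapes_iff: assumes "\<gamma> \<in> space \<Gamma>"
  shows "(random_orbit \<gamma> z \<longlonglongrightarrow> Infty) \<longleftrightarrow> (\<exists>n. srun (word \<gamma> 0 n) z \<in> nbhd_Infty Rad)"
proof
  assume "random_orbit \<gamma> z \<longlonglongrightarrow> Infty"
  then have "eventually (\<lambda>n. random_orbit \<gamma> z n \<in> nbhd_Infty Rad) sequentially" by (simp add: tendsto_Infty_iff)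
  then show "\<exists>n. srun (word \<gamma> 0 n) z \<in> nbhd_Infty Rad" using random_orbit_word[OF assms] by (auto simp: eventually_sequentially)
next
  assume "\<exists>n. srun (word \<gamma> 0 n) z \<in> nbhd_Infty Rad"
  then obtain n where n: "srun (word \<gamma> 0 n) z \<in> nbhd_Infty Rad" by blast
  show "random_orbit \<gamma> z \<longlonglongrightarrow> Infty" unfolding tendsto_Infty_iff
  proof
    fix R :: real
    obtain k where k: "R < 2 ^ k" using real_arch_pow[of 2 R] by auto
    show "eventually (\<lambda>n. random_orbit \<gamma> z n \<in> nbhd_Infty R) sequentially"
      unfolding eventually_sequentially
    proof (intro exI[of _ "n + k"] allI impI)
      fix m assume m: "n + k \<le> m"
      have "srun (word \<gamma> n m) (srun (word \<gamma> 0 n) z) \<in> nbhd_Infty (2 ^ (m - n) * Rad)"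
        using srun_growth[OF n, of "word \<gamma> n m"] by (simp add: length_word)
      moreover have "R \<le> 2 ^ (m - n) * Rad"
      proof -
        have "(2::real) ^ k \<le> 2 ^ (m - n)" using m by (intro power_increasing) auto
        then have "R \<le> 2 ^ (m - n) * 1" using k by linarith
        also have "\<dots> \<le> 2 ^ (m - n) * Rad" using Rad_ge1 by (intro mult_left_mono) auto
        finally show ?thesis .
      qed
      ultimately show "random_orbit \<gamma> z m \<in> nbhd_Infty R"
        using m by (auto simp: random_orbit_word[OF assms] word_append[of n m] nbhd_Infty_def)
    qed
  qed
qed

lemma escape_set_eq: "{\<gamma> \<in> space \<Gamma>. random_orbit \<gamma> z \<longlonglongrightarrow> Infty} = {\<gamma> \<in> space \<Gamma>. \<exists>n. srun (word \<gamma> 0 n) z \<in> nbhd_Infty Rad}"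
  using escapes_iff by auto

lemma escape_set: "{\<gamma> \<in> space \<Gamma>. random_orbit \<gamma> z \<longlonglongrightarrow> Infty} \<in> sets \<Gamma>"
proof -
  have "{\<gamma> \<in> space \<Gamma>. \<exists>n. srun (word \<gamma> 0 n) z \<in> nbhd_Infty Rad} = (\<Union>n. {\<gamma> \<in> space \<Gamma>. srun (word \<gamma> 0 n) z \<in> nbhd_Infty Rad})" by auto
  then show ?thesis unfolding escape_set_eq using sets_word by auto
qed

lemma random_orbit_case_nat: "random_orbit (case_nat s \<omega>) z (Suc n) = random_orbit \<omega> (s z) n"
  by (induction n) auto

lemma T_fixed: "T h1 h2 q z = q * T h1 h2 q (h1 z) + (1 - q) * T h1 h2 q (h2 z)"
proof -
  have "(random_orbit (case_nat s \<omega>) z \<longlonglongrightarrow> Infty) \<longleftrightarrow> (random_orbit \<omega> (s z) \<longlonglongrightarrow> Infty)" for s \<omega>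
    using filterlim_sequentially_Suc[of "random_orbit (case_nat s \<omega>) z" "nhds Infty"] by (simp only: random_orbit_case_nat)
  then show ?thesis unfolding T_def by (subst measure_split[OF escape_set]) simp
qed

lemma T_K1: assumes "z \<in> Fin ` K1" shows "T h1 h2 q z = 0"
proof -
  have "srun ws z \<notin> nbhd_Infty Rad" for ws
    using srun_K1[OF assms, of ws] fillK_norm_less[OF escape_radius_Rad(1)] by (force simp: nbhd_Infty_def)
  then show ?thesis unfolding T_def escape_set_eq by simp
qed

lemma T_nbhd_Infty: assumes "z \<in> nbhd_Infty Rad" shows "T h1 h2 q z = 1"
proof -
  have "srun (word \<gamma> 0 0) z \<in> nbhd_Infty Rad" for \<gamma> using assms by (simp add: word_def)
  then have "{\<gamma> \<in> space \<Gamma>. \<exists>n. srun (word \<gamma> 0 n) z \<in> nbhd_Infty Rad} = space \<Gamma>" by blast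
  then show ?thesis unfolding T_def escape_set_eq by (simp add: G.prob_space)
qed

lemma T_bounds: "0 \<le> T h1 h2 q z" "T h1 h2 q z \<le> 1" unfolding T_def by auto

lemma q_open_lens: "complex_of_real q \<in> open_lens" using q by (intro of_real_open_lens) auto

lemma continuous_Tc: "continuous_on UNIV (Tc (of_real q))" using continuous_dTc_snd[OF q_open_lens, of 0] by (simp add: dTc_0)

text \<open>Both are bounded solutions of the same functional equation, with the same values on the absorbing set.\<close>

lemma T_eq_Tc: "complex_of_real (T h1 h2 q z) = Tc (of_real q) z"
proof -
  obtain C where C: "C > 0" "\<And>x. norm (Tc (of_real q) x) \<le> C" using bounded_continuous_csphere[OF continuous_Tc] by metis
  have "of_real (T h1 h2 q z) - Tc (of_real q) z = 0"
  proof (rule Mc_fixed_unique[OF q, of "\<lambda>z. of_real (T h1 h2 q z) - Tc (of_real q) z" "1 + C"])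
    fix x
    have "complex_of_real (T h1 h2 q x) = of_real q * of_real (T h1 h2 q (h1 x)) + (1 - of_real q) * of_real (T h1 h2 q (h2 x))"
      by (subst T_fixed) simp
    then have "M (\<lambda>z. complex_of_real (T h1 h2 q z)) x = of_real (T h1 h2 q x)" by (simp add: Mc_def)
    then show "M (\<lambda>z. of_real (T h1 h2 q z) - Tc (of_real q) z) x = of_real (T h1 h2 q x) - Tc (of_real q) x"
      by (simp add: Mc_diff Tc_fixed[OF q_open_lens])
    have "norm (complex_of_real (T h1 h2 q x)) \<le> 1" using T_bounds[of x] by simp
    then show "norm (of_real (T h1 h2 q x) - Tc (of_real q) x) \<le> 1 + C"
      using C(2)[of x] norm_triangle_ineq4[of "complex_of_real (T h1 h2 q x)" "Tc (of_real q) x"] by linarith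
    show "of_real (T h1 h2 q x) - Tc (of_real q) x = 0" if "x \<in> absorbing"
      using that nbhd_Infty_outer T_K1[of x] T_nbhd_Infty[of x] Tc_K1[OF q_open_lens, of x] Tc_outer[OF q_open_lens, of x]
      by (auto simp: absorbing_def)
  qed
  then show ?thesis by simp
qed

lemma T_outer: "z \<in> outer \<Longrightarrow> T h1 h2 q z = 1"
  using T_eq_Tc[of z] Tc_outer[OF q_open_lens] by (metis of_real_eq_1_iff)

section \<open>Almost sure behaviour\<close>

definition infinitely_often_Q :: "(nat \<Rightarrow> csphere \<Rightarrow> csphere) \<Rightarrow> bool" where "infinitely_often_Q \<gamma> \<longleftrightarrow> (\<forall>N. \<exists>n\<ge>N. \<gamma> n \<noteq> h1)"

lemma sets_infinitely_often_Q: "{\<gamma> \<in> space \<Gamma>. infinitely_often_Q \<gamma>} \<in> sets \<Gamma>"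
proof -
  have "{\<gamma> \<in> space \<Gamma>. infinitely_often_Q \<gamma>} = (\<Inter>N. \<Union>n\<in>{N..}. space \<Gamma> - {\<gamma> \<in> space \<Gamma>. \<gamma> n = h1})" unfolding infinitely_often_Q_def by auto
  also have "\<dots> \<in> sets \<Gamma>" using sets_coord by (intro sets.countable_INT sets.countable_UN') auto
  finally show ?thesis .
qed

lemma sets_tail: "{\<gamma> \<in> space \<Gamma>. \<forall>n\<ge>N. \<gamma> n = h1} \<in> sets \<Gamma>"
proof -
  have "{\<gamma> \<in> space \<Gamma>. \<forall>n\<ge>N. \<gamma> n = h1} = space \<Gamma> \<inter> (\<Inter>n\<in>{N..}. {\<gamma> \<in> space \<Gamma>. \<gamma> n = h1})" by auto
  also have "\<dots> \<in> sets \<Gamma>" using sets_coord by (intro sets.Int sets.top sets.countable_INT') auto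
  finally show ?thesis .
qed

text \<open>The first letter does not affect whether the tail is constantly \<open>h1\<close>, so the probability is independent of \<open>N\<close>; for \<open>N = 0\<close>
it equals \<open>q\<close> times itself.\<close>

lemma measure_tail: "measure \<Gamma> {\<gamma> \<in> space \<Gamma>. \<forall>n\<ge>N. \<gamma> n = h1} = 0"
proof (induction N)
  case 0
  have all: "(\<forall>n\<ge>0. case_nat s \<omega> n = h1) \<longleftrightarrow> s = h1 \<and> (\<forall>n\<ge>0. \<omega> n = h1)" for s \<omega>
    by (auto split: nat.splits)
  let ?u = "measure \<Gamma> {\<gamma> \<in> space \<Gamma>. \<forall>n\<ge>0. \<gamma> n = h1}"
  have "?u = q * ?u + (1 - q) * 0"
    by (subst measure_split[OF sets_tail], subst all, subst all) (use maps_distinct in simp)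
  then have "(1 - q) * ?u = 0" by (simp add: algebra_simps)
  then show ?case using q by simp
next
  case (Suc N)
  have all: "(\<forall>n\<ge>Suc N. case_nat s \<omega> n = h1) \<longleftrightarrow> (\<forall>n\<ge>N. \<omega> n = h1)" for s \<omega>
  proof
    assume "\<forall>n\<ge>Suc N. case_nat s \<omega> n = h1"
    then show "\<forall>n\<ge>N. \<omega> n = h1" by (metis Suc_le_mono old.nat.simps(5))
  qed (auto split: nat.splits)
  have eq: "{\<omega> \<in> space \<Gamma>. \<forall>n\<ge>Suc N. case_nat s \<omega> n = h1} = {\<omega> \<in> space \<Gamma>. \<forall>n\<ge>N. \<omega> n = h1}" for s using all by simp
  show ?case using measure_split[OF sets_tail[of "Suc N"]] Suc by (simp only: eq mult_zero_right add_0)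
qed

lemma AE_infinitely_often_Q: "AE \<gamma> in \<Gamma>. infinitely_often_Q \<gamma>"
proof -
  have "AE \<gamma> in \<Gamma>. \<not> (\<forall>n\<ge>N. \<gamma> n = h1)" for N
  proof (rule AE_I[where N = "{\<gamma> \<in> space \<Gamma>. \<forall>n\<ge>N. \<gamma> n = h1}"])
    show "emeasure \<Gamma> {\<gamma> \<in> space \<Gamma>. \<forall>n\<ge>N. \<gamma> n = h1} = 0" using measure_tail by (simp add: G.emeasure_eq_measure)
    show "{\<gamma> \<in> space \<Gamma>. \<forall>n\<ge>N. \<gamma> n = h1} \<in> sets \<Gamma>" by (rule sets_tail)
  qed blast
  then have "AE \<gamma> in \<Gamma>. \<forall>N. \<not> (\<forall>n\<ge>N. \<gamma> n = h1)" by (simp add: AE_all_countable)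
  then show ?thesis by (simp add: infinitely_often_Q_def)
qed

text \<open>The probability of not being absorbed by time \<open>n\<close> is the \<open>n\<close>-th image of the indicator of the complement of the absorbing
set.\<close>

lemma AE_absorbed: "AE \<gamma> in \<Gamma>. \<exists>n. srun (word \<gamma> 0 n) z \<in> absorbing"
proof -
  define ch :: "csphere \<Rightarrow> complex" where "ch = indicator (- absorbing)"
  have bd: "norm (ch x) \<le> 1" for x by (simp add: ch_def indicator_def)
  have "uniform_limit UNIV (\<lambda>n. (M ^^ n) ch) (\<lambda>x. 0) sequentially"
    by (rule Mc_pow_converges[OF q bd]) (rule exI[of _ 0], auto simp: ch_def)
  then have lim: "(\<lambda>n. (M ^^ n) ch z) \<longlonglongrightarrow> 0" by (rule tendsto_uniform_limitI) simp
  let ?A = "\<lambda>n. {\<gamma> \<in> space \<Gamma>. srun (word \<gamma> 0 n) z \<notin> absorbing}"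
  have meas: "complex_of_real (measure \<Gamma> (?A n)) = (M ^^ n) ch z" for n
  proof -
    have "(\<integral>\<gamma>. ch (srun (word \<gamma> 0 n) z) \<partial>\<Gamma>) = (\<integral>\<gamma>. complex_of_real (indicator (?A n) \<gamma>) \<partial>\<Gamma>)"
      by (rule Bochner_Integration.integral_cong) (auto simp: ch_def indicator_def)
    also have "\<dots> = complex_of_real (measure \<Gamma> (?A n))"
      using sets_word[of "\<lambda>w. srun w z \<notin> absorbing" n] by (simp add: integral_complex_of_real Int_absorb1)
    finally show ?thesis using expectation_forward[of ch 1 n z, OF bd] by simp
  qed
  let ?B = "{\<gamma> \<in> space \<Gamma>. \<forall>n. srun (word \<gamma> 0 n) z \<notin> absorbing}"
  have "?B = space \<Gamma> \<inter> (\<Inter>n. ?A n)" by auto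
  then have B: "?B \<in> sets \<Gamma>" using sets_word by auto
  have "norm (complex_of_real (measure \<Gamma> ?B)) \<le> norm ((M ^^ n) ch z)" for n
  proof -
    have "measure \<Gamma> ?B \<le> measure \<Gamma> (?A n)" by (rule G.finite_measure_mono) (use sets_word in auto)
    then show ?thesis unfolding meas[symmetric] by simp
  qed
  then have "norm (complex_of_real (measure \<Gamma> ?B)) \<le> norm (0::complex)"
    using LIMSEQ_le_const[OF tendsto_norm[OF lim]] by blast
  then have "measure \<Gamma> ?B = 0" using measure_nonneg[of \<Gamma> ?B] by simp
  then have e: "emeasure \<Gamma> ?B = 0" by (simp add: G.emeasure_eq_measure)
  show ?thesis by (rule AE_I[OF _ e B]) auto
qed

lemma Q_count_word_tendsto: assumes "infinitely_often_Q \<gamma>" shows "filterlim (\<lambda>n. Q_count (word \<gamma> m n)) at_top sequentially"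
proof -
  have mono: "Q_count (word \<gamma> m n) \<le> Q_count (word \<gamma> m n')" if "n \<le> n'" "m \<le> n" for n n'
  proof -
    have "word \<gamma> m n' = word \<gamma> m n @ word \<gamma> n n'" unfolding word_def using that upt_add_eq_append[of m n "n' - n"] by (metis le_add_diff_inverse map_append)
    then show ?thesis by simp
  qed
  have "\<exists>n\<ge>m. k \<le> Q_count (word \<gamma> m n)" for k
  proof (induction k)
    case (Suc k)
    then obtain n where n: "n \<ge> m" "k \<le> Q_count (word \<gamma> m n)" by blast
    obtain n' where n': "n' \<ge> n" "\<gamma> n' \<noteq> h1" using assms unfolding infinitely_often_Q_def by blast
    have "word \<gamma> m (Suc n') = word \<gamma> m n' @ [False]" using n n' by (simp add: word_def)
    then have "Suc k \<le> Q_count (word \<gamma> m (Suc n'))" using mono[OF n'(1) n(1)] n by simp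
    then show ?case using n n' by (intro exI[of _ "Suc n'"]) auto
  qed auto
  then show ?thesis unfolding filterlim_at_top eventually_sequentially using mono by (meson order_trans)
qed

text \<open>An orbit absorbed in \<open>K1\<close> synchronises with the orbit of the attracting point, which stays in \<open>Lmin\<close>.\<close>

lemma AE_converges:
  assumes g: "\<gamma> \<in> space \<Gamma>" "infinitely_often_Q \<gamma>" and ab: "srun (word \<gamma> 0 n) z \<in> absorbing"
  shows "(\<lambda>n. infdist (random_orbit \<gamma> z n) ({Infty} \<union> Lmin)) \<longlonglongrightarrow> 0"
proof (cases "srun (word \<gamma> 0 n) z \<in> nbhd_Infty Rad")
  case True
  then have "random_orbit \<gamma> z \<longlonglongrightarrow> Infty" using escapes_iff[OF g(1)] by blast
  then have lim: "(\<lambda>n. dist (random_orbit \<gamma> z n) Infty) \<longlonglongrightarrow> 0" by (rule tendsto_dist_iff[THEN iffD1])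
  have le: "norm (infdist (random_orbit \<gamma> z n) ({Infty} \<union> Lmin)) \<le> dist (random_orbit \<gamma> z n) Infty" for n
    unfolding real_norm_def abs_of_nonneg[OF infdist_nonneg] by (rule infdist_le) simp
  show ?thesis by (rule Lim_null_comparison[OF always_eventually[OF allI[OF le]] lim])
next
  case False
  then obtain u where u: "u \<in> K1" "srun (word \<gamma> 0 n) z = Fin u" using ab by (auto simp: absorbing_def)
  obtain MM r where r: "0 < r" "r < 1" "0 < MM" and
    sy: "\<And>ws x y. x \<in> K1 \<Longrightarrow> y \<in> K1 \<Longrightarrow> norm (run ws x - run ws y) \<le> MM * r ^ Q_count ws" using sync_ex by blast
  have le: "infdist (random_orbit \<gamma> z m) ({Infty} \<union> Lmin) \<le> 4 * (MM * r ^ Q_count (word \<gamma> n m))" if "n \<le> m" for m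
  proof -
    have eq: "random_orbit \<gamma> z m = Fin (run (word \<gamma> n m) u)" using u by (simp add: random_orbit_word[OF g(1)] word_append[OF that])
    have "infdist (Fin (run (word \<gamma> n m) u)) ({Infty} \<union> Lmin) \<le> dist (Fin (run (word \<gamma> n m) u)) (Fin (run (word \<gamma> n m) attractor))"
      using run_attractor_Lmin by (intro infdist_le) auto
    moreover have "\<dots> \<le> 4 * dist (run (word \<gamma> n m) u) (run (word \<gamma> n m) attractor)" by (rule dist_Fin_le)
    moreover have "\<dots> \<le> 4 * (MM * r ^ Q_count (word \<gamma> n m))" using sy[OF u(1) attractor(1)] by (simp add: dist_norm)
    ultimately show ?thesis unfolding eq by linarith
  qed
  have "(\<lambda>m. r ^ Q_count (word \<gamma> n m)) \<longlonglongrightarrow> 0"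
    using filterlim_compose[OF LIMSEQ_realpow_zero Q_count_word_tendsto[OF g(2)], of r n] r by simp
  then have "(\<lambda>m. 4 * (MM * r ^ Q_count (word \<gamma> n m))) \<longlonglongrightarrow> 4 * (MM * 0)" by (intro tendsto_intros)
  then have "(\<lambda>m. 4 * (MM * r ^ Q_count (word \<gamma> n m))) \<longlonglongrightarrow> 0" by simp
  moreover have "eventually (\<lambda>m. norm (infdist (random_orbit \<gamma> z m) ({Infty} \<union> Lmin)) \<le> 4 * (MM * r ^ Q_count (word \<gamma> n m))) sequentially"
    unfolding eventually_sequentially real_norm_def abs_of_nonneg[OF infdist_nonneg] using le by blast
  ultimately show ?thesis by (rule Lim_null_comparison[rotated])
qed

lemma almost_sure_convergence:
  "\<exists>B \<in> sets \<Gamma>. emeasure \<Gamma> B = 1 \<and> (\<forall>\<gamma>\<in>B. (\<lambda>n. infdist (random_orbit \<gamma> z n) ({Infty} \<union> Lmin)) \<longlonglongrightarrow> 0)"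
proof -
  let ?A = "{\<gamma> \<in> space \<Gamma>. \<exists>n. srun (word \<gamma> 0 n) z \<in> absorbing}"
  have "?A = (\<Union>n. {\<gamma> \<in> space \<Gamma>. srun (word \<gamma> 0 n) z \<in> absorbing})" by auto
  then have A: "?A \<in> sets \<Gamma>" using sets_word by auto
  let ?B = "?A \<inter> {\<gamma> \<in> space \<Gamma>. infinitely_often_Q \<gamma>}"
  have B: "?B \<in> sets \<Gamma>" using A sets_infinitely_often_Q by auto
  have "AE \<gamma> in \<Gamma>. \<gamma> \<in> ?B" using AE_absorbed[of z] AE_infinitely_often_Q AE_space by eventually_elim auto
  then have "emeasure \<Gamma> ?B = 1" using G.emeasure_eq_1_AE[OF B] by simp
  then show ?thesis using B AE_converges by (intro bexI[of _ ?B]) auto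
qed

section \<open>The invariant measure\<close>

text \<open>The backward compositions at the attracting point, replaced by a constant on the null set of sequences with finitely
many letters \<open>Q\<close>, so that they converge everywhere.\<close>

definition backward :: "nat \<Rightarrow> (nat \<Rightarrow> csphere \<Rightarrow> csphere) \<Rightarrow> csphere" where
  "backward n \<gamma> = (if infinitely_often_Q \<gamma> then Fin (run (rev (word \<gamma> 0 n)) attractor) else Fin attractor)"

text \<open>Adding letters inside a backward composition changes the value by at most the diameter of the image of \<open>K1\<close> under the
outer ones.\<close>

lemma backward_convergent: "\<exists>z\<in>K1. (\<lambda>n. backward n \<gamma>) \<longlonglongrightarrow> Fin z"
proof (cases "infinitely_often_Q \<gamma>")
  case False then show ?thesis using attractor(1) by (auto simp: backward_def)
next
  case True
  obtain MM r where r: "0 < r" "r < 1" "0 < MM" and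
    sy: "\<And>ws x y. x \<in> K1 \<Longrightarrow> y \<in> K1 \<Longrightarrow> norm (run ws x - run ws y) \<le> MM * r ^ Q_count ws" using sync_ex by blast
  define c where "c = (\<lambda>n. run (rev (word \<gamma> 0 n)) attractor)"
  have cK: "c n \<in> K1" for n using run_K1[OF attractor(1)] by (simp add: c_def)
  have Q_count_rev: "Q_count (rev w) = Q_count w" for w by (simp add: Q_count_def rev_filter[symmetric])
  have step: "norm (c m - c n) \<le> MM * r ^ Q_count (word \<gamma> 0 n)" if "n \<le> m" for m n
  proof -
    have "c m = run (rev (word \<gamma> 0 n)) (run (rev (word \<gamma> n m)) attractor)" by (simp add: c_def word_append[OF that])
    then show ?thesis using sy[OF run_K1[OF attractor(1)] attractor(1), of "rev (word \<gamma> 0 n)"] by (simp add: c_def Q_count_rev)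
  qed
  have "(\<lambda>m. r ^ Q_count (word \<gamma> 0 m)) \<longlonglongrightarrow> 0"
    using filterlim_compose[OF LIMSEQ_realpow_zero Q_count_word_tendsto[OF True], of r 0] r by simp
  then have lim: "(\<lambda>m. MM * r ^ Q_count (word \<gamma> 0 m)) \<longlonglongrightarrow> 0" by (rule tendsto_mult_right_zero)
  have "Cauchy c"
  proof (rule CauchyI)
    fix e :: real assume "0 < e"
    then have "eventually (\<lambda>m. MM * r ^ Q_count (word \<gamma> 0 m) < e/2) sequentially" using order_tendstoD(2)[OF lim, of "e/2"] by simp
    then obtain N where N: "MM * r ^ Q_count (word \<gamma> 0 N) < e/2" by (auto simp: eventually_sequentially)
    show "\<exists>N. \<forall>m\<ge>N. \<forall>n\<ge>N. norm (c m - c n) < e"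
    proof (intro exI[of _ N] allI impI)
      fix m n assume "N \<le> m" "N \<le> n"
      then show "norm (c m - c n) < e" using step[of N m] step[of N n] N norm_triangle_ineq4[of "c m - c N" "c n - c N"] by simp
    qed
  qed
  then obtain z where z: "c \<longlonglongrightarrow> z" using Cauchy_convergent convergent_def by blast
  have "z \<in> K1" by (rule closed_sequentially[OF compact_imp_closed[OF compact_K1] _ z]) (rule cK)
  moreover have "(\<lambda>n. Fin (c n)) \<longlonglongrightarrow> Fin z"
    by (rule continuous_on_tendsto_compose[OF continuous_on_Fin[of UNIV] z]) auto
  ultimately show ?thesis using True by (auto simp: backward_def c_def)
qed

definition backward_limit :: "(nat \<Rightarrow> csphere \<Rightarrow> csphere) \<Rightarrow> csphere" where "backward_limit \<gamma> = Fin (SOME z. z \<in> K1 \<and> (\<lambda>n. backward n \<gamma>) \<longlonglongrightarrow> Fin z)"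

lemma backward_limit: "backward_limit \<gamma> \<in> Fin ` K1" "(\<lambda>n. backward n \<gamma>) \<longlonglongrightarrow> backward_limit \<gamma>"
proof -
  have "\<exists>z. z \<in> K1 \<and> (\<lambda>n. backward n \<gamma>) \<longlonglongrightarrow> Fin z" using backward_convergent by blast
  from someI_ex[OF this] show "backward_limit \<gamma> \<in> Fin ` K1" "(\<lambda>n. backward n \<gamma>) \<longlonglongrightarrow> backward_limit \<gamma>" unfolding backward_limit_def by auto
qed

lemma measurable_backward: "backward n \<in> borel_measurable \<Gamma>"
proof -
  have "(\<lambda>\<gamma>. if infinitely_often_Q \<gamma> then Fin (run (rev (word \<gamma> 0 n)) attractor) else Fin attractor) \<in> borel_measurable \<Gamma>"
    by (rule measurable_If[OF borel_word]) (use sets_infinitely_often_Q in auto)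
  then show ?thesis by (simp add: backward_def[abs_def])
qed

lemma measurable_backward_limit: "backward_limit \<in> borel_measurable \<Gamma>"
  by (rule borel_measurable_LIMSEQ_metric[OF measurable_backward]) (rule backward_limit)

text \<open>The law of the limit of the backward compositions.\<close>

definition \<nu> :: "csphere measure" where "\<nu> = distr \<Gamma> borel backward_limit"

lemma prob_nu: "prob_space \<nu>" unfolding \<nu>_def by (rule G.prob_space_distr[OF measurable_backward_limit])

lemma borel_prob_nu: "borel_prob \<nu>" using prob_nu by (simp add: borel_prob_def \<nu>_def)

lemma emeasure_nu_K1: "emeasure \<nu> (Fin ` K1) = 1"
proof -
  have "Fin ` K1 \<in> sets borel" using closed_Fin_K1 by simp
  then have "emeasure \<nu> (Fin ` K1) = emeasure \<Gamma> (backward_limit -` (Fin ` K1) \<inter> space \<Gamma>)" unfolding \<nu>_def using measurable_backward_limit by (simp add: emeasure_distr)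
  also have "backward_limit -` (Fin ` K1) \<inter> space \<Gamma> = space \<Gamma>" using backward_limit(1) by auto
  finally show ?thesis by (simp add: G.emeasure_space_1)
qed

text \<open>Backward and forward compositions of \<open>n\<close> letters have the same law, so dominated convergence applies.\<close>

lemma nu_limit:
  fixes \<phi> :: "csphere \<Rightarrow> complex"
  assumes \<phi>: "continuous_on UNIV \<phi>"
  shows "(\<lambda>n. (M ^^ n) \<phi> (Fin attractor)) \<longlonglongrightarrow> (\<integral>w. \<phi> w \<partial>\<nu>)"
proof -
  obtain C where C: "C > 0" "\<And>x. norm (\<phi> x) \<le> C" using bounded_continuous_csphere[OF \<phi>] by metis
  have m: "\<phi> \<in> borel_measurable borel" using \<phi> by (rule borel_measurable_continuous_onI)
  have "(\<lambda>n. \<integral>\<gamma>. \<phi> (backward n \<gamma>) \<partial>\<Gamma>) \<longlonglongrightarrow> (\<integral>\<gamma>. \<phi> (backward_limit \<gamma>) \<partial>\<Gamma>)"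
  proof (rule integral_dominated_convergence[where w = "\<lambda>_. C"])
    show "(\<lambda>\<gamma>. \<phi> (backward_limit \<gamma>)) \<in> borel_measurable \<Gamma>" by (rule measurable_compose[OF measurable_backward_limit m])
    show "(\<lambda>\<gamma>. \<phi> (backward n \<gamma>)) \<in> borel_measurable \<Gamma>" for n by (rule measurable_compose[OF measurable_backward m])
    show "AE \<gamma> in \<Gamma>. (\<lambda>n. \<phi> (backward n \<gamma>)) \<longlonglongrightarrow> \<phi> (backward_limit \<gamma>)"
      by (rule AE_I2) (rule continuous_on_tendsto_compose[OF \<phi> backward_limit(2)], auto)
  qed (use C in auto)
  moreover have "(\<integral>\<gamma>. \<phi> (backward n \<gamma>) \<partial>\<Gamma>) = (M ^^ n) \<phi> (Fin attractor)" for n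
  proof -
    have "(\<integral>\<gamma>. \<phi> (backward n \<gamma>) \<partial>\<Gamma>) = (\<integral>\<gamma>. \<phi> (srun (rev (word \<gamma> 0 n)) (Fin attractor)) \<partial>\<Gamma>)"
    proof (rule integral_cong_AE)
      show "(\<lambda>\<gamma>. \<phi> (backward n \<gamma>)) \<in> borel_measurable \<Gamma>" by (rule measurable_compose[OF measurable_backward m])
      show "(\<lambda>\<gamma>. \<phi> (srun (rev (word \<gamma> 0 n)) (Fin attractor))) \<in> borel_measurable \<Gamma>" by (rule borel_word)
      show "AE \<gamma> in \<Gamma>. \<phi> (backward n \<gamma>) = \<phi> (srun (rev (word \<gamma> 0 n)) (Fin attractor))"
        using AE_infinitely_often_Q by eventually_elim (simp add: backward_def)
    qed
    also have "\<dots> = (M ^^ n) \<phi> (Fin attractor)" by (rule expectation_backward[OF C(2)])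
    finally show ?thesis .
  qed
  moreover have "(\<integral>w. \<phi> w \<partial>\<nu>) = (\<integral>\<gamma>. \<phi> (backward_limit \<gamma>) \<partial>\<Gamma>)" unfolding \<nu>_def by (rule integral_distr[OF measurable_backward_limit m])
  ultimately show ?thesis by simp
qed

lemma few_h2: "(\<lambda>n. measure \<Gamma> {\<gamma> \<in> space \<Gamma>. Q_count (word \<gamma> 0 n) < m}) \<longlonglongrightarrow> 0"
proof -
  let ?A = "\<lambda>n. {\<gamma> \<in> space \<Gamma>. Q_count (word \<gamma> 0 n) < m}"
  have s: "range ?A \<subseteq> sets \<Gamma>" using sets_word by auto
  have d: "decseq ?A"
  proof (rule decseq_SucI)
    show "?A (Suc n) \<subseteq> ?A n" for n by (auto simp: word_Suc)
  qed
  have "measure \<Gamma> (\<Inter>n. ?A n) = 0"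
  proof -
    have iA: "(\<Inter>n. ?A n) \<in> sets \<Gamma>" using s by (intro sets.countable_INT) auto
    have "AE \<gamma> in \<Gamma>. \<gamma> \<notin> (\<Inter>n. ?A n)" using AE_infinitely_often_Q
    proof eventually_elim
      case (elim \<gamma>)
      have "eventually (\<lambda>n. m \<le> Q_count (word \<gamma> 0 n)) sequentially" using Q_count_word_tendsto[OF elim, of 0] by (simp add: filterlim_at_top)
      then obtain n where "m \<le> Q_count (word \<gamma> 0 n)" by (auto simp: eventually_sequentially)
      then have "\<gamma> \<notin> ?A n" by simp
      then show ?case by blast
    qed
    then show ?thesis using G.prob_eq_0[OF iA] by simp
  qed
  then show ?thesis using G.finite_Lim_measure_decseq[OF s d] by simp
qed

text \<open>Two orbits in \<open>K1\<close> driven by the same letters are close unless the word has few letters \<open>Q\<close>, an event of vanishing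
probability that does not depend on the points.\<close>

lemma uniform_limit_K1:
  fixes \<phi> :: "csphere \<Rightarrow> complex"
  assumes \<phi>: "continuous_on UNIV \<phi>" and e: "\<epsilon> > 0"
  shows "\<exists>N. \<forall>n\<ge>N. \<forall>x\<in>Fin ` K1. norm ((M ^^ n) \<phi> x - (\<integral>w. \<phi> w \<partial>\<nu>)) \<le> \<epsilon>"
proof -
  obtain C where C: "C > 0" "\<And>x. norm (\<phi> x) \<le> C" using bounded_continuous_csphere[OF \<phi>] by metis
  have "uniformly_continuous_on UNIV \<phi>" using \<phi> compact_UNIV_csphere by (rule compact_uniformly_continuous)
  moreover have "\<epsilon>/3 > 0" using e by simp
  ultimately obtain \<delta> where \<delta>: "\<delta> > 0" "\<And>x y. dist y x < \<delta> \<Longrightarrow> dist (\<phi> y) (\<phi> x) < \<epsilon>/3"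
    unfolding uniformly_continuous_on_def by (metis UNIV_I)
  obtain MM r where r: "0 < r" "r < 1" "0 < MM" and
    sy: "\<And>ws x y. x \<in> K1 \<Longrightarrow> y \<in> K1 \<Longrightarrow> norm (run ws x - run ws y) \<le> MM * r ^ Q_count ws" using sync_ex by blast
  have "(\<lambda>m. r ^ m) \<longlonglongrightarrow> 0" using r by (intro LIMSEQ_realpow_zero) auto
  then have "(\<lambda>m. 4 * (MM * r ^ m)) \<longlonglongrightarrow> 4 * (MM * 0)" by (intro tendsto_mult tendsto_const)
  then have "(\<lambda>m. 4 * (MM * r ^ m)) \<longlonglongrightarrow> 0" by simp
  then have "eventually (\<lambda>m. 4 * (MM * r ^ m) < \<delta>) sequentially" using \<delta>(1) by (rule order_tendstoD(2))
  then obtain m where m: "4 * (MM * r ^ m) < \<delta>" by (auto simp: eventually_sequentially)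
  have "eventually (\<lambda>n. measure \<Gamma> {\<gamma> \<in> space \<Gamma>. Q_count (word \<gamma> 0 n) < m} < \<epsilon> / (6 * C)) sequentially"
    using order_tendstoD(2)[OF few_h2[of m], of "\<epsilon> / (6 * C)"] e C by simp
  then obtain N1 where N1: "\<And>n. n \<ge> N1 \<Longrightarrow> measure \<Gamma> {\<gamma> \<in> space \<Gamma>. Q_count (word \<gamma> 0 n) < m} < \<epsilon> / (6 * C)"
    by (auto simp: eventually_sequentially)
  have "eventually (\<lambda>n. dist ((M ^^ n) \<phi> (Fin attractor)) (\<integral>w. \<phi> w \<partial>\<nu>) < \<epsilon>/3) sequentially"
    by (rule tendstoD[OF nu_limit[OF \<phi>]]) (use e in simp)
  then obtain N2 where N2: "\<And>n. n \<ge> N2 \<Longrightarrow> dist ((M ^^ n) \<phi> (Fin attractor)) (\<integral>w. \<phi> w \<partial>\<nu>) < \<epsilon>/3"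
    by (auto simp: eventually_sequentially)
  show ?thesis
  proof (intro exI[of _ "max N1 N2"] allI impI ballI)
    fix n x assume n: "max N1 N2 \<le> n" and "x \<in> Fin ` K1"
    then obtain u where u: "u \<in> K1" "x = Fin u" by auto
    let ?A = "{\<gamma> \<in> space \<Gamma>. Q_count (word \<gamma> 0 n) < m}"
    have int: "integrable \<Gamma> (\<lambda>\<gamma>. \<phi> (srun (word \<gamma> 0 n) y))" for y
      by (rule G.integrable_const_bound[where B = C]) (use C in \<open>auto intro: borel_word\<close>)
    have intR: "integrable \<Gamma> (\<lambda>\<gamma>. \<epsilon>/3 + 2 * C * indicator ?A \<gamma>)"
      using sets_word[of "\<lambda>w. Q_count w < m" n] by (intro Bochner_Integration.integrable_add integrable_mult_right) (auto simp: G.emeasure_eq_measure)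
    have pt: "norm (\<phi> (srun (word \<gamma> 0 n) x) - \<phi> (srun (word \<gamma> 0 n) (Fin attractor))) \<le> \<epsilon>/3 + 2 * C * indicator ?A \<gamma>" if g: "\<gamma> \<in> space \<Gamma>" for \<gamma>
    proof (cases "Q_count (word \<gamma> 0 n) < m")
      case True
      have "norm (\<phi> (srun (word \<gamma> 0 n) x) - \<phi> (srun (word \<gamma> 0 n) (Fin attractor))) \<le> C + C"
        using norm_triangle_ineq4 C(2) by (meson add_mono order_trans)
      then show ?thesis using True g e by (simp add: indicator_def)
    next
      case False
      have "dist (srun (word \<gamma> 0 n) x) (srun (word \<gamma> 0 n) (Fin attractor)) \<le> 4 * dist (run (word \<gamma> 0 n) u) (run (word \<gamma> 0 n) attractor)"
        using dist_Fin_le u by simp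
      also have "\<dots> \<le> 4 * (MM * r ^ Q_count (word \<gamma> 0 n))" using sy[OF u(1) attractor(1)] by (simp add: dist_norm)
      also have "\<dots> \<le> 4 * (MM * r ^ m)" using False r by (intro mult_left_mono power_decreasing) auto
      also have "\<dots> < \<delta>" by (rule m)
      finally have "dist (\<phi> (srun (word \<gamma> 0 n) x)) (\<phi> (srun (word \<gamma> 0 n) (Fin attractor))) < \<epsilon>/3" by (rule \<delta>(2))
      then show ?thesis using False by (simp add: indicator_def dist_norm)
    qed
    have "(M ^^ n) \<phi> x - (M ^^ n) \<phi> (Fin attractor) = (\<integral>\<gamma>. \<phi> (srun (word \<gamma> 0 n) x) - \<phi> (srun (word \<gamma> 0 n) (Fin attractor)) \<partial>\<Gamma>)"
      using expectation_forward[of \<phi> C n x, OF C(2)] expectation_forward[of \<phi> C n "Fin attractor", OF C(2)]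
        Bochner_Integration.integral_diff[OF int[of x] int[of "Fin attractor"]] by (simp only:)
    then have "norm ((M ^^ n) \<phi> x - (M ^^ n) \<phi> (Fin attractor)) \<le> (\<integral>\<gamma>. norm (\<phi> (srun (word \<gamma> 0 n) x) - \<phi> (srun (word \<gamma> 0 n) (Fin attractor))) \<partial>\<Gamma>)"
      by (simp only: integral_norm_bound)
    also have "\<dots> \<le> (\<integral>\<gamma>. \<epsilon>/3 + 2 * C * indicator ?A \<gamma> \<partial>\<Gamma>)"
      by (rule integral_mono[OF integrable_norm[OF Bochner_Integration.integrable_diff[OF int[of x] int[of "Fin attractor"]]] intR pt])
    also have "\<dots> = \<epsilon>/3 + 2 * C * measure \<Gamma> ?A"
      using sets_word[of "\<lambda>w. Q_count w < m" n] by (subst Bochner_Integration.integral_add) (auto simp: G.prob_space Int_absorb1 G.emeasure_eq_measure)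
    also have "\<dots> \<le> \<epsilon>/3 + 2 * C * (\<epsilon> / (6 * C))" using N1[of n] n C by (intro add_left_mono mult_left_mono) auto
    also have "\<dots> = \<epsilon>/3 + \<epsilon>/3" using C by simp
    finally have "norm ((M ^^ n) \<phi> x - (M ^^ n) \<phi> (Fin attractor)) \<le> \<epsilon>/3 + \<epsilon>/3" .
    moreover have "norm ((M ^^ n) \<phi> (Fin attractor) - (\<integral>w. \<phi> w \<partial>\<nu>)) < \<epsilon>/3" using N2[of n] n by (simp add: dist_norm)
    ultimately show "norm ((M ^^ n) \<phi> x - (\<integral>w. \<phi> w \<partial>\<nu>)) \<le> \<epsilon>"
      using norm_triangle_ineq[of "(M ^^ n) \<phi> x - (M ^^ n) \<phi> (Fin attractor)" "(M ^^ n) \<phi> (Fin attractor) - (\<integral>w. \<phi> w \<partial>\<nu>)"] by simp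
  qed
qed

lemma Mc_pow_words:
  assumes "\<And>ws. length ws = n \<Longrightarrow> norm (\<phi> (srun ws x) - c) \<le> \<epsilon>"
  shows "norm ((M ^^ n) \<phi> x - c) \<le> \<epsilon>"
  using assms
proof (induction n arbitrary: x)
  case (Suc n)
  have ih: "norm ((M ^^ n) \<phi> (sstep b x) - c) \<le> \<epsilon>" for b
  proof (rule Suc.IH)
    fix ws :: "bool list" assume "length ws = n"
    then show "norm (\<phi> (srun ws (sstep b x)) - c) \<le> \<epsilon>" using Suc.prems[of "b # ws"] by simp
  qed
  have "(M ^^ Suc n) \<phi> x - c = M (\<lambda>x. (M ^^ n) \<phi> x - c) x" by (simp add: Mc_def algebra_simps)
  also have "norm \<dots> \<le> q * \<epsilon> + (1 - q) * \<epsilon>" using ih[of True] ih[of False] by (intro norm_Mc_le[OF q]) auto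
  finally show ?case by (simp add: algebra_simps)
qed simp

lemma uniform_limit_nbhd_Infty:
  fixes \<phi> :: "csphere \<Rightarrow> complex"
  assumes \<phi>: "continuous_on UNIV \<phi>" and e: "\<epsilon> > 0"
  shows "\<exists>N. \<forall>n\<ge>N. \<forall>x\<in>nbhd_Infty Rad. norm ((M ^^ n) \<phi> x - \<phi> Infty) \<le> \<epsilon>"
proof -
  have "open (\<phi> -` ball (\<phi> Infty) \<epsilon>)" using \<phi> by (simp add: open_vimage)
  moreover have "Infty \<in> \<phi> -` ball (\<phi> Infty) \<epsilon>" using e by simp
  ultimately obtain R where "R > 0" and R: "nbhd_Infty R \<subseteq> \<phi> -` ball (\<phi> Infty) \<epsilon>" by (rule open_Infty_imp_nbhd)
  obtain N where N: "R < 2 ^ N" using real_arch_pow[of 2 R] by auto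
  show ?thesis
  proof (intro exI[of _ N] allI impI ballI)
    fix n x assume n: "N \<le> n" and x: "x \<in> nbhd_Infty Rad"
    show "norm ((M ^^ n) \<phi> x - \<phi> Infty) \<le> \<epsilon>"
    proof (rule Mc_pow_words)
      fix ws :: "bool list" assume l: "length ws = n"
      have "srun ws x \<in> nbhd_Infty (2 ^ n * Rad)" using srun_growth[OF x, of ws] l by simp
      moreover have "R \<le> 2 ^ n * Rad"
      proof -
        have "(2::real) ^ N \<le> 2 ^ n" using n by (intro power_increasing) auto
        then have "R \<le> 2 ^ n * 1" using N by linarith
        also have "\<dots> \<le> 2 ^ n * Rad" using Rad_ge1 by (intro mult_left_mono) auto
        finally show ?thesis .
      qed
      ultimately have "srun ws x \<in> nbhd_Infty R" by (auto simp: nbhd_Infty_def)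
      then have "\<phi> (srun ws x) \<in> ball (\<phi> Infty) \<epsilon>" using R by blast
      then show "norm (\<phi> (srun ws x) - \<phi> Infty) \<le> \<epsilon>" by (simp add: dist_norm norm_minus_commute)
    qed
  qed
qed

text \<open>The claimed limit is a fixed point, so the difference of \<open>\<phi>\<close> and the limit may be iterated instead. It tends
to \<open>0\<close> on the absorbing set, where \<open>T\<close> is \<open>0\<close> or \<open>1\<close>.\<close>

lemma Mc_pow_uniform_limit:
  fixes \<phi> :: "csphere \<Rightarrow> complex"
  assumes \<phi>: "continuous_on UNIV \<phi>"
  defines "\<Phi> \<equiv> (\<lambda>z. of_real (T h1 h2 q z) * \<phi> Infty + of_real (1 - T h1 h2 q z) * (\<integral>w. \<phi> w \<partial>\<nu>))"
  shows "uniform_limit UNIV (\<lambda>n. (M ^^ n) \<phi>) \<Phi> sequentially"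
proof -
  let ?I = "\<integral>w. \<phi> w \<partial>\<nu>"
  have fx: "M \<Phi> = \<Phi>"
  proof
    fix x
    have "complex_of_real (T h1 h2 q x) = of_real q * of_real (T h1 h2 q (h1 x)) + (1 - of_real q) * of_real (T h1 h2 q (h2 x))"
      by (subst T_fixed) simp
    then show "M \<Phi> x = \<Phi> x" unfolding \<Phi>_def Mc_def by (simp only: of_real_diff of_real_1) (simp add: algebra_simps)
  qed
  have fxn: "(M ^^ n) \<Phi> = \<Phi>" for n by (induction n) (auto simp: fx)
  obtain C where C: "C > 0" "\<And>x. norm (\<phi> x) \<le> C" using bounded_continuous_csphere[OF \<phi>] by metis
  have \<Phi>b: "norm (\<Phi> x) \<le> norm (\<phi> Infty) + norm ?I" for x
  proof -
    have "norm (\<Phi> x) \<le> norm (complex_of_real (T h1 h2 q x)) * norm (\<phi> Infty) + norm (complex_of_real (1 - T h1 h2 q x)) * norm ?I"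
      unfolding \<Phi>_def by (metis norm_mult norm_triangle_ineq)
    also have "\<dots> \<le> 1 * norm (\<phi> Infty) + 1 * norm ?I"
      using T_bounds[of x] by (intro add_mono mult_right_mono) (auto simp del: of_real_diff)
    finally show ?thesis by simp
  qed
  have "uniform_limit UNIV (\<lambda>n. (M ^^ n) (\<lambda>x. \<phi> x - \<Phi> x)) (\<lambda>x. 0) sequentially"
  proof (rule Mc_pow_converges[OF q])
    show "norm (\<phi> x - \<Phi> x) \<le> C + (norm (\<phi> Infty) + norm ?I)" for x
      using C(2)[of x] \<Phi>b[of x] norm_triangle_ineq4[of "\<phi> x" "\<Phi> x"] by linarith
    fix \<epsilon> :: real assume e: "\<epsilon> > 0"
    obtain N1 where N1: "\<And>n x. n \<ge> N1 \<Longrightarrow> x \<in> Fin ` K1 \<Longrightarrow> norm ((M ^^ n) \<phi> x - ?I) \<le> \<epsilon>" using uniform_limit_K1[OF \<phi> e] by blast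
    obtain N2 where N2: "\<And>n x. n \<ge> N2 \<Longrightarrow> x \<in> nbhd_Infty Rad \<Longrightarrow> norm ((M ^^ n) \<phi> x - \<phi> Infty) \<le> \<epsilon>" using uniform_limit_nbhd_Infty[OF \<phi> e] by blast
    show "\<exists>n. \<forall>x\<in>absorbing. norm ((M ^^ n) (\<lambda>x. \<phi> x - \<Phi> x) x) \<le> \<epsilon>"
    proof (intro exI[of _ "max N1 N2"] ballI)
      fix x assume "x \<in> absorbing"
      then consider "x \<in> Fin ` K1" | "x \<in> nbhd_Infty Rad" by (auto simp: absorbing_def)
      then show "norm ((M ^^ max N1 N2) (\<lambda>x. \<phi> x - \<Phi> x) x) \<le> \<epsilon>"
      proof cases
        case 1
        then have "\<Phi> x = ?I" using T_K1 by (simp add: \<Phi>_def)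
        then show ?thesis using N1[OF _ 1, of "max N1 N2"] by (simp add: Mc_pow_diff fxn)
      next
        case 2
        then have "\<Phi> x = \<phi> Infty" using T_nbhd_Infty by (simp add: \<Phi>_def)
        then show ?thesis using N2[OF _ 2, of "max N1 N2"] by (simp add: Mc_pow_diff fxn)
      qed
    qed
  qed
  then have u: "uniform_limit UNIV (\<lambda>n x. (M ^^ n) \<phi> x - \<Phi> x) (\<lambda>x. 0) sequentially" by (simp add: Mc_pow_diff fxn)
  show ?thesis
  proof (rule uniform_limitI)
    fix e :: real assume "e > 0"
    from uniform_limitD[OF u this] show "eventually (\<lambda>n. \<forall>x\<in>UNIV. dist ((M ^^ n) \<phi> x) (\<Phi> x) < e) sequentially"
      by eventually_elim (simp add: dist_norm)
  qed
qed

lemma nu_invariant: "invariant_prob_on h1 h2 q (Fin ` K1) \<nu>"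
  unfolding invariant_prob_on_def M_dual_def
proof (intro conjI borel_prob_nu emeasure_nu_K1 allI impI)
  fix \<phi> :: "csphere \<Rightarrow> complex" assume \<phi>: "continuous_on UNIV \<phi>"
  have "(\<lambda>n. (M ^^ Suc n) \<phi> (Fin attractor)) \<longlonglongrightarrow> (\<integral>w. \<phi> w \<partial>\<nu>)" using nu_limit[OF \<phi>] by (rule LIMSEQ_Suc)
  moreover have "(\<lambda>n. (M ^^ n) (M \<phi>) (Fin attractor)) \<longlonglongrightarrow> (\<integral>w. M \<phi> w \<partial>\<nu>)" using nu_limit[OF Mc_continuous[OF \<phi>]] .
  ultimately show "(\<integral>z. \<phi> z \<partial>\<nu>) = (\<integral>z. M_op h1 h2 q \<phi> z \<partial>\<nu>)"
    unfolding M_op_Mc using LIMSEQ_unique by (simp add: funpow_swap1) blast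
qed

text \<open>Invariance replaces \<open>\<phi>\<close> by its images under the operator, which converge to a constant on \<open>K1\<close>.\<close>

lemma invariant_integral:
  fixes \<phi> :: "csphere \<Rightarrow> complex"
  assumes inv: "invariant_prob_on h1 h2 q (Fin ` K1) \<nu>'" and \<phi>: "continuous_on UNIV \<phi>"
  shows "(\<integral>w. \<phi> w \<partial>\<nu>') = (\<integral>w. \<phi> w \<partial>\<nu>)"
proof -
  have bp: "sets \<nu>' = sets borel" "prob_space \<nu>'" and e1: "emeasure \<nu>' (Fin ` K1) = 1"
    and du: "\<And>\<phi> :: csphere \<Rightarrow> complex. continuous_on UNIV \<phi> \<Longrightarrow> (\<integral>z. \<phi> z \<partial>\<nu>') = (\<integral>z. M \<phi> z \<partial>\<nu>')"
    using inv by (auto simp: invariant_prob_on_def M_dual_def borel_prob_def M_op_Mc)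
  interpret N: prob_space \<nu>' by (rule bp)
  have K: "Fin ` K1 \<in> sets \<nu>'" using closed_Fin_K1 by (simp add: bp)
  have aeK: "AE x in \<nu>'. x \<in> Fin ` K1" using e1 N.AE_in_set_eq_1[OF K] by (simp add: N.emeasure_eq_measure)
  have iterated: "(\<integral>z. \<phi> z \<partial>\<nu>') = (\<integral>z. (M ^^ n) \<phi> z \<partial>\<nu>')" for n
    by (induction n) (use du[OF Mc_pow_continuous[OF \<phi>]] in auto)
  obtain C where C: "C > 0" "\<And>x. norm (\<phi> x) \<le> C" using bounded_continuous_csphere[OF \<phi>] by metis
  have "norm ((\<integral>w. \<phi> w \<partial>\<nu>') - (\<integral>w. \<phi> w \<partial>\<nu>)) \<le> \<epsilon>" if e: "\<epsilon> > 0" for \<epsilon>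
  proof -
    obtain n where n: "\<And>x. x \<in> Fin ` K1 \<Longrightarrow> norm ((M ^^ n) \<phi> x - (\<integral>w. \<phi> w \<partial>\<nu>)) \<le> \<epsilon>" using uniform_limit_K1[OF \<phi> e] by blast
    have mm: "(M ^^ n) \<phi> \<in> borel_measurable \<nu>'"
      using borel_measurable_continuous_onI[OF Mc_pow_continuous[OF \<phi>]] measurable_cong_sets[OF bp(1) refl] by blast
    have int: "integrable \<nu>' ((M ^^ n) \<phi>)"
      by (rule N.integrable_const_bound[where B = C]) (use mm norm_Mc_pow_le[OF q C(2)] in auto)
    have "(\<integral>w. \<phi> w \<partial>\<nu>') - (\<integral>w. \<phi> w \<partial>\<nu>) = (\<integral>z. (M ^^ n) \<phi> z - (\<integral>w. \<phi> w \<partial>\<nu>) \<partial>\<nu>')"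
      unfolding iterated[of n] using int by (simp add: Bochner_Integration.integral_diff N.prob_space)
    then have "norm ((\<integral>w. \<phi> w \<partial>\<nu>') - (\<integral>w. \<phi> w \<partial>\<nu>)) \<le> (\<integral>z. norm ((M ^^ n) \<phi> z - (\<integral>w. \<phi> w \<partial>\<nu>)) \<partial>\<nu>')"
      by (simp only: integral_norm_bound)
    also have "\<dots> \<le> (\<integral>z. \<epsilon> \<partial>\<nu>')"
      by (rule integral_mono_AE) (use int aeK n in auto)
    also have "\<dots> = \<epsilon>" by (simp add: N.prob_space)
    finally show ?thesis .
  qed
  then have "norm ((\<integral>w. \<phi> w \<partial>\<nu>') - (\<integral>w. \<phi> w \<partial>\<nu>)) \<le> 0" by (rule field_le_epsilon[of _ 0, simplified])
  then show ?thesis by simp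
qed

end

text \<open>The indicator of a closed set is the pointwise limit of continuous functions, and closed sets generate the Borel sets.\<close>

lemma measure_eq_continuous_integrals:
  fixes \<mu> \<nu> :: "'a::metric_space measure"
  assumes "sets \<mu> = sets borel" "prob_space \<mu>" "sets \<nu> = sets borel" "prob_space \<nu>"
    and eq: "\<And>\<phi> :: 'a \<Rightarrow> complex. continuous_on UNIV \<phi> \<Longrightarrow> (\<integral>z. \<phi> z \<partial>\<mu>) = (\<integral>z. \<phi> z \<partial>\<nu>)"
  shows "\<mu> = \<nu>"
proof (rule measure_eqI_generator_eq[where E = "Collect closed" and \<Omega> = UNIV and A = "\<lambda>_. UNIV"])
  have sb: "sets borel = sigma_sets UNIV (Collect (closed :: 'a set \<Rightarrow> bool))" unfolding borel_eq_closed by (simp add: sets_measure_of)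
  show "sets \<mu> = sigma_sets UNIV (Collect closed)" "sets \<nu> = sigma_sets UNIV (Collect closed)" using assms sb by auto
  show "Int_stable (Collect closed)" by (auto simp: Int_stable_def)
  show "emeasure \<mu> UNIV \<noteq> \<infinity>" using assms(2) by (metis ennreal_top_neq_one infinity_ennreal_def prob_space.emeasure_space_1 emeasure_space top.extremum_uniqueI order_refl sets_eq_imp_space_eq assms(1) space_borel)
  fix F :: "'a set" assume "F \<in> Collect closed"
  then have F: "closed F" by simp
  define f where "f = (\<lambda>k x. max 0 (1 - real k * infdist x F))"
  have lim: "(\<lambda>k. \<integral>x. complex_of_real (f k x) \<partial>m) \<longlonglongrightarrow> of_real (measure m F)"
    if m: "sets m = sets borel" "prob_space m" and ne: "F \<noteq> {}" for m
  proof -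
    interpret m: prob_space m by (rule m)
    have Fm: "F \<in> sets m" using F m by simp
    have meas: "f k \<in> borel_measurable m" for k
    proof -
      have "continuous_on UNIV (f k)" unfolding f_def by (intro continuous_intros)
      then show ?thesis using borel_measurable_continuous_onI measurable_cong_sets[OF m(1) refl] by blast
    qed
    have "(\<lambda>k. \<integral>x. f k x \<partial>m) \<longlonglongrightarrow> (\<integral>x. indicator F x \<partial>m)"
    proof (rule integral_dominated_convergence[where w = "\<lambda>_. 1"])
      show "AE x in m. (\<lambda>k. f k x) \<longlonglongrightarrow> indicator F x"
      proof (rule AE_I2)
        fix x
        show "(\<lambda>k. f k x) \<longlonglongrightarrow> indicator F x"
        proof (cases "x \<in> F")
          case True then show ?thesis by (simp add: f_def)
        next
          case False
          then have d: "infdist x F > 0" using in_closed_iff_infdist_zero[OF F ne] infdist_nonneg[of x F] by (metis order_less_le)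
          obtain K where K: "1 / infdist x F < real K" using reals_Archimedean2 by blast
          have "f k x = 0" if "K \<le> k" for k
          proof -
            have "1 / infdist x F < real k" using K that by (meson of_nat_mono less_le_trans)
            then have "1 < real k * infdist x F" using d by (simp add: field_simps)
            then show ?thesis by (simp add: f_def)
          qed
          then have "eventually (\<lambda>k. f k x = 0) sequentially" by (auto simp: eventually_sequentially)
          then show ?thesis using False by (simp add: tendsto_eventually)
        qed
      qed
      show "AE x in m. norm (f k x) \<le> 1" for k using infdist_nonneg[of _ F] by (intro AE_I2) (simp add: f_def)
    qed (use meas Fm in auto)
    then have "(\<lambda>k. complex_of_real (\<integral>x. f k x \<partial>m)) \<longlonglongrightarrow> of_real (\<integral>x. indicator F x \<partial>m)" by (rule tendsto_of_real)
    then show ?thesis using Fm by (simp add: Int_absorb2 sets.sets_into_space)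
  qed
  show "emeasure \<mu> F = emeasure \<nu> F"
  proof (cases "F = {}")
    case False
    have "(\<integral>x. complex_of_real (f k x) \<partial>\<mu>) = (\<integral>x. complex_of_real (f k x) \<partial>\<nu>)" for k
      by (rule eq) (unfold f_def, intro continuous_intros)
    then have "complex_of_real (measure \<mu> F) = of_real (measure \<nu> F)"
      using LIMSEQ_unique[OF lim[OF assms(1,2) False]] lim[OF assms(3,4) False] by simp
    then have "measure \<mu> F = measure \<nu> F" by simp
    moreover have "finite_measure \<mu>" "finite_measure \<nu>" using assms by (auto simp: prob_space_def)
    ultimately show ?thesis by (simp add: finite_measure.emeasure_eq_measure)
  qed simp
qed auto

context random_pair begin

lemma nu_unique: assumes "invariant_prob_on h1 h2 q (Fin ` K1) \<nu>'" shows "\<nu>' = \<nu>"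
  by (rule measure_eq_continuous_integrals)
    (use assms borel_prob_nu invariant_integral[OF assms] in \<open>auto simp: invariant_prob_on_def borel_prob_def\<close>)

end

section \<open>Hoelder continuity\<close>

text \<open>For given \<open>x\<close>, \<open>y\<close> the two terms are balanced by choosing \<open>n\<close> with \<open>\<Lambda>\<^sup>n\<close> about \<open>dist x y powr (-1/2)\<close>.\<close>

lemma Hoelder_interpolation:
  fixes f :: "csphere \<Rightarrow> real"
  assumes r: "0 < r" "r < 1" and L: "2 \<le> \<Lambda>" and AB: "0 \<le> A" "0 \<le> B"
    and bd: "\<And>x y. \<bar>f x - f y\<bar> \<le> 1"
    and est: "\<And>n x y. \<bar>f x - f y\<bar> \<le> A * r ^ n + B * \<Lambda> ^ n * dist x y"
  shows "Hoelder_continuous f"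
proof -
  define \<beta> where "\<beta> = - ln r / (2 * ln \<Lambda>)"
  have lnL: "ln \<Lambda> > 0" and lnr: "ln r < 0" using L r by auto
  have \<beta>: "\<beta> > 0" using lnL lnr by (simp add: \<beta>_def divide_neg_pos)
  define \<alpha> where "\<alpha> = min (1/2) \<beta>"
  have \<alpha>: "0 < \<alpha>" "\<alpha> \<le> 1/2" "\<alpha> \<le> \<beta>" using \<beta> by (auto simp: \<alpha>_def)
  define C where "C = A / r + B + 1"
  have C: "C \<ge> 1" using AB r by (simp add: C_def)
  have "\<bar>f x - f y\<bar> \<le> C * dist x y powr \<alpha>" for x y
  proof -
    define d where "d = dist x y"
    consider "d = 0" | "d \<ge> 1" | "0 < d" "d < 1" unfolding d_def using zero_le_dist[of x y] by linarith
    then show ?thesis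
    proof cases
      case 1 then show ?thesis by (simp add: d_def)
    next
      case 2
      then have "1 \<le> d powr \<alpha>" using \<alpha> by (simp add: ge_one_powr_ge_zero)
      then have "1 * 1 \<le> C * d powr \<alpha>" using C by (intro mult_mono) auto
      then show ?thesis using bd[of x y] by (simp add: d_def)
    next
      case 3
      define s where "s = - ln d / (2 * ln \<Lambda>)"
      have lnd: "ln d < 0" using 3 by simp
      have s: "s \<ge> 0" using lnd lnL by (simp add: s_def divide_nonpos_pos)
      \<comment> \<open>For this \<open>s\<close>, \<open>\<Lambda> powr s = d powr (-1/2)\<close> and \<open>r powr s = d powr \<beta>\<close>.\<close>
      define n where "n = nat \<lfloor>s\<rfloor>"
      have n: "real n \<le> s" "s < real n + 1" using s by (auto simp: n_def)
      have "\<Lambda> ^ n = exp (real n * ln \<Lambda>)" using L by (simp add: exp_of_nat_mult)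
      also have "\<dots> \<le> exp (s * ln \<Lambda>)" using n lnL by simp
      also have "s * ln \<Lambda> = - ln d / 2" using lnL by (simp add: s_def)
      finally have "\<Lambda> ^ n * d \<le> exp (- ln d / 2) * exp (ln d)" using 3 by simp
      also have "\<dots> = exp (1/2 * ln d)" by (simp flip: exp_add)
      also have "\<dots> \<le> exp (\<alpha> * ln d)" using \<alpha> lnd by (simp add: mult_right_mono_neg)
      finally have 1: "\<Lambda> ^ n * d \<le> d powr \<alpha>" using 3 by (simp add: powr_def)
      have "r ^ Suc n = exp (real (Suc n) * ln r)" using r by (simp add: exp_of_nat_mult del: of_nat_Suc power_Suc)
      also have "\<dots> \<le> exp (s * ln r)" using n lnr by (simp add: mult_right_mono_neg)
      also have "s * ln r = \<beta> * ln d" by (simp add: s_def \<beta>_def)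
      also have "exp (\<beta> * ln d) \<le> exp (\<alpha> * ln d)" using \<alpha> lnd by (simp add: mult_right_mono_neg)
      finally have "r * r ^ n \<le> d powr \<alpha>" using 3 by (simp add: powr_def)
      then have 2: "r ^ n \<le> d powr \<alpha> / r" using r by (simp add: field_simps)
      have "\<bar>f x - f y\<bar> \<le> A * r ^ n + B * (\<Lambda> ^ n * d)" using est[of x y n] by (simp add: d_def)
      also have "\<dots> \<le> A * (d powr \<alpha> / r) + B * d powr \<alpha>" using 1 2 AB by (intro add_mono mult_left_mono)
      also have "\<dots> = (A / r + B) * d powr \<alpha>" by (simp add: algebra_simps)
      also have "\<dots> \<le> C * d powr \<alpha>" by (intro mult_right_mono) (auto simp: C_def)
      finally show ?thesis by (simp add: d_def)
    qed
  qed
  then show ?thesis unfolding Hoelder_continuous_def using \<alpha> by (intro exI[of _ \<alpha>] exI[of _ C]) auto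
qed

context random_pair begin

lemma q_lens: "complex_of_real q \<in> lens (max q (1 - q))"
proof -
  have "1 - complex_of_real q = of_real (1 - q)" by simp
  then have "norm (1 - complex_of_real q) = 1 - q" using q by (simp only: norm_of_real)
  then show ?thesis using q by (simp add: lens_def)
qed

lemma Hoelder_T: "Hoelder_continuous (T h1 h2 q)"
proof -
  obtain \<Lambda>0 where L0: "\<Lambda>0 \<ge> 1" "\<And>b x y. dist (sstep b x) (sstep b y) \<le> \<Lambda>0 * dist x y" using sstep_lipschitz by blast
  define \<Lambda> where "\<Lambda> = max 2 \<Lambda>0"
  have L: "dist (sstep b x) (sstep b y) \<le> \<Lambda> * dist x y" for b x y
  proof -
    have "\<Lambda>0 * dist x y \<le> \<Lambda> * dist x y" by (intro mult_right_mono) (auto simp: \<Lambda>_def)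
    then show ?thesis using L0(2)[of b x y] by linarith
  qed
  define p where "p = complex_of_real q"
  define r where "r = max q (1 - q)"
  have r: "0 < r" "r < 1" using q by (auto simp: r_def)
  have lip: "norm (profile n p x - profile n p y) \<le> 1 / gap_width * \<Lambda> ^ n * dist x y" for n x y
  proof (induction n arbitrary: x y)
    case 0
    show ?case using profile0_lipschitz[of x y] by (simp add: profile_Suc flip: of_real_diff)
  next
    case (Suc n)
    have b: "norm (profile n p (sstep b x) - profile n p (sstep b y)) \<le> 1 / gap_width * \<Lambda> ^ Suc n * dist x y" for b
    proof -
      have "1 / gap_width * \<Lambda> ^ n * dist (sstep b x) (sstep b y) \<le> 1 / gap_width * \<Lambda> ^ n * (\<Lambda> * dist x y)"
        using L gap_width(1) by (intro mult_left_mono) (auto simp: \<Lambda>_def)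
      then show ?thesis using Suc[of "sstep b x" "sstep b y"] by (simp add: algebra_simps)
    qed
    have "profile (Suc n) p x - profile (Suc n) p y = p * (profile n p (sstep True x) - profile n p (sstep True y)) + (1 - p) * (profile n p (sstep False x) - profile n p (sstep False y))"
      by (simp add: profile_Suc Mc_def algebra_simps)
    then have "norm (profile (Suc n) p x - profile (Suc n) p y) \<le> norm p * norm (profile n p (sstep True x) - profile n p (sstep True y)) + norm (1 - p) * norm (profile n p (sstep False x) - profile n p (sstep False y))"
      by (metis norm_mult norm_triangle_ineq)
    also have "\<dots> \<le> norm p * (1 / gap_width * \<Lambda> ^ Suc n * dist x y) + norm (1 - p) * (1 / gap_width * \<Lambda> ^ Suc n * dist x y)"
      by (intro add_mono mult_left_mono b norm_ge_zero)
    also have "norm p = q" using q by (simp add: p_def)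
    also have "norm (1 - p) = 1 - q"
    proof -
      have "1 - p = of_real (1 - q)" by (simp add: p_def)
      then show ?thesis using q by (simp only: norm_of_real)
    qed
    also have "q * (1 / gap_width * \<Lambda> ^ Suc n * dist x y) + (1 - q) * (1 / gap_width * \<Lambda> ^ Suc n * dist x y) = 1 / gap_width * \<Lambda> ^ Suc n * dist x y"
      unfolding distrib_right[symmetric] by simp
    finally show ?case .
  qed
  obtain C where C: "C > 0" "\<And>x. norm (Tc p x) \<le> C" using bounded_continuous_csphere[OF continuous_Tc] unfolding p_def by metis
  have Tn: "(Mc p ^^ n) (Tc p) = Tc p" for n
  proof (induction n)
    case (Suc n)
    have "Mc p (Tc p) = Tc p" using Tc_fixed[OF q_open_lens] by (auto simp: p_def)
    then show ?case using Suc by simp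
  qed simp
  have err: "norm (profile n p x - Tc p x) \<le> r ^ n * (1 + C)" for n x
  proof -
    have "norm ((Mc p ^^ n) (\<lambda>x. profile 0 p x - Tc p x) x) \<le> r ^ n * (1 + C)"
    proof (rule Mc_pow_contraction[THEN conjunct1])
      show "p \<in> lens r" using q_lens by (simp add: p_def r_def)
      show "profile 0 p x - Tc p x = 0" if "x \<notin> intermediate" for x
        using that profile_bdry[of x 0 p] Tc_K1[OF q_open_lens, of x] Tc_outer[OF q_open_lens, of x]
        by (cases x rule: sphere_cases) (auto simp: p_def)
      show "norm (profile 0 p x - Tc p x) \<le> 1 + C" for x
        using norm_triangle_ineq4[of "profile 0 p x" "Tc p x"] C(2)[of x] profile0_bounds[of x] by (simp add: profile_Suc)
    qed
    moreover have "(Mc p ^^ n) (\<lambda>x. profile 0 p x - Tc p x) x = profile n p x - Tc p x"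
      unfolding Mc_pow_diff Tn by (simp add: profile_def)
    ultimately show ?thesis by simp
  qed
  show ?thesis
  proof (rule Hoelder_interpolation[OF r, of \<Lambda> "2 * (1 + C)" "1 / gap_width"])
    show "\<bar>T h1 h2 q x - T h1 h2 q y\<bar> \<le> 1" for x y using T_bounds[of x] T_bounds[of y] by linarith
    show "\<bar>T h1 h2 q x - T h1 h2 q y\<bar> \<le> 2 * (1 + C) * r ^ n + 1 / gap_width * \<Lambda> ^ n * dist x y" for n x y
    proof -
      have "\<bar>T h1 h2 q x - T h1 h2 q y\<bar> = norm (Tc p x - Tc p y)"
        unfolding p_def T_eq_Tc[symmetric] by (simp flip: of_real_diff)
      also have "Tc p x - Tc p y = (profile n p x - profile n p y) - (profile n p x - Tc p x) + (profile n p y - Tc p y)" by simp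
      also have "norm \<dots> \<le> norm (profile n p x - profile n p y) + norm (profile n p x - Tc p x) + norm (profile n p y - Tc p y)"
        using norm_triangle_ineq[of "(profile n p x - profile n p y) - (profile n p x - Tc p x)" "profile n p y - Tc p y"]
          norm_triangle_ineq4[of "profile n p x - profile n p y" "profile n p x - Tc p x"] by linarith
      also have "\<dots> \<le> 1 / gap_width * \<Lambda> ^ n * dist x y + r ^ n * (1 + C) + r ^ n * (1 + C)"
        by (intro add_mono lip err)
      finally show ?thesis by (simp add: algebra_simps)
    qed
  qed (use C gap_width(1) in \<open>auto simp: \<Lambda>_def\<close>)
qed

section \<open>The Julia set as the set where T varies\<close>

abbreviation planar_T :: "complex \<Rightarrow> real" where "planar_T z \<equiv> T h1 h2 q (Fin z)"

lemma planar_T_fixed: "planar_T z = q * planar_T (poly P z) + (1 - q) * planar_T (poly Q z)" using T_fixed[of "Fin z"] by simp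
lemma planar_T_K1: "z \<in> K1 \<Longrightarrow> planar_T z = 0" by (intro T_K1) auto
lemma planar_T_outside: "z \<notin> interior K2 \<Longrightarrow> planar_T z = 1" by (intro T_outer) (auto simp: outer_def)
lemma planar_T_outside': "z \<notin> K2 \<Longrightarrow> planar_T z = 1" using planar_T_outside interior_subset by blast

text \<open>With probability at least \<open>q ^ n\<close> the first \<open>n\<close> letters are all \<open>P\<close>, which leads beyond the escape radius for large \<open>n\<close>.\<close>

lemma planar_T_pos: assumes "z \<notin> K1" shows "0 < planar_T z"
proof -
  have *: "q ^ n * planar_T ((poly P ^^ n) z) \<le> planar_T z" for n z
  proof (induction n arbitrary: z)
    case (Suc n)
    have "q * (q ^ n * planar_T ((poly P ^^ n) (poly P z))) \<le> q * planar_T (poly P z)" using Suc q by (intro mult_left_mono) auto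
    also have "\<dots> \<le> planar_T z" using planar_T_fixed[of z] T_bounds(1)[of "Fin (poly Q z)"] q by simp
    finally show ?case by (simp add: funpow_swap1 mult.assoc)
  qed simp
  obtain N where "\<And>z' n. z' \<in> {z} \<Longrightarrow> N \<le> n \<Longrightarrow> Rad < norm ((poly P ^^ n) z')"
    by (rule uniform_escape[OF escape_radius_Rad(1), of "{z}"]) (use assms in auto)
  then have "Rad < norm ((poly P ^^ N) z)" by blast
  then have "planar_T ((poly P ^^ N) z) = 1" by (intro T_nbhd_Infty) simp
  then show ?thesis using *[of N z] q by (smt (verit) zero_less_power mult_cancel_left2)
qed

text \<open>If the value were \<open>1\<close>, the whole \<open>Q\<close>-orbit would have the value \<open>1\<close> and thus never enter \<open>K1\<close>. The point would then survive with
the itinerary \<open>Q, Q, \<dots>\<close>, although the iterates of \<open>Q\<close> are bounded near it.\<close>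

lemma planar_T_less_1: assumes z: "z \<in> interior K2" shows "planar_T z < 1"
proof (rule ccontr)
  assume "\<not> planar_T z < 1"
  then have t1: "planar_T z = 1" using T_bounds(2)[of "Fin z"] by linarith
  have Qt: "planar_T (poly Q u) = 1" if "planar_T u = 1" for u
  proof (rule ccontr)
    assume "planar_T (poly Q u) \<noteq> 1"
    then have "planar_T (poly Q u) < 1" using T_bounds(2)[of "Fin (poly Q u)"] by linarith
    then have "(1 - q) * planar_T (poly Q u) < (1 - q) * 1" using q by (intro mult_strict_left_mono) auto
    moreover have "q * planar_T (poly P u) \<le> q * 1" using q T_bounds(2)[of "Fin (poly P u)"] by (intro mult_left_mono) auto
    ultimately show False using planar_T_fixed[of u] that by simp
  qed
  have orb: "planar_T ((poly Q ^^ n) z) = 1 \<and> (poly Q ^^ n) z \<in> interior K2" for n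
    by (induction n) (auto simp: t1 z Qt Q_interior_K2)
  have D: "u \<in> surviving n" if "(poly Q ^^ n) u \<in> surviving 0" for u n using that
  proof (induction n arbitrary: u)
    case (Suc n)
    then have "poly Q u \<in> surviving n" by (intro Suc.IH) (simp add: funpow_swap1)
    then show ?case by simp
  qed simp
  have J: "(poly Q ^^ m) z \<in> survivors" for m
    unfolding survivors_def
  proof
    fix n
    have "(poly Q ^^ n) ((poly Q ^^ m) z) \<in> surviving 0"
      using orb[of "n + m"] planar_T_K1[of "(poly Q ^^ (n + m)) z"] interior_subset by (auto simp: funpow_plus_apply)
    then show "(poly Q ^^ m) z \<in> surviving n" by (rule D)
  qed
  have rep: "map (\<lambda>_. False) [0..<n] = replicate n False" for n by (simp add: map_replicate_const)
  have in_J: "run (map (\<lambda>_. False) [0..<n]) z \<in> survivors" for n using J by (simp add: rep run_replicate)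
  obtain s where s: "s > 0" "ball z s \<subseteq> interior K2" using z openE[OF open_interior] by metis
  obtain n y where y: "y \<in> ball z s" "Rad < norm (run (map (\<lambda>_. False) [0..<n]) y)" using survivors_runs_unbounded[OF in_J s(1)] by blast
  have "y \<in> K2" using y(1) s(2) interior_subset by blast
  then have "(poly Q ^^ n) y \<in> K2" by (simp add: fillK_funpow)
  then show False using y(2) fillK_norm_less[OF escape_radius_Rad(2)] by (simp add: rep run_replicate) (meson less_asym)
qed

text \<open>On \<open>{z. P z \<in> K2}\<close> the values of \<open>T\<close> are at most \<open>q\<close>, elsewhere at least \<open>q\<close>. A set on which \<open>T\<close> is constant
and which contains a survivor cannot meet both parts, by the strict inequalities \<open>0 < T\<close> and \<open>T < 1\<close> off the
boundary values; on each part \<open>T\<close> is an affine function of its value at the image.\<close>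

lemma constant_step:
  assumes V: "open V" and c: "\<And>v. v \<in> V \<Longrightarrow> planar_T v = c" and x: "x \<in> V" "x \<in> survivors" "step b x \<in> survivors"
  shows "V \<subseteq> interior K2" "\<exists>c'. \<forall>v\<in>V. planar_T (step b v) = c'"
proof -
  have xD: "x \<in> K2" "x \<notin> interior K1" using JstD[OF x(2)] by auto
  have xb: "step b x \<in> K2" "step b x \<notin> interior K1" using JstD[OF x(3)] by auto
  show sub: "V \<subseteq> interior K2"
  proof
    fix v assume v: "v \<in> V"
    show "v \<in> interior K2"
    proof (rule ccontr)
      assume "v \<notin> interior K2"
      then have "c = 1" using c[OF v] planar_T_outside by simp
      moreover have "x \<in> closure (interior K2)" using closure_interior_K2 xD by blast
      then obtain y where "y \<in> V" "y \<in> interior K2" using V x(1) closure_iff_nhds_not_empty[of x "interior K2"] by blast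
      ultimately show False using c planar_T_less_1 by fastforce
    qed
  qed
  have outP: "planar_T v = q + (1 - q) * planar_T (poly Q v)" if "poly P v \<notin> K2" for v
    using planar_T_fixed[of v] planar_T_outside'[OF that] by simp
  have inP: "planar_T v = q * planar_T (poly P v)" if "poly P v \<in> K2" for v
    using planar_T_fixed[of v] planar_T_K1[OF P_K2[OF that]] by simp
  show "\<exists>c'. \<forall>v\<in>V. planar_T (step b v) = c'"
  proof (cases b)
    case True
    have "poly P v \<in> K2" if v: "v \<in> V" for v
    proof (rule ccontr)
      assume "poly P v \<notin> K2"
      then have "q \<le> c" using outP[of v] c[OF v] T_bounds(1)[of "Fin (poly Q v)"] q by simp
      have "open (poly P ` V)" using V by (rule openP)
      moreover have "poly P x \<in> closure (interior K2)" using closure_interior_K2 xb True by auto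
      ultimately obtain y where y: "y \<in> V" "poly P y \<in> interior K2"
        using x(1) closure_iff_nhds_not_empty[of "poly P x" "interior K2"] by blast
      have "q * planar_T (poly P y) < q * 1" using planar_T_less_1[OF y(2)] q by (intro mult_strict_left_mono) auto
      moreover have "poly P y \<in> K2" using y(2) interior_subset by blast
      ultimately have "c < q" using c[OF y(1)] inP[of y] by simp
      then show False using \<open>q \<le> c\<close> by simp
    qed
    then have "planar_T (poly P v) = c / q" if "v \<in> V" for v using inP[of v] c[OF that] q that by (simp add: field_simps)
    then show ?thesis using True by auto
  next
    case False
    have "open (poly Q ` V)" using V by (rule openQ)
    moreover have "poly Q x \<in> poly Q ` V" "poly Q x \<notin> interior K1" using x(1) xb False by auto
    ultimately have "\<not> poly Q ` V \<subseteq> K1" by (meson interior_maximal subsetD)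
    then obtain y where y: "y \<in> V" "poly Q y \<notin> K1" by blast
    have "poly P y \<notin> K2" using y(2) P_K2 by blast
    then have cq: "q < c" using outP[of y] c[OF y(1)] planar_T_pos[OF y(2)] q by simp
    have "poly P v \<notin> K2" if v: "v \<in> V" for v
    proof
      assume a: "poly P v \<in> K2"
      have "q * planar_T (poly P v) \<le> q * 1" using q T_bounds(2)[of "Fin (poly P v)"] by (intro mult_left_mono) auto
      then show False using inP[OF a] c[OF v] cq by simp
    qed
    then have "planar_T (poly Q v) = (c - q) / (1 - q)" if "v \<in> V" for v using outP[of v] c[OF that] q that by (simp add: field_simps)
    then show ?thesis using False by auto
  qed
qed

text \<open>Constancy is carried along the itinerary, so all images of the disc would stay in \<open>K2\<close>.\<close>

lemma T_nonconstant_survivors: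
  assumes x: "x \<in> survivors" and s: "0 < s"
  shows "\<not> (\<exists>c. \<forall>v\<in>ball x s. planar_T v = c)"
proof
  assume "\<exists>c. \<forall>v\<in>ball x s. planar_T v = c"
  then obtain c where c: "\<And>v. v \<in> ball x s \<Longrightarrow> planar_T v = c" by blast
  obtain \<beta> where \<beta>: "\<And>n. run (map \<beta> [0..<n]) x \<in> survivors" using survivors_itinerary[OF x] by metis
  have const: "\<exists>c. \<forall>v\<in>run (map \<beta> [0..<n]) ` ball x s. planar_T v = c" for n
  proof (induction n)
    case 0 then show ?case using c by auto
  next
    case (Suc n)
    let ?V = "run (map \<beta> [0..<n]) ` ball x s"
    obtain c where c: "\<And>v. v \<in> ?V \<Longrightarrow> planar_T v = c" using Suc by blast
    have "\<exists>c'. \<forall>v\<in>?V. planar_T (step (\<beta> n) v) = c'"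
    proof (rule constant_step(2)[OF _ c])
      show "open ?V" by (rule open_run) simp
      show "run (map \<beta> [0..<n]) x \<in> ?V" using s by auto
      show "step (\<beta> n) (run (map \<beta> [0..<n]) x) \<in> survivors" using \<beta>[of "Suc n"] by simp
    qed (assumption | rule \<beta>)+
    then show ?case by simp
  qed
  have sub: "run (map \<beta> [0..<n]) ` ball x s \<subseteq> interior K2" for n
  proof -
    obtain c where c: "\<And>v. v \<in> run (map \<beta> [0..<n]) ` ball x s \<Longrightarrow> planar_T v = c" using const[of n] by blast
    show ?thesis
    proof (rule constant_step(1)[OF _ c])
      show "open (run (map \<beta> [0..<n]) ` ball x s)" by (rule open_run) simp
      show "run (map \<beta> [0..<n]) x \<in> run (map \<beta> [0..<n]) ` ball x s" using s by auto
      show "step (\<beta> n) (run (map \<beta> [0..<n]) x) \<in> survivors" using \<beta>[of "Suc n"] by simp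
    qed (assumption | rule \<beta>)+
  qed
  obtain n y where y: "y \<in> ball x s" "Rad < norm (run (map \<beta> [0..<n]) y)" using survivors_runs_unbounded[OF \<beta> s] by blast
  then have "run (map \<beta> [0..<n]) y \<in> K2" using sub[of n] interior_subset by blast
  then show False using y(2) fillK_norm_less[OF escape_radius_Rad(2)] less_asym by blast
qed

lemma Julia_eq_nonconstant: "Julia G = {z0. \<forall>V. open V \<and> z0 \<in> V \<longrightarrow> \<not> T h1 h2 q constant_on V}"
proof
  show "Julia G \<subseteq> {z0. \<forall>V. open V \<and> z0 \<in> V \<longrightarrow> \<not> T h1 h2 q constant_on V}"
  proof
    fix z0 assume "z0 \<in> Julia G"
    then obtain x where x: "x \<in> survivors" "z0 = Fin x" by (auto simp: Julia_eq)
    have "\<not> T h1 h2 q constant_on V" if V: "open V" "z0 \<in> V" for V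
    proof
      assume "T h1 h2 q constant_on V"
      then obtain c where c: "\<And>v. v \<in> V \<Longrightarrow> T h1 h2 q v = c" by (auto simp: constant_on_def)
      obtain s where "s > 0" "ball x s \<subseteq> Fin -` V" using openE[OF open_vimage_Fin[OF V(1)], of x] V(2) x by auto
      then show False using T_nonconstant_survivors[OF x(1), of s] c by blast
    qed
    then show "z0 \<in> {z0. \<forall>V. open V \<and> z0 \<in> V \<longrightarrow> \<not> T h1 h2 q constant_on V}" by blast
  qed
  show "{z0. \<forall>V. open V \<and> z0 \<in> V \<longrightarrow> \<not> T h1 h2 q constant_on V} \<subseteq> Julia G"
  proof (rule ccontr)
    assume "\<not> {z0. \<forall>V. open V \<and> z0 \<in> V \<longrightarrow> \<not> T h1 h2 q constant_on V} \<subseteq> Julia G"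
    then obtain z0 where z0: "z0 \<notin> Fin ` survivors" "\<And>V. open V \<Longrightarrow> z0 \<in> V \<Longrightarrow> \<not> T h1 h2 q constant_on V" unfolding Julia_eq by blast
    from Tc_locally_constant[OF z0(1)] obtain V where V0: "open V" "z0 \<in> V" "\<forall>u\<in>open_lens. \<forall>y\<in>V. Tc u y = Tc u z0" by blast
    then have V: "open V" "z0 \<in> V" "\<And>y. y \<in> V \<Longrightarrow> Tc (of_real q) y = Tc (of_real q) z0" using q_open_lens by blast+
    have "T h1 h2 q y = T h1 h2 q z0" if "y \<in> V" for y
    proof -
      have "complex_of_real (T h1 h2 q y) = of_real (T h1 h2 q z0)" unfolding T_eq_Tc by (rule V(3)[OF that])
      then show ?thesis by simp
    qed
    then have "T h1 h2 q constant_on V" by (auto simp: constant_on_def)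
    then show False using z0(2) V by blast
  qed
qed

end

section \<open>Dependence on the probability parameter\<close>

lemma locally_constant_onI:
  assumes "\<And>x. x \<in> S \<Longrightarrow> \<exists>V. open V \<and> x \<in> V \<and> (\<forall>y\<in>V. f y = f x)"
  shows "locally (\<lambda>V. f constant_on V) S"
  unfolding locally_def
proof (intro allI impI, elim conjE)
  fix w x assume w: "openin (top_of_set S) w" "x \<in> w"
  then have "x \<in> S" using openin_imp_subset by blast
  then obtain V where V: "open V" "x \<in> V" "\<forall>y\<in>V. f y = f x" using assms by blast
  show "\<exists>u v. openin (top_of_set S) u \<and> f constant_on v \<and> x \<in> u \<and> u \<subseteq> v \<and> v \<subseteq> w"
  proof (intro exI conjI)
    show "openin (top_of_set S) (w \<inter> V)" using w(1) V(1) by (rule openin_Int_open)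
    show "f constant_on w \<inter> V" unfolding constant_on_def using V(3) by blast
  qed (use w V in auto)
qed

context poly_pair begin

lemma T_eq_Tc_param: assumes "q \<in> {0<..<1}" shows "complex_of_real (T (poly_map P) (poly_map Q) q z) = Tc (of_real q) z"
proof -
  interpret random_pair P Q q by unfold_locales (use assms in auto)
  show ?thesis by (rule T_eq_Tc)
qed

lemma dT_eq_dTc: assumes "q \<in> {0<..<1}" shows "complex_of_real (dT n (poly_map P) (poly_map Q) q z) = dTc n (of_real q) z"
  unfolding dT_def dTc_def
  by (rule higher_deriv_real_restriction[OF open_open_lens holomorphic_Tc _ assms]) (use T_eq_Tc_param of_real_open_lens in blast)

lemma real_analytic_T: "real_analytic_on (\<lambda>q. T (poly_map P) (poly_map Q) q z) {0<..<1}"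
  unfolding real_analytic_on_def
proof
  fix x :: real assume x: "x \<in> {0<..<1}"
  obtain r where r: "r > 0" "ball (complex_of_real x) r \<subseteq> open_lens" using openE[OF open_open_lens of_real_open_lens[OF x]] by blast
  define a where "a = (\<lambda>n. Re ((deriv ^^ n) (\<lambda>p. Tc p z) (of_real x) / fact n))"
  have "(\<lambda>n. a n * (y - x) ^ n) sums T (poly_map P) (poly_map Q) y z" if y: "\<bar>y - x\<bar> < r" for y
  proof -
    have yb: "complex_of_real y \<in> ball (of_real x) r" using y by (simp add: dist_norm norm_minus_commute flip: of_real_diff)
    then have yo: "complex_of_real y \<in> open_lens" using r by blast
    have "y \<in> {0<..<1}"
    proof -
      have "1 - complex_of_real y = of_real (1 - y)" by simp
      then have "norm (1 - complex_of_real y) = \<bar>1 - y\<bar>" by (simp only: norm_of_real)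
      then show ?thesis using yo by (auto simp: open_lens_def)
    qed
    then have T: "T (poly_map P) (poly_map Q) y z = Re (Tc (of_real y) z)" using T_eq_Tc_param by (metis Re_complex_of_real)
    have "(\<lambda>n. (deriv ^^ n) (\<lambda>p. Tc p z) (of_real x) / fact n * (of_real y - of_real x) ^ n) sums Tc (of_real y) z"
      by (rule holomorphic_power_series[OF holomorphic_on_subset[OF holomorphic_Tc r(2)] yb])
    then have "(\<lambda>n. Re ((deriv ^^ n) (\<lambda>p. Tc p z) (of_real x) / fact n * (of_real y - of_real x) ^ n)) sums Re (Tc (of_real y) z)"
      by (rule sums_Re)
    moreover have "Re (c * (of_real y - of_real x) ^ n) = Re c * (y - x) ^ n" for c :: complex and n
    proof -
      have "(complex_of_real y - of_real x) ^ n = of_real ((y - x) ^ n)" by simp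
      then show ?thesis by (simp only: Re_complex_of_real Im_complex_of_real times_complex.sel mult_zero_right diff_zero)
    qed
    ultimately show ?thesis by (simp only: a_def T)
  qed
  then show "\<exists>r>0. \<exists>a. \<forall>y. \<bar>y - x\<bar> < r \<longrightarrow> (\<lambda>n. a n * (y - x) ^ n) sums T (poly_map P) (poly_map Q) y z"
    using r(1) by blast
qed

lemma continuous_dT: "continuous_on ({0<..<1} \<times> UNIV) (\<lambda>(q, z). dT n (poly_map P) (poly_map Q) q z)"
proof -
  have "continuous_on ({0<..<1} \<times> UNIV) ((\<lambda>(p, z). dTc n p z) \<circ> (\<lambda>(q, z). (complex_of_real q, z)))"
  proof (rule continuous_on_compose)
    show "continuous_on ({0<..<1} \<times> UNIV) (\<lambda>(q, z :: csphere). (complex_of_real q, z))"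
      unfolding case_prod_unfold by (intro continuous_intros)
    show "continuous_on ((\<lambda>(q, z). (complex_of_real q, z)) ` ({0<..<1} \<times> UNIV)) (\<lambda>(p, z). dTc n p z)"
      by (rule continuous_on_subset[OF continuous_dTc]) (use of_real_open_lens in auto)
  qed
  then have "continuous_on ({0<..<1} \<times> UNIV) (\<lambda>x. Re (((\<lambda>(p, z). dTc n p z) \<circ> (\<lambda>(q, z). (complex_of_real q, z))) x))"
    by (rule continuous_on_Re)
  moreover have "Re (((\<lambda>(p, z). dTc n p z) \<circ> (\<lambda>(q, z). (complex_of_real q, z))) x) = (\<lambda>(q, z). dT n (poly_map P) (poly_map Q) q z) x"
    if x: "x \<in> {0<..<1} \<times> UNIV" for x
  proof (cases x)
    case (Pair q z)
    then have "q \<in> {0<..<1}" using x by simp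
    from dT_eq_dTc[OF this, of n z] show ?thesis using Pair by (simp flip: dT_eq_dTc) (metis Re_complex_of_real)
  qed
  ultimately show ?thesis by (rule continuous_on_eq)
qed

text \<open>Adding infinity to the image of a connected outer region keeps it connected, as infinity is in its closure.\<close>

lemma nbhd_Infty_Fatou_infty: "nbhd_Infty Rad \<subseteq> Fatou_infty G"
  unfolding Fatou_infty_def
proof (rule connected_component_maximal)
  show "Infty \<in> nbhd_Infty Rad" by simp
  show "nbhd_Infty Rad \<subseteq> Fatou G"
    unfolding Fatou_eq using JstD fillK_norm_less[OF escape_radius_Rad(2)] by (fastforce simp: nbhd_Infty_def)
  have eq: "{z::complex. Rad < norm z} = - cball 0 Rad" by auto
  have "connected (- cball (0::complex) Rad)" by (rule connected_complement_bounded_convex) auto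
  then have c1: "connected (Fin ` {z. Rad < norm z})" unfolding eq by (intro connected_continuous_image continuous_on_Fin)
  have c2: "Infty \<in> closure (Fin ` {z. Rad < norm z})"
  proof (unfold closure_iff_nhds_not_empty, intro allI impI)
    fix A S assume S: "S \<subseteq> A" "open S" "Infty \<in> S"
    obtain R where R: "nbhd_Infty R \<subseteq> S" using open_Infty_imp_nbhd[OF S(2,3)] by metis
    obtain z :: complex where z: "norm z = max R Rad + 1" using vector_choose_size[of "max R Rad + 1"] Rad_ge1 by (metis add_nonneg_nonneg max.coboundedI2 order_trans zero_le_one)
    then have "Fin z \<in> nbhd_Infty R" "z \<in> {z. Rad < norm z}" by auto
    then show "Fin ` {z. Rad < norm z} \<inter> A \<noteq> {}" using R S by blast
  qed
  show "connected (nbhd_Infty Rad)" unfolding nbhd_Infty_def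
  proof (rule connected_intermediate_closure[OF c1])
    show "insert Infty (Fin ` {z. Rad < norm z}) \<subseteq> closure (Fin ` {z. Rad < norm z})"
      using c2 closure_subset by (rule insert_subsetI)
  qed blast
qed

text \<open>Local constancy on the Fatou set and connectedness carry the value at infinity through the component.\<close>

lemma Tc_Fatou_infty: assumes "x \<in> Fatou_infty G" "u \<in> open_lens" shows "Tc u x = 1"
proof -
  let ?S = "Fatou_infty G"
  have I: "Infty \<in> ?S" using nbhd_Infty_Fatou_infty by auto
  have "Tc u Infty = Tc u x"
  proof (rule connected_equivalence_relation[of ?S Infty x "\<lambda>x y. Tc u x = Tc u y"])
    show "connected ?S" unfolding Fatou_infty_def by (rule connected_connected_component)
    fix a assume a: "a \<in> ?S"
    then have "a \<in> Fatou G" unfolding Fatou_infty_def using connected_component_subset by blast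
    then have "a \<notin> Fin ` survivors" by (simp add: Fatou_eq)
    from Tc_locally_constant[OF this] obtain V where V0: "open V" "a \<in> V" "\<forall>u\<in>open_lens. \<forall>y\<in>V. Tc u y = Tc u a" by blast
    then have V: "open V" "a \<in> V" "\<And>y. y \<in> V \<Longrightarrow> Tc u y = Tc u a" using assms(2) by blast+
    show "\<exists>T. openin (top_of_set ?S) T \<and> a \<in> T \<and> (\<forall>x\<in>T. Tc u a = Tc u x)"
    proof (intro exI[of _ "?S \<inter> V"] conjI ballI)
      show "openin (top_of_set ?S) (?S \<inter> V)" using V(1) by (rule openin_open_Int)
      show "a \<in> ?S \<inter> V" using a V(2) by simp
      show "Tc u a = Tc u x" if "x \<in> ?S \<inter> V" for x using V(3)[of x] that by simp
    qed
  qed (use I assms in auto)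
  then show ?thesis using Tc_outer[OF assms(2), of Infty] by (simp add: outer_def image_iff)
qed

end

context random_pair begin

lemma q_in: "q \<in> {0<..<1}" using q by simp

lemma absorbing_subset: "absorbing \<subseteq> Khat G \<union> Fatou_infty G"
  unfolding absorbing_def Khat_eq using nbhd_Infty_Fatou_infty by blast

text \<open>The uniqueness in both characterisations: the inhomogeneities cancel.\<close>

lemma fixed_difference_zero:
  assumes \<phi>: "continuous_on UNIV \<phi>" and \<psi>: "continuous_on UNIV \<psi>"
    and fx: "\<And>z. \<phi> z = M \<phi> z + g z" "\<And>z. \<psi> z = M \<psi> z + g z" and eq: "\<And>z. z \<in> Khat G \<union> Fatou_infty G \<Longrightarrow> \<phi> z = \<psi> z"
  shows "\<phi> = \<psi>"
proof
  fix z
  obtain C where C: "\<And>x. norm (\<phi> x - \<psi> x) \<le> C"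
    using bounded_continuous_csphere[OF continuous_on_diff[OF \<phi> \<psi>]] by metis
  have "\<phi> z - \<psi> z = 0"
  proof (rule Mc_fixed_unique[OF q, of "\<lambda>z. \<phi> z - \<psi> z" C])
    show "M (\<lambda>z. \<phi> z - \<psi> z) x = \<phi> x - \<psi> x" for x using fx(1)[of x] fx(2)[of x] by (simp add: Mc_diff)
    show "\<phi> x - \<psi> x = 0" if "x \<in> absorbing" for x using eq[of x] absorbing_subset that by auto
  qed (rule C)
  then show "\<phi> z = \<psi> z" by simp
qed

lemma of_real_T: "(\<lambda>z. complex_of_real (T h1 h2 q z)) = Tc (of_real q)" using T_eq_Tc by auto

lemma T_characterization:
  "{\<phi>. continuous_on UNIV \<phi> \<and> M_op h1 h2 q \<phi> = \<phi> \<and> (\<forall>z\<in>Khat G. \<phi> z = 0) \<and> (\<forall>z\<in>Fatou_infty G. \<phi> z = 1)}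
    = {\<lambda>z. of_real (T h1 h2 q z)}" (is "?S = _")
proof -
  have ex: "Tc (of_real q) \<in> ?S"
    using continuous_Tc Tc_fixed[OF q_open_lens] Tc_K1[OF q_open_lens] Tc_Fatou_infty[OF _ q_open_lens] by (auto simp: M_op_Mc Khat_eq)
  have "\<phi> = Tc (of_real q)" if \<phi>: "\<phi> \<in> ?S" for \<phi>
  proof (rule fixed_difference_zero[where g = "\<lambda>_. 0"])
    show "\<phi> z = M \<phi> z + 0" for z using \<phi> by (simp add: M_op_Mc)
    show "Tc (of_real q) z = M (Tc (of_real q)) z + 0" for z using Tc_fixed[OF q_open_lens] by simp
    show "\<phi> z = Tc (of_real q) z" if "z \<in> Khat G \<union> Fatou_infty G" for z using \<phi> ex that by auto
  qed (use \<phi> continuous_Tc in auto)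
  then show ?thesis unfolding of_real_T using ex by blast
qed

lemma of_real_dT: "(\<lambda>z. complex_of_real (dT n h1 h2 q z)) = dTc n (of_real q)" using dT_eq_dTc[OF q_in] by auto

lemma dTc_vanish: assumes "z \<in> Khat G \<union> Fatou_infty G" shows "dTc (Suc n) (of_real q) z = 0"
  using assms
proof
  assume "z \<in> Khat G"
  then show ?thesis using Tc_K1 by (intro dTc_const[OF q_open_lens, of z 0]) (auto simp: Khat_eq)
next
  assume "z \<in> Fatou_infty G"
  then show ?thesis using Tc_Fatou_infty by (intro dTc_const[OF q_open_lens, of z 1]) auto
qed

lemma dT_characterization:
  "{\<phi>. continuous_on UNIV \<phi>
       \<and> (\<forall>z. \<phi> z = M_op h1 h2 q \<phi> z + of_nat (n + 1) * of_real (dT n h1 h2 q (h1 z) - dT n h1 h2 q (h2 z)))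
       \<and> (\<forall>z \<in> Khat G \<union> Fatou_infty G. \<phi> z = 0)}
     = {\<lambda>z. of_real (dT (n + 1) h1 h2 q z)}" (is "?S = _")
proof -
  let ?g = "\<lambda>z. of_nat (n + 1) * (dTc n (of_real q) (h1 z) - dTc n (of_real q) (h2 z))"
  have geq: "of_nat (n + 1) * of_real (dT n h1 h2 q (h1 z) - dT n h1 h2 q (h2 z)) = ?g z" for z
    by (simp add: dT_eq_dTc[OF q_in])
  have rec: "dTc (n + 1) (of_real q) z = M (dTc (n + 1) (of_real q)) z + ?g z" for z using dTc_recursion[OF q_open_lens, of n z] by simp
  have ex: "dTc (n + 1) (of_real q) \<in> ?S"
    unfolding geq M_op_Mc using continuous_dTc_snd[OF q_open_lens, of "n+1"] rec dTc_vanish[of _ n] by auto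
  have "\<phi> = dTc (n + 1) (of_real q)" if \<phi>: "\<phi> \<in> ?S" for \<phi>
  proof (rule fixed_difference_zero[where g = ?g])
    show "\<phi> z = M \<phi> z + ?g z" for z using \<phi> unfolding geq M_op_Mc by blast
    show "\<phi> z = dTc (n + 1) (of_real q) z" if z: "z \<in> Khat G \<union> Fatou_infty G" for z
    proof -
      have "\<phi> z = 0" using \<phi> z by blast
      then show ?thesis using dTc_vanish[OF z, of n] by simp
    qed
    show "continuous_on UNIV \<phi>" using \<phi> by blast
  qed (rule continuous_dTc_snd[OF q_open_lens], rule rec)
  then show ?thesis unfolding of_real_dT using ex by blast
qed

lemma locally_constant_T: "locally (\<lambda>V. T h1 h2 q constant_on V) (Fatou G)"
proof (rule locally_constant_onI)
  fix x assume "x \<in> Fatou G"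
  then have "x \<notin> Fin ` survivors" by (simp add: Fatou_eq)
  from Tc_locally_constant[OF this] obtain V where V0: "open V" "x \<in> V" "\<forall>u\<in>open_lens. \<forall>y\<in>V. Tc u y = Tc u x" by blast
  then have V: "open V" "x \<in> V" "\<And>y. y \<in> V \<Longrightarrow> Tc (of_real q) y = Tc (of_real q) x" using q_open_lens by blast+
  have "T h1 h2 q y = T h1 h2 q x" if "y \<in> V" for y
  proof -
    have "complex_of_real (T h1 h2 q y) = of_real (T h1 h2 q x)" unfolding T_eq_Tc by (rule V(3)[OF that])
    then show ?thesis by simp
  qed
  then show "\<exists>V. open V \<and> x \<in> V \<and> (\<forall>y\<in>V. T h1 h2 q y = T h1 h2 q x)" using V by blast
qed

lemma locally_constant_dT: "locally (\<lambda>V. dT n h1 h2 q constant_on V) (Fatou G)"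
proof (rule locally_constant_onI)
  fix x assume "x \<in> Fatou G"
  then have "x \<notin> Fin ` survivors" by (simp add: Fatou_eq)
  from Tc_locally_constant[OF this] obtain V where V0: "open V" "x \<in> V" "\<forall>u\<in>open_lens. \<forall>y\<in>V. Tc u y = Tc u x" by blast
  then have V: "open V" "x \<in> V" "\<And>u y. u \<in> open_lens \<Longrightarrow> y \<in> V \<Longrightarrow> Tc u y = Tc u x" by blast+
  have "dT n h1 h2 q y = dT n h1 h2 q x" if "y \<in> V" for y
  proof -
    have "complex_of_real (dT n h1 h2 q y) = of_real (dT n h1 h2 q x)"
      unfolding dT_eq_dTc[OF q_in] by (rule dTc_cong[OF q_open_lens V(3)[OF _ that]])
    then show ?thesis by simp
  qed
  then show "\<exists>V. open V \<and> x \<in> V \<and> (\<forall>y\<in>V. dT n h1 h2 q y = dT n h1 h2 q x)" using V by blast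
qed

lemma dT_series:
  "uniform_limit UNIV (\<lambda>N z. \<Sum>j<N. (M_op h1 h2 q ^^ j)
      (\<lambda>w. of_nat (n + 1) * of_real (dT n h1 h2 q (h1 w) - dT n h1 h2 q (h2 w))) z)
    (\<lambda>z. of_real (dT (n + 1) h1 h2 q z)) sequentially"
proof -
  have geq: "(\<lambda>w. of_nat (n + 1) * of_real (dT n h1 h2 q (h1 w) - dT n h1 h2 q (h2 w))) =
     (\<lambda>w. of_nat (Suc n) * (dTc n (of_real q) (h1 w) - dTc n (of_real q) (h2 w)))"
    by (simp add: dT_eq_dTc[OF q_in])
  show ?thesis unfolding geq M_op_Mc of_real_dT using dTc_series[OF q_open_lens, of n] by simp
qed

end

section \<open>From the sphere to the plane\<close>

lemma poly_map_funpow: "(poly_map P ^^ n) (Fin z) = Fin ((poly P ^^ n) z)" by (induction n) auto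

lemma filled_Julia_poly_map: "filled_Julia (poly_map P) = Fin ` fillK P"
proof -
  have "bounded_in_plane {(poly_map P ^^ n) (Fin z) | n. True} \<longleftrightarrow> z \<in> fillK P" for z
  proof -
    have "Fin -` {(poly_map P ^^ n) (Fin z) | n. True} = range (\<lambda>n. (poly P ^^ n) z)" by (auto simp: poly_map_funpow)
    moreover have "Infty \<notin> {(poly_map P ^^ n) (Fin z) | n. True}" by (auto simp: poly_map_funpow)
    ultimately show ?thesis by (simp add: bounded_in_plane_def fillK_def)
  qed
  then show ?thesis unfolding filled_Julia_def by auto
qed

text \<open>A critical point of \<open>P\<close> or \<open>Q\<close> is critical for that map followed by any iterate of \<open>P\<close>, so the \<open>P\<close>-orbit of its value
consists of planar postcritical points.\<close>

lemma critical_value_in_fillK: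
  assumes bd: "bounded_in_plane (planar_postcritical (semigroup_gen {poly_map P, poly_map Q}))"
    and B: "B = P \<or> B = Q" and a: "poly (pderiv B) a = 0"
  shows "poly B a \<in> fillK P"
proof -
  let ?G = "semigroup_gen {poly_map P, poly_map Q}"
  have g: "(poly_map P ^^ n) \<circ> poly_map B \<in> ?G" for n
  proof (induction n)
    case 0
    have "poly_map B \<in> ?G" using B by (intro semigroup_gen.gen) auto
    then show ?case by simp
  next
    case (Suc n)
    have "poly_map P \<circ> ((poly_map P ^^ n) \<circ> poly_map B) \<in> ?G" by (intro semigroup_gen.comp Suc semigroup_gen.gen) auto
    then show ?case by (simp only: funpow.simps comp_assoc)
  qed
  have "(poly P ^^ n) (poly B a) \<in> Fin -` planar_postcritical ?G" for n
  proof -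
    let ?g = "(poly_map P ^^ n) \<circ> poly_map B"
    have ga: "?g (Fin w) = Fin ((poly P ^^ n) (poly B w))" for w by (simp add: poly_map_funpow)
    obtain R where R: "poly R = poly P ^^ n" using poly_funpow_poly .
    have "((poly R \<circ> poly B) has_field_derivative poly (pderiv R) (poly B a) * poly (pderiv B) a) (at a)"
      by (rule DERIV_chain[OF poly_DERIV poly_DERIV])
    then have "((coord (?g (Fin a)) \<circ> ?g \<circ> param (Fin a)) has_field_derivative 0) (at (coord (Fin a) (Fin a)))"
      using a by (simp add: ga R o_def poly_map_funpow)
    then have "Fin a \<in> critical_points ?g" by (simp add: critical_points_def)
    then have "Fin ((poly P ^^ n) (poly B a)) \<in> critical_values ?g" unfolding critical_values_def using ga by (metis imageI)
    then have "Fin ((poly P ^^ n) (poly B a)) \<in> (\<Union>g\<in>?G. critical_values g)" using g by blast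
    then have "Fin ((poly P ^^ n) (poly B a)) \<in> postcritical ?G" unfolding postcritical_def by (rule closure_subset[THEN subsetD])
    then show ?thesis by (simp add: planar_postcritical_def)
  qed
  then have "range (\<lambda>n. (poly P ^^ n) (poly B a)) \<subseteq> Fin -` planar_postcritical ?G" by blast
  then show ?thesis using bd unfolding bounded_in_plane_def fillK_def by (auto intro: bounded_subset)
qed

text \<open>The open set condition is read off on \<open>U = interior K\<^sub>2 - K\<^sub>1\<close>: backward invariance under \<open>Q\<close> gives \<open>Q(K\<^sub>1) \<subseteq> K\<^sub>1\<close>, and
disjointness of the preimages gives the implication from \<open>P z \<in> interior K\<^sub>2\<close> to \<open>Q z \<in> K\<^sub>1\<close>.\<close>

lemma poly_pairI:
  assumes deg: "2 \<le> degree P" "2 \<le> degree Q"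
    and bd: "bounded_in_plane (planar_postcritical (semigroup_gen {poly_map P, poly_map Q}))"
    and nest: "filled_Julia (poly_map P) \<subseteq> interior (filled_Julia (poly_map Q))"
    and osc: "open_set_condition (poly_map P) (poly_map Q) (interior (filled_Julia (poly_map Q)) - filled_Julia (poly_map P))"
  shows "poly_pair P Q"
proof -
  let ?U = "Fin ` (interior (fillK Q) - fillK P)"
  have nest': "fillK P \<subseteq> interior (fillK Q)"
    using nest unfolding filled_Julia_poly_map interior_Fin_image by auto
  have Ueq: "interior (filled_Julia (poly_map Q)) - filled_Julia (poly_map P) = ?U"
    unfolding filled_Julia_poly_map interior_Fin_image by auto
  have osc': "\<And>z. Fin (poly P z) \<in> ?U \<Longrightarrow> Fin z \<in> ?U" "\<And>z. Fin (poly Q z) \<in> ?U \<Longrightarrow> Fin z \<in> ?U"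
    "\<And>z. Fin (poly P z) \<in> ?U \<Longrightarrow> Fin (poly Q z) \<notin> ?U"
  proof -
    have o: "poly_map P -` ?U \<union> poly_map Q -` ?U \<subseteq> ?U" "poly_map P -` ?U \<inter> poly_map Q -` ?U = {}"
      using osc unfolding Ueq open_set_condition_def by blast+
    show "Fin z \<in> ?U" if "Fin (poly P z) \<in> ?U" for z
    proof -
      have "Fin z \<in> poly_map P -` ?U" using that by simp
      then show ?thesis using o(1) by blast
    qed
    show "Fin z \<in> ?U" if "Fin (poly Q z) \<in> ?U" for z
    proof -
      have "Fin z \<in> poly_map Q -` ?U" using that by simp
      then show ?thesis using o(1) by blast
    qed
    show "Fin (poly Q z) \<notin> ?U" if "Fin (poly P z) \<in> ?U" for z
    proof
      assume "Fin (poly Q z) \<in> ?U"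
      then have "Fin z \<in> poly_map P -` ?U \<inter> poly_map Q -` ?U" using that by simp
      then show False using o(2) by blast
    qed
  qed
  have Uiff: "Fin z \<in> ?U \<longleftrightarrow> z \<in> interior (fillK Q) \<and> z \<notin> fillK P" for z by auto
  have Qint: "poly Q z \<in> interior (fillK Q)" if "z \<in> interior (fillK Q)" for z
  proof -
    have "poly Q ` interior (fillK Q) \<subseteq> interior (fillK Q)"
    proof (rule interior_maximal)
      show "open (poly Q ` interior (fillK Q))" using deg by (intro poly_nonconst_open open_interior) simp
      show "poly Q ` interior (fillK Q) \<subseteq> fillK Q" using fillK_step interior_subset by blast
    qed
    then show ?thesis using that by blast
  qed
  have QK: "poly Q z \<in> fillK P" if z: "z \<in> fillK P" for z
  proof (rule ccontr)
    assume "poly Q z \<notin> fillK P"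
    then have "Fin (poly Q z) \<in> ?U" using Qint nest' z unfolding Uiff by blast
    then have "Fin z \<in> ?U" by (rule osc'(2))
    then show False using z unfolding Uiff by blast
  qed
  show ?thesis
  proof
    show "poly Q z \<in> fillK P" if Pz: "poly P z \<in> interior (fillK Q)" for z
    proof (rule ccontr)
      assume n: "poly Q z \<notin> fillK P"
      then have "z \<notin> fillK P" using QK by blast
      then have "poly P z \<notin> fillK P" by (simp add: fillK_step)
      then have PU: "Fin (poly P z) \<in> ?U" using Pz unfolding Uiff by blast
      then have "Fin z \<in> ?U" by (rule osc'(1))
      then have "Fin (poly Q z) \<in> ?U" using Qint n unfolding Uiff by blast
      then show False using osc'(3)[OF PU] by blast
    qed
  qed (use deg nest' QK critical_value_in_fillK[OF bd] in auto)
qed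

theorem theorem2p42:
  fixes h1 h2 :: "csphere \<Rightarrow> csphere" and p :: real
    and G :: "(csphere \<Rightarrow> csphere) set" and U :: "csphere set"
  assumes "(h1, h2) \<in> class_B"
    and "G = semigroup_gen {h1, h2}"
    and "p \<in> {0<..<1}"
    and "filled_Julia h1 \<subseteq> interior (filled_Julia h2)"
    and "U = interior (filled_Julia h2) - filled_Julia h1"
    and "open_set_condition h1 h2 U"
  shows
    \<comment> \<open>(i)\<close>
    "(Jker G = {}
      \<and> Hoelder_continuous (T h1 h2 p)
      \<and> locally (\<lambda>V. T h1 h2 p constant_on V) (Fatou G)
      \<and> Julia G = {z0. \<forall>V. open V \<and> z0 \<in> V \<longrightarrow> \<not> T h1 h2 p constant_on V})
    \<and>
    \<comment> \<open>(ii) and (iii)\<close>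
    (\<exists>L. {L'. minimal_set G (Khat G) L'} = {L}
      \<and> {L'. minimal_set G UNIV L'} = {{Infty}, L}
      \<and> (\<forall>z. \<exists>B \<in> sets (tau_seq h1 h2 p). emeasure (tau_seq h1 h2 p) B = 1
            \<and> (\<forall>\<gamma>\<in>B. (\<lambda>n. infdist (random_orbit \<gamma> z n) ({Infty} \<union> L)) \<longlonglongrightarrow> 0)))
    \<and>
    \<comment> \<open>(iv)\<close>
    (\<exists>\<nu>. invariant_prob_on h1 h2 p (Khat G) \<nu>
      \<and> (\<forall>\<nu>'. invariant_prob_on h1 h2 p (Khat G) \<nu>' \<longrightarrow> \<nu>' = \<nu>)
      \<and> (\<forall>\<phi> :: csphere \<Rightarrow> complex. continuous_on UNIV \<phi> \<longrightarrow>
            uniform_limit UNIV (\<lambda>n. (M_op h1 h2 p ^^ n) \<phi>)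
              (\<lambda>z. of_real (T h1 h2 p z) * \<phi> Infty
                    + of_real (1 - T h1 h2 p z) * (\<integral>w. \<phi> w \<partial>\<nu>))
              sequentially))
    \<and>
    \<comment> \<open>(v)\<close>
    ((\<forall>z. real_analytic_on (\<lambda>q. T h1 h2 q z) {0<..<1})
      \<and> (\<forall>n. continuous_on ({0<..<1} \<times> UNIV) (\<lambda>(q, z). dT n h1 h2 q z))
      \<and> {\<phi>. continuous_on UNIV \<phi> \<and> M_op h1 h2 p \<phi> = \<phi>
              \<and> (\<forall>z\<in>Khat G. \<phi> z = 0) \<and> (\<forall>z\<in>Fatou_infty G. \<phi> z = 1)}
          = {\<lambda>z. of_real (T h1 h2 p z)}
      \<and> (\<forall>n. {\<phi>. continuous_on UNIV \<phi>
                 \<and> (\<forall>z. \<phi> z = M_op h1 h2 p \<phi> z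
                        + of_nat (n + 1)
                            * of_real (dT n h1 h2 p (h1 z) - dT n h1 h2 p (h2 z)))
                 \<and> (\<forall>z \<in> Khat G \<union> Fatou_infty G. \<phi> z = 0)}
               = {\<lambda>z. of_real (dT (n + 1) h1 h2 p z)})
      \<and> (\<forall>n. locally (\<lambda>V. dT (n + 1) h1 h2 p constant_on V) (Fatou G))
      \<and> (\<forall>n. uniform_limit UNIV
               (\<lambda>N z. \<Sum>j<N. (M_op h1 h2 p ^^ j)
                    (\<lambda>w. of_nat (n + 1)
                          * of_real (dT n h1 h2 p (h1 w) - dT n h1 h2 p (h2 w))) z)
               (\<lambda>z. of_real (dT (n + 1) h1 h2 p z))
               sequentially))"
proof -
  obtain P Q where PQ: "h1 = poly_map P" "2 \<le> degree P" "h2 = poly_map Q" "2 \<le> degree Q"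
    and bd: "bounded_in_plane (planar_postcritical (semigroup_gen {h1, h2}))"
    using assms(1) unfolding class_B_def polymaps_def by blast
  have G: "G = semigroup_gen {poly_map P, poly_map Q}" using assms(2) PQ by simp
  interpret pair: poly_pair P Q
    by (rule poly_pairI) (use PQ bd assms(4-6) in simp_all)
  interpret random_pair P Q p
    by unfold_locales (use assms(3) in auto)
  have inv: "invariant_prob_on h1 h2 p (Khat G) \<mu> \<longleftrightarrow> invariant_prob_on (poly_map P) (poly_map Q) p (Fin ` fillK P) \<mu>" for \<mu>
    unfolding G PQ(1,3) pair.Khat_eq ..
  have unif: "uniform_limit UNIV (\<lambda>n. (M_op (poly_map P) (poly_map Q) p ^^ n) \<phi>)
      (\<lambda>z. of_real (T (poly_map P) (poly_map Q) p z) * \<phi> Infty + of_real (1 - T (poly_map P) (poly_map Q) p z) * (\<integral>w. \<phi> w \<partial>\<nu>)) sequentially"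
    if "continuous_on UNIV \<phi>" for \<phi> :: "csphere \<Rightarrow> complex"
    using Mc_pow_uniform_limit[OF that] by (simp only: pair.M_op_Mc)
  show ?thesis
    unfolding G PQ(1,3)
  proof (intro conjI exI[of _ pair.Lmin] exI[of _ \<nu>] allI impI)
    show "invariant_prob_on (poly_map P) (poly_map Q) p (Khat pair.G) \<nu>" unfolding pair.Khat_eq by (rule nu_invariant)
    show "\<nu>' = \<nu>" if "invariant_prob_on (poly_map P) (poly_map Q) p (Khat pair.G) \<nu>'" for \<nu>'
      using that unfolding pair.Khat_eq by (rule nu_unique)
  qed (rule pair.Jker_empty Hoelder_T locally_constant_T Julia_eq_nonconstant pair.minimal_sets_Khat pair.minimal_sets_UNIV
      almost_sure_convergence unif pair.real_analytic_T pair.continuous_dT T_characterization dT_characterization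
      locally_constant_dT dT_series | assumption)+
qed

end
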